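(* Let $(\mathcal{T},\otimes,\mathbb{1})$ be a rigidly-compactly generated tensor triangulated category which satisfies the detection property and admits a model. Suppose that $\mathrm{Spc}(\mathcal{T}^c)$ carries the constructible topology and that $t\in\mathcal{T}$ is an object such that $\mathrm{Supp}(t)\subseteq\mathrm{Spc}(\mathcal{T}^c)$ is a scattered subset. Then the local-to-global principle holds for $t$.
   Context: $\mathcal{T}^c$ is the subcategory of compact (= rigid) objects of $\mathcal{T}$ and $\mathrm{Spc}(\mathcal{T}^c)$ is its Balmer spectrum, a spectral space. It carries the constructible topology if its topology coincides with the associated constructible (patch) topology. A subset of a space is scattered if each of its non-empty subsets has an isolated point (in the subspace topology). A subset of $\mathrm{Spc}(\mathcal{T}^c)$ is Thomason if it is a union of closed subsets with quasi-compact complement. Rickard idempotents: for a Thomason subset $Y$, let $\mathcal{T}^c_Y$ be the corresponding thick tensor ideal of compact objects (those whose Balmer support is contained in $Y$). There is an exact triangle $\Gamma_Y\mathbb{1}\to\mathbb{1}\to L_{Y^c}\mathbb{1}\to\Sigma\Gamma_Y\mathbb{1}$ with $\Gamma_Y\mathbb{1}\in \mathrm{Loc}\langle\mathcal{T}^c_Y\rangle$ and $L_{Y^c}\mathbb{1}\in \mathrm{Loc}\langle\mathcal{T}^c_Y\rangle^{\perp}$, where $\mathrm{Loc}\langle -\rangle$ is the generated localizing subcategory. A subset $Z\subseteq\mathrm{Spc}(\mathcal{T}^c)$ is weakly visible if $Z=Y_1\cap Y_2^c$ for Thomason subsets $Y_1,Y_2$; then $g(Z):=\Gamma_{Y_1}\mathbb{1}\otimes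 L_{Y_2^c}\mathbb{1}$ (independent of the choice up to isomorphism). Tensor triangular support: $\mathrm{Supp}(t)=\{\mathfrak{p}\in\mathrm{Spc}(\mathcal{T}^c) : t\otimes g(W)\neq 0 \text{ for every weakly visible } W \text{ containing } \mathfrak{p}\}$. Detection property: $\mathrm{Supp}(t)=\emptyset$ implies $t=0$, for every $t\in\mathcal{T}$. "Admits a model" means: $\mathcal{T}$ is the homotopy category of a stable monoidal model category or of a stable monoidal $\infty$-category, or it is the underlying category of a strong stable monoidal derivator. Local-to-global principle for $t$: for every cover $\{W_i\}_{i\in I}$ of $\mathrm{Spc}(\mathcal{T}^c)$ by weakly visible subsets, $t\in\mathrm{Locid}\langle t\otimes g(W_i): i\in I\rangle$, where $\mathrm{Locid}\langle -\rangle$ denotes the generated localizing tensor ideal. *)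

theory Defs
  imports "HOL-Analysis.Abstract_Topology" "HOL-Algebra.FiniteProduct"
begin

unbundle cardinal_syntax

section \<open>Categories\<close>

record ('o, 'm) cat =
  Obj :: "'o set"
  Mor :: "'m set"
  Dom :: "'m \<Rightarrow> 'o"
  Cod :: "'m \<Rightarrow> 'o"
  Idn :: "'o \<Rightarrow> 'm"
  Cmp :: "'m \<Rightarrow> 'm \<Rightarrow> 'm"  (infixr "\<cdot>\<index>" 70)

definition Hom :: "('o, 'm, 'z) cat_scheme \<Rightarrow> 'o \<Rightarrow> 'o \<Rightarrow> 'm set" where
  "Hom C x y = {f \<in> Mor C. Dom C f = x \<and> Cod C f = y}"

locale category =
  fixes C :: "('o, 'm, 'z) cat_scheme" (structure)
  assumes dom_cod: "f \<in> Mor C \<Longrightarrow> Dom C f \<in> Obj C \<and> Cod C f \<in> Obj C"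
    and idn_in: "x \<in> Obj C \<Longrightarrow> Idn C x \<in> Hom C x x"
    and cmp_in: "f \<in> Hom C x y \<Longrightarrow> g \<in> Hom C y z \<Longrightarrow> g \<cdot> f \<in> Hom C x z"
    and idn_left: "f \<in> Hom C x y \<Longrightarrow> Idn C y \<cdot> f = f"
    and idn_right: "f \<in> Hom C x y \<Longrightarrow> f \<cdot> Idn C x = f"
    and cmp_assoc: "f \<in> Hom C w x \<Longrightarrow> g \<in> Hom C x y \<Longrightarrow> h \<in> Hom C y z
      \<Longrightarrow> (h \<cdot> g) \<cdot> f = h \<cdot> (g \<cdot> f)"

definition is_inverse :: "('o, 'm, 'z) cat_scheme \<Rightarrow> 'm \<Rightarrow> 'm \<Rightarrow> bool" where
  "is_inverse C f g \<longleftrightarrow> f \<in> Mor C \<and> g \<in> Hom C (Cod C f) (Dom C f)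
     \<and> g \<cdot>\<^bsub>C\<^esub> f = Idn C (Dom C f) \<and> f \<cdot>\<^bsub>C\<^esub> g = Idn C (Cod C f)"

definition is_iso :: "('o, 'm, 'z) cat_scheme \<Rightarrow> 'm \<Rightarrow> bool" where
  "is_iso C f \<longleftrightarrow> (\<exists>g. is_inverse C f g)"

definition inverse_mor :: "('o, 'm, 'z) cat_scheme \<Rightarrow> 'm \<Rightarrow> 'm" where
  "inverse_mor C f = (THE g. is_inverse C f g)"

definition isomorphic :: "('o, 'm, 'z) cat_scheme \<Rightarrow> 'o \<Rightarrow> 'o \<Rightarrow> bool" where
  "isomorphic C x y \<longleftrightarrow> (\<exists>f \<in> Hom C x y. is_iso C f)"

definition is_zero :: "('o, 'm, 'z) cat_scheme \<Rightarrow> 'o \<Rightarrow> bool" where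
  "is_zero C x \<longleftrightarrow> x \<in> Obj C \<and> (\<forall>y \<in> Obj C. (\<exists>!f. f \<in> Hom C x y) \<and> (\<exists>!f. f \<in> Hom C y x))"

text \<open>Maps that factor through a zero object.\<close>
definition is_zero_map :: "('o, 'm, 'z) cat_scheme \<Rightarrow> 'm \<Rightarrow> bool" where
  "is_zero_map C f \<longleftrightarrow> (\<exists>z a b. is_zero C z \<and> a \<in> Hom C (Dom C f) z \<and> b \<in> Hom C z (Cod C f)
     \<and> f \<in> Mor C \<and> f = b \<cdot>\<^bsub>C\<^esub> a)"

definition is_coproduct ::
    "('o, 'm, 'z) cat_scheme \<Rightarrow> 'i set \<Rightarrow> ('i \<Rightarrow> 'o) \<Rightarrow> 'o \<Rightarrow> ('i \<Rightarrow> 'm) \<Rightarrow> bool" where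
  "is_coproduct C I X c \<iota> \<longleftrightarrow> c \<in> Obj C \<and> (\<forall>i \<in> I. \<iota> i \<in> Hom C (X i) c)
     \<and> (\<forall>y \<in> Obj C. \<forall>f. (\<forall>i \<in> I. f i \<in> Hom C (X i) y)
          \<longrightarrow> (\<exists>!h. h \<in> Hom C c y \<and> (\<forall>i \<in> I. h \<cdot>\<^bsub>C\<^esub> \<iota> i = f i)))"

text \<open>The square \<open>p \<cdot> f = q \<cdot> g\<close> is a pushout.\<close>
definition is_pushout ::
    "('o, 'm, 'z) cat_scheme \<Rightarrow> 'm \<Rightarrow> 'm \<Rightarrow> 'm \<Rightarrow> 'm \<Rightarrow> bool" where
  "is_pushout C f g p q \<longleftrightarrow> f \<in> Mor C \<and> g \<in> Mor C \<and> Dom C f = Dom C g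
     \<and> p \<in> Hom C (Cod C f) (Cod C p) \<and> q \<in> Hom C (Cod C g) (Cod C p)
     \<and> p \<cdot>\<^bsub>C\<^esub> f = q \<cdot>\<^bsub>C\<^esub> g
     \<and> (\<forall>y \<in> Obj C. \<forall>a \<in> Hom C (Cod C f) y. \<forall>b \<in> Hom C (Cod C g) y.
          a \<cdot>\<^bsub>C\<^esub> f = b \<cdot>\<^bsub>C\<^esub> g
          \<longrightarrow> (\<exists>!h. h \<in> Hom C (Cod C p) y \<and> h \<cdot>\<^bsub>C\<^esub> p = a \<and> h \<cdot>\<^bsub>C\<^esub> q = b))"

record ('o, 'm, 'p, 'n) fctr =
  ob :: "'o \<Rightarrow> 'p"
  ar :: "'m \<Rightarrow> 'n"

definition is_functor :: "('o, 'm, 'y) cat_scheme \<Rightarrow> ('p, 'n, 'z) cat_scheme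
    \<Rightarrow> ('o, 'm, 'p, 'n) fctr \<Rightarrow> bool" where
  "is_functor C D F \<longleftrightarrow>
     (\<forall>x \<in> Obj C. ob F x \<in> Obj D \<and> ar F (Idn C x) = Idn D (ob F x))
     \<and> (\<forall>x y. \<forall>f \<in> Hom C x y. ar F f \<in> Hom D (ob F x) (ob F y))
     \<and> (\<forall>x y z. \<forall>f \<in> Hom C x y. \<forall>g \<in> Hom C y z.
          ar F (g \<cdot>\<^bsub>C\<^esub> f) = ar F g \<cdot>\<^bsub>D\<^esub> ar F f)"

definition is_equivalence :: "('o, 'm, 'y) cat_scheme \<Rightarrow> ('p, 'n, 'z) cat_scheme
    \<Rightarrow> ('o, 'm, 'p, 'n) fctr \<Rightarrow> bool" where
  "is_equivalence C D F \<longleftrightarrow> is_functor C D F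
     \<and> (\<forall>x \<in> Obj C. \<forall>y \<in> Obj C. bij_betw (ar F) (Hom C x y) (Hom D (ob F x) (ob F y)))
     \<and> (\<forall>d \<in> Obj D. \<exists>x \<in> Obj C. isomorphic D (ob F x) d)"

definition is_nat_trans :: "('o, 'm, 'y) cat_scheme \<Rightarrow> ('p, 'n, 'z) cat_scheme
    \<Rightarrow> ('o, 'm, 'p, 'n) fctr \<Rightarrow> ('o, 'm, 'p, 'n) fctr \<Rightarrow> ('o \<Rightarrow> 'n) \<Rightarrow> bool" where
  "is_nat_trans C D F G \<alpha> \<longleftrightarrow> is_functor C D F \<and> is_functor C D G
     \<and> (\<forall>x \<in> Obj C. \<alpha> x \<in> Hom D (ob F x) (ob G x))
     \<and> (\<forall>x y. \<forall>f \<in> Hom C x y. \<alpha> y \<cdot>\<^bsub>D\<^esub> ar F f = ar G f \<cdot>\<^bsub>D\<^esub> \<alpha> x)"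

definition id_fctr :: "('o, 'm, 'o, 'm) fctr" where
  "id_fctr = \<lparr>ob = (\<lambda>x. x), ar = (\<lambda>f. f)\<rparr>"

definition fcomp_fctr :: "('p, 'n, 'q, 'l) fctr \<Rightarrow> ('o, 'm, 'p, 'n) fctr \<Rightarrow> ('o, 'm, 'q, 'l) fctr" where
  "fcomp_fctr G F = \<lparr>ob = ob G \<circ> ob F, ar = ar G \<circ> ar F\<rparr>"

definition const_fctr :: "('p, 'n, 'z) cat_scheme \<Rightarrow> 'p \<Rightarrow> ('o, 'm, 'p, 'n) fctr" where
  "const_fctr D d = \<lparr>ob = (\<lambda>_. d), ar = (\<lambda>_. Idn D d)\<rparr>"

definition fctr_agree :: "('o, 'm, 'z) cat_scheme \<Rightarrow> ('o, 'm, 'p, 'n) fctr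
    \<Rightarrow> ('o, 'm, 'p, 'n) fctr \<Rightarrow> bool" where
  "fctr_agree C F G \<longleftrightarrow> (\<forall>x \<in> Obj C. ob F x = ob G x) \<and> (\<forall>f \<in> Mor C. ar F f = ar G f)"


section \<open>Universes\<close>

text \<open>A type cannot have arbitrary coproducts indexed by itself, so smallness is measured by a
  Grothendieck universe, given as a set \<open>U\<close> of uncountable strongly inaccessible cardinality: a set
  of any type is small if its cardinality is less than that of \<open>U\<close>.\<close>

definition inaccessible :: "'u set \<Rightarrow> bool" where
  "inaccessible U \<longleftrightarrow> natLeq <o |U| \<and> regularCard |U|
     \<and> (\<forall>A :: 'u set. |A| <o |U| \<longrightarrow> |Pow A| <o |U| )"

definition small :: "'u set \<Rightarrow> 'a set \<Rightarrow> bool" where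
  "small U A \<longleftrightarrow> |A| <o |U|"

definition small_cat :: "'u set \<Rightarrow> ('u, 'u) cat \<Rightarrow> bool" where
  "small_cat U J \<longleftrightarrow> category J \<and> small U (Obj J) \<and> small U (Mor J)"


section \<open>Symmetric monoidal categories\<close>

record ('o, 'm) smc = "('o, 'm) cat" +
  Tob :: "'o \<Rightarrow> 'o \<Rightarrow> 'o"  (infixr "\<boxtimes>\<index>" 75)
  Tar :: "'m \<Rightarrow> 'm \<Rightarrow> 'm"  (infixr "\<boxdot>\<index>" 75)
  Unit :: 'o
  Assoc :: "'o \<Rightarrow> 'o \<Rightarrow> 'o \<Rightarrow> 'm"
  LUnit :: "'o \<Rightarrow> 'm"
  RUnit :: "'o \<Rightarrow> 'm"
  Braid :: "'o \<Rightarrow> 'o \<Rightarrow> 'm"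

locale symmetric_monoidal = category C for C :: "('o, 'm, 'z) smc_scheme" (structure) +
  assumes tob_in: "x \<in> Obj C \<Longrightarrow> y \<in> Obj C \<Longrightarrow> x \<boxtimes> y \<in> Obj C"
    and tar_in: "f \<in> Hom C x x' \<Longrightarrow> g \<in> Hom C y y' \<Longrightarrow> f \<boxdot> g \<in> Hom C (x \<boxtimes> y) (x' \<boxtimes> y')"
    and tar_idn: "x \<in> Obj C \<Longrightarrow> y \<in> Obj C \<Longrightarrow> Idn C x \<boxdot> Idn C y = Idn C (x \<boxtimes> y)"
    and tar_cmp: "f \<in> Hom C x x' \<Longrightarrow> f' \<in> Hom C x' x'' \<Longrightarrow> g \<in> Hom C y y' \<Longrightarrow> g' \<in> Hom C y' y''
      \<Longrightarrow> (f' \<cdot> f) \<boxdot> (g' \<cdot> g) = (f' \<boxdot> g') \<cdot> (f \<boxdot> g)"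
    and unit_in: "Unit C \<in> Obj C"
    and assoc_iso: "x \<in> Obj C \<Longrightarrow> y \<in> Obj C \<Longrightarrow> z \<in> Obj C \<Longrightarrow>
      Assoc C x y z \<in> Hom C ((x \<boxtimes> y) \<boxtimes> z) (x \<boxtimes> (y \<boxtimes> z)) \<and> is_iso C (Assoc C x y z)"
    and assoc_nat: "f \<in> Hom C x x' \<Longrightarrow> g \<in> Hom C y y' \<Longrightarrow> h \<in> Hom C z z' \<Longrightarrow>
      Assoc C x' y' z' \<cdot> ((f \<boxdot> g) \<boxdot> h) = (f \<boxdot> (g \<boxdot> h)) \<cdot> Assoc C x y z"
    and lunit_iso: "x \<in> Obj C \<Longrightarrow> LUnit C x \<in> Hom C (Unit C \<boxtimes> x) x \<and> is_iso C (LUnit C x)"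
    and lunit_nat: "f \<in> Hom C x y \<Longrightarrow> LUnit C y \<cdot> (Idn C (Unit C) \<boxdot> f) = f \<cdot> LUnit C x"
    and runit_iso: "x \<in> Obj C \<Longrightarrow> RUnit C x \<in> Hom C (x \<boxtimes> Unit C) x \<and> is_iso C (RUnit C x)"
    and runit_nat: "f \<in> Hom C x y \<Longrightarrow> RUnit C y \<cdot> (f \<boxdot> Idn C (Unit C)) = f \<cdot> RUnit C x"
    and braid_in: "x \<in> Obj C \<Longrightarrow> y \<in> Obj C \<Longrightarrow> Braid C x y \<in> Hom C (x \<boxtimes> y) (y \<boxtimes> x)"
    and braid_nat: "f \<in> Hom C x x' \<Longrightarrow> g \<in> Hom C y y' \<Longrightarrow>
      Braid C x' y' \<cdot> (f \<boxdot> g) = (g \<boxdot> f) \<cdot> Braid C x y"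
    and braid_sym: "x \<in> Obj C \<Longrightarrow> y \<in> Obj C \<Longrightarrow> Braid C y x \<cdot> Braid C x y = Idn C (x \<boxtimes> y)"
    and pentagon: "w \<in> Obj C \<Longrightarrow> x \<in> Obj C \<Longrightarrow> y \<in> Obj C \<Longrightarrow> z \<in> Obj C \<Longrightarrow>
      Assoc C w x (y \<boxtimes> z) \<cdot> Assoc C (w \<boxtimes> x) y z
        = (Idn C w \<boxdot> Assoc C x y z) \<cdot> (Assoc C w (x \<boxtimes> y) z \<cdot> (Assoc C w x y \<boxdot> Idn C z))"
    and triangle_coherence: "x \<in> Obj C \<Longrightarrow> y \<in> Obj C \<Longrightarrow>
      (Idn C x \<boxdot> LUnit C y) \<cdot> Assoc C x (Unit C) y = RUnit C x \<boxdot> Idn C y"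
    and hexagon: "x \<in> Obj C \<Longrightarrow> y \<in> Obj C \<Longrightarrow> z \<in> Obj C \<Longrightarrow>
      Assoc C y z x \<cdot> (Braid C x (y \<boxtimes> z) \<cdot> Assoc C x y z)
        = (Idn C y \<boxdot> Braid C x z) \<cdot> (Assoc C y x z \<cdot> (Braid C x y \<boxdot> Idn C z))"

definition closed_monoidal :: "('o, 'm, 'z) smc_scheme \<Rightarrow> bool" where
  "closed_monoidal C \<longleftrightarrow> (\<forall>y \<in> Obj C. \<forall>z \<in> Obj C. \<exists>h \<in> Obj C. \<exists>ev \<in> Hom C (h \<boxtimes>\<^bsub>C\<^esub> y) z.
     \<forall>x \<in> Obj C. \<forall>f \<in> Hom C (x \<boxtimes>\<^bsub>C\<^esub> y) z.
       \<exists>!g. g \<in> Hom C x h \<and> ev \<cdot>\<^bsub>C\<^esub> (g \<boxdot>\<^bsub>C\<^esub> Idn C y) = f)"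

text \<open>Rigid, i.e. strongly dualizable, objects: there is a dual \<open>y\<close> with evaluation and coevaluation
  satisfying the two triangle identities.\<close>
definition rigid :: "('o, 'm, 'z) smc_scheme \<Rightarrow> 'o \<Rightarrow> bool" where
  "rigid C x \<longleftrightarrow> x \<in> Obj C \<and> (\<exists>y \<in> Obj C. \<exists>ev \<in> Hom C (y \<boxtimes>\<^bsub>C\<^esub> x) (Unit C).
     \<exists>coev \<in> Hom C (Unit C) (x \<boxtimes>\<^bsub>C\<^esub> y).
       RUnit C x \<cdot>\<^bsub>C\<^esub> ((Idn C x \<boxdot>\<^bsub>C\<^esub> ev) \<cdot>\<^bsub>C\<^esub> (Assoc C x y x \<cdot>\<^bsub>C\<^esub> (coev \<boxdot>\<^bsub>C\<^esub> Idn C x))) = LUnit C x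
     \<and> LUnit C y \<cdot>\<^bsub>C\<^esub> ((ev \<boxdot>\<^bsub>C\<^esub> Idn C y) \<cdot>\<^bsub>C\<^esub>
          (inverse_mor C (Assoc C y x y) \<cdot>\<^bsub>C\<^esub> (Idn C y \<boxdot>\<^bsub>C\<^esub> coev))) = RUnit C y)"

text \<open>Strong symmetric monoidal functors, with structure isomorphisms
  \<open>\<mu> x y : F x \<otimes> F y \<rightarrow> F (x \<otimes> y)\<close> and \<open>\<eta> : \<one> \<rightarrow> F \<one>\<close>.\<close>
definition is_monoidal_functor :: "('o, 'm, 'y) smc_scheme \<Rightarrow> ('p, 'n, 'z) smc_scheme
    \<Rightarrow> ('o, 'm, 'p, 'n) fctr \<Rightarrow> ('o \<Rightarrow> 'o \<Rightarrow> 'n) \<Rightarrow> 'n \<Rightarrow> bool" where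
  "is_monoidal_functor C D F \<mu> \<eta> \<longleftrightarrow> is_functor C D F
     \<and> \<eta> \<in> Hom D (Unit D) (ob F (Unit C)) \<and> is_iso D \<eta>
     \<and> (\<forall>x \<in> Obj C. \<forall>y \<in> Obj C. \<mu> x y \<in> Hom D (ob F x \<boxtimes>\<^bsub>D\<^esub> ob F y) (ob F (x \<boxtimes>\<^bsub>C\<^esub> y))
          \<and> is_iso D (\<mu> x y))
     \<and> (\<forall>x x' y y'. \<forall>f \<in> Hom C x x'. \<forall>g \<in> Hom C y y'.
          \<mu> x' y' \<cdot>\<^bsub>D\<^esub> (ar F f \<boxdot>\<^bsub>D\<^esub> ar F g) = ar F (f \<boxdot>\<^bsub>C\<^esub> g) \<cdot>\<^bsub>D\<^esub> \<mu> x y)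
     \<and> (\<forall>x \<in> Obj C. \<forall>y \<in> Obj C. \<forall>z \<in> Obj C.
          ar F (Assoc C x y z) \<cdot>\<^bsub>D\<^esub> (\<mu> (x \<boxtimes>\<^bsub>C\<^esub> y) z \<cdot>\<^bsub>D\<^esub> (\<mu> x y \<boxdot>\<^bsub>D\<^esub> Idn D (ob F z)))
          = \<mu> x (y \<boxtimes>\<^bsub>C\<^esub> z) \<cdot>\<^bsub>D\<^esub>
              ((Idn D (ob F x) \<boxdot>\<^bsub>D\<^esub> \<mu> y z) \<cdot>\<^bsub>D\<^esub> Assoc D (ob F x) (ob F y) (ob F z)))
     \<and> (\<forall>x \<in> Obj C. \<forall>y \<in> Obj C.
          ar F (Braid C x y) \<cdot>\<^bsub>D\<^esub> \<mu> x y = \<mu> y x \<cdot>\<^bsub>D\<^esub> Braid D (ob F x) (ob F y))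
     \<and> (\<forall>x \<in> Obj C.
          ar F (LUnit C x) \<cdot>\<^bsub>D\<^esub> (\<mu> (Unit C) x \<cdot>\<^bsub>D\<^esub> (\<eta> \<boxdot>\<^bsub>D\<^esub> Idn D (ob F x))) = LUnit D (ob F x)
        \<and> ar F (RUnit C x) \<cdot>\<^bsub>D\<^esub> (\<mu> x (Unit C) \<cdot>\<^bsub>D\<^esub> (Idn D (ob F x) \<boxdot>\<^bsub>D\<^esub> \<eta>)) = RUnit D (ob F x))"


section \<open>Tensor triangulated categories\<close>

text \<open>\<open>Univ\<close> is the universe relative to which smallness is understood; \<open>Dist\<close> consists of the
  distinguished triangles \<open>x \<rightarrow> y \<rightarrow> z \<rightarrow> \<Sigma> x\<close>.\<close>
record ('u, 'o, 'm) ttc = "('o, 'm) smc" +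
  Univ :: "'u set"
  Add :: "'m \<Rightarrow> 'm \<Rightarrow> 'm"
  Zero :: "'o \<Rightarrow> 'o \<Rightarrow> 'm"
  Susp :: "('o, 'm, 'o, 'm) fctr"
  Dist :: "('m \<times> 'm \<times> 'm) set"

abbreviation susp_ob :: "('u, 'o, 'm, 'z) ttc_scheme \<Rightarrow> 'o \<Rightarrow> 'o" where
  "susp_ob T \<equiv> ob (Susp T)"

abbreviation susp_ar :: "('u, 'o, 'm, 'z) ttc_scheme \<Rightarrow> 'm \<Rightarrow> 'm" where
  "susp_ar T \<equiv> ar (Susp T)"

definition hom_group :: "('u, 'o, 'm, 'z) ttc_scheme \<Rightarrow> 'o \<Rightarrow> 'o \<Rightarrow> 'm monoid" where
  "hom_group T x y = \<lparr>carrier = Hom T x y, mult = Add T, one = Zero T x y\<rparr>"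

definition neg :: "('u, 'o, 'm, 'z) ttc_scheme \<Rightarrow> 'm \<Rightarrow> 'm" where
  "neg T f = m_inv (hom_group T (Dom T f) (Cod T f)) f"

definition is_triangle :: "('u, 'o, 'm, 'z) ttc_scheme \<Rightarrow> 'm \<times> 'm \<times> 'm \<Rightarrow> bool" where
  "is_triangle T = (\<lambda>(f, g, h). f \<in> Mor T \<and> g \<in> Hom T (Cod T f) (Cod T g)
     \<and> h \<in> Hom T (Cod T g) (susp_ob T (Dom T f)))"

text \<open>A morphism of triangles, with components \<open>a\<close>, \<open>b\<close>, \<open>c\<close>.\<close>
definition is_triangle_map ::
    "('u, 'o, 'm, 'z) ttc_scheme \<Rightarrow> 'm \<times> 'm \<times> 'm \<Rightarrow> 'm \<times> 'm \<times> 'm \<Rightarrow> 'm \<Rightarrow> 'm \<Rightarrow> 'm \<Rightarrow> bool" where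
  "is_triangle_map T = (\<lambda>(f, g, h) (f', g', h') a b c.
     is_triangle T (f, g, h) \<and> is_triangle T (f', g', h')
     \<and> a \<in> Hom T (Dom T f) (Dom T f') \<and> b \<in> Hom T (Cod T f) (Cod T f')
     \<and> c \<in> Hom T (Cod T g) (Cod T g')
     \<and> b \<cdot>\<^bsub>T\<^esub> f = f' \<cdot>\<^bsub>T\<^esub> a \<and> c \<cdot>\<^bsub>T\<^esub> g = g' \<cdot>\<^bsub>T\<^esub> b \<and> susp_ar T a \<cdot>\<^bsub>T\<^esub> h = h' \<cdot>\<^bsub>T\<^esub> c)"

definition triangles_isomorphic ::
    "('u, 'o, 'm, 'z) ttc_scheme \<Rightarrow> 'm \<times> 'm \<times> 'm \<Rightarrow> 'm \<times> 'm \<times> 'm \<Rightarrow> bool" where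
  "triangles_isomorphic T s t \<longleftrightarrow>
     (\<exists>a b c. is_triangle_map T s t a b c \<and> is_iso T a \<and> is_iso T b \<and> is_iso T c)"

locale additive_category = category T for T :: "('u, 'o, 'm, 'z) ttc_scheme" (structure) +
  assumes hom_comm_group: "x \<in> Obj T \<Longrightarrow> y \<in> Obj T \<Longrightarrow> comm_group (hom_group T x y)"
    and cmp_add: "f \<in> Hom T x y \<Longrightarrow> f' \<in> Hom T x y \<Longrightarrow> g \<in> Hom T y z \<Longrightarrow> g' \<in> Hom T y z \<Longrightarrow>
      g \<cdot> Add T f f' = Add T (g \<cdot> f) (g \<cdot> f') \<and> Add T g g' \<cdot> f = Add T (g \<cdot> f) (g' \<cdot> f)"
    and ex_zero: "\<exists>z. is_zero T z"
    and ex_sum: "\<forall>i. X i \<in> Obj T \<Longrightarrow> \<exists>c \<iota>. is_coproduct T (UNIV :: bool set) X c \<iota>"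

locale triangulated_category = additive_category T
    for T :: "('u, 'o, 'm, 'z) ttc_scheme" (structure) +
  assumes susp_equivalence: "is_equivalence T T (Susp T)"
    and susp_add: "f \<in> Hom T x y \<Longrightarrow> g \<in> Hom T x y \<Longrightarrow>
      susp_ar T (Add T f g) = Add T (susp_ar T f) (susp_ar T g)"
    and dist_triangle: "t \<in> Dist T \<Longrightarrow> is_triangle T t"
    and dist_iso: "t \<in> Dist T \<Longrightarrow> triangles_isomorphic T t t' \<Longrightarrow> t' \<in> Dist T"
    and dist_idn: "x \<in> Obj T \<Longrightarrow> is_zero T z \<Longrightarrow> (Idn T x, Zero T x z, Zero T z (susp_ob T x)) \<in> Dist T"
    and dist_cone: "f \<in> Mor T \<Longrightarrow> \<exists>g h. (f, g, h) \<in> Dist T"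
    and dist_rotate: "is_triangle T (f, g, h) \<Longrightarrow>
      (f, g, h) \<in> Dist T \<longleftrightarrow> (g, h, neg T (susp_ar T f)) \<in> Dist T"
    and dist_fill: "(f, g, h) \<in> Dist T \<Longrightarrow> (f', g', h') \<in> Dist T
      \<Longrightarrow> a \<in> Hom T (Dom T f) (Dom T f') \<Longrightarrow> b \<in> Hom T (Cod T f) (Cod T f') \<Longrightarrow> b \<cdot> f = f' \<cdot> a
      \<Longrightarrow> \<exists>c. is_triangle_map T (f, g, h) (f', g', h') a b c"
    and octahedral: "(f, j, d) \<in> Dist T \<Longrightarrow> (g, k, e) \<in> Dist T \<Longrightarrow> Dom T g = Cod T f
      \<Longrightarrow> (g \<cdot> f, l, r) \<in> Dist T
      \<Longrightarrow> \<exists>m n. (m, n, susp_ar T j \<cdot> e) \<in> Dist T \<and> m \<cdot> j = l \<cdot> g \<and> n \<cdot> l = k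
            \<and> r \<cdot> m = d \<and> e \<cdot> n = susp_ar T f \<cdot> r"

text \<open>Compatibility of the tensor product with the triangulation: there are natural isomorphisms
  \<open>e x y : \<Sigma> x \<otimes> y \<rightarrow> \<Sigma> (x \<otimes> y)\<close>, compatible with unit and associativity isomorphisms, which make
  \<open>- \<otimes> y\<close> exact and for which the two identifications of \<open>\<Sigma> x \<otimes> \<Sigma> y\<close> with \<open>\<Sigma> (\<Sigma> (x \<otimes> y))\<close> differ by
  a sign.  Exactness in the other variable follows by symmetry.\<close>
definition tensor_exact :: "('u, 'o, 'm, 'z) ttc_scheme \<Rightarrow> bool" where
  "tensor_exact T \<longleftrightarrow> (\<exists>e :: 'o \<Rightarrow> 'o \<Rightarrow> 'm.
     (\<forall>x \<in> Obj T. \<forall>y \<in> Obj T.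
        e x y \<in> Hom T (susp_ob T x \<boxtimes>\<^bsub>T\<^esub> y) (susp_ob T (x \<boxtimes>\<^bsub>T\<^esub> y)) \<and> is_iso T (e x y))
     \<and> (\<forall>x x' y y'. \<forall>f \<in> Hom T x x'. \<forall>g \<in> Hom T y y'.
          e x' y' \<cdot>\<^bsub>T\<^esub> (susp_ar T f \<boxdot>\<^bsub>T\<^esub> g) = susp_ar T (f \<boxdot>\<^bsub>T\<^esub> g) \<cdot>\<^bsub>T\<^esub> e x y)
     \<and> (\<forall>x \<in> Obj T. susp_ar T (RUnit T x) \<cdot>\<^bsub>T\<^esub> e x (Unit T) = RUnit T (susp_ob T x))
     \<and> (\<forall>x \<in> Obj T. \<forall>y \<in> Obj T. \<forall>z \<in> Obj T.
          susp_ar T (Assoc T x y z) \<cdot>\<^bsub>T\<^esub> (e (x \<boxtimes>\<^bsub>T\<^esub> y) z \<cdot>\<^bsub>T\<^esub> (e x y \<boxdot>\<^bsub>T\<^esub> Idn T z))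
          = e x (y \<boxtimes>\<^bsub>T\<^esub> z) \<cdot>\<^bsub>T\<^esub> Assoc T (susp_ob T x) y z)
     \<and> (\<forall>f g h. \<forall>y \<in> Obj T. (f, g, h) \<in> Dist T \<longrightarrow>
          (f \<boxdot>\<^bsub>T\<^esub> Idn T y, g \<boxdot>\<^bsub>T\<^esub> Idn T y, e (Dom T f) y \<cdot>\<^bsub>T\<^esub> (h \<boxdot>\<^bsub>T\<^esub> Idn T y)) \<in> Dist T)
     \<and> (\<forall>x \<in> Obj T. \<forall>y \<in> Obj T.
          let e' = (\<lambda>x y. susp_ar T (Braid T y x) \<cdot>\<^bsub>T\<^esub> (e y x \<cdot>\<^bsub>T\<^esub> Braid T x (susp_ob T y)))
          in susp_ar T (e' x y) \<cdot>\<^bsub>T\<^esub> e x (susp_ob T y)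
             = neg T (susp_ar T (e x y) \<cdot>\<^bsub>T\<^esub> e' (susp_ob T x) y)))"

locale tensor_triangulated_category = triangulated_category T + symmetric_monoidal T
    for T :: "('u, 'o, 'm, 'z) ttc_scheme" (structure) +
  assumes tensor_exact: "tensor_exact T"
    and tensor_add: "f \<in> Hom T x x' \<Longrightarrow> f' \<in> Hom T x x' \<Longrightarrow> g \<in> Hom T y y' \<Longrightarrow>
      Add T f f' \<boxdot> g = Add T (f \<boxdot> g) (f' \<boxdot> g) \<and> g \<boxdot> Add T f f' = Add T (g \<boxdot> f) (g \<boxdot> f')"

text \<open>An object \<open>x\<close> is compact if for every small coproduct \<open>c\<close> of objects \<open>X i\<close> the canonical map
  from the direct sum of the groups \<open>Hom x (X i)\<close> to \<open>Hom x c\<close> is bijective.\<close>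
definition compact_obj :: "('u, 'o, 'm, 'z) ttc_scheme \<Rightarrow> 'o \<Rightarrow> bool" where
  "compact_obj T x \<longleftrightarrow> x \<in> Obj T \<and> (\<forall>(I :: 'u set) X c \<iota>.
     small (Univ T) I \<and> (\<forall>i \<in> I. X i \<in> Obj T) \<and> is_coproduct T I X c \<iota> \<longrightarrow>
     bij_betw
       (\<lambda>\<phi>. finprod (hom_group T x c) (\<lambda>i. \<iota> i \<cdot>\<^bsub>T\<^esub> \<phi> i) {i \<in> I. \<phi> i \<noteq> Zero T x (X i)})
       {\<phi> \<in> (\<Pi>\<^sub>E i \<in> I. Hom T x (X i)). finite {i \<in> I. \<phi> i \<noteq> Zero T x (X i)}}
       (Hom T x c))"

abbreviation compacts :: "('u, 'o, 'm, 'z) ttc_scheme \<Rightarrow> 'o set" where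
  "compacts T \<equiv> {x. compact_obj T x}"

locale rigidly_compactly_generated = tensor_triangulated_category T
    for T :: "('u, 'o, 'm, 'z) ttc_scheme" (structure) +
  assumes universe: "inaccessible (Univ T)"
    and locally_small: "x \<in> Obj T \<Longrightarrow> y \<in> Obj T \<Longrightarrow> small (Univ T) (Hom T x y)"
    and closed: "closed_monoidal T"
    and ex_coproduct: "small (Univ T) (I :: 'u set) \<Longrightarrow> \<forall>i \<in> I. X i \<in> Obj T \<Longrightarrow>
      \<exists>c \<iota>. is_coproduct T I X c \<iota>"
    and compacts_essentially_small:
      "\<exists>S. S \<subseteq> compacts T \<and> small (Univ T) S \<and> (\<forall>x \<in> compacts T. \<exists>y \<in> S. isomorphic T x y)"
    and compacts_generate: "x \<in> Obj T \<Longrightarrow> \<forall>c \<in> compacts T. Hom T c x = {Zero T c x} \<Longrightarrow> is_zero T x"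
    and compact_iff_rigid: "compact_obj T x \<longleftrightarrow> rigid T x"


section \<open>Localizing subcategories and the Balmer spectrum\<close>

text \<open>Full triangulated subcategories closed under isomorphism, given by their objects.\<close>
definition triangulated_subcat :: "('u, 'o, 'm, 'z) ttc_scheme \<Rightarrow> 'o set \<Rightarrow> bool" where
  "triangulated_subcat T S \<longleftrightarrow> S \<subseteq> Obj T \<and> {z. is_zero T z} \<subseteq> S
     \<and> (\<forall>x \<in> S. \<forall>y. isomorphic T x y \<longrightarrow> y \<in> S)
     \<and> (\<forall>x \<in> Obj T. susp_ob T x \<in> S \<longleftrightarrow> x \<in> S)
     \<and> (\<forall>f g h. (f, g, h) \<in> Dist T \<and> Dom T f \<in> S \<and> Cod T f \<in> S \<longrightarrow> Cod T g \<in> S)"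

definition localizing_subcat :: "('u, 'o, 'm, 'z) ttc_scheme \<Rightarrow> 'o set \<Rightarrow> bool" where
  "localizing_subcat T S \<longleftrightarrow> triangulated_subcat T S
     \<and> (\<forall>(I :: 'u set) X c \<iota>. small (Univ T) I \<and> (\<forall>i \<in> I. X i \<in> S) \<and> is_coproduct T I X c \<iota>
          \<longrightarrow> c \<in> S)"

definition localizing_ideal :: "('u, 'o, 'm, 'z) ttc_scheme \<Rightarrow> 'o set \<Rightarrow> bool" where
  "localizing_ideal T S \<longleftrightarrow> localizing_subcat T S \<and> (\<forall>x \<in> S. \<forall>y \<in> Obj T. x \<boxtimes>\<^bsub>T\<^esub> y \<in> S)"

definition Loc :: "('u, 'o, 'm, 'z) ttc_scheme \<Rightarrow> 'o set \<Rightarrow> 'o set" where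
  "Loc T X = \<Inter>{S. localizing_subcat T S \<and> X \<subseteq> S}"

definition Locid :: "('u, 'o, 'm, 'z) ttc_scheme \<Rightarrow> 'o set \<Rightarrow> 'o set" where
  "Locid T X = \<Inter>{S. localizing_ideal T S \<and> X \<subseteq> S}"

definition right_orthogonal :: "('u, 'o, 'm, 'z) ttc_scheme \<Rightarrow> 'o set \<Rightarrow> 'o set" where
  "right_orthogonal T S = {y \<in> Obj T. \<forall>x \<in> S. Hom T x y = {Zero T x y}}"

definition thick_ideal :: "('u, 'o, 'm, 'z) ttc_scheme \<Rightarrow> 'o set \<Rightarrow> bool" where
  "thick_ideal T S \<longleftrightarrow> S \<subseteq> compacts T \<and> triangulated_subcat T S
     \<and> (\<forall>X c \<iota>. (\<forall>i. X i \<in> Obj T) \<and> is_coproduct T (UNIV :: bool set) X c \<iota> \<and> c \<in> S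
          \<longrightarrow> (\<forall>i. X i \<in> S))
     \<and> (\<forall>x \<in> S. \<forall>y \<in> compacts T. x \<boxtimes>\<^bsub>T\<^esub> y \<in> S)"

definition Spc :: "('u, 'o, 'm, 'z) ttc_scheme \<Rightarrow> 'o set set" where
  "Spc T = {P. thick_ideal T P \<and> P \<noteq> compacts T
     \<and> (\<forall>x \<in> compacts T. \<forall>y \<in> compacts T. x \<boxtimes>\<^bsub>T\<^esub> y \<in> P \<longrightarrow> x \<in> P \<or> y \<in> P)}"

definition balmer_supp :: "('u, 'o, 'm, 'z) ttc_scheme \<Rightarrow> 'o \<Rightarrow> 'o set set" where
  "balmer_supp T x = {P \<in> Spc T. x \<notin> P}"

text \<open>The sets \<open>balmer_supp T x\<close> form a basis of closed sets.\<close>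
definition spectrum :: "('u, 'o, 'm, 'z) ttc_scheme \<Rightarrow> 'o set topology" where
  "spectrum T = topology_generated_by {Spc T - balmer_supp T x | x. x \<in> compacts T}"

definition constructible_topology :: "'a topology \<Rightarrow> 'a topology" where
  "constructible_topology X = topology_generated_by
     ({V. openin X V \<and> compactin X V} \<union> {topspace X - V | V. openin X V \<and> compactin X V})"

definition scattered :: "'a topology \<Rightarrow> 'a set \<Rightarrow> bool" where
  "scattered X A \<longleftrightarrow> A \<subseteq> topspace X
     \<and> (\<forall>S. S \<subseteq> A \<and> S \<noteq> {} \<longrightarrow> (\<exists>x \<in> S. openin (subtopology X S) {x}))"

definition thomason :: "'a topology \<Rightarrow> 'a set \<Rightarrow> bool" where
  "thomason X Y \<longleftrightarrow> (\<exists>\<F>. (\<forall>Z \<in> \<F>. closedin X Z \<and> compactin X (topspace X - Z)) \<and> Y = \<Union>\<F>)"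


section \<open>Rickard idempotents and tensor triangular support\<close>

definition compacts_on :: "('u, 'o, 'm, 'z) ttc_scheme \<Rightarrow> 'o set set \<Rightarrow> 'o set" where
  "compacts_on T Y = {x \<in> compacts T. balmer_supp T x \<subseteq> Y}"

definition is_rickard_pair :: "('u, 'o, 'm, 'z) ttc_scheme \<Rightarrow> 'o set set \<Rightarrow> 'o \<Rightarrow> 'o \<Rightarrow> bool" where
  "is_rickard_pair T Y G L \<longleftrightarrow> G \<in> Loc T (compacts_on T Y)
     \<and> L \<in> right_orthogonal T (Loc T (compacts_on T Y))
     \<and> (\<exists>f g h. (f, g, h) \<in> Dist T \<and> Dom T f = G \<and> Cod T f = Unit T \<and> Cod T g = L)"

text \<open>The objects \<open>\<Gamma>\<^sub>Y \<one>\<close> and \<open>L\<^sub>Z \<one>\<close> for \<open>Z\<close> the complement of \<open>Y\<close> are unique up to isomorphism, so we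
  may fix a choice of them for each Thomason subset \<open>Y\<close>.\<close>
definition rickard_pair :: "('u, 'o, 'm, 'z) ttc_scheme \<Rightarrow> 'o set set \<Rightarrow> 'o \<times> 'o" where
  "rickard_pair T Y = (SOME (G, L). is_rickard_pair T Y G L)"

definition weakly_visible :: "'a topology \<Rightarrow> 'a set \<Rightarrow> bool" where
  "weakly_visible X W \<longleftrightarrow> (\<exists>Y1 Y2. thomason X Y1 \<and> thomason X Y2 \<and> W = Y1 \<inter> (topspace X - Y2))"

definition idem :: "('u, 'o, 'm, 'z) ttc_scheme \<Rightarrow> 'o set set \<Rightarrow> 'o" where
  "idem T W = (let (Y1, Y2) = (SOME (Y1, Y2). thomason (spectrum T) Y1 \<and> thomason (spectrum T) Y2
                                  \<and> W = Y1 \<inter> (topspace (spectrum T) - Y2))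
               in fst (rickard_pair T Y1) \<boxtimes>\<^bsub>T\<^esub> snd (rickard_pair T Y2))"

definition Supp :: "('u, 'o, 'm, 'z) ttc_scheme \<Rightarrow> 'o \<Rightarrow> 'o set set" where
  "Supp T t = {P \<in> Spc T. \<forall>W. weakly_visible (spectrum T) W \<and> P \<in> W
                  \<longrightarrow> \<not> is_zero T (t \<boxtimes>\<^bsub>T\<^esub> idem T W)}"

definition detection_property :: "('u, 'o, 'm, 'z) ttc_scheme \<Rightarrow> bool" where
  "detection_property T \<longleftrightarrow> (\<forall>t \<in> Obj T. Supp T t = {} \<longrightarrow> is_zero T t)"

definition local_to_global :: "('u, 'o, 'm, 'z) ttc_scheme \<Rightarrow> 'o \<Rightarrow> bool" where
  "local_to_global T t \<longleftrightarrow> (\<forall>\<W>. (\<forall>W \<in> \<W>. weakly_visible (spectrum T) W) \<and> \<Union>\<W> = Spc T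
     \<longrightarrow> t \<in> Locid T ((\<lambda>W. t \<boxtimes>\<^bsub>T\<^esub> idem T W) ` \<W>))"


section \<open>Models: comparing triangulations\<close>

text \<open>In each kind of model the suspension of an object is computed by choices \<open>s \<in> I\<close> (a cone, or a
  pushout square with two zero corners), which exhibit \<open>tgt s\<close> as the suspension of \<open>src s\<close>; \<open>mph\<close>
  contains the maps \<open>(s, s', a, b)\<close> between such choices, with induced maps \<open>a : src s \<rightarrow> src s'\<close> and
  \<open>b : tgt s \<rightarrow> tgt s'\<close> in \<open>T\<close>, and \<open>tri\<close> contains the triangles \<open>(f, g, h, s)\<close> of the model, where
  \<open>h\<close> has target \<open>tgt s\<close>.  The triangulation of \<open>T\<close> is induced by the model if, for suitable natural
  isomorphisms \<open>\<sigma> s : tgt s \<rightarrow> \<Sigma> (src s)\<close>, the distinguished triangles are the triangles isomorphic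
  to those of the model.  Sign conventions are absorbed by \<open>\<sigma>\<close>.\<close>
definition triangulation_induced :: "('u, 'o, 'm, 'z) ttc_scheme \<Rightarrow> 's set \<Rightarrow> ('s \<Rightarrow> 'o) \<Rightarrow> ('s \<Rightarrow> 'o)
    \<Rightarrow> ('s \<times> 's \<times> 'm \<times> 'm) set \<Rightarrow> ('m \<times> 'm \<times> 'm \<times> 's) set \<Rightarrow> bool" where
  "triangulation_induced T I src tgt mph tri \<longleftrightarrow> (\<exists>\<sigma>.
     (\<forall>s \<in> I. \<sigma> s \<in> Hom T (tgt s) (susp_ob T (src s)) \<and> is_iso T (\<sigma> s))
     \<and> (\<forall>(s, s', a, b) \<in> mph. susp_ar T a \<cdot>\<^bsub>T\<^esub> \<sigma> s = \<sigma> s' \<cdot>\<^bsub>T\<^esub> b)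
     \<and> (\<forall>t. t \<in> Dist T \<longleftrightarrow> (\<exists>(f, g, h, s) \<in> tri. triangles_isomorphic T t (f, g, \<sigma> s \<cdot>\<^bsub>T\<^esub> h))))"


section \<open>Stable monoidal model categories\<close>

record ('o, 'm) modelcat = "('o, 'm) smc" +
  Weq :: "'m set"
  Cofb :: "'m set"
  Fibn :: "'m set"

definition is_limit :: "('o, 'm, 'z) cat_scheme \<Rightarrow> ('u, 'u) cat \<Rightarrow> ('u, 'u, 'o, 'm) fctr
    \<Rightarrow> 'o \<Rightarrow> ('u \<Rightarrow> 'm) \<Rightarrow> bool" where
  "is_limit C J F l \<pi> \<longleftrightarrow>
     (let cone = (\<lambda>x p. x \<in> Obj C \<and> (\<forall>j \<in> Obj J. p j \<in> Hom C x (ob F j))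
                       \<and> (\<forall>i j. \<forall>f \<in> Hom J i j. ar F f \<cdot>\<^bsub>C\<^esub> p i = p j))
      in cone l \<pi> \<and> (\<forall>x p. cone x p \<longrightarrow>
           (\<exists>!h. h \<in> Hom C x l \<and> (\<forall>j \<in> Obj J. \<pi> j \<cdot>\<^bsub>C\<^esub> h = p j))))"

definition is_colimit :: "('o, 'm, 'z) cat_scheme \<Rightarrow> ('u, 'u) cat \<Rightarrow> ('u, 'u, 'o, 'm) fctr
    \<Rightarrow> 'o \<Rightarrow> ('u \<Rightarrow> 'm) \<Rightarrow> bool" where
  "is_colimit C J F l \<iota> \<longleftrightarrow>
     (let cocone = (\<lambda>x p. x \<in> Obj C \<and> (\<forall>j \<in> Obj J. p j \<in> Hom C (ob F j) x)
                       \<and> (\<forall>i j. \<forall>f \<in> Hom J i j. p j \<cdot>\<^bsub>C\<^esub> ar F f = p i))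
      in cocone l \<iota> \<and> (\<forall>x p. cocone x p \<longrightarrow>
           (\<exists>!h. h \<in> Hom C l x \<and> (\<forall>j \<in> Obj J. h \<cdot>\<^bsub>C\<^esub> \<iota> j = p j))))"

definition bicomplete :: "'u set \<Rightarrow> ('o, 'm, 'z) cat_scheme \<Rightarrow> bool" where
  "bicomplete U C \<longleftrightarrow> (\<forall>J F. small_cat U J \<and> is_functor J C F
     \<longrightarrow> (\<exists>l \<pi>. is_limit C J F l \<pi>) \<and> (\<exists>l \<iota>. is_colimit C J F l \<iota>))"

definition retract_of :: "('o, 'm, 'z) cat_scheme \<Rightarrow> 'm \<Rightarrow> 'm \<Rightarrow> bool" where
  "retract_of C f g \<longleftrightarrow> f \<in> Mor C \<and> g \<in> Mor C
     \<and> (\<exists>i \<in> Hom C (Dom C f) (Dom C g). \<exists>r \<in> Hom C (Dom C g) (Dom C f).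
        \<exists>i' \<in> Hom C (Cod C f) (Cod C g). \<exists>r' \<in> Hom C (Cod C g) (Cod C f).
          r \<cdot>\<^bsub>C\<^esub> i = Idn C (Dom C f) \<and> r' \<cdot>\<^bsub>C\<^esub> i' = Idn C (Cod C f)
          \<and> g \<cdot>\<^bsub>C\<^esub> i = i' \<cdot>\<^bsub>C\<^esub> f \<and> f \<cdot>\<^bsub>C\<^esub> r = r' \<cdot>\<^bsub>C\<^esub> g)"

definition has_lift :: "('o, 'm, 'z) cat_scheme \<Rightarrow> 'm \<Rightarrow> 'm \<Rightarrow> bool" where
  "has_lift C i p \<longleftrightarrow> (\<forall>u \<in> Hom C (Dom C i) (Dom C p). \<forall>v \<in> Hom C (Cod C i) (Cod C p).
     p \<cdot>\<^bsub>C\<^esub> u = v \<cdot>\<^bsub>C\<^esub> i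
     \<longrightarrow> (\<exists>h \<in> Hom C (Cod C i) (Dom C p). h \<cdot>\<^bsub>C\<^esub> i = u \<and> p \<cdot>\<^bsub>C\<^esub> h = v))"

definition cofibrant :: "('o, 'm, 'z) modelcat_scheme \<Rightarrow> 'o \<Rightarrow> bool" where
  "cofibrant M x \<longleftrightarrow> (\<exists>f \<in> Cofb M. Cod M f = x
     \<and> (\<forall>y \<in> Obj M. \<exists>!g. g \<in> Hom M (Dom M f) y))"

locale model_category = category M for M :: "('o, 'm, 'z) modelcat_scheme" (structure) +
  fixes U :: "'u set"
  assumes bicomplete: "bicomplete U M"
    and classes: "Weq M \<subseteq> Mor M" "Cofb M \<subseteq> Mor M" "Fibn M \<subseteq> Mor M"
    and two_of_three: "f \<in> Hom M x y \<Longrightarrow> g \<in> Hom M y z \<Longrightarrow>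
      (f \<in> Weq M \<and> g \<in> Weq M \<longrightarrow> g \<cdot> f \<in> Weq M) \<and> (f \<in> Weq M \<and> g \<cdot> f \<in> Weq M \<longrightarrow> g \<in> Weq M)
      \<and> (g \<in> Weq M \<and> g \<cdot> f \<in> Weq M \<longrightarrow> f \<in> Weq M)"
    and retracts: "retract_of M f g \<Longrightarrow>
      (g \<in> Weq M \<longrightarrow> f \<in> Weq M) \<and> (g \<in> Cofb M \<longrightarrow> f \<in> Cofb M) \<and> (g \<in> Fibn M \<longrightarrow> f \<in> Fibn M)"
    and lifting: "i \<in> Cofb M \<Longrightarrow> p \<in> Fibn M \<Longrightarrow> i \<in> Weq M \<or> p \<in> Weq M \<Longrightarrow> has_lift M i p"
    and factorization: "f \<in> Mor M \<Longrightarrow>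
      (\<exists>i \<in> Cofb M \<inter> Weq M. \<exists>p \<in> Fibn M. Cod M i = Dom M p \<and> f = p \<cdot> i)
      \<and> (\<exists>i \<in> Cofb M. \<exists>p \<in> Fibn M \<inter> Weq M. Cod M i = Dom M p \<and> f = p \<cdot> i)"

locale monoidal_model_category = model_category M U + symmetric_monoidal M
    for M :: "('o, 'm, 'z) modelcat_scheme" (structure) and U :: "'u set" +
  assumes closed: "closed_monoidal M"
    and pushout_product: "f \<in> Cofb M \<Longrightarrow> g \<in> Cofb M
      \<Longrightarrow> is_pushout M (f \<boxdot> Idn M (Dom M g)) (Idn M (Dom M f) \<boxdot> g) p q
      \<Longrightarrow> k \<in> Hom M (Cod M p) (Cod M f \<boxtimes> Cod M g)
      \<Longrightarrow> k \<cdot> p = Idn M (Cod M f) \<boxdot> g \<Longrightarrow> k \<cdot> q = f \<boxdot> Idn M (Cod M g)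
      \<Longrightarrow> k \<in> Cofb M \<and> (f \<in> Weq M \<or> g \<in> Weq M \<longrightarrow> k \<in> Weq M)"
    and unit_axiom: "q \<in> Weq M \<Longrightarrow> Cod M q = Unit M \<Longrightarrow> cofibrant M (Dom M q) \<Longrightarrow> cofibrant M x
      \<Longrightarrow> q \<boxdot> Idn M x \<in> Weq M"

text \<open>The Gabriel-Zisman localization: words in the morphisms and formal inverses of weak
  equivalences, read in order of application, modulo the evident relations.\<close>
datatype 'm step = Fwd 'm | Bwd 'm

fun zigzag :: "('o, 'm, 'z) cat_scheme \<Rightarrow> 'm set \<Rightarrow> 'o \<Rightarrow> 'o \<Rightarrow> 'm step list \<Rightarrow> bool" where
  "zigzag C W x y [] \<longleftrightarrow> x \<in> Obj C \<and> x = y"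
| "zigzag C W x y (Fwd f # zs) \<longleftrightarrow> f \<in> Mor C \<and> Dom C f = x \<and> zigzag C W (Cod C f) y zs"
| "zigzag C W x y (Bwd f # zs) \<longleftrightarrow> f \<in> W \<and> Cod C f = x \<and> zigzag C W (Dom C f) y zs"

inductive zigzag_eq :: "('o, 'm, 'z) cat_scheme \<Rightarrow> 'm set \<Rightarrow> 'o \<Rightarrow> 'o \<Rightarrow> 'm step list \<Rightarrow> 'm step list \<Rightarrow> bool"
  for C W where
  "zigzag C W x y s \<Longrightarrow> zigzag_eq C W x y s s"
| "zigzag_eq C W x y s t \<Longrightarrow> zigzag_eq C W x y t s"
| "zigzag_eq C W x y r s \<Longrightarrow> zigzag_eq C W x y s t \<Longrightarrow> zigzag_eq C W x y r t"
| "zigzag_eq C W x y s s' \<Longrightarrow> zigzag_eq C W y z t t' \<Longrightarrow> zigzag_eq C W x z (s @ t) (s' @ t')"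
| "x \<in> Obj C \<Longrightarrow> zigzag_eq C W x x [Fwd (Idn C x)] []"
| "f \<in> Hom C x y \<Longrightarrow> g \<in> Hom C y z \<Longrightarrow> zigzag_eq C W x z [Fwd f, Fwd g] [Fwd (g \<cdot>\<^bsub>C\<^esub> f)]"
| "w \<in> W \<Longrightarrow> w \<in> Hom C x y \<Longrightarrow> zigzag_eq C W x x [Fwd w, Bwd w] []"
| "w \<in> W \<Longrightarrow> w \<in> Hom C x y \<Longrightarrow> zigzag_eq C W y y [Bwd w, Fwd w] []"

fun zigzag_value :: "('o, 'm, 'y) cat_scheme \<Rightarrow> ('p, 'n, 'z) cat_scheme \<Rightarrow> ('o, 'm, 'p, 'n) fctr
    \<Rightarrow> 'o \<Rightarrow> 'm step list \<Rightarrow> 'n" where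
  "zigzag_value C D F x [] = Idn D (ob F x)"
| "zigzag_value C D F x (Fwd f # zs) = zigzag_value C D F (Cod C f) zs \<cdot>\<^bsub>D\<^esub> ar F f"
| "zigzag_value C D F x (Bwd f # zs) = zigzag_value C D F (Dom C f) zs \<cdot>\<^bsub>D\<^esub> inverse_mor D (ar F f)"

text \<open>\<open>F\<close> inverts \<open>W\<close> and the induced functor from the localization of \<open>C\<close> at \<open>W\<close> to \<open>D\<close> is an
  equivalence.\<close>
definition is_localization :: "('o, 'm, 'y) cat_scheme \<Rightarrow> 'm set \<Rightarrow> ('p, 'n, 'z) cat_scheme
    \<Rightarrow> ('o, 'm, 'p, 'n) fctr \<Rightarrow> bool" where
  "is_localization C W D F \<longleftrightarrow> is_functor C D F \<and> (\<forall>w \<in> W. is_iso D (ar F w))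
     \<and> (\<forall>d \<in> Obj D. \<exists>x \<in> Obj C. isomorphic D (ob F x) d)
     \<and> (\<forall>x \<in> Obj C. \<forall>y \<in> Obj C. \<forall>h \<in> Hom D (ob F x) (ob F y).
          \<exists>zs. zigzag C W x y zs \<and> zigzag_value C D F x zs = h)
     \<and> (\<forall>x y s t. zigzag C W x y s \<and> zigzag C W x y t
          \<and> zigzag_value C D F x s = zigzag_value C D F x t \<longrightarrow> zigzag_eq C W x y s t)"

definition is_cofiber :: "('o, 'm, 'z) cat_scheme \<Rightarrow> 'm \<Rightarrow> 'm \<Rightarrow> bool" where
  "is_cofiber M i p \<longleftrightarrow> (\<exists>z u v. is_zero M z \<and> u \<in> Hom M (Dom M i) z \<and> v \<in> Hom M z (Cod M p)
     \<and> is_pushout M i u p v)"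

text \<open>\<open>(j, q)\<close> consists of a cofibration \<open>j : x \<rightarrow> c\<close> from a cofibrant object to a weakly contractible
  one and its cofiber \<open>q : c \<rightarrow> s\<close>, so that \<open>s\<close> is a model for the suspension of \<open>x\<close>.\<close>
definition is_cone_datum :: "('o, 'm, 'z) modelcat_scheme \<Rightarrow> 'm \<times> 'm \<Rightarrow> bool" where
  "is_cone_datum M = (\<lambda>(j, q). j \<in> Cofb M \<and> cofibrant M (Dom M j) \<and> is_cofiber M j q
     \<and> (\<exists>z. is_zero M z \<and> (\<exists>w \<in> Weq M. w \<in> Hom M (Cod M j) z)))"

definition cone_maps :: "('o, 'm, 'y) modelcat_scheme \<Rightarrow> ('o, 'm, 'p, 'n) fctr
    \<Rightarrow> (('m \<times> 'm) \<times> ('m \<times> 'm) \<times> 'n \<times> 'n) set" where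
  "cone_maps M \<gamma> = {((j, q), (j', q'), ar \<gamma> a, ar \<gamma> b) | j q j' q' a b.
     is_cone_datum M (j, q) \<and> is_cone_datum M (j', q')
     \<and> a \<in> Hom M (Dom M j) (Dom M j') \<and> b \<in> Hom M (Cod M q) (Cod M q')
     \<and> (\<exists>c \<in> Hom M (Cod M j) (Cod M j'). c \<cdot>\<^bsub>M\<^esub> j = j' \<cdot>\<^bsub>M\<^esub> a \<and> b \<cdot>\<^bsub>M\<^esub> q = q' \<cdot>\<^bsub>M\<^esub> c)}"

text \<open>The Puppe sequence of a cofibration \<open>i : x \<rightarrow> y\<close> with cofiber \<open>p : y \<rightarrow> y / x\<close>: the mapping
  cone of \<open>i\<close> maps to \<open>y / x\<close> by the weak equivalence \<open>c1\<close> which collapses the cone \<open>c\<close> on \<open>x\<close>, and to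
  the suspension by the map \<open>c2\<close> which collapses \<open>y\<close>.\<close>
definition cofiber_triangles :: "('o, 'm, 'y) modelcat_scheme \<Rightarrow> ('p, 'n, 'z) cat_scheme
    \<Rightarrow> ('o, 'm, 'p, 'n) fctr \<Rightarrow> ('n \<times> 'n \<times> 'n \<times> ('m \<times> 'm)) set" where
  "cofiber_triangles M T \<gamma> = {(ar \<gamma> i, ar \<gamma> p, ar \<gamma> c2 \<cdot>\<^bsub>T\<^esub> inverse_mor T (ar \<gamma> c1), (j, q)) | i p c1 c2 j q.
     i \<in> Cofb M \<and> cofibrant M (Dom M i) \<and> is_cofiber M i p
     \<and> is_cone_datum M (j, q) \<and> Dom M j = Dom M i
     \<and> (\<exists>k l. is_pushout M i j k l
          \<and> c1 \<in> Hom M (Cod M k) (Cod M p) \<and> c1 \<cdot>\<^bsub>M\<^esub> k = p \<and> is_zero_map M (c1 \<cdot>\<^bsub>M\<^esub> l)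
          \<and> c2 \<in> Hom M (Cod M k) (Cod M q) \<and> c2 \<cdot>\<^bsub>M\<^esub> l = q \<and> is_zero_map M (c2 \<cdot>\<^bsub>M\<^esub> k))}"

text \<open>\<open>T\<close> is, as a tensor triangulated category, the homotopy category of the pointed monoidal model
  category \<open>M\<close>: the tensor product of cofibrant objects computes the derived tensor product, and the
  suspension and the triangles are those of \<open>M\<close>.  Since the suspension of \<open>T\<close> is an equivalence, \<open>M\<close>
  is then stable.\<close>
definition is_homotopy_category_of_model_category ::
    "('u, 'p, 'n, 'z) ttc_scheme \<Rightarrow> ('o, 'm) modelcat \<Rightarrow> bool" where
  "is_homotopy_category_of_model_category T M \<longleftrightarrow>
     monoidal_model_category M (Univ T) \<and> (\<exists>z. is_zero M z)
     \<and> (\<exists>\<gamma> \<mu> \<eta>. is_localization M (Weq M) T \<gamma>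
        \<and> \<eta> \<in> Hom T (Unit T) (ob \<gamma> (Unit M)) \<and> is_iso T \<eta>
        \<and> (\<forall>x y. cofibrant M x \<and> cofibrant M y \<longrightarrow>
             \<mu> x y \<in> Hom T (ob \<gamma> x \<boxtimes>\<^bsub>T\<^esub> ob \<gamma> y) (ob \<gamma> (x \<boxtimes>\<^bsub>M\<^esub> y)) \<and> is_iso T (\<mu> x y)
             \<and> ar \<gamma> (Braid M x y) \<cdot>\<^bsub>T\<^esub> \<mu> x y = \<mu> y x \<cdot>\<^bsub>T\<^esub> Braid T (ob \<gamma> x) (ob \<gamma> y))
        \<and> (\<forall>x x' y y'. \<forall>f \<in> Hom M x x'. \<forall>g \<in> Hom M y y'.
             cofibrant M x \<and> cofibrant M x' \<and> cofibrant M y \<and> cofibrant M y' \<longrightarrow>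
             \<mu> x' y' \<cdot>\<^bsub>T\<^esub> (ar \<gamma> f \<boxdot>\<^bsub>T\<^esub> ar \<gamma> g) = ar \<gamma> (f \<boxdot>\<^bsub>M\<^esub> g) \<cdot>\<^bsub>T\<^esub> \<mu> x y)
        \<and> (\<forall>x y z. cofibrant M x \<and> cofibrant M y \<and> cofibrant M z \<longrightarrow>
             ar \<gamma> (Assoc M x y z) \<cdot>\<^bsub>T\<^esub> (\<mu> (x \<boxtimes>\<^bsub>M\<^esub> y) z \<cdot>\<^bsub>T\<^esub> (\<mu> x y \<boxdot>\<^bsub>T\<^esub> Idn T (ob \<gamma> z)))
             = \<mu> x (y \<boxtimes>\<^bsub>M\<^esub> z) \<cdot>\<^bsub>T\<^esub>
                 ((Idn T (ob \<gamma> x) \<boxdot>\<^bsub>T\<^esub> \<mu> y z) \<cdot>\<^bsub>T\<^esub> Assoc T (ob \<gamma> x) (ob \<gamma> y) (ob \<gamma> z)))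
        \<and> (\<forall>x. \<forall>q \<in> Weq M. cofibrant M x \<and> cofibrant M (Dom M q) \<and> Cod M q = Unit M \<longrightarrow>
             ar \<gamma> (LUnit M x \<cdot>\<^bsub>M\<^esub> (q \<boxdot>\<^bsub>M\<^esub> Idn M x)) \<cdot>\<^bsub>T\<^esub> (\<mu> (Dom M q) x \<cdot>\<^bsub>T\<^esub>
               ((inverse_mor T (ar \<gamma> q) \<cdot>\<^bsub>T\<^esub> \<eta>) \<boxdot>\<^bsub>T\<^esub> Idn T (ob \<gamma> x))) = LUnit T (ob \<gamma> x))
        \<and> triangulation_induced T {s. is_cone_datum M s}
            (\<lambda>(j, q). ob \<gamma> (Dom M j)) (\<lambda>(j, q). ob \<gamma> (Cod M q))
            (cone_maps M \<gamma>) (cofiber_triangles M T \<gamma>))"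


section \<open>Stable symmetric monoidal infinity-categories\<close>

text \<open>\<open>Face n i : X n \<rightarrow> X (n - 1)\<close> and \<open>Degen n i : X n \<rightarrow> X (n + 1)\<close>.\<close>
record 's sset =
  Simp :: "nat \<Rightarrow> 's set"
  Face :: "nat \<Rightarrow> nat \<Rightarrow> 's \<Rightarrow> 's"
  Degen :: "nat \<Rightarrow> nat \<Rightarrow> 's \<Rightarrow> 's"

definition is_sset :: "('s, 'z) sset_scheme \<Rightarrow> bool" where
  "is_sset X \<longleftrightarrow>
     (\<forall>n. \<forall>x \<in> Simp X (Suc n). \<forall>i \<le> Suc n. Face X (Suc n) i x \<in> Simp X n)
     \<and> (\<forall>n. \<forall>x \<in> Simp X n. \<forall>i \<le> n. Degen X n i x \<in> Simp X (Suc n))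
     \<and> (\<forall>n. \<forall>x \<in> Simp X (Suc (Suc n)). \<forall>i j. i < j \<and> j \<le> Suc (Suc n) \<longrightarrow>
          Face X (Suc n) i (Face X (Suc (Suc n)) j x)
          = Face X (Suc n) (j - 1) (Face X (Suc (Suc n)) i x))
     \<and> (\<forall>n. \<forall>x \<in> Simp X n. \<forall>i j. i \<le> j \<and> j \<le> n \<longrightarrow>
          Degen X (Suc n) i (Degen X n j x) = Degen X (Suc n) (Suc j) (Degen X n i x))
     \<and> (\<forall>n. \<forall>x \<in> Simp X n. \<forall>i \<le> Suc n. \<forall>j \<le> n. Face X (Suc n) i (Degen X n j x) =
          (if i < j then Degen X (n - 1) (j - 1) (Face X n i x)
           else if i \<le> Suc j then x
           else Degen X (n - 1) j (Face X n (i - 1) x)))"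

text \<open>A set \<open>K\<close> of finite nonempty sets of natural numbers, closed under nonempty subsets, is an
  ordered simplicial complex.  The simplices of the associated simplicial set are the nonempty weakly
  increasing lists with set of entries in \<open>K\<close>; faces delete entries and degeneracies repeat them.\<close>
definition chains :: "nat set set \<Rightarrow> nat list set" where
  "chains K = {xs. xs \<noteq> [] \<and> sorted xs \<and> set xs \<in> K}"

definition sset_map :: "nat set set \<Rightarrow> ('s, 'z) sset_scheme \<Rightarrow> (nat list \<Rightarrow> 's) \<Rightarrow> bool" where
  "sset_map K X \<phi> \<longleftrightarrow> (\<forall>n. \<forall>xs \<in> chains K. length xs = Suc n \<longrightarrow>
     \<phi> xs \<in> Simp X n
     \<and> (\<forall>i \<le> n. n \<noteq> 0 \<longrightarrow> \<phi> (take i xs @ drop (Suc i) xs) = Face X n i (\<phi> xs))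
     \<and> (\<forall>i \<le> n. \<phi> (take (Suc i) xs @ drop i xs) = Degen X n i (\<phi> xs)))"

definition agree_on :: "nat set set \<Rightarrow> (nat list \<Rightarrow> 's) \<Rightarrow> (nat list \<Rightarrow> 's) \<Rightarrow> bool" where
  "agree_on K \<phi> \<psi> \<longleftrightarrow> (\<forall>xs \<in> chains K. \<phi> xs = \<psi> xs)"

definition extends :: "('s, 'z) sset_scheme \<Rightarrow> nat set set \<Rightarrow> nat set set \<Rightarrow> (nat list \<Rightarrow> 's) \<Rightarrow> bool" where
  "extends X K L \<phi> \<longleftrightarrow> (\<exists>\<psi>. sset_map L X \<psi> \<and> agree_on K \<phi> \<psi>)"

definition full_simplex :: "nat \<Rightarrow> nat set set" where
  "full_simplex n = {S. S \<subseteq> {..n} \<and> S \<noteq> {}}"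

definition boundary :: "nat \<Rightarrow> nat set set" where
  "boundary n = full_simplex n - {{..n}}"

definition horn :: "nat \<Rightarrow> nat \<Rightarrow> nat set set" where
  "horn n i = {S \<in> full_simplex n. \<exists>j \<le> n. j \<noteq> i \<and> j \<notin> S}"

definition quasicategory :: "('s, 'z) sset_scheme \<Rightarrow> bool" where
  "quasicategory X \<longleftrightarrow> is_sset X \<and> (\<forall>n i \<phi>. 0 < i \<and> i < n \<and> sset_map (horn n i) X \<phi>
     \<longrightarrow> extends X (horn n i) (full_simplex n) \<phi>)"

abbreviation esrc :: "('s, 'z) sset_scheme \<Rightarrow> 's \<Rightarrow> 's" where
  "esrc X f \<equiv> Face X 1 1 f"

abbreviation etgt :: "('s, 'z) sset_scheme \<Rightarrow> 's \<Rightarrow> 's" where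
  "etgt X f \<equiv> Face X 1 0 f"

definition edges :: "('s, 'z) sset_scheme \<Rightarrow> 's \<Rightarrow> 's \<Rightarrow> 's set" where
  "edges X x y = {f \<in> Simp X 1. esrc X f = x \<and> etgt X f = y}"

text \<open>The edge \<open>h\<close> is a composite of \<open>f\<close> followed by \<open>g\<close>.\<close>
definition is_composite :: "('s, 'z) sset_scheme \<Rightarrow> 's \<Rightarrow> 's \<Rightarrow> 's \<Rightarrow> bool" where
  "is_composite X f g h \<longleftrightarrow> (\<exists>s \<in> Simp X 2. Face X 2 2 s = f \<and> Face X 2 0 s = g \<and> Face X 2 1 s = h)"

text \<open>In the homotopy category, \<open>f\<close> followed by \<open>g\<close> equals \<open>f'\<close> followed by \<open>g'\<close>.\<close>
definition commutes :: "('s, 'z) sset_scheme \<Rightarrow> 's \<Rightarrow> 's \<Rightarrow> 's \<Rightarrow> 's \<Rightarrow> bool" where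
  "commutes X f g f' g' \<longleftrightarrow> (\<exists>h. is_composite X f g h \<and> is_composite X f' g' h)"

definition is_edge_equivalence :: "('s, 'z) sset_scheme \<Rightarrow> 's \<Rightarrow> bool" where
  "is_edge_equivalence X f \<longleftrightarrow> f \<in> Simp X 1 \<and> (\<exists>g.
     is_composite X f g (Degen X 0 0 (esrc X f)) \<and> is_composite X g f (Degen X 0 0 (etgt X f)))"

definition is_zero_vertex :: "('s, 'z) sset_scheme \<Rightarrow> 's \<Rightarrow> bool" where
  "is_zero_vertex X x \<longleftrightarrow> x \<in> Simp X 0
     \<and> (\<forall>n \<phi>. n \<ge> 1 \<and> sset_map (boundary n) X \<phi> \<and> (\<phi> [0] = x \<or> \<phi> [n] = x)
          \<longrightarrow> extends X (boundary n) (full_simplex n) \<phi>)"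

text \<open>\<open>cocone_complex n\<close> is the join of the span \<open>1 \<leftarrow> 0 \<rightarrow> 2\<close> with the simplex on \<open>3, \<dots>, n + 3\<close>, and
  dually for \<open>cone_complex n\<close> with the cospan \<open>n + 1 \<rightarrow> n + 3 \<leftarrow> n + 2\<close>.  For \<open>n = 0\<close> both are the
  square with initial vertex \<open>0\<close>, intermediate vertices \<open>1\<close>, \<open>2\<close> and final vertex \<open>3\<close>.\<close>
definition cocone_complex :: "nat \<Rightarrow> nat set set" where
  "cocone_complex n = {S \<in> full_simplex (n + 3). \<not> {1, 2} \<subseteq> S}"

definition cone_complex :: "nat \<Rightarrow> nat set set" where
  "cone_complex n = {S \<in> full_simplex (n + 3). \<not> {n + 1, n + 2} \<subseteq> S}"

abbreviation square :: "nat set set" where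
  "square \<equiv> cocone_complex 0"

text \<open>A square is a pushout if it is an initial object of the category of cocones on its span.\<close>
definition pushout_square :: "('s, 'z) sset_scheme \<Rightarrow> (nat list \<Rightarrow> 's) \<Rightarrow> bool" where
  "pushout_square X \<phi> \<longleftrightarrow> sset_map square X \<phi>
     \<and> (\<forall>n \<psi>. let B = {S \<in> cocone_complex n. \<not> {3..n + 3} \<subseteq> S} in
          n \<ge> 1 \<and> sset_map B X \<psi> \<and> agree_on square \<phi> \<psi> \<longrightarrow> extends X B (cocone_complex n) \<psi>)"

definition pullback_square :: "('s, 'z) sset_scheme \<Rightarrow> (nat list \<Rightarrow> 's) \<Rightarrow> bool" where
  "pullback_square X \<phi> \<longleftrightarrow> sset_map square X \<phi>
     \<and> (\<forall>n \<psi>. let B = {S \<in> cone_complex n. \<not> {..n} \<subseteq> S} in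
          n \<ge> 1 \<and> sset_map B X \<psi> \<and> agree_on square \<phi> (\<lambda>xs. \<psi> (map (\<lambda>i. i + n) xs))
          \<longrightarrow> extends X B (cone_complex n) \<psi>)"

definition stable_quasicategory :: "('s, 'z) sset_scheme \<Rightarrow> bool" where
  "stable_quasicategory X \<longleftrightarrow> quasicategory X \<and> (\<exists>x. is_zero_vertex X x)
     \<and> (\<forall>f \<in> Simp X 1.
          (\<exists>\<phi>. pullback_square X \<phi> \<and> is_zero_vertex X (\<phi> [2]) \<and> \<phi> [1, 3] = f)
        \<and> (\<exists>\<phi>. pushout_square X \<phi> \<and> is_zero_vertex X (\<phi> [2]) \<and> \<phi> [0, 1] = f))
     \<and> (\<forall>\<phi>. sset_map square X \<phi> \<and> is_zero_vertex X (\<phi> [2])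
          \<longrightarrow> (pullback_square X \<phi> \<longleftrightarrow> pushout_square X \<phi>))"

text \<open>Pointed maps from \<open>{0..n}\<close> to \<open>{0..m}\<close>, with base point \<open>0\<close>, extended by \<open>0\<close>.\<close>
definition fin_hom :: "nat \<Rightarrow> nat \<Rightarrow> (nat \<Rightarrow> nat) set" where
  "fin_hom n m = {\<alpha>. \<alpha> 0 = 0 \<and> (\<forall>i \<le> n. \<alpha> i \<le> m) \<and> (\<forall>i > n. \<alpha> i = 0)}"

definition fin_id :: "nat \<Rightarrow> nat \<Rightarrow> nat" where
  "fin_id n = (\<lambda>i. if i \<le> n then i else 0)"

text \<open>The map \<open>\<rho>\<^sup>i\<close> which sends \<open>i\<close> to \<open>1\<close> and everything else to the base point.\<close>
definition fin_rho :: "nat \<Rightarrow> nat \<Rightarrow> nat" where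
  "fin_rho i = (\<lambda>k. if k = i then 1 else 0)"

text \<open>Pointed maps given by the list of the images of \<open>1, 2, \<dots>\<close>.\<close>
definition fin_map :: "nat list \<Rightarrow> nat \<Rightarrow> nat" where
  "fin_map as = (\<lambda>k. if 1 \<le> k \<and> k \<le> length as then as ! (k - 1) else 0)"

text \<open>A simplicial set with a map to the nerve of the category of finite pointed sets; as the nerve is
  2-coskeletal, the map is determined by its effect \<open>Lvl\<close> on vertices and \<open>Fin\<close> on edges.\<close>
record 's sset_fin = "'s sset" +
  Lvl :: "'s \<Rightarrow> nat"
  Fin :: "'s \<Rightarrow> nat \<Rightarrow> nat"

definition maps_to_fin :: "('s, 'z) sset_fin_scheme \<Rightarrow> bool" where
  "maps_to_fin E \<longleftrightarrow>
     (\<forall>f \<in> Simp E 1. Fin E f \<in> fin_hom (Lvl E (esrc E f)) (Lvl E (etgt E f)))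
     \<and> (\<forall>x \<in> Simp E 0. Fin E (Degen E 0 0 x) = fin_id (Lvl E x))
     \<and> (\<forall>s \<in> Simp E 2. Fin E (Face E 2 1 s) = Fin E (Face E 2 0 s) \<circ> Fin E (Face E 2 2 s))"

text \<open>\<open>b\<close> is a map from the complex \<open>L\<close> to the nerve of finite pointed sets with values \<open>l\<close> on
  vertices.\<close>
definition base_map :: "nat set set \<Rightarrow> (nat \<Rightarrow> nat) \<Rightarrow> (nat \<Rightarrow> nat \<Rightarrow> nat \<Rightarrow> nat) \<Rightarrow> bool" where
  "base_map L l b \<longleftrightarrow>
     (\<forall>i j. i \<le> j \<and> {i, j} \<in> L \<longrightarrow> b i j \<in> fin_hom (l i) (l j))
     \<and> (\<forall>i. {i} \<in> L \<longrightarrow> b i i = fin_id (l i))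
     \<and> (\<forall>i j k. i \<le> j \<and> j \<le> k \<and> {i, j, k} \<in> L \<longrightarrow> b i k = b j k \<circ> b i j)"

definition lies_over ::
    "('s, 'z) sset_fin_scheme \<Rightarrow> nat set set \<Rightarrow> (nat list \<Rightarrow> 's) \<Rightarrow> (nat \<Rightarrow> nat \<Rightarrow> nat \<Rightarrow> nat) \<Rightarrow> bool" where
  "lies_over E K \<phi> b \<longleftrightarrow> (\<forall>i j. i \<le> j \<and> {i, j} \<in> K \<longrightarrow> Fin E (\<phi> [i, j]) = b i j)"

text \<open>Every extension to \<open>L\<close> of the projection of \<open>\<phi>\<close> lifts to an extension of \<open>\<phi>\<close>; only used when \<open>K\<close>
  and \<open>L\<close> have the same vertices.\<close>
definition extends_over ::
    "('s, 'z) sset_fin_scheme \<Rightarrow> nat set set \<Rightarrow> nat set set \<Rightarrow> (nat list \<Rightarrow> 's) \<Rightarrow> bool" where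
  "extends_over E K L \<phi> \<longleftrightarrow>
     (\<forall>b. base_map L (\<lambda>i. Lvl E (\<phi> [i])) b \<and> lies_over E K \<phi> b
        \<longrightarrow> (\<exists>\<psi>. sset_map L E \<psi> \<and> agree_on K \<phi> \<psi> \<and> lies_over E L \<psi> b))"

definition is_cocartesian :: "('s, 'z) sset_fin_scheme \<Rightarrow> 's \<Rightarrow> bool" where
  "is_cocartesian E f \<longleftrightarrow> f \<in> Simp E 1
     \<and> (\<forall>n \<phi>. n \<ge> 2 \<and> sset_map (horn n 0) E \<phi> \<and> \<phi> [0, 1] = f
          \<longrightarrow> extends_over E (horn n 0) (full_simplex n) \<phi>)"

definition cocart_edges :: "('s, 'z) sset_fin_scheme \<Rightarrow> 's \<Rightarrow> 's \<Rightarrow> (nat \<Rightarrow> nat) \<Rightarrow> 's set" where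
  "cocart_edges E x y \<alpha> = {f \<in> edges E x y. Fin E f = \<alpha> \<and> is_cocartesian E f}"

text \<open>The join of an \<open>m\<close>-simplex with the discrete set \<open>{m + 1..m + k}\<close>.\<close>
definition discrete_cone :: "nat \<Rightarrow> nat \<Rightarrow> nat set set" where
  "discrete_cone m k = {S \<in> full_simplex (m + k). card (S \<inter> {m + 1..m + k}) \<le> 1}"

text \<open>A symmetric monoidal infinity-category, as a cocartesian fibration over finite pointed sets
  satisfying the Segal conditions: every \<open>n\<close> objects over \<open>1\<close> are the components of some object over
  \<open>n\<close>, and the cocartesian edges \<open>f i\<close> over the maps \<open>\<rho>\<^sup>i\<close> exhibit an object over \<open>n\<close> as the relative
  product of its components.  Since the base is the nerve of a category, the projection is an inner
  fibration if and only if \<open>E\<close> is a quasicategory.\<close>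
definition symmetric_monoidal_infty :: "('s, 'z) sset_fin_scheme \<Rightarrow> bool" where
  "symmetric_monoidal_infty E \<longleftrightarrow> quasicategory E \<and> maps_to_fin E
     \<and> (\<forall>x \<in> Simp E 0. \<forall>n. \<forall>\<alpha> \<in> fin_hom (Lvl E x) n.
          \<exists>y \<in> Simp E 0. Lvl E y = n \<and> cocart_edges E x y \<alpha> \<noteq> {})
     \<and> (\<forall>n x. (\<forall>i \<in> {1..n}. x i \<in> Simp E 0 \<and> Lvl E (x i) = 1)
          \<longrightarrow> (\<exists>z \<in> Simp E 0. Lvl E z = n \<and> (\<forall>i \<in> {1..n}. cocart_edges E z (x i) (fin_rho i) \<noteq> {})))
     \<and> (\<forall>n z x f. z \<in> Simp E 0 \<and> Lvl E z = n
          \<and> (\<forall>i \<in> {1..n}. Lvl E (x i) = 1 \<and> f i \<in> cocart_edges E z (x i) (fin_rho i))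
          \<longrightarrow> (\<forall>m \<phi>. let B = {S \<in> discrete_cone m n. \<not> {..m} \<subseteq> S} in
                 m \<ge> 1 \<and> sset_map B E \<phi> \<and> \<phi> [m] = z \<and> (\<forall>i \<in> {1..n}. \<phi> [m, m + i] = f i)
                 \<longrightarrow> extends_over E B (discrete_cone m n) \<phi>))"

text \<open>The fiber over the finite pointed set \<open>{0..n}\<close>.  By the Yoneda lemma a \<open>k\<close>-simplex is a map
  from the standard simplex.\<close>
definition fiber :: "('s, 'z) sset_fin_scheme \<Rightarrow> nat \<Rightarrow> 's sset" where
  "fiber E n = \<lparr>Simp = (\<lambda>k. {\<phi> [0..<Suc k] | \<phi>. sset_map (full_simplex k) E \<phi>
       \<and> (\<forall>i \<le> k. Lvl E (\<phi> [i]) = n) \<and> lies_over E (full_simplex k) \<phi> (\<lambda>_ _. fin_id n)}),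
     Face = Face E, Degen = Degen E\<rparr>"

text \<open>The cocartesian edges \<open>a\<close>, \<open>b\<close>, \<open>m\<close> out of an object over \<open>2\<close> exhibit the target of \<open>m\<close> as the
  tensor product of the targets of \<open>a\<close> and \<open>b\<close>.\<close>
definition is_tensor_datum :: "('s, 'z) sset_fin_scheme \<Rightarrow> 's \<Rightarrow> 's \<Rightarrow> 's \<Rightarrow> 's \<Rightarrow> bool" where
  "is_tensor_datum E z a b m \<longleftrightarrow> z \<in> Simp E 0 \<and> Lvl E z = 2
     \<and> Lvl E (etgt E a) = 1 \<and> Lvl E (etgt E b) = 1 \<and> Lvl E (etgt E m) = 1
     \<and> a \<in> cocart_edges E z (etgt E a) (fin_map [1, 0])
     \<and> b \<in> cocart_edges E z (etgt E b) (fin_map [0, 1])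
     \<and> m \<in> cocart_edges E z (etgt E m) (fin_map [1, 1])"

text \<open>The cube with bottom square on \<open>0, 1, 2, 3\<close>, ordered as above, and top square on \<open>4, 5, 6, 7\<close>.\<close>
definition cube :: "nat set set" where
  "cube = {S \<in> full_simplex 7. \<forall>i \<in> S. \<forall>j \<in> S. i \<le> j \<longrightarrow>
     i div 4 \<le> j div 4 \<and> (i mod 4 = j mod 4 \<or> i mod 4 = 0 \<or> j mod 4 = 3)}"

definition top_square :: "(nat list \<Rightarrow> 's) \<Rightarrow> nat list \<Rightarrow> 's" where
  "top_square \<Phi> = (\<lambda>xs. \<Phi> (map (\<lambda>i. i + 4) xs))"

text \<open>The tensor product is exact in each variable: it preserves zero objects and pushout squares.
  The square \<open>A\<close> is tensored with the essentially constant square \<open>B\<close>, yielding \<open>M\<close>.  The other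
  variable is covered by symmetry.\<close>
definition infty_tensor_exact :: "('s, 'z) sset_fin_scheme \<Rightarrow> bool" where
  "infty_tensor_exact E \<longleftrightarrow>
     (\<forall>z a b m. is_tensor_datum E z a b m \<and> is_zero_vertex (fiber E 1) (etgt E a)
        \<longrightarrow> is_zero_vertex (fiber E 1) (etgt E m))
     \<and> (\<forall>A B M. sset_map cube E A \<and> sset_map cube E B \<and> sset_map cube E M
        \<and> agree_on square A B \<and> agree_on square A M
        \<and> sset_map square (fiber E 2) A
        \<and> (\<forall>i \<le> 3. is_tensor_datum E (A [i]) (A [i, i + 4]) (B [i, i + 4]) (M [i, i + 4]))
        \<and> (\<forall>i j. i \<le> j \<and> {i, j} \<in> square \<longrightarrow> is_edge_equivalence (fiber E 1) (top_square B [i, j]))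
        \<and> pushout_square (fiber E 1) (top_square A)
        \<longrightarrow> pushout_square (fiber E 1) (top_square M))"

text \<open>\<open>\<gamma>\<close> induces an equivalence from the homotopy category of \<open>X\<close> to \<open>T\<close>.\<close>
definition is_homotopy_category :: "('s, 'y) sset_scheme \<Rightarrow> ('o, 'm, 'z) cat_scheme
    \<Rightarrow> ('s, 's, 'o, 'm) fctr \<Rightarrow> bool" where
  "is_homotopy_category X T \<gamma> \<longleftrightarrow>
     (\<forall>x \<in> Simp X 0. ob \<gamma> x \<in> Obj T \<and> ar \<gamma> (Degen X 0 0 x) = Idn T (ob \<gamma> x))
     \<and> (\<forall>x y. \<forall>f \<in> edges X x y. ar \<gamma> f \<in> Hom T (ob \<gamma> x) (ob \<gamma> y))
     \<and> (\<forall>f g h. is_composite X f g h \<longrightarrow> ar \<gamma> h = ar \<gamma> g \<cdot>\<^bsub>T\<^esub> ar \<gamma> f)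
     \<and> (\<forall>x \<in> Simp X 0. \<forall>y \<in> Simp X 0. ar \<gamma> ` edges X x y = Hom T (ob \<gamma> x) (ob \<gamma> y))
     \<and> (\<forall>x y. \<forall>f \<in> edges X x y. \<forall>g \<in> edges X x y. ar \<gamma> f = ar \<gamma> g
          \<longrightarrow> is_composite X f (Degen X 0 0 y) g)
     \<and> (\<forall>d \<in> Obj T. \<exists>x \<in> Simp X 0. isomorphic T (ob \<gamma> x) d)"

definition is_infty_unit :: "('s, 'z) sset_fin_scheme \<Rightarrow> 's \<Rightarrow> bool" where
  "is_infty_unit E n \<longleftrightarrow> Lvl E (esrc E n) = 0 \<and> Lvl E (etgt E n) = 1
     \<and> n \<in> cocart_edges E (esrc E n) (etgt E n) (fin_map [])"

text \<open>The equivalence \<open>\<gamma>\<close> is symmetric monoidal, with structure isomorphisms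
  \<open>\<mu> a b m : \<gamma> x \<otimes> \<gamma> y \<rightarrow> \<gamma> w\<close> for each tensor datum exhibiting \<open>w\<close> as the tensor product of \<open>x\<close> and \<open>y\<close>,
  and \<open>\<eta> n : \<one> \<rightarrow> \<gamma> u\<close> for each cocartesian edge \<open>n\<close> exhibiting \<open>u\<close> as unit object.\<close>
definition is_monoidal_comparison :: "('s, 'y) sset_fin_scheme \<Rightarrow> ('o, 'm, 'z) smc_scheme
    \<Rightarrow> ('s, 's, 'o, 'm) fctr \<Rightarrow> ('s \<Rightarrow> 's \<Rightarrow> 's \<Rightarrow> 'm) \<Rightarrow> ('s \<Rightarrow> 'm) \<Rightarrow> bool" where
  "is_monoidal_comparison E T \<gamma> \<mu> \<eta> \<longleftrightarrow>
     \<comment> \<open>structure isomorphisms and their naturality\<close>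
     (\<forall>z a b m. is_tensor_datum E z a b m \<longrightarrow>
        \<mu> a b m \<in> Hom T (ob \<gamma> (etgt E a) \<boxtimes>\<^bsub>T\<^esub> ob \<gamma> (etgt E b)) (ob \<gamma> (etgt E m))
        \<and> is_iso T (\<mu> a b m))
     \<and> (\<forall>n. is_infty_unit E n \<longrightarrow> \<eta> n \<in> Hom T (Unit T) (ob \<gamma> (etgt E n)) \<and> is_iso T (\<eta> n))
     \<and> (\<forall>z a b m z' a' b' m'. \<forall>c \<in> edges E z z'.
          \<forall>u \<in> Simp (fiber E 1) 1. \<forall>v \<in> Simp (fiber E 1) 1. \<forall>w \<in> Simp (fiber E 1) 1.
          is_tensor_datum E z a b m \<and> is_tensor_datum E z' a' b' m' \<and> Fin E c = fin_id 2
          \<and> commutes E a u c a' \<and> commutes E b v c b' \<and> commutes E m w c m'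
          \<longrightarrow> ar \<gamma> w \<cdot>\<^bsub>T\<^esub> \<mu> a b m = \<mu> a' b' m' \<cdot>\<^bsub>T\<^esub> (ar \<gamma> u \<boxdot>\<^bsub>T\<^esub> ar \<gamma> v))
     \<and> (\<forall>n n' c. \<forall>w \<in> Simp (fiber E 1) 1.
          is_infty_unit E n \<and> is_infty_unit E n' \<and> commutes E n w c n' \<longrightarrow> ar \<gamma> w \<cdot>\<^bsub>T\<^esub> \<eta> n = \<eta> n')
     \<comment> \<open>symmetry\<close>
     \<and> (\<forall>z a b m z' a' b' m'. \<forall>c \<in> edges E z z'.
          is_tensor_datum E z a b m \<and> is_tensor_datum E z' a' b' m' \<and> Fin E c = fin_map [2, 1]
          \<and> is_composite E c a' b \<and> is_composite E c b' a \<and> is_composite E c m' m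
          \<longrightarrow> \<mu> a' b' m' \<cdot>\<^bsub>T\<^esub> Braid T (ob \<gamma> (etgt E a)) (ob \<gamma> (etgt E b)) = \<mu> a b m)
     \<comment> \<open>associativity: \<open>t\<close> has components \<open>x1\<close>, \<open>x2\<close>, \<open>x3\<close>, while \<open>s\<close>, \<open>s'\<close>, \<open>u\<close>, \<open>v\<close> have components
          \<open>(x1, x2)\<close>, \<open>(x2, x3)\<close>, \<open>(x1 \<otimes> x2, x3)\<close>, \<open>(x1, x2 \<otimes> x3)\<close>\<close>
     \<and> (\<forall>t s s' u v as bs ms as' bs' ms' au bu mu av bv mv p1 p2 p3.
          \<forall>k \<in> cocart_edges E t s (fin_map [1, 2, 0]). \<forall>k' \<in> cocart_edges E t s' (fin_map [0, 1, 2]).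
          \<forall>l \<in> cocart_edges E t u (fin_map [1, 1, 2]). \<forall>r \<in> cocart_edges E t v (fin_map [1, 2, 2]).
          Lvl E t = 3 \<and> is_tensor_datum E s as bs ms \<and> is_tensor_datum E s' as' bs' ms'
          \<and> is_tensor_datum E u au bu mu \<and> is_tensor_datum E v av bv mv
          \<and> is_composite E k as p1 \<and> is_composite E r av p1
          \<and> is_composite E k bs p2 \<and> is_composite E k' as' p2
          \<and> is_composite E k' bs' p3 \<and> is_composite E l bu p3
          \<and> commutes E l au k ms \<and> commutes E r bv k' ms' \<and> commutes E l mu r mv
          \<longrightarrow> \<mu> au bu mu \<cdot>\<^bsub>T\<^esub> (\<mu> as bs ms \<boxdot>\<^bsub>T\<^esub> Idn T (ob \<gamma> (etgt E bs')))
              = \<mu> av bv mv \<cdot>\<^bsub>T\<^esub> ((Idn T (ob \<gamma> (etgt E as)) \<boxdot>\<^bsub>T\<^esub> \<mu> as' bs' ms')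
                  \<cdot>\<^bsub>T\<^esub> Assoc T (ob \<gamma> (etgt E as)) (ob \<gamma> (etgt E bs)) (ob \<gamma> (etgt E bs'))))
     \<comment> \<open>unit: \<open>i\<close> inserts the unit as first component of an object over \<open>2\<close>\<close>
     \<and> (\<forall>x z a b m n d y w. \<forall>i \<in> edges E x z.
          Lvl E x = 1 \<and> Fin E i = fin_map [2] \<and> is_tensor_datum E z a b m
          \<and> is_infty_unit E n \<and> etgt E n = etgt E a \<and> d \<in> edges E x (esrc E n)
          \<and> commutes E i a d n \<and> is_composite E i b y \<and> is_composite E i m w
          \<longrightarrow> ar \<gamma> w \<cdot>\<^bsub>T\<^esub> LUnit T (ob \<gamma> x) = \<mu> a b m \<cdot>\<^bsub>T\<^esub> (\<eta> n \<boxdot>\<^bsub>T\<^esub> ar \<gamma> y))"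

definition suspension_square :: "('s, 'z) sset_scheme \<Rightarrow> (nat list \<Rightarrow> 's) \<Rightarrow> bool" where
  "suspension_square X \<phi> \<longleftrightarrow>
     pushout_square X \<phi> \<and> is_zero_vertex X (\<phi> [1]) \<and> is_zero_vertex X (\<phi> [2])"

text \<open>The rectangle with rows \<open>0 \<rightarrow> 1 \<rightarrow> 2\<close> and \<open>3 \<rightarrow> 4 \<rightarrow> 5\<close> and columns \<open>0 \<rightarrow> 3\<close>, \<open>1 \<rightarrow> 4\<close>, \<open>2 \<rightarrow> 5\<close>.\<close>
definition rectangle :: "nat set set" where
  "rectangle = {S \<in> full_simplex 5. \<forall>i \<in> S. \<forall>j \<in> S. i \<le> j \<longrightarrow> i div 3 \<le> j div 3 \<and> i mod 3 \<le> j mod 3}"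

definition restrict_along :: "nat list \<Rightarrow> (nat list \<Rightarrow> 's) \<Rightarrow> nat list \<Rightarrow> 's" where
  "restrict_along vs \<phi> = (\<lambda>xs. \<phi> (map ((!) vs) xs))"

definition infty_triangles :: "('s, 'z) sset_scheme \<Rightarrow> ('s, 's, 'o, 'm) fctr
    \<Rightarrow> ('m \<times> 'm \<times> 'm \<times> (nat list \<Rightarrow> 's)) set" where
  "infty_triangles X \<gamma> =
     {(ar \<gamma> (\<phi> [0, 1]), ar \<gamma> (\<phi> [1, 4]), ar \<gamma> (\<phi> [4, 5]), restrict_along [0, 2, 3, 5] \<phi>) | \<phi>.
       sset_map rectangle X \<phi> \<and> is_zero_vertex X (\<phi> [2]) \<and> is_zero_vertex X (\<phi> [3])
       \<and> pushout_square X (restrict_along [0, 1, 3, 4] \<phi>)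
       \<and> pushout_square X (restrict_along [1, 2, 4, 5] \<phi>)}"

definition suspension_square_maps :: "('s, 'z) sset_scheme \<Rightarrow> ('s, 's, 'o, 'm) fctr
    \<Rightarrow> ((nat list \<Rightarrow> 's) \<times> (nat list \<Rightarrow> 's) \<times> 'm \<times> 'm) set" where
  "suspension_square_maps X \<gamma> = {(\<phi>, \<phi>', ar \<gamma> (\<Phi> [0, 4]), ar \<gamma> (\<Phi> [3, 7])) | \<phi> \<phi>' \<Phi>.
     suspension_square X \<phi> \<and> suspension_square X \<phi>' \<and> sset_map cube X \<Phi>
     \<and> agree_on square \<phi> \<Phi> \<and> agree_on square \<phi>' (top_square \<Phi>)}"

definition is_homotopy_category_of_infty_category ::
    "('u, 'o, 'm, 'z) ttc_scheme \<Rightarrow> 's sset_fin \<Rightarrow> bool" where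
  "is_homotopy_category_of_infty_category T E \<longleftrightarrow>
     symmetric_monoidal_infty E \<and> stable_quasicategory (fiber E 1) \<and> infty_tensor_exact E
     \<and> (\<exists>\<gamma> \<mu> \<eta>. is_homotopy_category (fiber E 1) T \<gamma> \<and> is_monoidal_comparison E T \<gamma> \<mu> \<eta>
        \<and> triangulation_induced T {\<phi>. suspension_square (fiber E 1) \<phi>}
            (\<lambda>\<phi>. ob \<gamma> (\<phi> [0])) (\<lambda>\<phi>. ob \<gamma> (\<phi> [3]))
            (suspension_square_maps (fiber E 1) \<gamma>) (infty_triangles (fiber E 1) \<gamma>))"


section \<open>Strong stable monoidal derivators\<close>

text \<open>\<open>Val J\<close> is the symmetric monoidal category of \<open>J\<close>-shaped diagrams, \<open>Pull J K u : Val K \<rightarrow> Val J\<close>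
  is restriction along \<open>u : J \<rightarrow> K\<close>, with monoidal structure \<open>PMul J K u\<close> and \<open>PUnit J K u\<close>, and
  \<open>Cell J K u v \<alpha> : Pull J K u \<rightarrow> Pull J K v\<close> is the transformation induced by \<open>\<alpha> : u \<rightarrow> v\<close>.\<close>
record ('u, 'o, 'm) derivator_data =
  Val :: "('u, 'u) cat \<Rightarrow> ('o, 'm) smc"
  Pull :: "('u, 'u) cat \<Rightarrow> ('u, 'u) cat \<Rightarrow> ('u, 'u, 'u, 'u) fctr \<Rightarrow> ('o, 'm, 'o, 'm) fctr"
  PMul :: "('u, 'u) cat \<Rightarrow> ('u, 'u) cat \<Rightarrow> ('u, 'u, 'u, 'u) fctr \<Rightarrow> 'o \<Rightarrow> 'o \<Rightarrow> 'm"
  PUnit :: "('u, 'u) cat \<Rightarrow> ('u, 'u) cat \<Rightarrow> ('u, 'u, 'u, 'u) fctr \<Rightarrow> 'm"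
  Cell :: "('u, 'u) cat \<Rightarrow> ('u, 'u) cat \<Rightarrow> ('u, 'u, 'u, 'u) fctr \<Rightarrow> ('u, 'u, 'u, 'u) fctr
             \<Rightarrow> ('u \<Rightarrow> 'u) \<Rightarrow> 'o \<Rightarrow> 'm"

definition small_functor :: "'u set \<Rightarrow> ('u, 'u) cat \<Rightarrow> ('u, 'u) cat \<Rightarrow> ('u, 'u, 'u, 'u) fctr \<Rightarrow> bool" where
  "small_functor U J K u \<longleftrightarrow> small_cat U J \<and> small_cat U K \<and> is_functor J K u"

text \<open>A strict 2-functor from small categories, contravariant on functors, to symmetric monoidal
  categories, strong symmetric monoidal functors and monoidal transformations.\<close>
locale monoidal_prederivator =
  fixes U :: "'u set" and D :: "('u, 'o, 'm) derivator_data"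
  assumes val: "small_cat U J \<Longrightarrow> symmetric_monoidal (Val D J)"
    and pull: "small_functor U J K u \<Longrightarrow>
      is_monoidal_functor (Val D K) (Val D J) (Pull D J K u) (PMul D J K u) (PUnit D J K u)"
    and pull_id: "small_functor U J J u \<Longrightarrow> fctr_agree J u id_fctr \<Longrightarrow>
      fctr_agree (Val D J) (Pull D J J u) id_fctr
      \<and> (\<forall>X \<in> Obj (Val D J). \<forall>Y \<in> Obj (Val D J).
           PMul D J J u X Y = Idn (Val D J) (X \<boxtimes>\<^bsub>Val D J\<^esub> Y))
      \<and> PUnit D J J u = Idn (Val D J) (Unit (Val D J))"
    and pull_comp: "small_functor U J K u \<Longrightarrow> small_functor U K L v \<Longrightarrow> small_functor U J L w
      \<Longrightarrow> fctr_agree J w (fcomp_fctr v u) \<Longrightarrow>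
      fctr_agree (Val D L) (Pull D J L w) (fcomp_fctr (Pull D J K u) (Pull D K L v))
      \<and> (\<forall>X \<in> Obj (Val D L). \<forall>Y \<in> Obj (Val D L). PMul D J L w X Y
           = ar (Pull D J K u) (PMul D K L v X Y)
             \<cdot>\<^bsub>Val D J\<^esub> PMul D J K u (ob (Pull D K L v) X) (ob (Pull D K L v) Y))
      \<and> PUnit D J L w = ar (Pull D J K u) (PUnit D K L v) \<cdot>\<^bsub>Val D J\<^esub> PUnit D J K u"
    and cell: "small_functor U J K u \<Longrightarrow> small_functor U J K v \<Longrightarrow> is_nat_trans J K u v \<alpha> \<Longrightarrow>
      is_nat_trans (Val D K) (Val D J) (Pull D J K u) (Pull D J K v) (Cell D J K u v \<alpha>)
      \<and> (\<forall>X \<in> Obj (Val D K). \<forall>Y \<in> Obj (Val D K).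
           Cell D J K u v \<alpha> (X \<boxtimes>\<^bsub>Val D K\<^esub> Y) \<cdot>\<^bsub>Val D J\<^esub> PMul D J K u X Y
           = PMul D J K v X Y \<cdot>\<^bsub>Val D J\<^esub> (Cell D J K u v \<alpha> X \<boxdot>\<^bsub>Val D J\<^esub> Cell D J K u v \<alpha> Y))
      \<and> Cell D J K u v \<alpha> (Unit (Val D K)) \<cdot>\<^bsub>Val D J\<^esub> PUnit D J K u = PUnit D J K v"
    and cell_id: "small_functor U J K u \<Longrightarrow> \<forall>j \<in> Obj J. \<alpha> j = Idn K (ob u j)
      \<Longrightarrow> X \<in> Obj (Val D K) \<Longrightarrow> Cell D J K u u \<alpha> X = Idn (Val D J) (ob (Pull D J K u) X)"
    and cell_comp: "small_functor U J K u \<Longrightarrow> small_functor U J K v \<Longrightarrow> small_functor U J K w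
      \<Longrightarrow> is_nat_trans J K u v \<alpha> \<Longrightarrow> is_nat_trans J K v w \<beta> \<Longrightarrow> \<forall>j \<in> Obj J. \<delta> j = \<beta> j \<cdot>\<^bsub>K\<^esub> \<alpha> j
      \<Longrightarrow> X \<in> Obj (Val D K) \<Longrightarrow>
      Cell D J K u w \<delta> X = Cell D J K v w \<beta> X \<cdot>\<^bsub>Val D J\<^esub> Cell D J K u v \<alpha> X"
    and cell_precomp: "small_functor U J K w \<Longrightarrow> small_functor U K L u \<Longrightarrow> small_functor U K L v
      \<Longrightarrow> small_functor U J L u' \<Longrightarrow> small_functor U J L v'
      \<Longrightarrow> fctr_agree J u' (fcomp_fctr u w) \<Longrightarrow> fctr_agree J v' (fcomp_fctr v w)
      \<Longrightarrow> is_nat_trans K L u v \<alpha> \<Longrightarrow> \<forall>j \<in> Obj J. \<alpha>' j = \<alpha> (ob w j) \<Longrightarrow> X \<in> Obj (Val D L)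
      \<Longrightarrow> Cell D J L u' v' \<alpha>' X = ar (Pull D J K w) (Cell D K L u v \<alpha> X)"
    and cell_postcomp: "small_functor U J K u \<Longrightarrow> small_functor U J K v \<Longrightarrow> small_functor U K L w
      \<Longrightarrow> small_functor U J L u' \<Longrightarrow> small_functor U J L v'
      \<Longrightarrow> fctr_agree J u' (fcomp_fctr w u) \<Longrightarrow> fctr_agree J v' (fcomp_fctr w v)
      \<Longrightarrow> is_nat_trans J K u v \<alpha> \<Longrightarrow> \<forall>j \<in> Obj J. \<alpha>' j = ar w (\<alpha> j) \<Longrightarrow> X \<in> Obj (Val D L)
      \<Longrightarrow> Cell D J L u' v' \<alpha>' X = Cell D J K u v \<alpha> (ob (Pull D K L w) X)"

definition full_subcat :: "('o, 'm) cat \<Rightarrow> 'o set \<Rightarrow> ('o, 'm) cat" where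
  "full_subcat J A = J\<lparr>Obj := A, Mor := {f \<in> Mor J. Dom J f \<in> A \<and> Cod J f \<in> A}\<rparr>"

text \<open>\<open>J\<close> is isomorphic, via \<open>v\<close>, to the partially ordered set \<open>A\<close>.\<close>
definition poset_shape :: "'u set \<Rightarrow> ('u, 'u) cat \<Rightarrow> nat set \<Rightarrow> (nat \<Rightarrow> nat \<Rightarrow> bool) \<Rightarrow> (nat \<Rightarrow> 'u) \<Rightarrow> bool" where
  "poset_shape U J A r v \<longleftrightarrow> small_cat U J \<and> bij_betw v A (Obj J)
     \<and> (\<forall>i \<in> A. \<forall>j \<in> A. if r i j then \<exists>!f. f \<in> Hom J (v i) (v j) else Hom J (v i) (v j) = {})"

definition terminal_cat :: "'u set \<Rightarrow> ('u, 'u) cat \<Rightarrow> bool" where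
  "terminal_cat U J \<longleftrightarrow> (\<exists>v. poset_shape U J {0} (\<le>) v)"

text \<open>The orders of the square and of the rectangle above.\<close>
definition square_le :: "nat \<Rightarrow> nat \<Rightarrow> bool" where
  "square_le i j \<longleftrightarrow> i = j \<or> i = 0 \<or> j = 3"

definition rectangle_le :: "nat \<Rightarrow> nat \<Rightarrow> bool" where
  "rectangle_le i j \<longleftrightarrow> i div 3 \<le> j div 3 \<and> i mod 3 \<le> j mod 3"

definition is_product_cat :: "'u set \<Rightarrow> ('u, 'u) cat \<Rightarrow> ('u, 'u) cat \<Rightarrow> ('u, 'u) cat
    \<Rightarrow> ('u, 'u, 'u, 'u) fctr \<Rightarrow> ('u, 'u, 'u, 'u) fctr \<Rightarrow> bool" where
  "is_product_cat U P J K p q \<longleftrightarrow> small_functor U P J p \<and> small_functor U P K q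
     \<and> bij_betw (\<lambda>x. (ob p x, ob q x)) (Obj P) (Obj J \<times> Obj K)
     \<and> bij_betw (\<lambda>f. (ar p f, ar q f)) (Mor P) (Mor J \<times> Mor K)"

text \<open>The comma category of pairs \<open>(j, f : u j \<rightarrow> k)\<close>, respectively \<open>(j, f : k \<rightarrow> u j)\<close>, with
  projection \<open>p\<close> to \<open>J\<close> and tautological transformation \<open>\<alpha>\<close>.\<close>
definition is_comma_over :: "'u set \<Rightarrow> ('u, 'u) cat \<Rightarrow> ('u, 'u) cat \<Rightarrow> ('u, 'u) cat
    \<Rightarrow> ('u, 'u, 'u, 'u) fctr \<Rightarrow> 'u \<Rightarrow> ('u, 'u, 'u, 'u) fctr \<Rightarrow> ('u \<Rightarrow> 'u) \<Rightarrow> bool" where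
  "is_comma_over U P J K u k p \<alpha> \<longleftrightarrow> small_functor U P J p
     \<and> bij_betw (\<lambda>x. (ob p x, \<alpha> x)) (Obj P) {(j, f). j \<in> Obj J \<and> f \<in> Hom K (ob u j) k}
     \<and> (\<forall>x \<in> Obj P. \<forall>y \<in> Obj P. bij_betw (ar p) (Hom P x y)
          {g \<in> Hom J (ob p x) (ob p y). \<alpha> y \<cdot>\<^bsub>K\<^esub> ar u g = \<alpha> x})"

definition is_comma_under :: "'u set \<Rightarrow> ('u, 'u) cat \<Rightarrow> ('u, 'u) cat \<Rightarrow> ('u, 'u) cat
    \<Rightarrow> ('u, 'u, 'u, 'u) fctr \<Rightarrow> 'u \<Rightarrow> ('u, 'u, 'u, 'u) fctr \<Rightarrow> ('u \<Rightarrow> 'u) \<Rightarrow> bool" where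
  "is_comma_under U P J K u k p \<alpha> \<longleftrightarrow> small_functor U P J p
     \<and> bij_betw (\<lambda>x. (ob p x, \<alpha> x)) (Obj P) {(j, f). j \<in> Obj J \<and> f \<in> Hom K k (ob u j)}
     \<and> (\<forall>x \<in> Obj P. \<forall>y \<in> Obj P. bij_betw (ar p) (Hom P x y)
          {g \<in> Hom J (ob p x) (ob p y). ar u g \<cdot>\<^bsub>K\<^esub> \<alpha> x = \<alpha> y})"

text \<open>\<open>h : X \<rightarrow> u\<^sup>* Y\<close> exhibits \<open>Y\<close> as the left Kan extension of \<open>X\<close> along \<open>u\<close>, i.e. as the value at \<open>X\<close>
  of the left adjoint of \<open>u\<^sup>*\<close>; and dually.\<close>
definition is_lan :: "('u, 'o, 'm) derivator_data \<Rightarrow> ('u, 'u) cat \<Rightarrow> ('u, 'u) cat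
    \<Rightarrow> ('u, 'u, 'u, 'u) fctr \<Rightarrow> 'o \<Rightarrow> 'o \<Rightarrow> 'm \<Rightarrow> bool" where
  "is_lan D J K u X Y h \<longleftrightarrow> X \<in> Obj (Val D J) \<and> Y \<in> Obj (Val D K)
     \<and> h \<in> Hom (Val D J) X (ob (Pull D J K u) Y)
     \<and> (\<forall>Z \<in> Obj (Val D K). \<forall>f \<in> Hom (Val D J) X (ob (Pull D J K u) Z).
          \<exists>!g. g \<in> Hom (Val D K) Y Z \<and> ar (Pull D J K u) g \<cdot>\<^bsub>Val D J\<^esub> h = f)"

definition is_ran :: "('u, 'o, 'm) derivator_data \<Rightarrow> ('u, 'u) cat \<Rightarrow> ('u, 'u) cat
    \<Rightarrow> ('u, 'u, 'u, 'u) fctr \<Rightarrow> 'o \<Rightarrow> 'o \<Rightarrow> 'm \<Rightarrow> bool" where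
  "is_ran D J K u X Y h \<longleftrightarrow> X \<in> Obj (Val D J) \<and> Y \<in> Obj (Val D K)
     \<and> h \<in> Hom (Val D J) (ob (Pull D J K u) Y) X
     \<and> (\<forall>Z \<in> Obj (Val D K). \<forall>f \<in> Hom (Val D J) (ob (Pull D J K u) Z) X.
          \<exists>!g. g \<in> Hom (Val D K) Z Y \<and> h \<cdot>\<^bsub>Val D J\<^esub> ar (Pull D J K u) g = f)"

definition ev_ob :: "('u, 'o, 'm) derivator_data \<Rightarrow> ('u, 'u) cat \<Rightarrow> ('u, 'u) cat \<Rightarrow> 'u \<Rightarrow> 'o \<Rightarrow> 'o" where
  "ev_ob D e J j X = ob (Pull D e J (const_fctr J j)) X"

definition ev_ar :: "('u, 'o, 'm) derivator_data \<Rightarrow> ('u, 'u) cat \<Rightarrow> ('u, 'u) cat \<Rightarrow> 'u \<Rightarrow> 'm \<Rightarrow> 'm" where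
  "ev_ar D e J j f = ar (Pull D e J (const_fctr J j)) f"

text \<open>The mates in the axioms \<open>lan_pointwise\<close> and \<open>ran_pointwise\<close> are isomorphisms if and only if the
  adjunct maps are again universal, which is how the axioms are stated; likewise for the
  compatibility of the tensor product with left Kan extensions in \<open>tensor_cocontinuous\<close>.\<close>
locale monoidal_derivator = monoidal_prederivator U D
    for U :: "'u set" and D :: "('u, 'o, 'm) derivator_data" +
  assumes coproducts: "small_cat U J \<Longrightarrow> small U (I :: 'u set) \<Longrightarrow> Obj J = (\<Union>i \<in> I. A i)
      \<Longrightarrow> \<forall>i \<in> I. \<forall>j \<in> I. i \<noteq> j \<longrightarrow> A i \<inter> A j = {}
      \<Longrightarrow> \<forall>f \<in> Mor J. \<exists>i \<in> I. Dom J f \<in> A i \<and> Cod J f \<in> A i \<Longrightarrow>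
      (\<forall>X. (\<forall>i \<in> I. X i \<in> Obj (Val D (full_subcat J (A i)))) \<longrightarrow>
         (\<exists>Y \<in> Obj (Val D J). \<forall>i \<in> I.
            isomorphic (Val D (full_subcat J (A i))) (ob (Pull D (full_subcat J (A i)) J id_fctr) Y) (X i)))
      \<and> (\<forall>X \<in> Obj (Val D J). \<forall>Y \<in> Obj (Val D J). \<forall>f.
           (\<forall>i \<in> I. f i \<in> Hom (Val D (full_subcat J (A i)))
              (ob (Pull D (full_subcat J (A i)) J id_fctr) X) (ob (Pull D (full_subcat J (A i)) J id_fctr) Y))
           \<longrightarrow> (\<exists>!g. g \<in> Hom (Val D J) X Y
                 \<and> (\<forall>i \<in> I. ar (Pull D (full_subcat J (A i)) J id_fctr) g = f i)))"
    and conservative: "terminal_cat U e \<Longrightarrow> small_cat U J \<Longrightarrow> f \<in> Mor (Val D J)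
      \<Longrightarrow> \<forall>j \<in> Obj J. is_iso (Val D e) (ev_ar D e J j f) \<Longrightarrow> is_iso (Val D J) f"
    and ex_lan: "small_functor U J K u \<Longrightarrow> X \<in> Obj (Val D J) \<Longrightarrow> \<exists>Y h. is_lan D J K u X Y h"
    and ex_ran: "small_functor U J K u \<Longrightarrow> X \<in> Obj (Val D J) \<Longrightarrow> \<exists>Y h. is_ran D J K u X Y h"
    and lan_pointwise: "small_functor U J K u \<Longrightarrow> k \<in> Obj K \<Longrightarrow> terminal_cat U e \<Longrightarrow> \<epsilon> \<in> Obj e
      \<Longrightarrow> is_comma_over U P J K u k p \<alpha> \<Longrightarrow> is_lan D J K u X Y h \<Longrightarrow>
      is_lan D P e (const_fctr e \<epsilon>) (ob (Pull D P J p) X) (ev_ob D e K k Y)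
        (Cell D P K (fcomp_fctr u p) (const_fctr K k) \<alpha> Y \<cdot>\<^bsub>Val D P\<^esub> ar (Pull D P J p) h)"
    and ran_pointwise: "small_functor U J K u \<Longrightarrow> k \<in> Obj K \<Longrightarrow> terminal_cat U e \<Longrightarrow> \<epsilon> \<in> Obj e
      \<Longrightarrow> is_comma_under U P J K u k p \<alpha> \<Longrightarrow> is_ran D J K u X Y h \<Longrightarrow>
      is_ran D P e (const_fctr e \<epsilon>) (ob (Pull D P J p) X) (ev_ob D e K k Y)
        (ar (Pull D P J p) h \<cdot>\<^bsub>Val D P\<^esub> Cell D P K (const_fctr K k) (fcomp_fctr u p) \<alpha> Y)"
    and tensor_cocontinuous: "is_product_cat U P J L p q \<Longrightarrow> is_product_cat U Q K L p' q'
      \<Longrightarrow> small_functor U J K u \<Longrightarrow> small_functor U P Q w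
      \<Longrightarrow> fctr_agree P (fcomp_fctr p' w) (fcomp_fctr u p) \<Longrightarrow> fctr_agree P (fcomp_fctr q' w) q
      \<Longrightarrow> is_lan D J K u X Y h \<Longrightarrow> Z \<in> Obj (Val D L) \<Longrightarrow>
      is_lan D P Q w (ob (Pull D P J p) X \<boxtimes>\<^bsub>Val D P\<^esub> ob (Pull D P L q) Z)
        (ob (Pull D Q K p') Y \<boxtimes>\<^bsub>Val D Q\<^esub> ob (Pull D Q L q') Z)
        (PMul D P Q w (ob (Pull D Q K p') Y) (ob (Pull D Q L q') Z)
          \<cdot>\<^bsub>Val D P\<^esub> (ar (Pull D P J p) h \<boxdot>\<^bsub>Val D P\<^esub> Idn (Val D P) (ob (Pull D P L q) Z)))"

text \<open>The underlying morphism in \<open>Val e\<close> of the diagram \<open>X\<close> at the morphism \<open>a\<close> of \<open>J\<close>.\<close>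
definition at_mor :: "('u, 'o, 'm) derivator_data \<Rightarrow> ('u, 'u) cat \<Rightarrow> ('u, 'u) cat \<Rightarrow> 'u \<Rightarrow> 'o \<Rightarrow> 'm" where
  "at_mor D e J a X = Cell D e J (const_fctr J (Dom J a)) (const_fctr J (Cod J a)) (\<lambda>_. a) X"

text \<open>Strongness: the functor from diagrams of shape \<open>J \<times> [1]\<close> to morphisms of diagrams of shape \<open>J\<close>
  is full and essentially surjective.\<close>
definition strong_derivator :: "'u set \<Rightarrow> ('u, 'o, 'm) derivator_data \<Rightarrow> bool" where
  "strong_derivator U D \<longleftrightarrow> (\<forall>J K v P p q s0 s1 \<alpha>.
     small_cat U J \<and> poset_shape U K {0, 1} (\<le>) v \<and> is_product_cat U P J K p q
     \<and> fctr_agree J (fcomp_fctr p s0) id_fctr \<and> fctr_agree J (fcomp_fctr q s0) (const_fctr K (v 0))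
     \<and> fctr_agree J (fcomp_fctr p s1) id_fctr \<and> fctr_agree J (fcomp_fctr q s1) (const_fctr K (v 1))
     \<and> is_nat_trans J P s0 s1 \<alpha> \<and> (\<forall>j \<in> Obj J. ar p (\<alpha> j) = Idn J j)
     \<longrightarrow>
     (\<forall>f \<in> Mor (Val D J). \<exists>X \<in> Obj (Val D P).
        \<exists>a \<in> Hom (Val D J) (ob (Pull D J P s0) X) (Dom (Val D J) f).
        \<exists>b \<in> Hom (Val D J) (ob (Pull D J P s1) X) (Cod (Val D J) f).
          is_iso (Val D J) a \<and> is_iso (Val D J) b
          \<and> f \<cdot>\<^bsub>Val D J\<^esub> a = b \<cdot>\<^bsub>Val D J\<^esub> Cell D J P s0 s1 \<alpha> X)
     \<and> (\<forall>X \<in> Obj (Val D P). \<forall>Y \<in> Obj (Val D P).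
        \<forall>a \<in> Hom (Val D J) (ob (Pull D J P s0) X) (ob (Pull D J P s0) Y).
        \<forall>b \<in> Hom (Val D J) (ob (Pull D J P s1) X) (ob (Pull D J P s1) Y).
          b \<cdot>\<^bsub>Val D J\<^esub> Cell D J P s0 s1 \<alpha> X = Cell D J P s0 s1 \<alpha> Y \<cdot>\<^bsub>Val D J\<^esub> a
          \<longrightarrow> (\<exists>h \<in> Hom (Val D P) X Y. ar (Pull D J P s0) h = a \<and> ar (Pull D J P s1) h = b)))"

text \<open>Squares which are left Kan extended from the span, respectively right Kan extended from the
  cospan.\<close>
definition cocartesian_square ::
    "('u, 'o, 'm) derivator_data \<Rightarrow> ('u, 'u) cat \<Rightarrow> (nat \<Rightarrow> 'u) \<Rightarrow> 'o \<Rightarrow> bool" where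
  "cocartesian_square D Q v X \<longleftrightarrow> X \<in> Obj (Val D Q)
     \<and> (let S = full_subcat Q (v ` {0, 1, 2}); X' = ob (Pull D S Q id_fctr) X
        in is_lan D S Q id_fctr X' X (Idn (Val D S) X'))"

definition cartesian_square ::
    "('u, 'o, 'm) derivator_data \<Rightarrow> ('u, 'u) cat \<Rightarrow> (nat \<Rightarrow> 'u) \<Rightarrow> 'o \<Rightarrow> bool" where
  "cartesian_square D Q v X \<longleftrightarrow> X \<in> Obj (Val D Q)
     \<and> (let S = full_subcat Q (v ` {1, 2, 3}); X' = ob (Pull D S Q id_fctr) X
        in is_ran D S Q id_fctr X' X (Idn (Val D S) X'))"

definition stable_derivator :: "'u set \<Rightarrow> ('u, 'o, 'm) derivator_data \<Rightarrow> bool" where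
  "stable_derivator U D \<longleftrightarrow>
     (\<forall>e. terminal_cat U e \<longrightarrow> (\<exists>z. is_zero (Val D e) z))
     \<and> (\<forall>Q v X. poset_shape U Q {..3} square_le v
          \<longrightarrow> (cocartesian_square D Q v X \<longleftrightarrow> cartesian_square D Q v X))"

definition suspension_diagram :: "('u, 'o, 'm) derivator_data \<Rightarrow> ('u, 'u) cat \<Rightarrow> ('u, 'u) cat
    \<Rightarrow> (nat \<Rightarrow> 'u) \<Rightarrow> 'o \<Rightarrow> bool" where
  "suspension_diagram D e Q v X \<longleftrightarrow> cocartesian_square D Q v X
     \<and> is_zero (Val D e) (ev_ob D e Q (v 1) X) \<and> is_zero (Val D e) (ev_ob D e Q (v 2) X)"

text \<open>\<open>F\<close> is the inclusion of the square with shape \<open>Q\<close> on the vertices \<open>vs\<close> of the rectangle with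
  shape \<open>R\<close>.\<close>
definition includes_square :: "('u, 'u) cat \<Rightarrow> (nat \<Rightarrow> 'u) \<Rightarrow> ('u, 'u) cat \<Rightarrow> (nat \<Rightarrow> 'u) \<Rightarrow> nat list
    \<Rightarrow> ('u, 'u, 'u, 'u) fctr \<Rightarrow> bool" where
  "includes_square Q v R w vs F \<longleftrightarrow> is_functor Q R F \<and> (\<forall>i \<le> 3. ob F (v i) = w (vs ! i))"

definition derivator_triangles :: "('u, 'o, 'm) derivator_data \<Rightarrow> ('u, 'u) cat \<Rightarrow> ('u, 'u) cat
    \<Rightarrow> (nat \<Rightarrow> 'u) \<Rightarrow> ('u, 'u) cat \<Rightarrow> (nat \<Rightarrow> 'u) \<Rightarrow> ('o, 'm, 'p, 'n) fctr \<Rightarrow> ('n \<times> 'n \<times> 'n \<times> 'o) set" where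
  "derivator_triangles D e Q v R w \<gamma> =
     {(ar \<gamma> (at_mor D e R a X), ar \<gamma> (at_mor D e R b X), ar \<gamma> (at_mor D e R c X), ob (Pull D Q R F) X)
      | X a b c F. X \<in> Obj (Val D R)
        \<and> a \<in> Hom R (w 0) (w 1) \<and> b \<in> Hom R (w 1) (w 4) \<and> c \<in> Hom R (w 4) (w 5)
        \<and> includes_square Q v R w [0, 2, 3, 5] F
        \<and> is_zero (Val D e) (ev_ob D e R (w 2) X) \<and> is_zero (Val D e) (ev_ob D e R (w 3) X)
        \<and> (\<forall>G. includes_square Q v R w [0, 1, 3, 4] G \<or> includes_square Q v R w [1, 2, 4, 5] G
             \<longrightarrow> cocartesian_square D Q v (ob (Pull D Q R G) X))}"

text \<open>\<open>T\<close> is, as a tensor triangulated category, the underlying category \<open>Val e\<close> of the strong stable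
  monoidal derivator \<open>D\<close>, where \<open>e\<close> is the terminal category.\<close>
definition is_underlying_category_of_derivator ::
    "('u, 'p, 'n, 'z) ttc_scheme \<Rightarrow> ('u, 'o, 'm) derivator_data \<Rightarrow> bool" where
  "is_underlying_category_of_derivator T D \<longleftrightarrow>
     monoidal_derivator (Univ T) D \<and> strong_derivator (Univ T) D \<and> stable_derivator (Univ T) D
     \<and> (\<exists>e Q v R w \<gamma> \<mu> \<eta>. terminal_cat (Univ T) e
        \<and> poset_shape (Univ T) Q {..3} square_le v \<and> poset_shape (Univ T) R {..5} rectangle_le w
        \<and> is_equivalence (Val D e) T \<gamma> \<and> is_monoidal_functor (Val D e) T \<gamma> \<mu> \<eta>
        \<and> triangulation_induced T {X. suspension_diagram D e Q v X}
            (\<lambda>X. ob \<gamma> (ev_ob D e Q (v 0) X)) (\<lambda>X. ob \<gamma> (ev_ob D e Q (v 3) X))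
            {(X, Y, ar \<gamma> (ev_ar D e Q (v 0) f), ar \<gamma> (ev_ar D e Q (v 3) f)) | X Y f.
               suspension_diagram D e Q v X \<and> suspension_diagram D e Q v Y \<and> f \<in> Hom (Val D Q) X Y}
            (derivator_triangles D e Q v R w \<gamma>))"


section \<open>Models of tensor triangulated categories\<close>

datatype ('u, 'a, 'b, 's, 'c, 'd) enhancement =
    Model_Category "('a, 'b) modelcat"
  | Infinity_Category "'s sset_fin"
  | Derivator "('u, 'c, 'd) derivator_data"

fun is_model_of :: "('u, 'a, 'b, 's, 'c, 'd) enhancement \<Rightarrow> ('u, 'o, 'm, 'z) ttc_scheme \<Rightarrow> bool" where
  "is_model_of (Model_Category M) T \<longleftrightarrow> is_homotopy_category_of_model_category T M"
| "is_model_of (Infinity_Category E) T \<longleftrightarrow> is_homotopy_category_of_infty_category T E"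
| "is_model_of (Derivator D) T \<longleftrightarrow> is_underlying_category_of_derivator T D"

end

theory Submission
  imports Defs "HOL-Analysis.Function_Topology"
begin

text \<open>Let \<open>\<L>\<close> be the localizing ideal generated by the objects \<open>t \<otimes> g(W)\<close> and
  \<open>K\<close> the ideal of compact objects \<open>x\<close> with \<open>x \<otimes> t \<in> \<L>\<close>.  The localization triangle
  \<open>\<Gamma>\<^sub>K \<rightarrow> \<one> \<rightarrow> L\<^sub>K\<close> has \<open>\<Gamma>\<^sub>K \<otimes> t \<in> \<L>\<close>, so it suffices that \<open>t' = t \<otimes> L\<^sub>K\<close> is zero.  If not, then by
  detection \<open>Supp t'\<close> is a nonempty subset of \<open>Supp t\<close>, hence has an isolated point \<open>P\<close>.  As the
  topology is constructible, the supports of compact objects form a base, so there is a compact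
  object \<open>e\<close> with \<open>P \<in> supp e\<close> such that \<open>Supp (t' \<otimes> e)\<close> is contained in \<open>{P}\<close>.  For a member \<open>W\<close> of the cover
  with \<open>P \<in> W\<close>, detection identifies \<open>t' \<otimes> e\<close> with \<open>t' \<otimes> e \<otimes> g(W) \<in> \<L>\<close>.  Hence \<open>t \<otimes> e \<in> \<L>\<close>, i.e.
  \<open>e \<in> K\<close>, so \<open>t' \<otimes> e = 0\<close>, which contradicts \<open>P \<in> Supp t'\<close>.  The last step, like the
  behaviour of supports under tensoring with \<open>\<Gamma>\<^sub>Y\<close> and \<open>L\<^sub>Y\<close>, rests on the fact that vanishing of
  \<open>z \<otimes> M\<close> for compact \<open>z\<close> can be tested at the primes in \<open>supp z\<close>.\<close>


section \<open>Categories\<close>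

text \<open>Scatteredness suggests a transfinite induction on Cantor-Bendixson rank. The ideal K
  replaces it: K collects at once every compact object whose product with t lies in the localizing
  ideal, so an isolated point in the support of a nonzero t' would add one more member to K. Passing
  from the localizing ideal to its compact part K is what makes a localization triangle available,
  because compact objects are essentially small and the fiber is then a sequential telescope.
  Rigidity makes the localized unit be annihilated by K, not only receive no maps from it.

  The formal g(W) rests on a Hilbert choice of Thomason sets with W = Y1 - Y2, so every computation
  of supports has to work for an unknown pair. This is where primes come in: a compact object on Y1
  must be shown to annihilate although there is information only over W and over Y2 separately, and
  prime ideals avoiding a multiplicative set join the two. Detection acts twice, to give t' a point
  in its support and to discard the parts of the object near P that belong to \<Gamma> of Y2 and
  \<Lambda> of Y1.\<close>

lemma Hom_iff: "f \<in> Hom C x y \<longleftrightarrow> f \<in> Mor C \<and> Dom C f = x \<and> Cod C f = y"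
  by (auto simp: Hom_def)

context category
begin

lemma Dom_Obj [simp]: "f \<in> Mor C \<Longrightarrow> Dom C f \<in> Obj C"
  and Cod_Obj [simp]: "f \<in> Mor C \<Longrightarrow> Cod C f \<in> Obj C"
  using dom_cod by auto

lemma Hom_Obj: "f \<in> Hom C x y \<Longrightarrow> x \<in> Obj C \<and> y \<in> Obj C"
  by (auto simp: Hom_iff)

lemma Idn_simps [simp]:
  assumes "x \<in> Obj C"
  shows "Idn C x \<in> Mor C" "Dom C (Idn C x) = x" "Cod C (Idn C x) = x"
  using idn_in[OF assms] by (auto simp: Hom_iff)

text \<open>Typing by simplification: \<open>Hom_iff\<close> unfolds membership in a hom set into
  equations for \<open>Dom\<close> and \<open>Cod\<close>, and rules of this form compute both
  sides.\<close>

lemma cmp_simps [simp]: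
  assumes "f \<in> Mor C" "g \<in> Mor C" "Dom C g = Cod C f"
  shows "g \<cdot> f \<in> Mor C" "Dom C (g \<cdot> f) = Dom C f" "Cod C (g \<cdot> f) = Cod C g"
  using cmp_in[of f "Dom C f" "Cod C f" g "Cod C g"] assms by (auto simp: Hom_iff)

lemma cmp_idn [simp]:
  assumes "f \<in> Mor C"
  shows "Cod C f = y \<Longrightarrow> Idn C y \<cdot> f = f" "Dom C f = x \<Longrightarrow> f \<cdot> Idn C x = f"
  using assms idn_left idn_right by (auto simp: Hom_iff)

text \<open>As a simp rule it nests composites to the right. Calculations that want to collapse an
  inner pair must therefore regroup with its symmetric form or delete it.\<close>

lemma cmp_assoc' [simp]:
  assumes "f \<in> Mor C" "g \<in> Mor C" "h \<in> Mor C" "Dom C g = Cod C f" "Dom C h = Cod C g"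
  shows "(h \<cdot> g) \<cdot> f = h \<cdot> (g \<cdot> f)"
  using cmp_assoc[of f "Dom C f" "Cod C f" g "Cod C g" h "Cod C h"] assms by (auto simp: Hom_iff)

lemma is_isoE:
  assumes "is_iso C f" "f \<in> Hom C x y"
  obtains g where "g \<in> Hom C y x" "g \<cdot> f = Idn C x" "f \<cdot> g = Idn C y"
  using assms by (auto simp: is_iso_def is_inverse_def Hom_iff)

lemma is_isoI:
  assumes "f \<in> Hom C x y" "g \<in> Hom C y x" "g \<cdot> f = Idn C x" "f \<cdot> g = Idn C y"
  shows "is_iso C f"
  using assms by (auto simp: is_iso_def is_inverse_def Hom_iff)

lemma inverse_mor:
  assumes "is_iso C f" "f \<in> Hom C x y"
  shows "inverse_mor C f \<in> Hom C y x" "inverse_mor C f \<cdot> f = Idn C x" "f \<cdot> inverse_mor C f = Idn C y"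
proof -
  obtain g where g: "is_inverse C f g"
    using assms by (auto simp: is_iso_def)
  have "g' = g" if "is_inverse C f g'" for g'
  proof -
    have "g' = g' \<cdot> (f \<cdot> g)"
      using g that by (auto simp: is_inverse_def Hom_iff)
    also have "\<dots> = (g' \<cdot> f) \<cdot> g"
      using g that by (intro cmp_assoc'[symmetric]) (auto simp: is_inverse_def Hom_iff)
    also have "\<dots> = g"
      using g that by (simp add: is_inverse_def Hom_iff)
    finally show ?thesis .
  qed
  hence "is_inverse C f (inverse_mor C f)"
    unfolding inverse_mor_def using g by (rule_tac theI) auto
  thus "inverse_mor C f \<in> Hom C y x" "inverse_mor C f \<cdot> f = Idn C x" "f \<cdot> inverse_mor C f = Idn C y"
    using assms by (auto simp: is_inverse_def Hom_iff)
qed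

lemma iso_cancel_left:
  assumes "is_iso C f" "f \<in> Hom C x y" "a \<in> Hom C w x" "b \<in> Hom C w x" "f \<cdot> a = f \<cdot> b"
  shows "a = b"
proof -
  obtain g where g: "g \<in> Hom C y x" "g \<cdot> f = Idn C x"
    using assms(1,2) by (rule is_isoE)
  have "a = (g \<cdot> f) \<cdot> a"
    using g(2) assms by (simp add: Hom_iff)
  also have "\<dots> = g \<cdot> (f \<cdot> a)"
    using g(1) assms(2-4) by (auto simp: Hom_iff)
  also have "\<dots> = (g \<cdot> f) \<cdot> b"
    using g(1) assms(2-4) unfolding assms(5) by (auto simp: Hom_iff)
  also have "\<dots> = b"
    using g(2) assms by (simp add: Hom_iff)
  finally show ?thesis .
qed

lemma iso_cancel_right:
  assumes "is_iso C f" "f \<in> Hom C x y" "a \<in> Hom C y z" "b \<in> Hom C y z" "a \<cdot> f = b \<cdot> f"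
  shows "a = b"
proof -
  obtain g where g: "g \<in> Hom C y x" "f \<cdot> g = Idn C y"
    using assms(1,2) by (rule is_isoE)
  have "a = a \<cdot> (f \<cdot> g)"
    using g(2) assms by (simp add: Hom_iff)
  also have "\<dots> = (a \<cdot> f) \<cdot> g"
    using g(1) assms(2-4) by (intro cmp_assoc'[symmetric]) (auto simp: Hom_iff)
  also have "\<dots> = b \<cdot> (f \<cdot> g)"
    using g(1) assms(2-4) unfolding assms(5) by (intro cmp_assoc') (auto simp: Hom_iff)
  also have "\<dots> = b"
    using g(2) assms by (simp add: Hom_iff)
  finally show ?thesis .
qed

lemma is_iso_cmp:
  assumes "is_iso C f" "f \<in> Hom C x y" "is_iso C g" "g \<in> Hom C y z"
  shows "is_iso C (g \<cdot> f)"
proof -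
  obtain f' where f': "f' \<in> Hom C y x" "f' \<cdot> f = Idn C x" "f \<cdot> f' = Idn C y"
    using assms(1,2) by (rule is_isoE)
  obtain g' where g': "g' \<in> Hom C z y" "g' \<cdot> g = Idn C y" "g \<cdot> g' = Idn C z"
    using assms(3,4) by (rule is_isoE)
  have "(f' \<cdot> g') \<cdot> (g \<cdot> f) = f' \<cdot> ((g' \<cdot> g) \<cdot> f)"
    using assms f'(1) g'(1) by (simp add: Hom_iff)
  moreover have "(g \<cdot> f) \<cdot> (f' \<cdot> g') = g \<cdot> ((f \<cdot> f') \<cdot> g')"
    using assms f'(1) g'(1) by (simp add: Hom_iff)
  ultimately show ?thesis
    using assms f' g' by (intro is_isoI[of _ x z "f' \<cdot> g'"]) (auto simp: Hom_iff)
qed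

lemma isomorphicE:
  assumes "isomorphic C x y"
  obtains f g where "f \<in> Hom C x y" "g \<in> Hom C y x" "g \<cdot> f = Idn C x" "f \<cdot> g = Idn C y"
  using assms is_isoE unfolding isomorphic_def by metis

lemma isomorphicI:
  assumes "f \<in> Hom C x y" "g \<in> Hom C y x" "g \<cdot> f = Idn C x" "f \<cdot> g = Idn C y"
  shows "isomorphic C x y"
  using assms is_isoI unfolding isomorphic_def by metis

lemma isomorphic_refl: "x \<in> Obj C \<Longrightarrow> isomorphic C x x"
  by (rule isomorphicI[of "Idn C x" _ _ "Idn C x"]) (auto simp: Hom_iff)

lemma isomorphic_sym: "isomorphic C x y \<Longrightarrow> isomorphic C y x"
  by (metis isomorphicE isomorphicI)

lemma isomorphic_trans: "isomorphic C x y \<Longrightarrow> isomorphic C y z \<Longrightarrow> isomorphic C x z"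
  unfolding isomorphic_def using is_iso_cmp cmp_in by metis

lemma isomorphic_Obj: "isomorphic C x y \<Longrightarrow> x \<in> Obj C \<and> y \<in> Obj C"
  by (auto simp: isomorphic_def dest: Hom_Obj)

lemma coproduct_ex:
  assumes "is_coproduct C I X c \<iota>" "\<And>i. i \<in> I \<Longrightarrow> f i \<in> Hom C (X i) y" "y \<in> Obj C"
  shows "\<exists>h \<in> Hom C c y. \<forall>i \<in> I. h \<cdot> \<iota> i = f i"
proof -
  from assms have "\<exists>!h. h \<in> Hom C c y \<and> (\<forall>i \<in> I. h \<cdot> \<iota> i = f i)"
    unfolding is_coproduct_def by blast
  thus ?thesis
    by blast
qed

lemma coproduct_eqI:
  assumes "is_coproduct C I X c \<iota>" "h \<in> Hom C c y" "h' \<in> Hom C c y"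
    and "\<And>i. i \<in> I \<Longrightarrow> h \<cdot> \<iota> i = h' \<cdot> \<iota> i"
  shows "h = h'"
proof -
  have y: "y \<in> Obj C" and "\<forall>i \<in> I. h' \<cdot> \<iota> i \<in> Hom C (X i) y"
    using assms by (auto simp: is_coproduct_def Hom_iff)
  hence "\<exists>!k. k \<in> Hom C c y \<and> (\<forall>i \<in> I. k \<cdot> \<iota> i = h' \<cdot> \<iota> i)"
    using assms(1) unfolding is_coproduct_def
    by (elim conjE) (drule bspec[OF _ y], drule spec[of _ "\<lambda>i. h' \<cdot> \<iota> i"], blast)
  thus ?thesis
    using assms by blast
qed

lemma coproduct_in:
  assumes "is_coproduct C I X c \<iota>"
  shows "c \<in> Obj C" "i \<in> I \<Longrightarrow> \<iota> i \<in> Hom C (X i) c" "i \<in> I \<Longrightarrow> X i \<in> Obj C"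
  using assms Hom_Obj unfolding is_coproduct_def by blast+

lemma coproductI:
  assumes "c \<in> Obj C" "\<And>i. i \<in> I \<Longrightarrow> \<iota> i \<in> Hom C (X i) c"
    and "\<And>y f. y \<in> Obj C \<Longrightarrow> (\<And>i. i \<in> I \<Longrightarrow> f i \<in> Hom C (X i) y) \<Longrightarrow>
      \<exists>h \<in> Hom C c y. \<forall>i \<in> I. h \<cdot> \<iota> i = f i"
    and "\<And>y h h'. h \<in> Hom C c y \<Longrightarrow> h' \<in> Hom C c y \<Longrightarrow> (\<And>i. i \<in> I \<Longrightarrow> h \<cdot> \<iota> i = h' \<cdot> \<iota> i) \<Longrightarrow> h = h'"
  shows "is_coproduct C I X c \<iota>"
  unfolding is_coproduct_def
proof (intro conjI ballI allI impI)
  fix y f assume y: "y \<in> Obj C" and f: "\<forall>i \<in> I. f i \<in> Hom C (X i) y"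
  obtain h where h: "h \<in> Hom C c y" "\<forall>i \<in> I. h \<cdot> \<iota> i = f i"
    using assms(3)[OF y, of f] f by blast
  show "\<exists>!h. h \<in> Hom C c y \<and> (\<forall>i \<in> I. h \<cdot> \<iota> i = f i)"
  proof (intro ex1I[of _ h] conjI h)
    fix h' assume h': "h' \<in> Hom C c y \<and> (\<forall>i \<in> I. h' \<cdot> \<iota> i = f i)"
    show "h' = h"
      by (rule assms(4)) (use h h' in auto)
  qed
qed (use assms(1,2) in auto)

text \<open>Compactness and localizing subcategories quantify over index sets in the type of the
  universe only. An injection into that type carries over coproducts with other index types, such as
  the natural numbers or a set of morphisms.\<close>

lemma coproduct_reindex:
  assumes c: "is_coproduct C I X c \<iota>" and e: "inj_on e I"
  shows "is_coproduct C (e ` I) (X \<circ> inv_into I e) c (\<iota> \<circ> inv_into I e)"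
proof (rule coproductI)
  fix y f assume y: "y \<in> Obj C"
    and f: "\<And>i. i \<in> e ` I \<Longrightarrow> f i \<in> Hom C ((X \<circ> inv_into I e) i) y"
  have "f (e i) \<in> Hom C (X i) y" if "i \<in> I" for i
    using f[of "e i"] that e by (simp only: imageI o_apply inv_into_f_f)
  from coproduct_ex[OF c this y]
  obtain h where "h \<in> Hom C c y" "\<forall>i \<in> I. h \<cdot> \<iota> i = f (e i)"
    by blast
  thus "\<exists>h \<in> Hom C c y. \<forall>i \<in> e ` I. h \<cdot> (\<iota> \<circ> inv_into I e) i = f i"
    using e by auto
next
  fix y h h' assume h: "h \<in> Hom C c y" "h' \<in> Hom C c y"
    and eq: "\<And>i. i \<in> e ` I \<Longrightarrow> h \<cdot> (\<iota> \<circ> inv_into I e) i = h' \<cdot> (\<iota> \<circ> inv_into I e) i"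
  show "h = h'"
  proof (rule coproduct_eqI[OF c h])
    show "h \<cdot> \<iota> i = h' \<cdot> \<iota> i" if "i \<in> I" for i
      using eq[of "e i"] that e by simp
  qed
next
  fix i assume "i \<in> e ` I"
  thus "(\<iota> \<circ> inv_into I e) i \<in> Hom C ((X \<circ> inv_into I e) i) c"
    using coproduct_in(2)[OF c] e by auto
qed (rule coproduct_in(1)[OF c])

end


section \<open>Additive categories\<close>

context additive_category
begin

lemma Zero_Hom: "x \<in> Obj T \<Longrightarrow> y \<in> Obj T \<Longrightarrow> Zero T x y \<in> Hom T x y"
  using comm_groupE(2)[OF hom_comm_group, of x y] by (simp add: hom_group_def)

lemma Zero_simps [simp]:
  assumes "x \<in> Obj T" "y \<in> Obj T"
  shows "Zero T x y \<in> Mor T" "Dom T (Zero T x y) = x" "Cod T (Zero T x y) = y"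
  using Zero_Hom[OF assms] by (auto simp: Hom_iff)

lemma Add_Hom: "f \<in> Hom T x y \<Longrightarrow> g \<in> Hom T x y \<Longrightarrow> Add T f g \<in> Hom T x y"
  using comm_groupE(1)[OF hom_comm_group, of x y f g] by (auto simp: hom_group_def dest: Hom_Obj)

lemma Add_simps [simp]:
  assumes "f \<in> Mor T" "g \<in> Mor T" "Dom T g = Dom T f" "Cod T g = Cod T f"
  shows "Add T f g \<in> Mor T" "Dom T (Add T f g) = Dom T f" "Cod T (Add T f g) = Cod T f"
  using Add_Hom[of f "Dom T f" "Cod T f" g] assms by (auto simp: Hom_iff)

lemma Add_assoc:
  "f \<in> Hom T x y \<Longrightarrow> g \<in> Hom T x y \<Longrightarrow> h \<in> Hom T x y \<Longrightarrow>
    Add T (Add T f g) h = Add T f (Add T g h)"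
  using comm_groupE(3)[OF hom_comm_group, of x y f g h] by (auto simp: hom_group_def dest: Hom_Obj)

lemma Add_commute:
  "f \<in> Hom T x y \<Longrightarrow> g \<in> Hom T x y \<Longrightarrow> Add T f g = Add T g f"
  using comm_groupE(4)[OF hom_comm_group, of x y f g] by (auto simp: hom_group_def dest: Hom_Obj)

lemma Add_Zero [simp]:
  assumes "f \<in> Mor T"
  shows "Dom T f = x \<Longrightarrow> Cod T f = y \<Longrightarrow> Add T (Zero T x y) f = f"
    and "Dom T f = x \<Longrightarrow> Cod T f = y \<Longrightarrow> Add T f (Zero T x y) = f"
  using comm_groupE(5)[OF hom_comm_group, of x y f] Add_commute[of f x y "Zero T x y"] assms
  by (auto simp: hom_group_def Hom_iff)

lemma neg_Hom:
  assumes "f \<in> Hom T x y"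
  shows "neg T f \<in> Hom T x y" "Add T f (neg T f) = Zero T x y"
proof -
  have D: "Dom T f = x" "Cod T f = y" "x \<in> Obj T" "y \<in> Obj T"
    using assms by (auto simp: Hom_iff)
  interpret comm_group "hom_group T x y"
    using D by (rule_tac hom_comm_group)
  have f: "f \<in> carrier (hom_group T x y)"
    using assms by (simp add: hom_group_def)
  show "neg T f \<in> Hom T x y" "Add T f (neg T f) = Zero T x y"
    using inv_closed[OF f] r_inv[OF f] D by (auto simp: neg_def hom_group_def)
qed

lemma neg_simps [simp]:
  assumes "f \<in> Mor T"
  shows "neg T f \<in> Mor T" "Dom T (neg T f) = Dom T f" "Cod T (neg T f) = Cod T f"
  using neg_Hom(1)[of f "Dom T f" "Cod T f"] assms by (auto simp: Hom_iff)

lemma Add_eq_cancel: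
  assumes "f \<in> Hom T x y" "g \<in> Hom T x y" "h \<in> Hom T x y"
  shows "Add T f g = Add T f h \<longleftrightarrow> g = h"
proof -
  have D: "Dom T f = x" "Cod T f = y" "x \<in> Obj T" "y \<in> Obj T"
    using assms by (auto simp: Hom_iff)
  interpret comm_group "hom_group T x y"
    using D by (rule_tac hom_comm_group)
  show ?thesis
    using Units_l_cancel[of f g h] assms unfolding Units_eq by (auto simp: hom_group_def)
qed

lemma neg_unique:
  assumes "f \<in> Hom T x y" "g \<in> Hom T x y" "Add T f g = Zero T x y"
  shows "g = neg T f"
  using Add_eq_cancel[of f x y g "neg T f"] neg_Hom[OF assms(1)] assms by simp

lemma neg_neg [simp]: "f \<in> Mor T \<Longrightarrow> neg T (neg T f) = f"
  using neg_unique[of "neg T f" "Dom T f" "Cod T f" f] neg_Hom[of f "Dom T f" "Cod T f"]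
    Add_commute[of "neg T f" "Dom T f" "Cod T f" f]
  by (simp add: Hom_iff)

lemma cmp_Add:
  assumes "f \<in> Mor T" "f' \<in> Mor T" "g \<in> Mor T" "Dom T f' = Dom T f" "Cod T f' = Cod T f" "Dom T g = Cod T f"
  shows "g \<cdot> Add T f f' = Add T (g \<cdot> f) (g \<cdot> f')"
  using cmp_add[of f "Dom T f" "Cod T f" f' g "Cod T g" g] assms by (auto simp: Hom_iff)

lemma Add_cmp:
  assumes "f \<in> Mor T" "g \<in> Mor T" "g' \<in> Mor T" "Dom T g' = Dom T g" "Cod T g' = Cod T g" "Dom T g = Cod T f"
  shows "Add T g g' \<cdot> f = Add T (g \<cdot> f) (g' \<cdot> f)"
  using cmp_add[of f "Dom T f" "Cod T f" f g "Cod T g" g'] assms by (auto simp: Hom_iff)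

text \<open>The common reason why composition, suspension and tensor product preserve zero maps:
  each is additive, so the image of 0 = 0 + 0 equals its own double.\<close>

lemma Add_idem:
  assumes "f \<in> Hom T x y" "Add T f f = f"
  shows "f = Zero T x y"
  using Add_eq_cancel[of f x y f "Zero T x y"] assms by (auto simp: Hom_iff)

lemma cmp_Zero [simp]:
  assumes "g \<in> Mor T" "x \<in> Obj T" "Dom T g = y"
  shows "g \<cdot> Zero T x y = Zero T x (Cod T g)"
proof (rule Add_idem)
  have "Add T (g \<cdot> Zero T x y) (g \<cdot> Zero T x y) = g \<cdot> Add T (Zero T x y) (Zero T x y)"
    using assms by (auto intro!: cmp_Add[symmetric])
  thus "Add T (g \<cdot> Zero T x y) (g \<cdot> Zero T x y) = g \<cdot> Zero T x y"
    using assms by auto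
qed (use assms in \<open>auto simp: Hom_iff\<close>)

lemma Zero_cmp [simp]:
  assumes "f \<in> Mor T" "Cod T f = y" "z \<in> Obj T"
  shows "Zero T y z \<cdot> f = Zero T (Dom T f) z"
proof (rule Add_idem)
  have "Add T (Zero T y z \<cdot> f) (Zero T y z \<cdot> f) = Add T (Zero T y z) (Zero T y z) \<cdot> f"
    using assms by (auto intro!: Add_cmp[symmetric])
  thus "Add T (Zero T y z \<cdot> f) (Zero T y z \<cdot> f) = Zero T y z \<cdot> f"
    using assms by auto
qed (use assms in \<open>auto simp: Hom_iff\<close>)

lemma cmp_neg:
  assumes "f \<in> Mor T" "g \<in> Mor T" "Dom T g = Cod T f"
  shows "g \<cdot> neg T f = neg T (g \<cdot> f)" "neg T g \<cdot> f = neg T (g \<cdot> f)"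
  using assms neg_Hom(2)[of f "Dom T f" "Cod T f"] neg_Hom(2)[of g "Dom T g" "Cod T g"]
  by (auto intro!: neg_unique[of _ "Dom T f" "Cod T g"] simp: Hom_iff simp flip: cmp_Add Add_cmp)

lemma neg_eq_Zero_iff:
  assumes "f \<in> Hom T x y"
  shows "neg T f = Zero T x y \<longleftrightarrow> f = Zero T x y"
proof -
  have *: "neg T (Zero T x y) = Zero T x y"
    by (rule neg_unique[symmetric]) (use assms in \<open>auto simp: Hom_iff\<close>)
  show ?thesis
  proof
    assume "neg T f = Zero T x y"
    hence "neg T (neg T f) = Zero T x y"
      by (simp add: *)
    thus "f = Zero T x y"
      using assms by (auto simp: Hom_iff)
  qed (use * in auto)
qed

lemma diff_eq_Zero_iff:
  assumes "f \<in> Hom T x y" "g \<in> Hom T x y"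
  shows "Add T f (neg T g) = Zero T x y \<longleftrightarrow> f = g"
proof
  assume "Add T f (neg T g) = Zero T x y"
  hence "neg T g = neg T f"
    using assms neg_Hom by (intro neg_unique) auto
  hence "neg T (neg T g) = neg T (neg T f)"
    by simp
  thus "f = g"
    using assms by (auto simp: Hom_iff)
qed (use neg_Hom assms in auto)

lemma Zero_unique:
  assumes "Idn T x = Zero T x x" "x \<in> Obj T"
  shows "f \<in> Hom T x y \<Longrightarrow> f = Zero T x y" "f \<in> Hom T y x \<Longrightarrow> f = Zero T y x"
proof -
  show "f = Zero T x y" if "f \<in> Hom T x y"
  proof -
    have "f \<cdot> Idn T x = f"
      using that assms(2) by (simp add: Hom_iff)
    thus ?thesis
      using that assms(2) unfolding assms(1) by (auto simp: Hom_iff)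
  qed
  show "f = Zero T y x" if "f \<in> Hom T y x"
  proof -
    have "Idn T x \<cdot> f = f"
      using that assms(2) by (simp add: Hom_iff)
    thus ?thesis
      using that assms(2) unfolding assms(1) by (auto simp: Hom_iff)
  qed
qed

text \<open>This turns the universal property into one equation, which additive functors
  transport.\<close>

lemma is_zero_iff: "is_zero T x \<longleftrightarrow> x \<in> Obj T \<and> Idn T x = Zero T x x"
proof (intro iffI conjI)
  assume x: "is_zero T x"
  thus "x \<in> Obj T"
    by (simp add: is_zero_def)
  hence "\<exists>!f. f \<in> Hom T x x"
    using x by (simp add: is_zero_def)
  thus "Idn T x = Zero T x x"
    using Zero_Hom idn_in \<open>x \<in> Obj T\<close> by blast
next
  assume x: "x \<in> Obj T \<and> Idn T x = Zero T x x"
  show "is_zero T x"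
    unfolding is_zero_def
  proof (intro conjI ballI)
    fix y assume y: "y \<in> Obj T"
    show "\<exists>!f. f \<in> Hom T x y"
      using Zero_Hom[of x y] Zero_unique(1)[of x _ y] x y by blast
    show "\<exists>!f. f \<in> Hom T y x"
      using Zero_Hom[of y x] Zero_unique(2)[of x _ y] x y by blast
  qed (use x in auto)
qed

lemma zero_Hom_eq:
  assumes "is_zero T x"
  shows "f \<in> Hom T x y \<Longrightarrow> f = Zero T x y" "f \<in> Hom T y x \<Longrightarrow> f = Zero T y x"
  using assms Zero_unique unfolding is_zero_iff by blast+

lemma is_zero_retract:
  assumes "is_zero T x" "i \<in> Hom T y x" "r \<in> Hom T x y" "r \<cdot> i = Idn T y"
  shows "is_zero T y"
proof -
  have "i = Zero T y x"
    using zero_Hom_eq(2)[OF assms(1,2)] .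
  thus ?thesis
    using assms by (auto simp: is_zero_iff Hom_iff)
qed

lemma is_zero_iso: "isomorphic T x y \<Longrightarrow> is_zero T x \<longleftrightarrow> is_zero T y"
  by (metis is_zero_retract isomorphicE)


section \<open>Exact triangles\<close>

lemma Hom_eq_Zero_iff:
  "x \<in> Obj T \<Longrightarrow> y \<in> Obj T \<Longrightarrow> Hom T x y = {Zero T x y} \<longleftrightarrow> (\<forall>f \<in> Hom T x y. f = Zero T x y)"
  using Zero_Hom by blast

lemma Hom_zero_iso:
  assumes "isomorphic T x x'" "isomorphic T y y'" "\<forall>f \<in> Hom T x y. f = Zero T x y"
  shows "\<forall>f \<in> Hom T x' y'. f = Zero T x' y'"
proof
  fix f assume f: "f \<in> Hom T x' y'"
  obtain u u' where u: "u \<in> Hom T x x'" "u' \<in> Hom T x' x" "u \<cdot> u' = Idn T x'"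
    using assms(1) by (metis isomorphicE)
  obtain v v' where v: "v \<in> Hom T y y'" "v' \<in> Hom T y' y" "v \<cdot> v' = Idn T y'"
    using assms(2) by (metis isomorphicE)
  have "v' \<cdot> (f \<cdot> u) \<in> Hom T x y"
    using f u v by (auto simp: Hom_iff)
  hence z: "v' \<cdot> (f \<cdot> u) = Zero T x y"
    using assms(3) by blast
  have "f = (v \<cdot> v') \<cdot> (f \<cdot> (u \<cdot> u'))"
    using f u(1,2) v(1,2) unfolding u(3) v(3) by (simp add: Hom_iff)
  also have "\<dots> = v \<cdot> ((v' \<cdot> (f \<cdot> u)) \<cdot> u')"
    using f u(1,2) v(1,2) by (simp add: Hom_iff)
  also have "\<dots> = Zero T x' y'"
    using f u(1,2) v(1,2) unfolding z by (auto simp: Hom_iff)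
  finally show "f = Zero T x' y'" .
qed

end

section \<open>Suspension and exactness of Hom\<close>

context triangulated_category
begin

lemma susp_Obj [simp]: "x \<in> Obj T \<Longrightarrow> susp_ob T x \<in> Obj T"
  using susp_equivalence by (auto simp: is_equivalence_def is_functor_def)

lemma susp_Hom: "f \<in> Hom T x y \<Longrightarrow> susp_ar T f \<in> Hom T (susp_ob T x) (susp_ob T y)"
  using susp_equivalence by (auto simp: is_equivalence_def is_functor_def)

lemma susp_simps [simp]:
  assumes "f \<in> Mor T"
  shows "susp_ar T f \<in> Mor T" "Dom T (susp_ar T f) = susp_ob T (Dom T f)"
    "Cod T (susp_ar T f) = susp_ob T (Cod T f)"
  using susp_Hom[of f "Dom T f" "Cod T f"] assms by (auto simp: Hom_iff)

lemma susp_Idn [simp]: "x \<in> Obj T \<Longrightarrow> susp_ar T (Idn T x) = Idn T (susp_ob T x)"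
  using susp_equivalence by (auto simp: is_equivalence_def is_functor_def)

lemma susp_cmp:
  "f \<in> Mor T \<Longrightarrow> g \<in> Mor T \<Longrightarrow> Dom T g = Cod T f \<Longrightarrow>
    susp_ar T (g \<cdot> f) = susp_ar T g \<cdot> susp_ar T f"
  using susp_equivalence unfolding is_equivalence_def is_functor_def by (simp add: Hom_iff)

lemma susp_bij:
  "x \<in> Obj T \<Longrightarrow> y \<in> Obj T \<Longrightarrow> bij_betw (susp_ar T) (Hom T x y) (Hom T (susp_ob T x) (susp_ob T y))"
  using susp_equivalence by (auto simp: is_equivalence_def)

lemma susp_inj:
  assumes "f \<in> Hom T x y" "g \<in> Hom T x y" "susp_ar T f = susp_ar T g"
  shows "f = g"
  using bij_betw_imp_inj_on[OF susp_bij[of x y]] assms Hom_Obj[OF assms(1)] by (auto dest: inj_onD)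

lemma susp_full:
  assumes "h \<in> Hom T (susp_ob T x) (susp_ob T y)" "x \<in> Obj T" "y \<in> Obj T"
  obtains f where "f \<in> Hom T x y" "susp_ar T f = h"
proof -
  have "h \<in> susp_ar T ` Hom T x y"
    using bij_betw_imp_surj_on[OF susp_bij[OF assms(2,3)]] assms(1) by simp
  thus ?thesis
    using that by (elim imageE) simp
qed

lemma susp_surj:
  assumes "y \<in> Obj T"
  obtains x where "x \<in> Obj T" "isomorphic T (susp_ob T x) y"
  using susp_equivalence assms by (auto simp: is_equivalence_def)

lemma susp_Zero [simp]:
  assumes "x \<in> Obj T" "y \<in> Obj T"
  shows "susp_ar T (Zero T x y) = Zero T (susp_ob T x) (susp_ob T y)"
proof (rule Add_idem)
  have "Add T (susp_ar T (Zero T x y)) (susp_ar T (Zero T x y))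
      = susp_ar T (Add T (Zero T x y) (Zero T x y))"
    using susp_add[of "Zero T x y" x y] assms by (simp add: Hom_iff)
  thus "Add T (susp_ar T (Zero T x y)) (susp_ar T (Zero T x y)) = susp_ar T (Zero T x y)"
    using assms by simp
qed (use assms in \<open>simp add: Hom_iff\<close>)

lemma susp_eq_Zero:
  assumes "f \<in> Hom T x y" "susp_ar T f = Zero T (susp_ob T x) (susp_ob T y)"
  shows "f = Zero T x y"
proof (rule susp_inj[OF assms(1)])
  have "x \<in> Obj T" "y \<in> Obj T"
    using assms(1) Hom_Obj by auto
  thus "Zero T x y \<in> Hom T x y" "susp_ar T f = susp_ar T (Zero T x y)"
    using assms(2) Zero_Hom by auto
qed

lemma susp_is_zero:
  assumes "x \<in> Obj T"
  shows "is_zero T (susp_ob T x) \<longleftrightarrow> is_zero T x"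
proof
  assume "is_zero T (susp_ob T x)"
  hence "susp_ar T (Idn T x) = Zero T (susp_ob T x) (susp_ob T x)"
    using assms by (simp add: is_zero_iff)
  thus "is_zero T x"
    using susp_eq_Zero[of "Idn T x" x x] assms by (simp add: is_zero_iff Hom_iff)
next
  assume "is_zero T x"
  hence "susp_ar T (Idn T x) = susp_ar T (Zero T x x)"
    by (simp add: is_zero_iff)
  thus "is_zero T (susp_ob T x)"
    using assms by (simp add: is_zero_iff)
qed

lemma dist_simps:
  assumes "(f, g, h) \<in> Dist T"
  shows "f \<in> Mor T" "g \<in> Mor T" "h \<in> Mor T" "Dom T g = Cod T f" "Dom T h = Cod T g"
    "Cod T h = susp_ob T (Dom T f)"
  using dist_triangle[OF assms] by (auto simp: is_triangle_def Hom_iff)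

lemma dist_rot: "(f, g, h) \<in> Dist T \<Longrightarrow> (g, h, neg T (susp_ar T f)) \<in> Dist T"
  using dist_rotate dist_triangle by blast

text \<open>Comparing the triangle on the identity of \<open>Dom T f\<close> with the given one
  makes g \<cdot> f factor through the zero object in third place.\<close>

lemma dist_cmp_Zero:
  assumes "(f, g, h) \<in> Dist T"
  shows "g \<cdot> f = Zero T (Dom T f) (Cod T g)"
proof -
  note D = dist_simps[OF assms]
  obtain z where z: "is_zero T z"
    using ex_zero by blast
  have zO: "z \<in> Obj T"
    using z by (simp add: is_zero_def)
  let ?x = "Dom T f"
  have "(Idn T ?x, Zero T ?x z, Zero T z (susp_ob T ?x)) \<in> Dist T"
    using dist_idn[OF _ z] D by simp
  then obtain c where "is_triangle_map T (Idn T ?x, Zero T ?x z, Zero T z (susp_ob T ?x)) (f, g, h) (Idn T ?x) f c"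
    using dist_fill[OF _ assms, of "Idn T ?x" _ _ "Idn T ?x" f] D zO by (auto simp: Hom_iff)
  hence "c \<in> Hom T z (Cod T g)" "c \<cdot> Zero T ?x z = g \<cdot> f"
    using D zO by (auto simp: is_triangle_map_def Hom_iff)
  thus ?thesis
    using D zO by (auto simp: Hom_iff)
qed

lemma dist_cmp_Zero':
  assumes "(f, g, h) \<in> Dist T"
  shows "h \<cdot> g = Zero T (Cod T f) (susp_ob T (Dom T f))"
  using dist_cmp_Zero[OF dist_rot[OF assms]] dist_simps[OF assms] by simp

lemma dist_cmp_Zero'':
  assumes "(f, g, h) \<in> Dist T"
  shows "susp_ar T f \<cdot> h = Zero T (Cod T g) (susp_ob T (Cod T f))"
proof -
  note D = dist_simps[OF assms]
  have "neg T (susp_ar T f \<cdot> h) = Zero T (Cod T g) (susp_ob T (Cod T f))"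
    using dist_cmp_Zero'[OF dist_rot[OF assms]] D by (simp add: cmp_neg)
  thus ?thesis
    using neg_eq_Zero_iff[of "susp_ar T f \<cdot> h" "Cod T g" "susp_ob T (Cod T f)"] D
    by (simp add: Hom_iff)
qed

text \<open>The condition on k is a commutative square from w -> 0 to the first map of the rotated
  triangle. The fill-in from w -> 0 -> \<Sigma> w lives on suspensions and is brought back since the
  suspension is full.\<close>

lemma exact_lift:
  assumes dist: "(f, g, h) \<in> Dist T" and k: "k \<in> Hom T w (Cod T f)"
    and gk: "g \<cdot> k = Zero T w (Cod T g)"
  obtains l where "l \<in> Hom T w (Dom T f)" "f \<cdot> l = k"
proof -
  note D = dist_simps[OF dist]
  have k': "k \<in> Mor T" "Dom T k = w" "Cod T k = Cod T f" "w \<in> Obj T"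
    using k by (auto simp: Hom_iff)
  obtain z where z: "is_zero T z"
    using ex_zero by blast
  have zO: "z \<in> Obj T"
    using z by (simp add: is_zero_def)
  have "(Zero T w z, Zero T z (susp_ob T w), neg T (susp_ar T (Idn T w))) \<in> Dist T"
    by (rule dist_rot[OF dist_idn[OF k'(4) z]])
  moreover have "Zero T z (Cod T g) \<cdot> Zero T w z = g \<cdot> k"
    using k' D zO gk by simp
  ultimately obtain c where c: "is_triangle_map T (Zero T w z, Zero T z (susp_ob T w), neg T (susp_ar T (Idn T w)))
      (g, h, neg T (susp_ar T f)) k (Zero T z (Cod T g)) c"
    using dist_fill[OF _ dist_rot[OF dist], of "Zero T w z" "Zero T z (susp_ob T w)" _ k "Zero T z (Cod T g)"]
      D k' zO by (auto simp: Hom_iff)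
  hence c1: "c \<in> Hom T (susp_ob T w) (susp_ob T (Dom T f))"
    and c2: "susp_ar T k \<cdot> neg T (Idn T (susp_ob T w)) = neg T (susp_ar T f) \<cdot> c"
    using D zO k' by (auto simp: is_triangle_map_def Hom_iff)
  from c1 obtain l where l: "l \<in> Hom T w (Dom T f)" "susp_ar T l = c"
    using susp_full k'(4) D by (metis Dom_Obj)
  \<comment> \<open>Both rotated triangles carry a minus sign in their last map; the signs cancel,
    and faithfulness of the suspension finishes.\<close>
  have "neg T (susp_ar T k) = neg T (susp_ar T (f \<cdot> l))"
    using c2 l(1) D k' unfolding l(2)[symmetric] by (simp add: cmp_neg susp_cmp Hom_iff)
  hence "neg T (neg T (susp_ar T k)) = neg T (neg T (susp_ar T (f \<cdot> l)))"
    by simp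
  hence "susp_ar T (f \<cdot> l) = susp_ar T k"
    using l D k' by (simp add: Hom_iff)
  hence "f \<cdot> l = k"
    using l(1) D k by (intro susp_inj[OF _ k]) (auto simp: Hom_iff)
  thus ?thesis
    using that l by blast
qed

lemma exact_lift':
  assumes "(f, g, h) \<in> Dist T" "k \<in> Hom T w (Cod T g)" "h \<cdot> k = Zero T w (susp_ob T (Dom T f))"
  obtains l where "l \<in> Hom T w (Cod T f)" "g \<cdot> l = k"
  using exact_lift[OF dist_rot[OF assms(1)] assms(2)] assms(3) dist_simps[OF assms(1)] by metis

text \<open>Dual to \<open>exact_lift\<close>, with the triangle 0 -> w -> w -> \<Sigma> 0 as target
  of the comparison.\<close>

lemma exact_ext:
  assumes dist: "(f, g, h) \<in> Dist T" and k: "k \<in> Hom T (Cod T f) w"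
    and kf: "k \<cdot> f = Zero T (Dom T f) w"
  obtains l where "l \<in> Hom T (Cod T g) w" "l \<cdot> g = k"
proof -
  note D = dist_simps[OF dist]
  have k': "k \<in> Mor T" "Dom T k = Cod T f" "Cod T k = w" "w \<in> Obj T"
    using k by (auto simp: Hom_iff)
  obtain z where z: "is_zero T z"
    using ex_zero by blast
  have zO: "z \<in> Obj T"
    using z by (simp add: is_zero_def)
  \<comment> \<open>This triangle is obtained by undoing one rotation of the identity triangle of w,
    taken with the suspended zero object in third place.\<close>
  have "is_triangle T (Zero T z w, Idn T w, Zero T w (susp_ob T z))"
    using zO k' by (simp add: is_triangle_def Hom_iff)
  moreover have "neg T (Zero T (susp_ob T z) (susp_ob T w)) = Zero T (susp_ob T z) (susp_ob T w)"
    using neg_eq_Zero_iff[of "Zero T (susp_ob T z) (susp_ob T w)"] zO k' by (simp add: Hom_iff)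
  hence "(Idn T w, Zero T w (susp_ob T z), neg T (susp_ar T (Zero T z w))) \<in> Dist T"
    using dist_idn[OF k'(4), of "susp_ob T z"] susp_is_zero[OF zO] z zO k' by simp
  ultimately have "(Zero T z w, Idn T w, Zero T w (susp_ob T z)) \<in> Dist T"
    using dist_rotate by blast
  moreover have "k \<cdot> f = Zero T z w \<cdot> Zero T (Dom T f) z"
    using k' D zO kf by simp
  ultimately obtain c where "is_triangle_map T (f, g, h) (Zero T z w, Idn T w, Zero T w (susp_ob T z))
      (Zero T (Dom T f) z) k c"
    using dist_fill[OF dist, of "Zero T z w" "Idn T w" "Zero T w (susp_ob T z)" "Zero T (Dom T f) z" k]
      D k' zO by (auto simp: Hom_iff)
  hence "c \<in> Hom T (Cod T g) w" "c \<cdot> g = k"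
    using D zO k' by (auto simp: is_triangle_map_def Hom_iff)
  thus ?thesis
    using that by blast
qed

lemma exact_ext':
  assumes "(f, g, h) \<in> Dist T" "k \<in> Hom T (Cod T g) w" "k \<cdot> g = Zero T (Cod T f) w"
  obtains l where "l \<in> Hom T (susp_ob T (Dom T f)) w" "l \<cdot> h = k"
  using exact_ext[OF dist_rot[OF assms(1)] assms(2)] assms(3) dist_simps[OF assms(1)] by metis


section \<open>Triangulated and localizing subcategories\<close>

lemma tri_subD:
  assumes "triangulated_subcat T S"
  shows "S \<subseteq> Obj T" "is_zero T z \<Longrightarrow> z \<in> S" "isomorphic T x y \<Longrightarrow> x \<in> S \<longleftrightarrow> y \<in> S"
    "x \<in> Obj T \<Longrightarrow> susp_ob T x \<in> S \<longleftrightarrow> x \<in> S"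
    "(f, g, h) \<in> Dist T \<Longrightarrow> Dom T f \<in> S \<Longrightarrow> Cod T f \<in> S \<Longrightarrow> Cod T g \<in> S"
  using assms isomorphic_sym unfolding triangulated_subcat_def by blast+

text \<open>Rotation moves the missing vertex into the position of the cone, at the price of a
  suspension that the subcategory does not see.\<close>

lemma tri_sub_two_of_three:
  assumes S: "triangulated_subcat T S" and dist: "(f, g, h) \<in> Dist T"
  shows "Cod T f \<in> S \<Longrightarrow> Cod T g \<in> S \<Longrightarrow> Dom T f \<in> S"
    and "Dom T f \<in> S \<Longrightarrow> Cod T g \<in> S \<Longrightarrow> Cod T f \<in> S"
proof -
  note D = dist_simps[OF dist]
  note rot = dist_rot[OF dist]
  show "Dom T f \<in> S" if "Cod T f \<in> S" "Cod T g \<in> S"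
    using tri_subD(5)[OF S rot] tri_subD(4)[OF S, of "Dom T f"] D that by simp
  show "Cod T f \<in> S" if "Dom T f \<in> S" "Cod T g \<in> S"
  proof -
    have "susp_ob T (Dom T f) \<in> S"
      using tri_subD(4)[OF S, of "Dom T f"] D that by simp
    hence "susp_ob T (Cod T f) \<in> S"
      using tri_subD(5)[OF S dist_rot[OF rot]] D that by simp
    thus ?thesis
      using tri_subD(4)[OF S, of "Cod T f"] D by simp
  qed
qed

lemma triangulated_subcatI:
  assumes "S \<subseteq> Obj T" "\<And>z. is_zero T z \<Longrightarrow> z \<in> S"
    and "\<And>x y. x \<in> S \<Longrightarrow> isomorphic T x y \<Longrightarrow> y \<in> S"
    and "\<And>x. x \<in> S \<Longrightarrow> susp_ob T x \<in> S"
    and "\<And>x. x \<in> Obj T \<Longrightarrow> susp_ob T x \<in> S \<Longrightarrow> x \<in> S"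
    and "\<And>f g h. (f, g, h) \<in> Dist T \<Longrightarrow> Dom T f \<in> S \<Longrightarrow> Cod T f \<in> S \<Longrightarrow> Cod T g \<in> S"
  shows "triangulated_subcat T S"
  using assms unfolding triangulated_subcat_def by blast

lemma triangulated_subcat_Inter:
  assumes "\<And>S. S \<in> \<S> \<Longrightarrow> triangulated_subcat T S" "\<S> \<noteq> {}"
  shows "triangulated_subcat T (\<Inter>\<S>)"
proof (rule triangulated_subcatI)
  show "\<Inter>\<S> \<subseteq> Obj T"
    using assms tri_subD(1) by blast
  fix x y assume "x \<in> \<Inter>\<S>" "isomorphic T x y"
  thus "y \<in> \<Inter>\<S>"
    using tri_subD(3)[OF assms(1)] by blast
next
  fix f g h assume "(f, g, h) \<in> Dist T" "Dom T f \<in> \<Inter>\<S>" "Cod T f \<in> \<Inter>\<S>"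
  thus "Cod T g \<in> \<Inter>\<S>"
    using tri_subD(5)[OF assms(1)] by blast
next
  fix x assume x: "x \<in> \<Inter>\<S>"
  hence "x \<in> Obj T"
    using assms tri_subD(1) by blast
  thus "susp_ob T x \<in> \<Inter>\<S>"
    using tri_subD(4)[OF assms(1)] x by blast
next
  fix x assume "x \<in> Obj T" "susp_ob T x \<in> \<Inter>\<S>"
  thus "x \<in> \<Inter>\<S>"
    using tri_subD(4)[OF assms(1)] by blast
qed (use assms(1) tri_subD(2) in blast)

lemma localizing_subcat_Inter:
  assumes "\<And>S. S \<in> \<S> \<Longrightarrow> localizing_subcat T S" "\<S> \<noteq> {}"
  shows "localizing_subcat T (\<Inter>\<S>)"
  using triangulated_subcat_Inter[of \<S>] assms unfolding localizing_subcat_def by blast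

lemma localizing_subcat_Obj: "localizing_subcat T (Obj T)"
proof -
  have "triangulated_subcat T (Obj T)"
    by (rule triangulated_subcatI)
      (auto dest: isomorphic_Obj dist_simps(2) simp: is_zero_iff)
  thus ?thesis
    by (auto simp: localizing_subcat_def dest: coproduct_in)
qed

lemma Loc_localizing: "X \<subseteq> Obj T \<Longrightarrow> localizing_subcat T (Loc T X)"
  unfolding Loc_def using localizing_subcat_Obj by (intro localizing_subcat_Inter) auto

lemma Loc_subset: "X \<subseteq> Loc T X"
  by (auto simp: Loc_def)

lemma Loc_least: "localizing_subcat T S \<Longrightarrow> X \<subseteq> S \<Longrightarrow> Loc T X \<subseteq> S"
  by (auto simp: Loc_def)

text \<open>For cones: when the middle vertex vanishes, the identity of the third one composes to
  zero with g, hence factors through the suspension of the first. So the third vertex is a retract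
  of a zero object.\<close>

lemma localizing_zero: "localizing_subcat T {x. is_zero T x}"
proof -
  have "triangulated_subcat T {x. is_zero T x}"
  proof (rule triangulated_subcatI)
    fix f g h assume dist: "(f, g, h) \<in> Dist T"
      and z: "Dom T f \<in> {x. is_zero T x}" "Cod T f \<in> {x. is_zero T x}"
    note D = dist_simps[OF dist]
    have "Idn T (Cod T g) \<cdot> g = Zero T (Cod T f) (Cod T g)"
      using zero_Hom_eq(1)[of "Cod T f" g "Cod T g"] z D by (simp add: Hom_iff)
    then obtain l where l: "l \<in> Hom T (susp_ob T (Dom T f)) (Cod T g)" "l \<cdot> h = Idn T (Cod T g)"
      using exact_ext'[OF dist, of "Idn T (Cod T g)" "Cod T g"] D by (auto simp: Hom_iff)
    have "is_zero T (susp_ob T (Dom T f))"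
      using z susp_is_zero D by simp
    thus "Cod T g \<in> {x. is_zero T x}"
      using is_zero_retract[OF _ _ l] D by (simp add: Hom_iff)
  qed (use susp_is_zero is_zero_iso in \<open>auto simp: is_zero_def\<close>)
  moreover have "is_zero T c"
    if X: "\<forall>i \<in> I. is_zero T (X i)" and c: "is_coproduct T I X c \<iota>" for I :: "'u set" and X c \<iota>
  proof -
    note t = coproduct_in[OF c]
    have "Idn T c = Zero T c c"
    proof (rule coproduct_eqI[OF c])
      fix i assume i: "i \<in> I"
      have "Idn T c \<cdot> \<iota> i \<in> Hom T (X i) c" "Zero T c c \<cdot> \<iota> i \<in> Hom T (X i) c"
        using t(1) t(2)[OF i] t(3)[OF i] by (auto simp: Hom_iff)
      thus "Idn T c \<cdot> \<iota> i = Zero T c c \<cdot> \<iota> i"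
        using zero_Hom_eq(1)[OF X[rule_format, OF i]] by metis
    qed (use t(1) in \<open>auto simp: Hom_iff\<close>)
    thus ?thesis
      using t(1) by (simp add: is_zero_iff)
  qed
  ultimately show ?thesis
    unfolding localizing_subcat_def by blast
qed

text \<open>The closure shared by an ideal of compact objects and its right orthogonal. It allows
  test maps to be shifted by the suspension.\<close>

definition stable_under_susp :: "'o set \<Rightarrow> bool" where
  "stable_under_susp K \<longleftrightarrow> K \<subseteq> Obj T \<and> (\<forall>x \<in> K. \<forall>y. isomorphic T x y \<longrightarrow> y \<in> K)
     \<and> (\<forall>x \<in> Obj T. susp_ob T x \<in> K \<longleftrightarrow> x \<in> K)"

lemma stable_under_susp_desusp:
  assumes "stable_under_susp K" "x \<in> K"
  obtains y where "y \<in> K" "isomorphic T (susp_ob T y) x"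
proof -
  obtain y where y: "y \<in> Obj T" "isomorphic T (susp_ob T y) x"
    using susp_surj assms unfolding stable_under_susp_def by blast
  hence "susp_ob T y \<in> K"
    using assms isomorphic_sym unfolding stable_under_susp_def by blast
  thus ?thesis
    using that y assms unfolding stable_under_susp_def by blast
qed

lemma right_orthogonal_iff:
  "K \<subseteq> Obj T \<Longrightarrow> y \<in> right_orthogonal T K \<longleftrightarrow>
    y \<in> Obj T \<and> (\<forall>x \<in> K. \<forall>f \<in> Hom T x y. f = Zero T x y)"
  unfolding right_orthogonal_def using Hom_eq_Zero_iff by blast

text \<open>The delicate direction is from x to \<Sigma> x: a test object of K is, up to
  isomorphism, \<Sigma> k' with k' in K, and fullness brings maps \<Sigma> k' -> \<Sigma> x back to
  maps k' -> x.\<close>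

lemma right_orthogonal_stable:
  assumes K: "stable_under_susp K"
  shows "stable_under_susp (right_orthogonal T K)"
proof -
  have KO: "K \<subseteq> Obj T"
    using K by (simp add: stable_under_susp_def)
  note ro = right_orthogonal_iff[OF KO]
  show ?thesis
    unfolding stable_under_susp_def
  proof (intro conjI ballI allI impI iffI)
    fix x y assume "x \<in> right_orthogonal T K" and xy: "isomorphic T x y"
    thus "y \<in> right_orthogonal T K"
      using Hom_zero_iso[OF isomorphic_refl xy] KO isomorphic_Obj[OF xy] unfolding ro by blast
  next
    fix x assume x: "x \<in> Obj T" and s: "susp_ob T x \<in> right_orthogonal T K"
    have "f = Zero T k x" if k: "k \<in> K" and f: "f \<in> Hom T k x" for k f
    proof (rule susp_eq_Zero[OF f])
      have "susp_ob T k \<in> K"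
        using k K KO unfolding stable_under_susp_def by blast
      thus "susp_ar T f = Zero T (susp_ob T k) (susp_ob T x)"
        using s susp_Hom[OF f] unfolding ro by blast
    qed
    thus "x \<in> right_orthogonal T K"
      using x unfolding ro by blast
  next
    fix x assume x: "x \<in> Obj T" and s: "x \<in> right_orthogonal T K"
    have "\<forall>f \<in> Hom T k (susp_ob T x). f = Zero T k (susp_ob T x)" if "k \<in> K" for k
    proof -
      obtain k' where k': "k' \<in> K" "isomorphic T (susp_ob T k') k"
        using stable_under_susp_desusp[OF K \<open>k \<in> K\<close>] .
      have "\<forall>f \<in> Hom T (susp_ob T k') (susp_ob T x). f = Zero T (susp_ob T k') (susp_ob T x)"
      proof
        fix f assume "f \<in> Hom T (susp_ob T k') (susp_ob T x)"
        then obtain f' where f': "f' \<in> Hom T k' x" "susp_ar T f' = f"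
          using susp_full k' KO x by blast
        hence "f' = Zero T k' x"
          using s k' unfolding ro by blast
        thus "f = Zero T (susp_ob T k') (susp_ob T x)"
          using f' k' KO x by auto
      qed
      thus ?thesis
        using Hom_zero_iso[OF k'(2) isomorphic_refl] x by simp
    qed
    thus "susp_ob T x \<in> right_orthogonal T K"
      using x unfolding ro by auto
  qed (auto simp: right_orthogonal_def)
qed

text \<open>A map from a cone into n restricts to zero on the middle vertex, so it factors through
  the suspended first vertex, where maps into n vanish as well; on a coproduct the components
  decide.\<close>

lemma localizing_left_orthogonal:
  assumes N: "stable_under_susp N"
  shows "localizing_subcat T {z \<in> Obj T. \<forall>n \<in> N. \<forall>f \<in> Hom T z n. f = Zero T z n}" (is "localizing_subcat T ?S")
proof -
  have NO: "N \<subseteq> Obj T"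
    using N by (simp add: stable_under_susp_def)
  have susp: "susp_ob T x \<in> ?S" if x: "x \<in> ?S" for x
  proof -
    have xO: "x \<in> Obj T"
      using x by blast
    have "\<forall>f \<in> Hom T (susp_ob T x) n. f = Zero T (susp_ob T x) n" if "n \<in> N" for n
    proof -
      obtain m where m: "m \<in> N" "isomorphic T (susp_ob T m) n"
        using stable_under_susp_desusp[OF N \<open>n \<in> N\<close>] .
      have "\<forall>f \<in> Hom T (susp_ob T x) (susp_ob T m). f = Zero T (susp_ob T x) (susp_ob T m)"
      proof
        fix f assume "f \<in> Hom T (susp_ob T x) (susp_ob T m)"
        then obtain f' where f': "f' \<in> Hom T x m" "susp_ar T f' = f"
          using susp_full[OF _ xO] m(1) NO by blast
        hence "f' = Zero T x m"
          using x m(1) by blast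
        thus "f = Zero T (susp_ob T x) (susp_ob T m)"
          using f'(2) m(1) NO xO by auto
      qed
      thus ?thesis
        using Hom_zero_iso[OF isomorphic_refl[OF susp_Obj[OF xO]] m(2)] by blast
    qed
    thus ?thesis
      using susp_Obj[OF xO] by blast
  qed
  have "triangulated_subcat T ?S"
  proof (rule triangulated_subcatI)
    fix x y assume "x \<in> ?S" and xy: "isomorphic T x y"
    thus "y \<in> ?S"
      using Hom_zero_iso[OF xy isomorphic_refl] NO isomorphic_Obj[OF xy] by blast
  next
    fix x assume x: "x \<in> Obj T" and s: "susp_ob T x \<in> ?S"
    have "f = Zero T x n" if n: "n \<in> N" and f: "f \<in> Hom T x n" for n f
    proof (rule susp_eq_Zero[OF f])
      have "susp_ob T n \<in> N"
        using n N NO unfolding stable_under_susp_def by blast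
      thus "susp_ar T f = Zero T (susp_ob T x) (susp_ob T n)"
        using s susp_Hom[OF f] by blast
    qed
    thus "x \<in> ?S"
      using x by blast
  next
    fix f g h assume dist: "(f, g, h) \<in> Dist T" and S: "Dom T f \<in> ?S" "Cod T f \<in> ?S"
    note D = dist_simps[OF dist]
    have "k = Zero T (Cod T g) n" if n: "n \<in> N" and k: "k \<in> Hom T (Cod T g) n" for k n
    proof -
      have "k \<cdot> g \<in> Hom T (Cod T f) n"
        using k D by (auto simp: Hom_iff)
      hence "k \<cdot> g = Zero T (Cod T f) n"
        using S(2) n by blast
      then obtain l where l: "l \<in> Hom T (susp_ob T (Dom T f)) n" "l \<cdot> h = k"
        using exact_ext'[OF dist k] by blast
      hence "l = Zero T (susp_ob T (Dom T f)) n"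
        using susp[OF S(1)] n by blast
      thus ?thesis
        using l(2) D n NO by auto
    qed
    thus "Cod T g \<in> ?S"
      using D Cod_Obj by blast
  next
    fix z assume z: "is_zero T z"
    thus "z \<in> ?S"
      using zero_Hom_eq(1)[OF z] unfolding is_zero_def by blast
  qed (use susp in blast)+
  moreover have "c \<in> ?S"
    if X: "\<forall>i \<in> I. X i \<in> ?S" and c: "is_coproduct T I X c \<iota>" for I :: "'u set" and X c \<iota>
  proof -
    note t = coproduct_in[OF c]
    have "f = Zero T c n" if n: "n \<in> N" and f: "f \<in> Hom T c n" for n f
    proof (rule coproduct_eqI[OF c f])
      show "Zero T c n \<in> Hom T c n"
        using n NO t Zero_Hom by blast
      fix i assume i: "i \<in> I"
      have "f \<cdot> \<iota> i = Zero T (X i) n"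
        using cmp_in[OF t(2)[OF i] f] X i n by blast
      thus "f \<cdot> \<iota> i = Zero T c n \<cdot> \<iota> i"
        using t(2)[OF i] t(3)[OF i] t(1) n NO by (auto simp: Hom_iff)
    qed
    thus ?thesis
      using t by blast
  qed
  ultimately show ?thesis
    unfolding localizing_subcat_def by blast
qed

text \<open>K lies in the left orthogonal of its right orthogonal, which is localizing and so
  contains \<open>Loc T K\<close>. Rickard pairs are defined with \<open>Loc T K\<close>, while the
  construction of the localization controls maps out of K.\<close>

lemma right_orthogonal_Loc:
  assumes K: "stable_under_susp K"
  shows "right_orthogonal T (Loc T K) = right_orthogonal T K"
proof -
  have KO: "K \<subseteq> Obj T"
    using K by (simp add: stable_under_susp_def)
  have LO: "Loc T K \<subseteq> Obj T"
    using Loc_least[OF localizing_subcat_Obj KO] .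
  have "K \<subseteq> {z \<in> Obj T. \<forall>n \<in> right_orthogonal T K. \<forall>f \<in> Hom T z n. f = Zero T z n}"
    using KO right_orthogonal_iff[OF KO] by blast
  hence "Loc T K \<subseteq> {z \<in> Obj T. \<forall>n \<in> right_orthogonal T K. \<forall>f \<in> Hom T z n. f = Zero T z n}"
    by (rule Loc_least[OF localizing_left_orthogonal[OF right_orthogonal_stable[OF K]]])
  thus ?thesis
    using Loc_subset[of K] right_orthogonal_iff[OF KO] right_orthogonal_iff[OF LO] by blast
qed

end


section \<open>Coproducts and compact objects\<close>

context additive_category
begin

abbreviation Sum :: "'o \<Rightarrow> 'o \<Rightarrow> ('i \<Rightarrow> 'm) \<Rightarrow> 'i set \<Rightarrow> 'm" where
  "Sum x y \<equiv> finprod (hom_group T x y)"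

lemma
  assumes "x \<in> Obj T" "y \<in> Obj T"
  shows Sum_empty: "Sum x y f {} = Zero T x y"
    and Sum_insert: "finite F \<Longrightarrow> i \<notin> F \<Longrightarrow> (\<And>j. j \<in> insert i F \<Longrightarrow> f j \<in> Hom T x y) \<Longrightarrow>
      Sum x y f (insert i F) = Add T (f i) (Sum x y f F)"
    and Sum_Hom: "(\<And>i. i \<in> F \<Longrightarrow> f i \<in> Hom T x y) \<Longrightarrow> Sum x y f F \<in> Hom T x y"
    and Sum_mono_neutral: "finite F \<Longrightarrow> G \<subseteq> F \<Longrightarrow> (\<And>i. i \<in> F \<Longrightarrow> f i \<in> Hom T x y) \<Longrightarrow>
      (\<And>i. i \<in> F - G \<Longrightarrow> f i = Zero T x y) \<Longrightarrow> (\<And>i. i \<in> G \<Longrightarrow> g i = f i) \<Longrightarrow>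
      Sum x y g G = Sum x y f F"
proof -
  interpret comm_group "hom_group T x y"
    by (rule hom_comm_group[OF assms])
  have sel: "carrier (hom_group T x y) = Hom T x y" "\<one>\<^bsub>hom_group T x y\<^esub> = Zero T x y"
    "\<And>a b. a \<otimes>\<^bsub>hom_group T x y\<^esub> b = Add T a b"
    by (simp_all add: hom_group_def)
  show "Sum x y f {} = Zero T x y"
    by (simp add: sel)
  show "Sum x y f (insert i F) = Add T (f i) (Sum x y f F)"
    if "finite F" "i \<notin> F" "\<And>j. j \<in> insert i F \<Longrightarrow> f j \<in> Hom T x y"
    using finprod_insert[of F i f] that by (auto simp: sel)
  show "Sum x y f F \<in> Hom T x y" if "\<And>i. i \<in> F \<Longrightarrow> f i \<in> Hom T x y"
    using finprod_closed[of f F] that by (auto simp: sel)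
  show "Sum x y g G = Sum x y f F" if "finite F" "G \<subseteq> F" "\<And>i. i \<in> F \<Longrightarrow> f i \<in> Hom T x y"
    "\<And>i. i \<in> F - G \<Longrightarrow> f i = Zero T x y" "\<And>i. i \<in> G \<Longrightarrow> g i = f i"
    using finprod_mono_neutral_cong_left[of F G f g] that by (auto simp: sel)
qed

text \<open>The idempotent endomorphism of the coproduct that keeps the summands in F and kills the
  others. It stands in for the coproduct over F, so that no second coproduct has to be
  chosen.\<close>

definition cut :: "'i set \<Rightarrow> ('i \<Rightarrow> 'o) \<Rightarrow> 'o \<Rightarrow> ('i \<Rightarrow> 'm) \<Rightarrow> 'i set \<Rightarrow> 'm \<Rightarrow> bool" where
  "cut I X c \<iota> F p \<longleftrightarrow> p \<in> Hom T c c \<and> (\<forall>i \<in> I. p \<cdot> \<iota> i = (if i \<in> F then \<iota> i else Zero T (X i) c))"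

text \<open>Factoring through the finite partial coproduct over F, expressed by invariance under the
  cut.\<close>

definition supported :: "'i set \<Rightarrow> ('i \<Rightarrow> 'o) \<Rightarrow> 'o \<Rightarrow> ('i \<Rightarrow> 'm) \<Rightarrow> 'i set \<Rightarrow> 'm \<Rightarrow> bool" where
  "supported I X c \<iota> F f \<longleftrightarrow> finite F \<and> F \<subseteq> I \<and> (\<exists>p. cut I X c \<iota> F p \<and> p \<cdot> f = f)"

definition projections :: "'i set \<Rightarrow> ('i \<Rightarrow> 'o) \<Rightarrow> 'o \<Rightarrow> ('i \<Rightarrow> 'm) \<Rightarrow> ('i \<Rightarrow> 'm) \<Rightarrow> bool" where
  "projections I X c \<iota> \<pi> \<longleftrightarrow> (\<forall>j \<in> I. \<pi> j \<in> Hom T c (X j)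
     \<and> (\<forall>i \<in> I. \<pi> j \<cdot> \<iota> i = (if i = j then Idn T (X j) else Zero T (X i) (X j))))"

context
  fixes I :: "'i set" and X :: "'i \<Rightarrow> 'o" and c :: 'o and \<iota> :: "'i \<Rightarrow> 'm"
  assumes c: "is_coproduct T I X c \<iota>"
begin

lemma ex_cut: "\<exists>p. cut I X c \<iota> F p"
proof -
  have "(if i \<in> F then \<iota> i else Zero T (X i) c) \<in> Hom T (X i) c" if "i \<in> I" for i
    using coproduct_in[OF c] that Zero_Hom by auto
  from coproduct_ex[OF c this coproduct_in(1)[OF c]] show ?thesis
    unfolding cut_def by blast
qed

lemma ex_projections: "\<exists>\<pi>. projections I X c \<iota> \<pi>"
proof -
  have "\<exists>p. p \<in> Hom T c (X j) \<and> (\<forall>i \<in> I. p \<cdot> \<iota> i = (if i = j then Idn T (X j) else Zero T (X i) (X j)))"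
    if j: "j \<in> I" for j
  proof -
    have "(if i = j then Idn T (X j) else Zero T (X i) (X j)) \<in> Hom T (X i) (X j)" if "i \<in> I" for i
      using coproduct_in(3)[OF c] j that Zero_Hom idn_in by auto
    from coproduct_ex[OF c this coproduct_in(3)[OF c j]] show ?thesis
      by blast
  qed
  hence "\<forall>j \<in> I. \<exists>p. p \<in> Hom T c (X j) \<and> (\<forall>i \<in> I. p \<cdot> \<iota> i = (if i = j then Idn T (X j) else Zero T (X i) (X j)))"
    by blast
  thus ?thesis
    unfolding projections_def by (rule bchoice)
qed

lemma cut_cmp:
  assumes "cut I X c \<iota> F p" "cut I X c \<iota> G q" "F \<subseteq> G"
  shows "q \<cdot> p = p"
proof (rule coproduct_eqI[OF c])
  show p: "p \<in> Hom T c c" and "q \<cdot> p \<in> Hom T c c"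
    using assms cmp_in by (auto simp: cut_def)
  fix i assume i: "i \<in> I"
  note t = coproduct_in(2,3)[OF c i] coproduct_in(1)[OF c]
  have "(q \<cdot> p) \<cdot> \<iota> i = q \<cdot> (p \<cdot> \<iota> i)"
    using assms t by (intro cmp_assoc') (auto simp: cut_def Hom_iff)
  also have "\<dots> = p \<cdot> \<iota> i"
    using assms i t by (auto simp: cut_def Hom_iff)
  finally show "(q \<cdot> p) \<cdot> \<iota> i = p \<cdot> \<iota> i" .
qed

lemma cut_empty:
  assumes "cut I X c \<iota> {} p"
  shows "p = Zero T c c"
proof (rule coproduct_eqI[OF c])
  show "p \<in> Hom T c c" "Zero T c c \<in> Hom T c c"
    using assms Zero_Hom coproduct_in(1)[OF c] by (auto simp: cut_def)
  fix i assume i: "i \<in> I"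
  thus "p \<cdot> \<iota> i = Zero T c c \<cdot> \<iota> i"
    using assms coproduct_in(1)[OF c] coproduct_in(2)[OF c i] by (auto simp: cut_def Hom_iff)
qed

text \<open>Both sides agree on every summand: one more index adds one more idempotent \<iota> j
  \<cdot> \<pi> j. Iterated from the zero cut, this writes a finite cut as a finite sum.\<close>

lemma cut_insert:
  assumes p: "cut I X c \<iota> F p" and q: "cut I X c \<iota> (insert j F) q" and j: "j \<in> I" "j \<notin> F"
    and \<pi>: "projections I X c \<iota> \<pi>"
  shows "q = Add T (\<iota> j \<cdot> \<pi> j) p"
proof (rule coproduct_eqI[OF c])
  note t = coproduct_in[OF c] coproduct_in(2,3)[OF c j(1)]
  have m: "p \<in> Hom T c c" "q \<in> Hom T c c" "\<pi> j \<in> Hom T c (X j)"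
    using p q \<pi> j by (auto simp: cut_def projections_def)
  show "q \<in> Hom T c c" "Add T (\<iota> j \<cdot> \<pi> j) p \<in> Hom T c c"
    using m t(4) by (auto simp: Hom_iff)
  fix i assume i: "i \<in> I"
  note ti = t(2,3)[OF i]
  have "Add T (\<iota> j \<cdot> \<pi> j) p \<cdot> \<iota> i = Add T ((\<iota> j \<cdot> \<pi> j) \<cdot> \<iota> i) (p \<cdot> \<iota> i)"
    using m t(4) ti by (intro Add_cmp) (auto simp: Hom_iff)
  also have "(\<iota> j \<cdot> \<pi> j) \<cdot> \<iota> i = \<iota> j \<cdot> (\<pi> j \<cdot> \<iota> i)"
    using m t(4) ti by (intro cmp_assoc') (auto simp: Hom_iff)
  also have "\<pi> j \<cdot> \<iota> i = (if i = j then Idn T (X j) else Zero T (X i) (X j))"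
    using \<pi> i j by (simp add: projections_def)
  also have "p \<cdot> \<iota> i = (if i \<in> F then \<iota> i else Zero T (X i) c)"
    using p i by (simp add: cut_def)
  finally show "q \<cdot> \<iota> i = Add T (\<iota> j \<cdot> \<pi> j) p \<cdot> \<iota> i"
    using q i t(1,4,5) ti j by (auto simp: cut_def Hom_iff)
qed

lemma cut_eq_Sum:
  assumes \<pi>: "projections I X c \<iota> \<pi>" and f: "f \<in> Hom T w c" and F: "finite F"
  shows "F \<subseteq> I \<Longrightarrow> cut I X c \<iota> F p \<Longrightarrow> p \<cdot> f = Sum w c (\<lambda>i. \<iota> i \<cdot> (\<pi> i \<cdot> f)) F"
  using F
proof (induction F arbitrary: p)
  case empty
  have "p = Zero T c c"
    using empty cut_empty by blast
  thus ?case
    using f Hom_Obj[OF f] Sum_empty[of w c "\<lambda>i. \<iota> i \<cdot> (\<pi> i \<cdot> f)"] by (auto simp: Hom_iff)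
next
  case (insert j F)
  obtain p' where p': "cut I X c \<iota> F p'"
    using ex_cut by blast
  have j: "j \<in> I" "F \<subseteq> I"
    using insert.prems by auto
  have m: "\<iota> i \<in> Hom T (X i) c" "\<pi> i \<in> Hom T c (X i)" "\<iota> i \<cdot> (\<pi> i \<cdot> f) \<in> Hom T w c" if "i \<in> I" for i
  proof -
    show i: "\<iota> i \<in> Hom T (X i) c" "\<pi> i \<in> Hom T c (X i)"
      using coproduct_in(2)[OF c that] \<pi> that by (auto simp: projections_def)
    show "\<iota> i \<cdot> (\<pi> i \<cdot> f) \<in> Hom T w c"
      by (intro cmp_in[OF cmp_in[OF f i(2)] i(1)])
  qed
  have "p \<cdot> f = Add T (\<iota> j \<cdot> \<pi> j) p' \<cdot> f"
    using cut_insert[OF p' insert.prems(2) j(1) insert.hyps(2) \<pi>] by simp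
  also have "\<dots> = Add T ((\<iota> j \<cdot> \<pi> j) \<cdot> f) (p' \<cdot> f)"
    using m(1,2)[OF j(1)] p' f by (intro Add_cmp) (auto simp: Hom_iff cut_def)
  also have "(\<iota> j \<cdot> \<pi> j) \<cdot> f = \<iota> j \<cdot> (\<pi> j \<cdot> f)"
    using m(1,2)[OF j(1)] f by (intro cmp_assoc') (auto simp: Hom_iff)
  also have "p' \<cdot> f = Sum w c (\<lambda>i. \<iota> i \<cdot> (\<pi> i \<cdot> f)) F"
    by (rule insert.IH[OF j(2) p'])
  also have "Add T (\<iota> j \<cdot> (\<pi> j \<cdot> f)) \<dots> = Sum w c (\<lambda>i. \<iota> i \<cdot> (\<pi> i \<cdot> f)) (insert j F)"
    by (rule Sum_insert[symmetric]) (use Hom_Obj[OF f] insert j m(3) in auto)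
  finally show ?case .
qed

lemma supported_eq_Sum:
  assumes "supported I X c \<iota> F f" "projections I X c \<iota> \<pi>" "f \<in> Hom T w c"
  shows "f = Sum w c (\<lambda>i. \<iota> i \<cdot> (\<pi> i \<cdot> f)) F"
proof -
  obtain p where p: "finite F" "F \<subseteq> I" "cut I X c \<iota> F p" "p \<cdot> f = f"
    using assms(1) unfolding supported_def by blast
  show ?thesis
    using trans[OF p(4)[symmetric] cut_eq_Sum[OF assms(2,3) p(1-3)]] .
qed

lemma supported_cmp:
  assumes "supported I X c \<iota> F f" "f \<in> Hom T w c" "g \<in> Hom T v w"
  shows "supported I X c \<iota> F (f \<cdot> g)"
proof -
  obtain p where p: "cut I X c \<iota> F p" "p \<cdot> f = f"
    using assms unfolding supported_def by blast
  have "p \<cdot> (f \<cdot> g) = (p \<cdot> f) \<cdot> g"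
    using p(1) assms by (intro cmp_assoc'[symmetric]) (auto simp: cut_def Hom_iff)
  thus ?thesis
    using p assms unfolding supported_def by auto
qed

lemma supported_Add:
  assumes f: "supported I X c \<iota> F f" "f \<in> Hom T w c" and g: "supported I X c \<iota> G g" "g \<in> Hom T w c"
  shows "supported I X c \<iota> (F \<union> G) (Add T f g)"
proof -
  have FG: "finite (F \<union> G)" "F \<union> G \<subseteq> I"
    using f g by (auto simp: supported_def)
  obtain p where p: "cut I X c \<iota> (F \<union> G) p"
    using ex_cut by blast
  have "p \<cdot> h = h" if "supported I X c \<iota> H h" "h \<in> Hom T w c" "H \<subseteq> F \<union> G" for H h
  proof -
    obtain q where q: "cut I X c \<iota> H q" "q \<cdot> h = h"
      using \<open>supported I X c \<iota> H h\<close> unfolding supported_def by blast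
    have "p \<cdot> (q \<cdot> h) = (p \<cdot> q) \<cdot> h"
      using p q(1) that(2) by (intro cmp_assoc'[symmetric]) (auto simp: cut_def Hom_iff)
    thus ?thesis
      using cut_cmp[OF q(1) p that(3)] q(2) by simp
  qed
  hence "p \<cdot> f = f" "p \<cdot> g = g"
    using f g by auto
  hence "p \<cdot> Add T f g = Add T f g"
    using p f(2) g(2) cmp_Add[of f g p] by (auto simp: cut_def Hom_iff)
  thus ?thesis
    using p FG unfolding supported_def by blast
qed

lemma supported_inclusion:
  assumes "i \<in> I"
  shows "supported I X c \<iota> {i} (\<iota> i)"
  using ex_cut[of "{i}"] assms unfolding supported_def cut_def by auto

lemma supported_Zero:
  assumes "w \<in> Obj T"
  shows "supported I X c \<iota> {} (Zero T w c)"
proof -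
  obtain p where p: "cut I X c \<iota> {} p"
    using ex_cut by blast
  hence "p \<cdot> Zero T w c = Zero T w c"
    using assms by (auto simp: cut_def Hom_iff)
  thus ?thesis
    using p unfolding supported_def by blast
qed

lemma supported_Sum:
  assumes F: "finite F" and w: "w \<in> Obj T"
  shows "F \<subseteq> I \<Longrightarrow> (\<And>i. i \<in> F \<Longrightarrow> \<phi> i \<in> Hom T w (X i)) \<Longrightarrow>
    supported I X c \<iota> F (Sum w c (\<lambda>i. \<iota> i \<cdot> \<phi> i) F)"
  using F
proof induction
  case empty
  show ?case
    using supported_Zero[OF w] Sum_empty[OF w coproduct_in(1)[OF c], of "\<lambda>i. \<iota> i \<cdot> \<phi> i"] by simp
next
  case (insert j F)
  have m: "\<iota> i \<cdot> \<phi> i \<in> Hom T w c" if "i \<in> insert j F" for i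
    by (rule cmp_in[OF insert.prems(2)[OF that] coproduct_in(2)[OF c]]) (use that insert.prems(1) in auto)
  have j: "j \<in> I"
    using insert.prems by simp
  have "supported I X c \<iota> ({j} \<union> F) (Add T (\<iota> j \<cdot> \<phi> j) (Sum w c (\<lambda>i. \<iota> i \<cdot> \<phi> i) F))"
  proof (rule supported_Add)
    show "supported I X c \<iota> {j} (\<iota> j \<cdot> \<phi> j)"
      by (rule supported_cmp[OF supported_inclusion[OF j] coproduct_in(2)[OF c j] insert.prems(2)]) simp
    show "supported I X c \<iota> F (Sum w c (\<lambda>i. \<iota> i \<cdot> \<phi> i) F)"
      using insert by simp
    show "Sum w c (\<lambda>i. \<iota> i \<cdot> \<phi> i) F \<in> Hom T w c"
      by (rule Sum_Hom[OF w coproduct_in(1)[OF c]]) (use m in blast)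
  qed (use m in blast)
  moreover have "Sum w c (\<lambda>i. \<iota> i \<cdot> \<phi> i) (insert j F)
      = Add T (\<iota> j \<cdot> \<phi> j) (Sum w c (\<lambda>i. \<iota> i \<cdot> \<phi> i) F)"
    by (rule Sum_insert[OF w coproduct_in(1)[OF c] insert.hyps]) (use m in blast)
  ultimately show ?case
    by simp
qed

lemma projection_Sum:
  assumes \<pi>: "projections I X c \<iota> \<pi>" and F: "finite F" and w: "w \<in> Obj T" and j: "j \<in> I"
  shows "F \<subseteq> I \<Longrightarrow> (\<And>i. i \<in> F \<Longrightarrow> \<phi> i \<in> Hom T w (X i)) \<Longrightarrow>
    \<pi> j \<cdot> Sum w c (\<lambda>i. \<iota> i \<cdot> \<phi> i) F = (if j \<in> F then \<phi> j else Zero T w (X j))"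
  using F
proof induction
  case empty
  have "\<pi> j \<in> Hom T c (X j)"
    using \<pi> j by (simp add: projections_def)
  thus ?case
    using Sum_empty[OF w coproduct_in(1)[OF c], of "\<lambda>i. \<iota> i \<cdot> \<phi> i"] w by (simp add: Hom_iff)
next
  case (insert k F)
  have k: "k \<in> I" "F \<subseteq> I"
    using insert.prems by auto
  note tk = coproduct_in(2,3)[OF c k(1)] coproduct_in(3)[OF c j]
  have m: "\<iota> i \<cdot> \<phi> i \<in> Hom T w c" if "i \<in> insert k F" for i
    by (rule cmp_in[OF insert.prems(2)[OF that] coproduct_in(2)[OF c]]) (use that insert.prems(1) in auto)
  have S: "Sum w c (\<lambda>i. \<iota> i \<cdot> \<phi> i) F \<in> Hom T w c"
    by (rule Sum_Hom[OF w coproduct_in(1)[OF c]]) (use m in blast)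
  have \<pi>j: "\<pi> j \<in> Hom T c (X j)" and \<phi>: "\<phi> k \<in> Hom T w (X k)"
    using \<pi> j insert.prems by (auto simp: projections_def)
  have "Sum w c (\<lambda>i. \<iota> i \<cdot> \<phi> i) (insert k F)
      = Add T (\<iota> k \<cdot> \<phi> k) (Sum w c (\<lambda>i. \<iota> i \<cdot> \<phi> i) F)"
    by (rule Sum_insert[OF w coproduct_in(1)[OF c] insert.hyps]) (use m in blast)
  hence "\<pi> j \<cdot> Sum w c (\<lambda>i. \<iota> i \<cdot> \<phi> i) (insert k F)
      = \<pi> j \<cdot> Add T (\<iota> k \<cdot> \<phi> k) (Sum w c (\<lambda>i. \<iota> i \<cdot> \<phi> i) F)"
    by simp
  also have "\<dots> = Add T (\<pi> j \<cdot> (\<iota> k \<cdot> \<phi> k)) (\<pi> j \<cdot> Sum w c (\<lambda>i. \<iota> i \<cdot> \<phi> i) F)"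
    using \<pi>j S tk \<phi> by (intro cmp_Add) (auto simp: Hom_iff)
  also have "\<pi> j \<cdot> (\<iota> k \<cdot> \<phi> k) = (\<pi> j \<cdot> \<iota> k) \<cdot> \<phi> k"
    using \<pi>j tk \<phi> by (intro cmp_assoc'[symmetric]) (auto simp: Hom_iff)
  also have "\<pi> j \<cdot> \<iota> k = (if k = j then Idn T (X j) else Zero T (X k) (X j))"
    using \<pi> j k by (simp add: projections_def)
  also have "\<pi> j \<cdot> Sum w c (\<lambda>i. \<iota> i \<cdot> \<phi> i) F = (if j \<in> F then \<phi> j else Zero T w (X j))"
    using insert.IH k insert.prems by simp
  finally show ?case
    using insert.hyps(2) insert.prems(2)[of j] \<phi> tk w by (auto simp: Hom_iff split: if_splits)
qed

lemma projection_supported: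
  assumes f: "supported I X c \<iota> F f" "f \<in> Hom T w c" and \<pi>: "projections I X c \<iota> \<pi>" and j: "j \<in> I" "j \<notin> F"
  shows "\<pi> j \<cdot> f = Zero T w (X j)"
proof -
  have F: "finite F" "F \<subseteq> I"
    using f by (auto simp: supported_def)
  have "\<pi> i \<cdot> f \<in> Hom T w (X i)" if "i \<in> F" for i
    using \<pi> that F cmp_in[OF f(2)] by (auto simp: projections_def)
  from projection_Sum[OF \<pi> F(1) _ j(1) F(2) this]
  have "\<pi> j \<cdot> Sum w c (\<lambda>i. \<iota> i \<cdot> (\<pi> i \<cdot> f)) F = Zero T w (X j)"
    using Hom_Obj[OF f(2)] j(2) by simp
  thus ?thesis
    using supported_eq_Sum[OF f(1) \<pi> f(2)] by simp
qed

lemma supported_eq_Zero: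
  assumes f: "supported I X c \<iota> F f" "f \<in> Hom T w c" and \<pi>: "projections I X c \<iota> \<pi>"
    and z: "\<And>i. i \<in> I \<Longrightarrow> \<pi> i \<cdot> f = Zero T w (X i)"
  shows "f = Zero T w c"
proof -
  have F: "finite F" "F \<subseteq> I" and w: "w \<in> Obj T"
    using f Hom_Obj by (auto simp: supported_def)
  have z': "\<iota> i \<cdot> (\<pi> i \<cdot> f) = Zero T w c" if "i \<in> F" for i
    using coproduct_in(2,3)[OF c, of i] z[of i] that F w by (auto simp: Hom_iff)
  have "f = Sum w c (\<lambda>i. \<iota> i \<cdot> (\<pi> i \<cdot> f)) F"
    by (rule supported_eq_Sum[OF f(1) \<pi> f(2)])
  also have "\<dots> = Sum w c (\<lambda>i. \<iota> i \<cdot> (\<pi> i \<cdot> f)) {}"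
    by (rule Sum_mono_neutral[symmetric])
      (use w F z' Zero_Hom[OF w coproduct_in(1)[OF c]] coproduct_in(1)[OF c] in auto)
  also have "\<dots> = Zero T w c"
    by (rule Sum_empty[OF w coproduct_in(1)[OF c]])
  finally show ?thesis .
qed

end


lemma supported_reindex:
  assumes c: "is_coproduct T I X c \<iota>" and e: "inj_on e I"
    and s: "supported (e ` I) (X \<circ> inv_into I e) c (\<iota> \<circ> inv_into I e) F f"
  shows "supported I X c \<iota> (inv_into I e ` F) f"
proof -
  obtain p where F: "finite F" "F \<subseteq> e ` I" and pf: "p \<cdot> f = f"
    and p: "cut (e ` I) (X \<circ> inv_into I e) c (\<iota> \<circ> inv_into I e) F p"
    using s unfolding supported_def by blast
  have "p \<cdot> \<iota> i = (if i \<in> inv_into I e ` F then \<iota> i else Zero T (X i) c)" if i: "i \<in> I" for i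
  proof -
    have "i \<in> inv_into I e ` F \<longleftrightarrow> e i \<in> F"
    proof
      assume "i \<in> inv_into I e ` F"
      then obtain a where a: "a \<in> F" "i = inv_into I e a"
        by blast
      hence "e i = a"
        using F(2) f_inv_into_f[of a e I] by blast
      thus "e i \<in> F"
        using a by simp
    next
      assume "e i \<in> F"
      thus "i \<in> inv_into I e ` F"
        using inv_into_f_f[OF e i] by (metis imageI)
    qed
    moreover have "p \<cdot> (\<iota> \<circ> inv_into I e) (e i) = (if e i \<in> F then (\<iota> \<circ> inv_into I e) (e i)
        else Zero T ((X \<circ> inv_into I e) (e i)) c)"
      using p i unfolding cut_def by blast
    ultimately show ?thesis
      using i e by simp
  qed
  hence "cut I X c \<iota> (inv_into I e ` F) p"
    using p unfolding cut_def by blast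
  moreover have "inv_into I e ` F \<subseteq> I"
    using F(2) by (meson image_subsetI inv_into_into subsetD)
  ultimately show ?thesis
    using F(1) pf unfolding supported_def by blast
qed

text \<open>The canonical map from the direct sum is injective for every x, since projections
  recover the components of a sum. What remains of compactness is that each map into a coproduct is
  finitely supported, and the closure properties of compact objects are all proved by this
  criterion.\<close>

lemma compactI:
  assumes x: "x \<in> Obj T"
    and supp: "\<And>(I :: 'u set) X c \<iota> f. small (Univ T) I \<Longrightarrow> is_coproduct T I X c \<iota> \<Longrightarrow> f \<in> Hom T x c \<Longrightarrow>
      \<exists>F. supported I X c \<iota> F f"
  shows "compact_obj T x"
  unfolding compact_obj_def
proof (intro conjI x allI impI)
  fix I :: "'u set" and X c \<iota>
  assume "small (Univ T) I \<and> (\<forall>i \<in> I. X i \<in> Obj T) \<and> is_coproduct T I X c \<iota>"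
  hence I: "small (Univ T) I" and c: "is_coproduct T I X c \<iota>"
    by auto
  obtain \<pi> where \<pi>: "projections I X c \<iota> \<pi>"
    using ex_projections[OF c] by blast
  have cO: "c \<in> Obj T"
    using coproduct_in(1)[OF c] .
  define N where "N = (\<lambda>\<phi>. {i \<in> I. \<phi> i \<noteq> Zero T x (X i)})"
  define P where "P = {\<phi> \<in> (\<Pi>\<^sub>E i \<in> I. Hom T x (X i)). finite (N \<phi>)}"
  have recover: "\<pi> j \<cdot> Sum x c (\<lambda>i. \<iota> i \<cdot> \<phi> i) (N \<phi>) = \<phi> j" if \<phi>: "\<phi> \<in> P" and j: "j \<in> I" for \<phi> j
  proof -
    have "\<phi> i \<in> Hom T x (X i)" if "i \<in> N \<phi>" for i
      using that \<phi> by (auto simp: P_def N_def PiE_def)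
    moreover have "finite (N \<phi>)" "N \<phi> \<subseteq> I"
      using \<phi> by (auto simp: P_def N_def)
    ultimately have "\<pi> j \<cdot> Sum x c (\<lambda>i. \<iota> i \<cdot> \<phi> i) (N \<phi>) = (if j \<in> N \<phi> then \<phi> j else Zero T x (X j))"
      by (intro projection_Sum[OF c \<pi> _ x j])
    thus ?thesis
      using j by (auto simp: N_def)
  qed
  have "bij_betw (\<lambda>\<phi>. Sum x c (\<lambda>i. \<iota> i \<cdot> \<phi> i) (N \<phi>)) P (Hom T x c)"
    unfolding bij_betw_def
  proof (intro conjI)
    show "inj_on (\<lambda>\<phi>. Sum x c (\<lambda>i. \<iota> i \<cdot> \<phi> i) (N \<phi>)) P"
    proof (rule inj_onI)
      fix \<phi> \<psi> assume P: "\<phi> \<in> P" "\<psi> \<in> P"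
        and eq: "Sum x c (\<lambda>i. \<iota> i \<cdot> \<phi> i) (N \<phi>) = Sum x c (\<lambda>i. \<iota> i \<cdot> \<psi> i) (N \<psi>)"
      have "\<phi> j = \<psi> j" if "j \<in> I" for j
        using recover[OF P(1) that] recover[OF P(2) that] eq by simp
      thus "\<phi> = \<psi>"
        using P unfolding P_def by (metis (no_types, lifting) PiE_ext mem_Collect_eq)
    qed
    show "(\<lambda>\<phi>. Sum x c (\<lambda>i. \<iota> i \<cdot> \<phi> i) (N \<phi>)) ` P = Hom T x c"
    proof (intro equalityI subsetI)
      fix f assume "f \<in> (\<lambda>\<phi>. Sum x c (\<lambda>i. \<iota> i \<cdot> \<phi> i) (N \<phi>)) ` P"
      then obtain \<phi> where \<phi>: "\<phi> \<in> P" "f = Sum x c (\<lambda>i. \<iota> i \<cdot> \<phi> i) (N \<phi>)"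
        by blast
      have "\<iota> i \<cdot> \<phi> i \<in> Hom T x c" if "i \<in> N \<phi>" for i
        by (rule cmp_in[OF _ coproduct_in(2)[OF c]]) (use that \<phi> in \<open>auto simp: P_def N_def PiE_def\<close>)
      thus "f \<in> Hom T x c"
        unfolding \<phi>(2) by (rule Sum_Hom[OF x cO])
    next
      fix f assume f: "f \<in> Hom T x c"
      obtain F where F: "supported I X c \<iota> F f"
        using supp[OF I c f] by blast
      have FI: "finite F" "F \<subseteq> I"
        using F by (auto simp: supported_def)
      \<comment> \<open>The preimage of f is the family of its components, restricted to I because
        the function space is extensional.\<close>
      define \<phi> where "\<phi> = restrict (\<lambda>i. \<pi> i \<cdot> f) I"
      have m: "\<pi> i \<cdot> f \<in> Hom T x (X i)" if "i \<in> I" for i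
        using \<pi> that cmp_in[OF f] by (auto simp: projections_def)
      have N: "N \<phi> \<subseteq> F"
        using projection_supported[OF c F f \<pi>] by (auto simp: N_def \<phi>_def)
      hence \<phi>P: "\<phi> \<in> P"
        using m finite_subset[OF N FI(1)] by (auto simp: P_def \<phi>_def)
      have f_eq: "f = Sum x c (\<lambda>i. \<iota> i \<cdot> (\<pi> i \<cdot> f)) F"
        by (rule supported_eq_Sum[OF c F \<pi> f])
      \<comment> \<open>The canonical map sums over nonzero components only, while F may contain
        further indices; these contribute zero.\<close>
      have "Sum x c (\<lambda>i. \<iota> i \<cdot> \<phi> i) (N \<phi>) = Sum x c (\<lambda>i. \<iota> i \<cdot> (\<pi> i \<cdot> f)) F"
      proof (rule Sum_mono_neutral[OF x cO FI(1) N])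
        show "\<iota> i \<cdot> (\<pi> i \<cdot> f) \<in> Hom T x c" if "i \<in> F" for i
          using that FI(2) by (intro cmp_in[OF m coproduct_in(2)[OF c]]) auto
        show "\<iota> i \<cdot> (\<pi> i \<cdot> f) = Zero T x c" if i: "i \<in> F - N \<phi>" for i
        proof -
          have "i \<in> I"
            using i FI(2) by blast
          moreover from this have "\<pi> i \<cdot> f = Zero T x (X i)"
            using i by (auto simp: N_def \<phi>_def)
          ultimately show ?thesis
            using coproduct_in(2)[OF c, of i] x by (auto simp: Hom_iff)
        qed
        show "\<iota> i \<cdot> \<phi> i = \<iota> i \<cdot> (\<pi> i \<cdot> f)" if "i \<in> N \<phi>" for i
          using that by (auto simp: N_def \<phi>_def)
      qed
      from trans[OF f_eq this[symmetric]] \<phi>P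
      show "f \<in> (\<lambda>\<phi>. Sum x c (\<lambda>i. \<iota> i \<cdot> \<phi> i) (N \<phi>)) ` P"
        by (rule image_eqI)
    qed
  qed
  thus "bij_betw (\<lambda>\<phi>. Sum x c (\<lambda>i. \<iota> i \<cdot> \<phi> i) {i \<in> I. \<phi> i \<noteq> Zero T x (X i)})
      {\<phi> \<in> (\<Pi>\<^sub>E i \<in> I. Hom T x (X i)). finite {i \<in> I. \<phi> i \<noteq> Zero T x (X i)}} (Hom T x c)"
    by (simp add: N_def P_def)
qed

lemma small_inj:
  assumes "small (Univ T) I"
  obtains e :: "'i \<Rightarrow> 'u" where "inj_on e I" "small (Univ T) (e ` I)"
proof -
  have "|I| \<le>o |Univ T|"
    using assms by (simp add: small_def ordLess_imp_ordLeq)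
  from iffD2[OF card_of_ordLeq this] obtain e :: "'i \<Rightarrow> 'u" where "inj_on e I"
    by (elim exE conjE)
  moreover have "small (Univ T) (e ` I)"
    using ordLeq_ordLess_trans[OF card_of_image] assms unfolding small_def by blast
  ultimately show ?thesis
    using that by blast
qed

text \<open>Converse of \<open>compactI\<close>: a preimage under the canonical bijection has
  finitely many nonzero components, and their sum is fixed by the corresponding cut.\<close>

lemma compact_supported_aux:
  fixes I :: "'u set"
  assumes x: "compact_obj T x" and I: "small (Univ T) I"
    and c: "is_coproduct T I X c \<iota>" and f: "f \<in> Hom T x c"
  shows "\<exists>F. supported I X c \<iota> F f"
proof -
  have xO: "x \<in> Obj T"
    using x by (simp add: compact_obj_def)
  have "bij_betw (\<lambda>\<phi>. Sum x c (\<lambda>i. \<iota> i \<cdot> \<phi> i) {i \<in> I. \<phi> i \<noteq> Zero T x (X i)})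
      {\<phi> \<in> (\<Pi>\<^sub>E i \<in> I. Hom T x (X i)). finite {i \<in> I. \<phi> i \<noteq> Zero T x (X i)}} (Hom T x c)"
    using x I c coproduct_in(3)[OF c] unfolding compact_obj_def by blast
  then obtain \<phi> where \<phi>: "\<phi> \<in> (\<Pi>\<^sub>E i \<in> I. Hom T x (X i))" "finite {i \<in> I. \<phi> i \<noteq> Zero T x (X i)}"
    and eq: "f = Sum x c (\<lambda>i. \<iota> i \<cdot> \<phi> i) {i \<in> I. \<phi> i \<noteq> Zero T x (X i)}"
    using f unfolding bij_betw_def by blast
  show ?thesis
    unfolding eq by (rule exI, rule supported_Sum[OF c \<phi>(2) xO]) (use \<phi>(1) in \<open>auto simp: PiE_def\<close>)
qed

lemma compact_supported:
  assumes x: "compact_obj T x" and I: "small (Univ T) I"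
    and c: "is_coproduct T I X c \<iota>" and f: "f \<in> Hom T x c"
  obtains F where "supported I X c \<iota> F f"
proof -
  obtain e :: "'a \<Rightarrow> 'u" where e: "inj_on e I" "small (Univ T) (e ` I)"
    using small_inj[OF I] .
  show ?thesis
    using compact_supported_aux[OF x e(2) coproduct_reindex[OF c e(1)] f]
      supported_reindex[OF c e(1)] that by blast
qed

lemma compact_Obj: "compact_obj T x \<Longrightarrow> x \<in> Obj T"
  by (simp add: compact_obj_def)

lemma compact_zero:
  assumes "is_zero T x"
  shows "compact_obj T x"
proof (rule compactI)
  show x: "x \<in> Obj T"
    using assms by (simp add: is_zero_def)
  fix I :: "'u set" and X c \<iota> f
  assume c: "is_coproduct T I X c \<iota>" and f: "f \<in> Hom T x c"
  show "\<exists>F. supported I X c \<iota> F f"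
    using zero_Hom_eq(1)[OF assms f] supported_Zero[OF c x] by auto
qed

lemma compact_retract:
  assumes z: "compact_obj T z" and i: "i \<in> Hom T y z" "r \<in> Hom T z y" "r \<cdot> i = Idn T y"
  shows "compact_obj T y"
proof (rule compactI)
  show "y \<in> Obj T"
    using i Hom_Obj by blast
  fix I :: "'u set" and X c \<iota> f
  assume I: "small (Univ T) I" and c: "is_coproduct T I X c \<iota>" and f: "f \<in> Hom T y c"
  have fr: "f \<cdot> r \<in> Hom T z c"
    by (rule cmp_in[OF i(2) f])
  obtain F where "supported I X c \<iota> F (f \<cdot> r)"
    using compact_supported[OF z I c fr] .
  hence "supported I X c \<iota> F ((f \<cdot> r) \<cdot> i)"
    by (rule supported_cmp[OF c _ fr i(1)])
  moreover have "(f \<cdot> r) \<cdot> i = f"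
    using i f by (simp add: Hom_iff)
  ultimately show "\<exists>F. supported I X c \<iota> F f"
    by auto
qed

lemma compact_iso: "isomorphic T x y \<Longrightarrow> compact_obj T x \<Longrightarrow> compact_obj T y"
  by (metis compact_retract isomorphicE)

lemma compact_summand:
  assumes "is_coproduct T I X c \<iota>" "compact_obj T c" "i \<in> I"
  shows "compact_obj T (X i)"
proof -
  obtain \<pi> where "projections I X c \<iota> \<pi>"
    using ex_projections[OF assms(1)] by blast
  thus ?thesis
    using assms(3) compact_retract[OF assms(2) coproduct_in(2)[OF assms(1,3)], of "\<pi> i"]
    by (simp add: projections_def)
qed

end

section \<open>Compact objects under suspension and cones\<close>

context triangulated_category
begin

text \<open>The suspension is surjective on objects only up to isomorphism; hence a test object y is
  first replaced by an isomorphic \<Sigma> y', and fullness and faithfulness carry the universal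
  property over.\<close>

lemma coproduct_susp:
  assumes c: "is_coproduct T I X c \<iota>"
  shows "is_coproduct T I (\<lambda>i. susp_ob T (X i)) (susp_ob T c) (\<lambda>i. susp_ar T (\<iota> i))"
proof (rule coproductI)
  show "susp_ob T c \<in> Obj T"
    using coproduct_in(1)[OF c] by simp
  show "susp_ar T (\<iota> i) \<in> Hom T (susp_ob T (X i)) (susp_ob T c)" if "i \<in> I" for i
    by (rule susp_Hom[OF coproduct_in(2)[OF c that]])
next
  fix y f assume y: "y \<in> Obj T" and f: "\<And>i. i \<in> I \<Longrightarrow> f i \<in> Hom T (susp_ob T (X i)) y"
  obtain y' where y': "y' \<in> Obj T" "isomorphic T (susp_ob T y') y"
    using susp_surj[OF y] .
  obtain u v where u: "u \<in> Hom T (susp_ob T y') y" "v \<in> Hom T y (susp_ob T y')" "u \<cdot> v = Idn T y"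
    using y'(2) by (rule isomorphicE)
  have "\<exists>g. g \<in> Hom T (X i) y' \<and> susp_ar T g = v \<cdot> f i" if "i \<in> I" for i
    using susp_full[OF cmp_in[OF f[OF that] u(2)] coproduct_in(3)[OF c that] y'(1)] by blast
  then obtain g where g: "\<And>i. i \<in> I \<Longrightarrow> g i \<in> Hom T (X i) y'" "\<And>i. i \<in> I \<Longrightarrow> susp_ar T (g i) = v \<cdot> f i"
    by metis
  obtain h where h: "h \<in> Hom T c y'" "\<forall>i \<in> I. h \<cdot> \<iota> i = g i"
    using coproduct_ex[OF c g(1) y'(1)] by blast
  have "(u \<cdot> susp_ar T h) \<cdot> susp_ar T (\<iota> i) = f i" if i: "i \<in> I" for i
  proof -
    note ti = coproduct_in(2)[OF c i]
    have "(u \<cdot> susp_ar T h) \<cdot> susp_ar T (\<iota> i) = u \<cdot> susp_ar T (h \<cdot> \<iota> i)"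
      using u(1) h(1) ti by (simp add: susp_cmp Hom_iff)
    also have "\<dots> = u \<cdot> (v \<cdot> f i)"
      using h(2) g(2) i by simp
    also have "\<dots> = (u \<cdot> v) \<cdot> f i"
      using u(1,2) f[OF i] by (simp add: Hom_iff)
    also have "\<dots> = f i"
      using u(3) f[OF i] by (simp add: Hom_iff)
    finally show ?thesis .
  qed
  moreover have "u \<cdot> susp_ar T h \<in> Hom T (susp_ob T c) y"
    by (rule cmp_in[OF susp_Hom[OF h(1)] u(1)])
  ultimately show "\<exists>h \<in> Hom T (susp_ob T c) y. \<forall>i \<in> I. h \<cdot> susp_ar T (\<iota> i) = f i"
    by blast
next
  fix y h h' assume h: "h \<in> Hom T (susp_ob T c) y" "h' \<in> Hom T (susp_ob T c) y"
    and eq: "\<And>i. i \<in> I \<Longrightarrow> h \<cdot> susp_ar T (\<iota> i) = h' \<cdot> susp_ar T (\<iota> i)"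
  have y: "y \<in> Obj T"
    using h Hom_Obj by blast
  obtain y' where y': "y' \<in> Obj T" "isomorphic T (susp_ob T y') y"
    using susp_surj[OF y] .
  obtain u v where u: "u \<in> Hom T (susp_ob T y') y" "v \<in> Hom T y (susp_ob T y')" "u \<cdot> v = Idn T y"
    using y'(2) by (rule isomorphicE)
  note cO = coproduct_in(1)[OF c]
  obtain k where k: "k \<in> Hom T c y'" "susp_ar T k = v \<cdot> h"
    using susp_full[OF cmp_in[OF h(1) u(2)] cO y'(1)] .
  obtain k' where k': "k' \<in> Hom T c y'" "susp_ar T k' = v \<cdot> h'"
    using susp_full[OF cmp_in[OF h(2) u(2)] cO y'(1)] .
  have "k = k'"
  proof (rule coproduct_eqI[OF c k(1) k'(1)])
    fix i assume i: "i \<in> I"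
    note ti = coproduct_in(2)[OF c i]
    have "susp_ar T (k \<cdot> \<iota> i) = v \<cdot> (h \<cdot> susp_ar T (\<iota> i))"
      using k ti u(2) h by (simp add: susp_cmp Hom_iff)
    also have "\<dots> = susp_ar T (k' \<cdot> \<iota> i)"
      using k' ti u(2) h by (simp add: susp_cmp Hom_iff eq[OF i])
    finally show "k \<cdot> \<iota> i = k' \<cdot> \<iota> i"
      by (rule susp_inj[OF cmp_in[OF ti k(1)] cmp_in[OF ti k'(1)]])
  qed
  hence "u \<cdot> (v \<cdot> h) = u \<cdot> (v \<cdot> h')"
    using k(2) k'(2) by simp
  hence "(u \<cdot> v) \<cdot> h = (u \<cdot> v) \<cdot> h'"
    using u(1,2) h by (simp add: Hom_iff)
  thus "h = h'"
    using u(3) h by (simp add: Hom_iff)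
qed

text \<open>Suspending the coproduct makes a finite cut available, and full faithfulness turns this
  cut into one for the original coproduct.\<close>

lemma compact_desusp:
  assumes x: "x \<in> Obj T" and sx: "compact_obj T (susp_ob T x)"
  shows "compact_obj T x"
proof (rule compactI[OF x])
  fix I :: "'u set" and X c \<iota> f
  assume I: "small (Univ T) I" and c: "is_coproduct T I X c \<iota>" and f: "f \<in> Hom T x c"
  note cO = coproduct_in(1)[OF c]
  obtain F where "supported I (\<lambda>i. susp_ob T (X i)) (susp_ob T c) (\<lambda>i. susp_ar T (\<iota> i)) F (susp_ar T f)"
    using compact_supported[OF sx I coproduct_susp[OF c] susp_Hom[OF f]] .
  then obtain p where F: "finite F" "F \<subseteq> I"
    and p: "cut I (\<lambda>i. susp_ob T (X i)) (susp_ob T c) (\<lambda>i. susp_ar T (\<iota> i)) F p"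
    and pf: "p \<cdot> susp_ar T f = susp_ar T f"
    unfolding supported_def by blast
  obtain q where q: "q \<in> Hom T c c" "susp_ar T q = p"
    using susp_full[of p c c] p cO unfolding cut_def by blast
  have "q \<cdot> \<iota> i = (if i \<in> F then \<iota> i else Zero T (X i) c)" if i: "i \<in> I" for i
  proof (rule susp_inj)
    note ti = coproduct_in(2,3)[OF c i]
    show "q \<cdot> \<iota> i \<in> Hom T (X i) c" "(if i \<in> F then \<iota> i else Zero T (X i) c) \<in> Hom T (X i) c"
      using cmp_in[OF ti(1) q(1)] ti cO Zero_Hom by auto
    have "susp_ar T (q \<cdot> \<iota> i) = p \<cdot> susp_ar T (\<iota> i)"
      using q(1) ti unfolding q(2)[symmetric] by (simp add: susp_cmp Hom_iff)
    thus "susp_ar T (q \<cdot> \<iota> i) = susp_ar T (if i \<in> F then \<iota> i else Zero T (X i) c)"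
      using p i ti cO by (simp add: cut_def)
  qed
  hence "cut I X c \<iota> F q"
    using q(1) unfolding cut_def by blast
  moreover have "q \<cdot> f = f"
  proof (rule susp_inj[OF cmp_in[OF f q(1)] f])
    show "susp_ar T (q \<cdot> f) = susp_ar T f"
      using pf f q(1) unfolding q(2)[symmetric] by (simp add: susp_cmp Hom_iff)
  qed
  ultimately show "\<exists>F. supported I X c \<iota> F f"
    using F unfolding supported_def by blast
qed

end

context rigidly_compactly_generated
begin

lemma ex_small_coproduct:
  assumes I: "small (Univ T) I" and X: "\<And>i. i \<in> I \<Longrightarrow> X i \<in> Obj T"
  obtains c \<iota> where "is_coproduct T I X c \<iota>"
proof -
  obtain e :: "'a \<Rightarrow> 'u" where e: "inj_on e I" "small (Univ T) (e ` I)"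
    using small_inj[OF I] .
  have "\<forall>i \<in> e ` I. (X \<circ> inv_into I e) i \<in> Obj T"
    using X e(1) by auto
  then obtain c \<iota> where c: "is_coproduct T (e ` I) (X \<circ> inv_into I e) c \<iota>"
    using ex_coproduct[OF e(2)] by blast
  have "inj_on (inv_into I e) (e ` I)"
    by (rule inj_on_inv_into) simp
  from coproduct_reindex[OF c this]
  have "is_coproduct T I (X \<circ> inv_into I e \<circ> inv_into (e ` I) (inv_into I e)) c
      (\<iota> \<circ> inv_into (e ` I) (inv_into I e))"
    using inv_into_image_cancel e(1) by simp
  moreover have *: "inv_into (e ` I) (inv_into I e) i = e i" if "i \<in> I" for i
    using inv_into_f_f[of "inv_into I e" "e ` I" "e i"] inj_on_inv_into[of "e ` I" e I] e(1) that by simp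
  ultimately have "is_coproduct T I X c (\<iota> \<circ> e)"
    using e(1) unfolding is_coproduct_def by simp
  thus ?thesis
    using that by blast
qed

text \<open>Here the summands themselves must be desuspended. Choosing Y i with \<Sigma> (Y i)
  isomorphic to X i presents c as a retract of \<Sigma> d for the coproduct d of the Y i, and finite
  support is transported along this retraction.\<close>

lemma compact_susp:
  assumes x: "compact_obj T x"
  shows "compact_obj T (susp_ob T x)"
proof (rule compactI)
  note xO = compact_Obj[OF x]
  thus "susp_ob T x \<in> Obj T"
    by simp
  fix I :: "'u set" and X c \<iota> f
  assume I: "small (Univ T) I" and c: "is_coproduct T I X c \<iota>" and f: "f \<in> Hom T (susp_ob T x) c"
  note t = coproduct_in[OF c]
  have "\<exists>Y u v. Y \<in> Obj T \<and> u \<in> Hom T (susp_ob T Y) (X i) \<and> v \<in> Hom T (X i) (susp_ob T Y)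
      \<and> u \<cdot> v = Idn T (X i)" if "i \<in> I" for i
    using susp_surj[OF t(3)[OF that]] by (metis isomorphicE)
  then obtain Y u v where Y: "\<And>i. i \<in> I \<Longrightarrow> Y i \<in> Obj T"
    and u: "\<And>i. i \<in> I \<Longrightarrow> u i \<in> Hom T (susp_ob T (Y i)) (X i)"
    and v: "\<And>i. i \<in> I \<Longrightarrow> v i \<in> Hom T (X i) (susp_ob T (Y i))"
    and uv: "\<And>i. i \<in> I \<Longrightarrow> u i \<cdot> v i = Idn T (X i)"
    by metis
  obtain d \<kappa> where d: "is_coproduct T I Y d \<kappa>"
    using ex_small_coproduct[OF I Y] .
  note sd = coproduct_susp[OF d]
  note dO = coproduct_in(1)[OF d]
  have "susp_ar T (\<kappa> i) \<cdot> v i \<in> Hom T (X i) (susp_ob T d)" if "i \<in> I" for i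
    by (rule cmp_in[OF v[OF that] coproduct_in(2)[OF sd that]])
  from coproduct_ex[OF c this coproduct_in(1)[OF sd]]
  obtain w where w: "w \<in> Hom T c (susp_ob T d)" "\<forall>i \<in> I. w \<cdot> \<iota> i = susp_ar T (\<kappa> i) \<cdot> v i"
    by blast
  have "\<iota> i \<cdot> u i \<in> Hom T (susp_ob T (Y i)) c" if "i \<in> I" for i
    by (rule cmp_in[OF u[OF that] t(2)[OF that]])
  from coproduct_ex[OF sd this t(1)]
  obtain w' where w': "w' \<in> Hom T (susp_ob T d) c" "\<forall>i \<in> I. w' \<cdot> susp_ar T (\<kappa> i) = \<iota> i \<cdot> u i"
    by blast
  have ww: "w' \<cdot> w = Idn T c"
  proof (rule coproduct_eqI[OF c cmp_in[OF w(1) w'(1)] idn_in[OF t(1)]])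
    fix i assume i: "i \<in> I"
    have "(w' \<cdot> w) \<cdot> \<iota> i = w' \<cdot> (w \<cdot> \<iota> i)"
      using w(1) w'(1) t(2)[OF i] by (simp add: Hom_iff)
    also have "\<dots> = w' \<cdot> (susp_ar T (\<kappa> i) \<cdot> v i)"
      using w(2) i by simp
    also have "\<dots> = (w' \<cdot> susp_ar T (\<kappa> i)) \<cdot> v i"
      using w'(1) coproduct_in(2)[OF sd i] v[OF i] by (simp add: Hom_iff)
    also have "\<dots> = (\<iota> i \<cdot> u i) \<cdot> v i"
      using w'(2) i by simp
    also have "\<dots> = \<iota> i \<cdot> (u i \<cdot> v i)"
      using t(2)[OF i] u[OF i] v[OF i] by (simp add: Hom_iff)
    finally show "(w' \<cdot> w) \<cdot> \<iota> i = Idn T c \<cdot> \<iota> i"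
      using uv[OF i] t(2)[OF i] by (simp add: Hom_iff)
  qed
  obtain f' where f': "f' \<in> Hom T x d" "susp_ar T f' = w \<cdot> f"
    using susp_full[OF cmp_in[OF f w(1)] xO dO] .
  obtain F where F: "supported I Y d \<kappa> F f'"
    using compact_supported[OF x I d f'(1)] .
  then obtain q where FI: "finite F" "F \<subseteq> I" and q: "cut I Y d \<kappa> F q" "q \<cdot> f' = f'"
    unfolding supported_def by blast
  have qH: "q \<in> Hom T d d"
    using q(1) by (simp add: cut_def)
  obtain p where p: "cut I X c \<iota> F p"
    using ex_cut[OF c] by blast
  have pH: "p \<in> Hom T c c"
    using p by (simp add: cut_def)
  \<comment> \<open>The suspended cut q, followed by the map to c, lands in the summands indexed by
    F, so the cut p with the same index set fixes it; this is checked on each summand.\<close>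
  have pq: "p \<cdot> (w' \<cdot> susp_ar T q) = w' \<cdot> susp_ar T q"
  proof (rule coproduct_eqI[OF sd])
    show "w' \<cdot> susp_ar T q \<in> Hom T (susp_ob T d) c"
      by (rule cmp_in[OF susp_Hom[OF qH] w'(1)])
    thus "p \<cdot> (w' \<cdot> susp_ar T q) \<in> Hom T (susp_ob T d) c"
      by (rule cmp_in[OF _ pH])
    fix i assume i: "i \<in> I"
    note m = coproduct_in(2,3)[OF d i] t(2,3)[OF i] u[OF i] Y[OF i]
    have "(w' \<cdot> susp_ar T q) \<cdot> susp_ar T (\<kappa> i) = w' \<cdot> susp_ar T (q \<cdot> \<kappa> i)"
      using w'(1) qH m by (simp add: susp_cmp Hom_iff)
    also have "\<dots> = (if i \<in> F then \<iota> i \<cdot> u i else Zero T (susp_ob T (Y i)) c)"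
      using q(1) w' i m dO by (auto simp: cut_def Hom_iff)
    finally have e: "(w' \<cdot> susp_ar T q) \<cdot> susp_ar T (\<kappa> i) = (if i \<in> F then \<iota> i \<cdot> u i else Zero T (susp_ob T (Y i)) c)" .
    have "(p \<cdot> (w' \<cdot> susp_ar T q)) \<cdot> susp_ar T (\<kappa> i) = p \<cdot> ((w' \<cdot> susp_ar T q) \<cdot> susp_ar T (\<kappa> i))"
      using pH w'(1) qH m by (simp add: Hom_iff)
    also have "\<dots> = (if i \<in> F then (p \<cdot> \<iota> i) \<cdot> u i else Zero T (susp_ob T (Y i)) c)"
      unfolding e using pH m by (auto simp: Hom_iff)
    also have "\<dots> = (if i \<in> F then \<iota> i \<cdot> u i else Zero T (susp_ob T (Y i)) c)"
      using p i by (simp add: cut_def)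
    finally show "(p \<cdot> (w' \<cdot> susp_ar T q)) \<cdot> susp_ar T (\<kappa> i) = (w' \<cdot> susp_ar T q) \<cdot> susp_ar T (\<kappa> i)"
      using e by simp
  qed
  have "f = (w' \<cdot> w) \<cdot> f"
    unfolding ww using f by (simp add: Hom_iff)
  also have "\<dots> = w' \<cdot> susp_ar T (q \<cdot> f')"
    unfolding q(2) f'(2) using w(1) w'(1) f by (simp add: Hom_iff)
  also have "\<dots> = (w' \<cdot> susp_ar T q) \<cdot> susp_ar T f'"
    using w'(1) qH f'(1) by (simp add: susp_cmp Hom_iff)
  finally have f_eq: "f = (w' \<cdot> susp_ar T q) \<cdot> susp_ar T f'" .
  have "p \<cdot> f = (p \<cdot> (w' \<cdot> susp_ar T q)) \<cdot> susp_ar T f'"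
    unfolding f_eq using w'(1) qH pH f'(1) by (simp add: Hom_iff)
  hence "p \<cdot> f = f"
    unfolding pq f_eq[symmetric] .
  thus "\<exists>F. supported I X c \<iota> F f"
    using p FI unfolding supported_def by blast
qed

text \<open>For a map k out of the cone, choose a cut p fixing k \<cdot> g. Then k - p \<cdot> k
  vanishes after g, so it factors through the suspension of \<open>Dom T f\<close>, which is
  compact; both p \<cdot> k and the difference are finitely supported.\<close>

lemma compact_cone:
  assumes dist: "(f, g, h) \<in> Dist T" and x: "compact_obj T (Dom T f)" and y: "compact_obj T (Cod T f)"
  shows "compact_obj T (Cod T g)"
proof (rule compactI)
  note D = dist_simps[OF dist]
  show "Cod T g \<in> Obj T"
    using D by simp
  fix I :: "'u set" and X c \<iota> k
  assume I: "small (Univ T) I" and c: "is_coproduct T I X c \<iota>" and k: "k \<in> Hom T (Cod T g) c"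
  have gH: "g \<in> Hom T (Cod T f) (Cod T g)" and hH: "h \<in> Hom T (Cod T g) (susp_ob T (Dom T f))"
    using D by (auto simp: Hom_iff)
  obtain F where "supported I X c \<iota> F (k \<cdot> g)"
    using compact_supported[OF y I c cmp_in[OF gH k]] .
  then obtain p where F: "finite F" "F \<subseteq> I" and p: "cut I X c \<iota> F p" "p \<cdot> (k \<cdot> g) = k \<cdot> g"
    unfolding supported_def by blast
  have pH: "p \<in> Hom T c c"
    using p(1) by (simp add: cut_def)
  have pk: "p \<cdot> k \<in> Hom T (Cod T g) c"
    by (rule cmp_in[OF k pH])
  have "p \<cdot> (p \<cdot> k) = (p \<cdot> p) \<cdot> k"
    using pH k by (simp add: Hom_iff)
  hence "p \<cdot> (p \<cdot> k) = p \<cdot> k"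
    using cut_cmp[OF c p(1) p(1)] by simp
  hence s1: "supported I X c \<iota> F (p \<cdot> k)"
    using F p(1) unfolding supported_def by blast
  define k' where "k' = Add T k (neg T (p \<cdot> k))"
  have k': "k' \<in> Hom T (Cod T g) c"
    unfolding k'_def by (rule Add_Hom[OF k neg_Hom(1)[OF pk]])
  have "k' \<cdot> g = Add T (k \<cdot> g) (neg T (p \<cdot> k) \<cdot> g)"
    unfolding k'_def using k pk gH neg_Hom(1)[OF pk] by (intro Add_cmp) (auto simp: Hom_iff)
  also have "neg T (p \<cdot> k) \<cdot> g = neg T (k \<cdot> g)"
    using cmp_neg(2)[of g "p \<cdot> k"] p(2) pk pH k gH by (simp add: Hom_iff)
  also have "Add T (k \<cdot> g) (neg T (k \<cdot> g)) = Zero T (Cod T f) c"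
    by (rule neg_Hom(2)[OF cmp_in[OF gH k]])
  finally obtain l where l: "l \<in> Hom T (susp_ob T (Dom T f)) c" "l \<cdot> h = k'"
    using exact_ext'[OF dist k'] by blast
  obtain G where G: "supported I X c \<iota> G l"
    using compact_supported[OF compact_susp[OF x] I c l(1)] .
  have "supported I X c \<iota> G k'"
    using supported_cmp[OF c G l(1) hH] l(2) by simp
  hence "supported I X c \<iota> (F \<union> G) (Add T (p \<cdot> k) k')"
    by (rule supported_Add[OF c s1 pk _ k'])
  moreover have "Add T (p \<cdot> k) k' = Add T k (Add T (neg T (p \<cdot> k)) (p \<cdot> k))"
    using Add_commute[OF pk k'] Add_assoc[OF k neg_Hom(1)[OF pk] pk] by (simp add: k'_def)
  moreover have "Add T (neg T (p \<cdot> k)) (p \<cdot> k) = Zero T (Cod T g) c"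
    using Add_commute[OF pk neg_Hom(1)[OF pk]] neg_Hom(2)[OF pk] by simp
  ultimately show "\<exists>F. supported I X c \<iota> F k"
    using k by (auto simp: Hom_iff)
qed

lemma triangulated_compacts: "triangulated_subcat T (compacts T)"
  by (rule triangulated_subcatI)
    (auto intro: compact_Obj compact_zero compact_iso compact_susp compact_desusp compact_cone)

end


section \<open>Symmetric monoidal categories\<close>

context symmetric_monoidal
begin

lemma tob_Obj [simp]: "x \<in> Obj C \<Longrightarrow> y \<in> Obj C \<Longrightarrow> x \<boxtimes> y \<in> Obj C"
  by (rule tob_in)

lemma Unit_Obj [simp]: "Unit C \<in> Obj C"
  by (rule unit_in)

lemma tar_simps [simp]:
  assumes "f \<in> Mor C" "g \<in> Mor C"
  shows "f \<boxdot> g \<in> Mor C" "Dom C (f \<boxdot> g) = Dom C f \<boxtimes> Dom C g" "Cod C (f \<boxdot> g) = Cod C f \<boxtimes> Cod C g"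
  using tar_in[of f "Dom C f" "Cod C f" g "Dom C g" "Cod C g"] assms by (auto simp: Hom_iff)

lemma Assoc_simps [simp]:
  assumes "x \<in> Obj C" "y \<in> Obj C" "z \<in> Obj C"
  shows "Assoc C x y z \<in> Mor C" "Dom C (Assoc C x y z) = (x \<boxtimes> y) \<boxtimes> z"
    "Cod C (Assoc C x y z) = x \<boxtimes> (y \<boxtimes> z)"
  using assoc_iso[OF assms] by (auto simp: Hom_iff)

lemma unit_simps [simp]:
  assumes "x \<in> Obj C"
  shows "LUnit C x \<in> Mor C" "Dom C (LUnit C x) = Unit C \<boxtimes> x" "Cod C (LUnit C x) = x"
    "RUnit C x \<in> Mor C" "Dom C (RUnit C x) = x \<boxtimes> Unit C" "Cod C (RUnit C x) = x"
  using lunit_iso[OF assms] runit_iso[OF assms] by (auto simp: Hom_iff)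

lemma interchange:
  assumes "f \<in> Mor C" "f' \<in> Mor C" "g \<in> Mor C" "g' \<in> Mor C" "Dom C f' = Cod C f" "Dom C g' = Cod C g"
  shows "(f' \<boxdot> g') \<cdot> (f \<boxdot> g) = (f' \<cdot> f) \<boxdot> (g' \<cdot> g)"
  using tar_cmp[of f "Dom C f" "Cod C f" f' "Cod C f'" g "Dom C g" "Cod C g" g' "Cod C g'"] assms
  by (auto simp: Hom_iff)

lemma whisker_right: "f \<in> Mor C \<Longrightarrow> f' \<in> Mor C \<Longrightarrow> Dom C f' = Cod C f \<Longrightarrow> y \<in> Obj C \<Longrightarrow>
    (f' \<boxdot> Idn C y) \<cdot> (f \<boxdot> Idn C y) = (f' \<cdot> f) \<boxdot> Idn C y"
  by (simp add: interchange)

lemma whisker_left: "f \<in> Mor C \<Longrightarrow> f' \<in> Mor C \<Longrightarrow> Dom C f' = Cod C f \<Longrightarrow> y \<in> Obj C \<Longrightarrow>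
    (Idn C y \<boxdot> f') \<cdot> (Idn C y \<boxdot> f) = Idn C y \<boxdot> (f' \<cdot> f)"
  by (simp add: interchange)

lemma assoc_natural:
  assumes "f \<in> Mor C" "g \<in> Mor C" "h \<in> Mor C"
  shows "Assoc C (Cod C f) (Cod C g) (Cod C h) \<cdot> ((f \<boxdot> g) \<boxdot> h)
    = (f \<boxdot> (g \<boxdot> h)) \<cdot> Assoc C (Dom C f) (Dom C g) (Dom C h)"
  using assms by (intro assoc_nat) (auto simp: Hom_iff)

text \<open>By naturality \<open>RUnit\<close> conjugates f \<otimes> 1 into f. It lets an identity
  be proved after adding a unit factor, where the coherence axioms apply.\<close>

lemma tensor_unit_faithful:
  assumes f: "f \<in> Hom C a b" and g: "g \<in> Hom C a b" and eq: "f \<boxdot> Idn C (Unit C) = g \<boxdot> Idn C (Unit C)"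
  shows "f = g"
proof (rule iso_cancel_right[OF _ _ f g])
  have a: "a \<in> Obj C"
    using f Hom_Obj by blast
  show "is_iso C (RUnit C a)" "RUnit C a \<in> Hom C (a \<boxtimes> Unit C) a"
    using runit_iso[OF a] by auto
  show "f \<cdot> RUnit C a = g \<cdot> RUnit C a"
    using runit_nat[OF f] runit_nat[OF g] eq by simp
qed

text \<open>Kelly's argument: the pentagon for \<open>w, x, \<one>, \<one>\<close> gives the identity tensored with \<open>\<one>\<close>.\<close>
lemma RUnit_tensor:
  assumes w: "w \<in> Obj C" and x: "x \<in> Obj C"
  shows "(Idn C w \<boxdot> RUnit C x) \<cdot> Assoc C w x (Unit C) = RUnit C (w \<boxtimes> x)"
proof (rule tensor_unit_faithful[symmetric])
  let ?I = "Unit C"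
  let ?a = "Assoc C w x ?I"
  note [simp] = w x
  show "RUnit C (w \<boxtimes> x) \<in> Hom C ((w \<boxtimes> x) \<boxtimes> ?I) (w \<boxtimes> x)"
    and "(Idn C w \<boxdot> RUnit C x) \<cdot> ?a \<in> Hom C ((w \<boxtimes> x) \<boxtimes> ?I) (w \<boxtimes> x)"
    by (auto simp: Hom_iff)
  have "?a \<cdot> (RUnit C (w \<boxtimes> x) \<boxdot> Idn C ?I)
      = ?a \<cdot> ((Idn C (w \<boxtimes> x) \<boxdot> LUnit C ?I) \<cdot> Assoc C (w \<boxtimes> x) ?I ?I)"
    by (simp only: triangle_coherence[OF tob_Obj[OF w x] Unit_Obj])
  also have "\<dots> = (?a \<cdot> ((Idn C w \<boxdot> Idn C x) \<boxdot> LUnit C ?I)) \<cdot> Assoc C (w \<boxtimes> x) ?I ?I"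
    by (simp add: tar_idn)
  also have "?a \<cdot> ((Idn C w \<boxdot> Idn C x) \<boxdot> LUnit C ?I)
      = (Idn C w \<boxdot> (Idn C x \<boxdot> LUnit C ?I)) \<cdot> Assoc C w x (?I \<boxtimes> ?I)"
    using assoc_natural[of "Idn C w" "Idn C x" "LUnit C ?I"] by simp
  also have "((Idn C w \<boxdot> (Idn C x \<boxdot> LUnit C ?I)) \<cdot> Assoc C w x (?I \<boxtimes> ?I)) \<cdot> Assoc C (w \<boxtimes> x) ?I ?I
      = (Idn C w \<boxdot> (Idn C x \<boxdot> LUnit C ?I)) \<cdot> (Assoc C w x (?I \<boxtimes> ?I) \<cdot> Assoc C (w \<boxtimes> x) ?I ?I)"
    by simp
  also have "Assoc C w x (?I \<boxtimes> ?I) \<cdot> Assoc C (w \<boxtimes> x) ?I ?I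
      = (Idn C w \<boxdot> Assoc C x ?I ?I) \<cdot> (Assoc C w (x \<boxtimes> ?I) ?I \<cdot> (?a \<boxdot> Idn C ?I))"
    by (rule pentagon) simp_all
  also have "(Idn C w \<boxdot> (Idn C x \<boxdot> LUnit C ?I)) \<cdot> \<dots>
      = ((Idn C w \<boxdot> (Idn C x \<boxdot> LUnit C ?I)) \<cdot> (Idn C w \<boxdot> Assoc C x ?I ?I))
          \<cdot> (Assoc C w (x \<boxtimes> ?I) ?I \<cdot> (?a \<boxdot> Idn C ?I))"
    by simp
  also have "(Idn C w \<boxdot> (Idn C x \<boxdot> LUnit C ?I)) \<cdot> (Idn C w \<boxdot> Assoc C x ?I ?I)
      = Idn C w \<boxdot> (RUnit C x \<boxdot> Idn C ?I)"
    by (simp add: whisker_left triangle_coherence)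
  also have "(Idn C w \<boxdot> (RUnit C x \<boxdot> Idn C ?I)) \<cdot> (Assoc C w (x \<boxtimes> ?I) ?I \<cdot> (?a \<boxdot> Idn C ?I))
      = ((Idn C w \<boxdot> (RUnit C x \<boxdot> Idn C ?I)) \<cdot> Assoc C w (x \<boxtimes> ?I) ?I) \<cdot> (?a \<boxdot> Idn C ?I)"
    by simp
  also have "(Idn C w \<boxdot> (RUnit C x \<boxdot> Idn C ?I)) \<cdot> Assoc C w (x \<boxtimes> ?I) ?I
      = ?a \<cdot> ((Idn C w \<boxdot> RUnit C x) \<boxdot> Idn C ?I)"
    using assoc_natural[of "Idn C w" "RUnit C x" "Idn C ?I"] by simp
  also have "(?a \<cdot> ((Idn C w \<boxdot> RUnit C x) \<boxdot> Idn C ?I)) \<cdot> (?a \<boxdot> Idn C ?I)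
      = ?a \<cdot> (((Idn C w \<boxdot> RUnit C x) \<cdot> ?a) \<boxdot> Idn C ?I)"
    by (simp add: whisker_right)
  finally have "?a \<cdot> (RUnit C (w \<boxtimes> x) \<boxdot> Idn C ?I) = ?a \<cdot> (((Idn C w \<boxdot> RUnit C x) \<cdot> ?a) \<boxdot> Idn C ?I)" .
  from iso_cancel_left[OF _ _ _ _ this, of "(w \<boxtimes> x) \<boxtimes> ?I" "w \<boxtimes> (x \<boxtimes> ?I)" "((w \<boxtimes> x) \<boxtimes> ?I) \<boxtimes> ?I"]
  show "RUnit C (w \<boxtimes> x) \<boxdot> Idn C ?I = ((Idn C w \<boxdot> RUnit C x) \<cdot> ?a) \<boxdot> Idn C ?I"
    using assoc_iso[OF w x Unit_Obj] by (simp add: Hom_iff)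
qed

end

text \<open>The adjunction between tensoring with x and tensoring with y, unfolded into counit,
  unit, triangle identities and naturality. Later arguments transpose maps in this form, which keeps
  associators out of sight.\<close>

definition dual_adjunction ::
    "('o, 'm, 'z) smc_scheme \<Rightarrow> 'o \<Rightarrow> 'o \<Rightarrow> ('o \<Rightarrow> 'm) \<Rightarrow> ('o \<Rightarrow> 'm) \<Rightarrow> bool" where
  "dual_adjunction C x y \<epsilon> \<eta> \<longleftrightarrow>
     (\<forall>z \<in> Obj C. \<epsilon> z \<in> Hom C ((z \<boxtimes>\<^bsub>C\<^esub> y) \<boxtimes>\<^bsub>C\<^esub> x) z \<and> \<eta> z \<in> Hom C z ((z \<boxtimes>\<^bsub>C\<^esub> x) \<boxtimes>\<^bsub>C\<^esub> y)
        \<and> \<epsilon> (z \<boxtimes>\<^bsub>C\<^esub> x) \<cdot>\<^bsub>C\<^esub> (\<eta> z \<boxdot>\<^bsub>C\<^esub> Idn C x) = Idn C (z \<boxtimes>\<^bsub>C\<^esub> x)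
        \<and> (\<epsilon> z \<boxdot>\<^bsub>C\<^esub> Idn C y) \<cdot>\<^bsub>C\<^esub> \<eta> (z \<boxtimes>\<^bsub>C\<^esub> y) = Idn C (z \<boxtimes>\<^bsub>C\<^esub> y))
     \<and> (\<forall>z z'. \<forall>f \<in> Hom C z z'. \<epsilon> z' \<cdot>\<^bsub>C\<^esub> ((f \<boxdot>\<^bsub>C\<^esub> Idn C y) \<boxdot>\<^bsub>C\<^esub> Idn C x) = f \<cdot>\<^bsub>C\<^esub> \<epsilon> z
        \<and> \<eta> z' \<cdot>\<^bsub>C\<^esub> f = ((f \<boxdot>\<^bsub>C\<^esub> Idn C x) \<boxdot>\<^bsub>C\<^esub> Idn C y) \<cdot>\<^bsub>C\<^esub> \<eta> z)"

section \<open>Duality in a symmetric monoidal category\<close>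

context symmetric_monoidal
begin

abbreviation (input) A' :: "'o \<Rightarrow> 'o \<Rightarrow> 'o \<Rightarrow> 'm" where
  "A' u v w \<equiv> inverse_mor C (Assoc C u v w)"

abbreviation (input) R' :: "'o \<Rightarrow> 'm" where
  "R' u \<equiv> inverse_mor C (RUnit C u)"

lemma Assoc_inverse_simps [simp]:
  assumes "u \<in> Obj C" "v \<in> Obj C" "w \<in> Obj C"
  shows "A' u v w \<in> Mor C" "Dom C (A' u v w) = u \<boxtimes> (v \<boxtimes> w)" "Cod C (A' u v w) = (u \<boxtimes> v) \<boxtimes> w"
    "A' u v w \<cdot> Assoc C u v w = Idn C ((u \<boxtimes> v) \<boxtimes> w)" "Assoc C u v w \<cdot> A' u v w = Idn C (u \<boxtimes> (v \<boxtimes> w))"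
  using inverse_mor[of "Assoc C u v w"] assoc_iso[OF assms] by (auto simp: Hom_iff)

lemma RUnit_inverse_simps [simp]:
  assumes "u \<in> Obj C"
  shows "R' u \<in> Mor C" "Dom C (R' u) = u" "Cod C (R' u) = u \<boxtimes> Unit C"
    "R' u \<cdot> RUnit C u = Idn C (u \<boxtimes> Unit C)" "RUnit C u \<cdot> R' u = Idn C u"
  using inverse_mor[of "RUnit C u"] runit_iso[OF assms] by (auto simp: Hom_iff)

context
  fixes x y ev coev
  assumes x: "x \<in> Obj C" and y: "y \<in> Obj C"
    and ev: "ev \<in> Hom C (y \<boxtimes> x) (Unit C)" and coev: "coev \<in> Hom C (Unit C) (x \<boxtimes> y)"
    and zigzag1: "RUnit C x \<cdot> ((Idn C x \<boxdot> ev) \<cdot> (Assoc C x y x \<cdot> (coev \<boxdot> Idn C x))) = LUnit C x"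
    and zigzag2: "LUnit C y \<cdot> ((ev \<boxdot> Idn C y) \<cdot>
          (inverse_mor C (Assoc C y x y) \<cdot> (Idn C y \<boxdot> coev))) = RUnit C y"
begin

lemma dual_simps:
  "x \<in> Obj C" "y \<in> Obj C" "ev \<in> Mor C" "Dom C ev = y \<boxtimes> x" "Cod C ev = Unit C"
  "coev \<in> Mor C" "Dom C coev = Unit C" "Cod C coev = x \<boxtimes> y"
  using x y ev coev by (auto simp: Hom_iff)

definition dual_counit :: "'o \<Rightarrow> 'm" where
  "dual_counit z = RUnit C z \<cdot> ((Idn C z \<boxdot> ev) \<cdot> Assoc C z y x)"

definition dual_unit :: "'o \<Rightarrow> 'm" where
  "dual_unit z = A' z x y \<cdot> ((Idn C z \<boxdot> coev) \<cdot> R' z)"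

lemma counit_simps:
  "z \<in> Obj C \<Longrightarrow> dual_counit z \<in> Mor C \<and> Dom C (dual_counit z) = (z \<boxtimes> y) \<boxtimes> x \<and> Cod C (dual_counit z) = z"
  "z \<in> Obj C \<Longrightarrow> dual_unit z \<in> Mor C \<and> Dom C (dual_unit z) = z \<and> Cod C (dual_unit z) = (z \<boxtimes> x) \<boxtimes> y"
  by (simp_all add: dual_counit_def dual_unit_def dual_simps)

lemma counit_natural:
  assumes "f \<in> Mor C"
  shows "dual_counit (Cod C f) \<cdot> ((f \<boxdot> Idn C y) \<boxdot> Idn C x) = f \<cdot> dual_counit (Dom C f)"
proof -
  let ?u = "Dom C f" and ?v = "Cod C f"
  note [simp] = assms dual_simps counit_simps
  have "dual_counit ?v \<cdot> ((f \<boxdot> Idn C y) \<boxdot> Idn C x)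
      = RUnit C ?v \<cdot> ((Idn C ?v \<boxdot> ev) \<cdot> (Assoc C ?v y x \<cdot> ((f \<boxdot> Idn C y) \<boxdot> Idn C x)))"
    by (simp add: dual_counit_def)
  also have "Assoc C ?v y x \<cdot> ((f \<boxdot> Idn C y) \<boxdot> Idn C x) = (f \<boxdot> Idn C (y \<boxtimes> x)) \<cdot> Assoc C ?u y x"
    using assoc_natural[of f "Idn C y" "Idn C x"] by (simp add: tar_idn)
  also have "RUnit C ?v \<cdot> ((Idn C ?v \<boxdot> ev) \<cdot> ((f \<boxdot> Idn C (y \<boxtimes> x)) \<cdot> Assoc C ?u y x))
      = RUnit C ?v \<cdot> (((Idn C ?v \<boxdot> ev) \<cdot> (f \<boxdot> Idn C (y \<boxtimes> x))) \<cdot> Assoc C ?u y x)"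
    by simp
  also have "(Idn C ?v \<boxdot> ev) \<cdot> (f \<boxdot> Idn C (y \<boxtimes> x)) = (f \<boxdot> Idn C (Unit C)) \<cdot> (Idn C ?u \<boxdot> ev)"
    by (simp add: interchange)
  also have "RUnit C ?v \<cdot> (((f \<boxdot> Idn C (Unit C)) \<cdot> (Idn C ?u \<boxdot> ev)) \<cdot> Assoc C ?u y x)
      = (RUnit C ?v \<cdot> (f \<boxdot> Idn C (Unit C))) \<cdot> ((Idn C ?u \<boxdot> ev) \<cdot> Assoc C ?u y x)"
    by simp
  also have "RUnit C ?v \<cdot> (f \<boxdot> Idn C (Unit C)) = f \<cdot> RUnit C ?u"
    by (rule runit_nat) (simp add: Hom_iff)
  finally show ?thesis
    by (simp add: dual_counit_def)
qed

lemma unit_natural: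
  assumes "f \<in> Mor C"
  shows "dual_unit (Cod C f) \<cdot> f = ((f \<boxdot> Idn C x) \<boxdot> Idn C y) \<cdot> dual_unit (Dom C f)"
proof -
  let ?u = "Dom C f" and ?v = "Cod C f"
  note [simp] = assms dual_simps counit_simps
  \<comment> \<open>Naturality of an inverse isomorphism: compose with the isomorphism and cancel
    it.\<close>
  have 1: "R' ?v \<cdot> f = (f \<boxdot> Idn C (Unit C)) \<cdot> R' ?u"
  proof (rule iso_cancel_left)
    show "is_iso C (RUnit C ?v)" "RUnit C ?v \<in> Hom C (?v \<boxtimes> Unit C) ?v"
      using runit_iso[of ?v] by auto
    have "RUnit C ?v \<cdot> (R' ?v \<cdot> f) = (RUnit C ?v \<cdot> R' ?v) \<cdot> f"
      by (rule cmp_assoc'[symmetric]) simp_all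
    hence "RUnit C ?v \<cdot> (R' ?v \<cdot> f) = f"
      by (simp del: cmp_assoc')
    also have "f = (f \<cdot> RUnit C ?u) \<cdot> R' ?u"
      by simp
    also have "f \<cdot> RUnit C ?u = RUnit C ?v \<cdot> (f \<boxdot> Idn C (Unit C))"
      by (rule runit_nat[symmetric]) (simp add: Hom_iff)
    finally show "RUnit C ?v \<cdot> (R' ?v \<cdot> f) = RUnit C ?v \<cdot> ((f \<boxdot> Idn C (Unit C)) \<cdot> R' ?u)"
      by simp
  qed (simp_all add: Hom_iff)
  have 2: "A' ?v x y \<cdot> (f \<boxdot> Idn C (x \<boxtimes> y)) = ((f \<boxdot> Idn C x) \<boxdot> Idn C y) \<cdot> A' ?u x y"
  proof (rule iso_cancel_left)
    show "is_iso C (Assoc C ?v x y)" "Assoc C ?v x y \<in> Hom C ((?v \<boxtimes> x) \<boxtimes> y) (?v \<boxtimes> (x \<boxtimes> y))"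
      using assoc_iso[of ?v x y] by auto
    have "Assoc C ?v x y \<cdot> (A' ?v x y \<cdot> (f \<boxdot> Idn C (x \<boxtimes> y)))
        = (Assoc C ?v x y \<cdot> A' ?v x y) \<cdot> (f \<boxdot> Idn C (x \<boxtimes> y))"
      by (rule cmp_assoc'[symmetric]) simp_all
    hence "Assoc C ?v x y \<cdot> (A' ?v x y \<cdot> (f \<boxdot> Idn C (x \<boxtimes> y))) = f \<boxdot> Idn C (x \<boxtimes> y)"
      by (simp del: cmp_assoc')
    also have "\<dots> = ((f \<boxdot> Idn C (x \<boxtimes> y)) \<cdot> Assoc C ?u x y) \<cdot> A' ?u x y"
      by simp
    also have "(f \<boxdot> Idn C (x \<boxtimes> y)) \<cdot> Assoc C ?u x y = Assoc C ?v x y \<cdot> ((f \<boxdot> Idn C x) \<boxdot> Idn C y)"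
      using assoc_natural[of f "Idn C x" "Idn C y"] by (simp add: tar_idn)
    finally show "Assoc C ?v x y \<cdot> (A' ?v x y \<cdot> (f \<boxdot> Idn C (x \<boxtimes> y)))
        = Assoc C ?v x y \<cdot> (((f \<boxdot> Idn C x) \<boxdot> Idn C y) \<cdot> A' ?u x y)"
      by simp
  qed (simp_all add: Hom_iff)
  have "dual_unit ?v \<cdot> f = A' ?v x y \<cdot> ((Idn C ?v \<boxdot> coev) \<cdot> (R' ?v \<cdot> f))"
    by (simp add: dual_unit_def)
  also have "\<dots> = A' ?v x y \<cdot> (((Idn C ?v \<boxdot> coev) \<cdot> (f \<boxdot> Idn C (Unit C))) \<cdot> R' ?u)"
    by (simp add: 1)
  also have "(Idn C ?v \<boxdot> coev) \<cdot> (f \<boxdot> Idn C (Unit C)) = (f \<boxdot> Idn C (x \<boxtimes> y)) \<cdot> (Idn C ?u \<boxdot> coev)"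
    by (simp add: interchange)
  also have "A' ?v x y \<cdot> (((f \<boxdot> Idn C (x \<boxtimes> y)) \<cdot> (Idn C ?u \<boxdot> coev)) \<cdot> R' ?u)
      = (A' ?v x y \<cdot> (f \<boxdot> Idn C (x \<boxtimes> y))) \<cdot> ((Idn C ?u \<boxdot> coev) \<cdot> R' ?u)"
    by simp
  also have "\<dots> = ((f \<boxdot> Idn C x) \<boxdot> Idn C y) \<cdot> dual_unit ?u"
    unfolding 2 by (simp add: dual_unit_def)
  finally show ?thesis .
qed

text \<open>The pentagon moves the associators under w \<otimes> -, where the zigzag identity of x
  applies; what remains around it collapses by the triangle axiom. \<open>RUnit_tensor\<close>
  prepares the leftmost factor.\<close>

lemma triangle1:
  assumes w: "w \<in> Obj C"
  shows "dual_counit (w \<boxtimes> x) \<cdot> (dual_unit w \<boxdot> Idn C x) = Idn C (w \<boxtimes> x)"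
proof -
  note [simp] = w dual_simps counit_simps
  let ?k = "((Idn C w \<boxdot> coev) \<boxdot> Idn C x) \<cdot> (R' w \<boxdot> Idn C x)"
  have 0: "dual_unit w \<boxdot> Idn C x = (A' w x y \<boxdot> Idn C x) \<cdot> ?k"
    by (simp add: dual_unit_def whisker_right)
  have 1: "Assoc C w x (Unit C) \<cdot> (Idn C (w \<boxtimes> x) \<boxdot> ev) = (Idn C w \<boxdot> (Idn C x \<boxdot> ev)) \<cdot> Assoc C w x (y \<boxtimes> x)"
    using assoc_natural[of "Idn C w" "Idn C x" ev] by (simp add: tar_idn)
  have 2: "Assoc C w x (y \<boxtimes> x) \<cdot> Assoc C (w \<boxtimes> x) y x
      = (Idn C w \<boxdot> Assoc C x y x) \<cdot> (Assoc C w (x \<boxtimes> y) x \<cdot> (Assoc C w x y \<boxdot> Idn C x))"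
    by (rule pentagon) simp_all
  have 3: "(Assoc C w x y \<boxdot> Idn C x) \<cdot> (A' w x y \<boxdot> Idn C x) = Idn C ((w \<boxtimes> (x \<boxtimes> y)) \<boxtimes> x)"
    by (simp add: whisker_right tar_idn)
  have 4: "Assoc C w (x \<boxtimes> y) x \<cdot> ((Idn C w \<boxdot> coev) \<boxdot> Idn C x)
      = (Idn C w \<boxdot> (coev \<boxdot> Idn C x)) \<cdot> Assoc C w (Unit C) x"
    using assoc_natural[of "Idn C w" coev "Idn C x"] by simp
  have 5: "(Idn C w \<boxdot> LUnit C x) \<cdot> Assoc C w (Unit C) x = RUnit C w \<boxdot> Idn C x"
    by (rule triangle_coherence) simp_all
  have "dual_counit (w \<boxtimes> x) \<cdot> (dual_unit w \<boxdot> Idn C x) = (Idn C w \<boxdot> RUnit C x) \<cdot> ((Assoc C w x (Unit C) \<cdot>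
      (Idn C (w \<boxtimes> x) \<boxdot> ev)) \<cdot> (Assoc C (w \<boxtimes> x) y x \<cdot> ((A' w x y \<boxdot> Idn C x) \<cdot> ?k)))"
    unfolding 0 by (simp add: dual_counit_def RUnit_tensor[symmetric])
  also have "\<dots> = (Idn C w \<boxdot> RUnit C x) \<cdot> ((Idn C w \<boxdot> (Idn C x \<boxdot> ev)) \<cdot>
      ((Assoc C w x (y \<boxtimes> x) \<cdot> Assoc C (w \<boxtimes> x) y x) \<cdot> ((A' w x y \<boxdot> Idn C x) \<cdot> ?k)))"
    unfolding 1 by simp
  also have "\<dots> = (Idn C w \<boxdot> RUnit C x) \<cdot> ((Idn C w \<boxdot> (Idn C x \<boxdot> ev)) \<cdot> ((Idn C w \<boxdot> Assoc C x y x) \<cdot>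
      (Assoc C w (x \<boxtimes> y) x \<cdot> (((Assoc C w x y \<boxdot> Idn C x) \<cdot> (A' w x y \<boxdot> Idn C x)) \<cdot> ?k))))"
    unfolding 2 by simp
  also have "\<dots> = (Idn C w \<boxdot> RUnit C x) \<cdot> ((Idn C w \<boxdot> (Idn C x \<boxdot> ev)) \<cdot> ((Idn C w \<boxdot> Assoc C x y x) \<cdot>
      ((Assoc C w (x \<boxtimes> y) x \<cdot> ((Idn C w \<boxdot> coev) \<boxdot> Idn C x)) \<cdot> (R' w \<boxdot> Idn C x))))"
    unfolding 3 by simp
  also have "\<dots> = ((Idn C w \<boxdot> RUnit C x) \<cdot> ((Idn C w \<boxdot> (Idn C x \<boxdot> ev)) \<cdot> ((Idn C w \<boxdot> Assoc C x y x) \<cdot>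
      (Idn C w \<boxdot> (coev \<boxdot> Idn C x))))) \<cdot> (Assoc C w (Unit C) x \<cdot> (R' w \<boxdot> Idn C x))"
    unfolding 4 by simp
  also have "(Idn C w \<boxdot> RUnit C x) \<cdot> ((Idn C w \<boxdot> (Idn C x \<boxdot> ev)) \<cdot> ((Idn C w \<boxdot> Assoc C x y x) \<cdot>
      (Idn C w \<boxdot> (coev \<boxdot> Idn C x)))) = Idn C w \<boxdot> LUnit C x"
    by (simp add: whisker_left zigzag1)
  also have "(Idn C w \<boxdot> LUnit C x) \<cdot> (Assoc C w (Unit C) x \<cdot> (R' w \<boxdot> Idn C x))
      = ((Idn C w \<boxdot> LUnit C x) \<cdot> Assoc C w (Unit C) x) \<cdot> (R' w \<boxdot> Idn C x)"
    by simp
  also have "\<dots> = Idn C (w \<boxtimes> x)"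
    unfolding 5 by (simp add: whisker_right tar_idn)
  finally show ?thesis .
qed

text \<open>Mirror image of \<open>triangle1\<close> with the zigzag identity of y. The associators
  now occur inverted, so the pentagon enters in the solved form of fact \<open>1\<close>.\<close>

lemma triangle2:
  assumes z: "z \<in> Obj C"
  shows "(dual_counit z \<boxdot> Idn C y) \<cdot> dual_unit (z \<boxtimes> y) = Idn C (z \<boxtimes> y)"
proof -
  note [simp] = z dual_simps counit_simps
  let ?k = "(RUnit C z \<boxdot> Idn C y) \<cdot> ((Idn C z \<boxdot> ev) \<boxdot> Idn C y)"
  let ?r = "(Idn C (z \<boxtimes> y) \<boxdot> coev) \<cdot> R' (z \<boxtimes> y)"
  have 0: "dual_counit z \<boxdot> Idn C y = ?k \<cdot> (Assoc C z y x \<boxdot> Idn C y)"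
    by (simp add: dual_counit_def whisker_right)
  have pent: "Assoc C z y (x \<boxtimes> y) \<cdot> Assoc C (z \<boxtimes> y) x y
      = (Idn C z \<boxdot> Assoc C y x y) \<cdot> (Assoc C z (y \<boxtimes> x) y \<cdot> (Assoc C z y x \<boxdot> Idn C y))"
    by (rule pentagon) simp_all
  have 1: "Assoc C z (y \<boxtimes> x) y \<cdot> ((Assoc C z y x \<boxdot> Idn C y) \<cdot> A' (z \<boxtimes> y) x y)
      = (Idn C z \<boxdot> A' y x y) \<cdot> Assoc C z y (x \<boxtimes> y)"
  proof -
    have "Assoc C z (y \<boxtimes> x) y \<cdot> ((Assoc C z y x \<boxdot> Idn C y) \<cdot> A' (z \<boxtimes> y) x y)
      = ((Idn C z \<boxdot> A' y x y) \<cdot> (Idn C z \<boxdot> Assoc C y x y)) \<cdot>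
          (Assoc C z (y \<boxtimes> x) y \<cdot> ((Assoc C z y x \<boxdot> Idn C y) \<cdot> A' (z \<boxtimes> y) x y))"
      by (simp add: whisker_left tar_idn del: cmp_assoc')
    also have "\<dots> = (Idn C z \<boxdot> A' y x y) \<cdot> (((Idn C z \<boxdot> Assoc C y x y) \<cdot>
          (Assoc C z (y \<boxtimes> x) y \<cdot> (Assoc C z y x \<boxdot> Idn C y))) \<cdot> A' (z \<boxtimes> y) x y)"
      by simp
    also have "\<dots> = (Idn C z \<boxdot> A' y x y) \<cdot> Assoc C z y (x \<boxtimes> y)"
      unfolding pent[symmetric] by simp
    finally show ?thesis .
  qed
  have 2: "RUnit C z \<boxdot> Idn C y = (Idn C z \<boxdot> LUnit C y) \<cdot> Assoc C z (Unit C) y"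
    by (rule triangle_coherence[symmetric]) simp_all
  have 3: "Assoc C z (Unit C) y \<cdot> ((Idn C z \<boxdot> ev) \<boxdot> Idn C y)
      = (Idn C z \<boxdot> (ev \<boxdot> Idn C y)) \<cdot> Assoc C z (y \<boxtimes> x) y"
    using assoc_natural[of "Idn C z" ev "Idn C y"] by simp
  have 4: "Assoc C z y (x \<boxtimes> y) \<cdot> (Idn C (z \<boxtimes> y) \<boxdot> coev)
      = (Idn C z \<boxdot> (Idn C y \<boxdot> coev)) \<cdot> Assoc C z y (Unit C)"
    using assoc_natural[of "Idn C z" "Idn C y" coev] by (simp add: tar_idn)
  have "(dual_counit z \<boxdot> Idn C y) \<cdot> dual_unit (z \<boxtimes> y)
      = (Idn C z \<boxdot> LUnit C y) \<cdot> ((Assoc C z (Unit C) y \<cdot> ((Idn C z \<boxdot> ev) \<boxdot> Idn C y)) \<cdot>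
          ((Assoc C z y x \<boxdot> Idn C y) \<cdot> (A' (z \<boxtimes> y) x y \<cdot> ?r)))"
    unfolding 0 by (simp add: dual_unit_def 2)
  also have "\<dots> = (Idn C z \<boxdot> LUnit C y) \<cdot> ((Idn C z \<boxdot> (ev \<boxdot> Idn C y)) \<cdot>
      ((Assoc C z (y \<boxtimes> x) y \<cdot> ((Assoc C z y x \<boxdot> Idn C y) \<cdot> A' (z \<boxtimes> y) x y)) \<cdot> ?r))"
    unfolding 3 by simp
  also have "\<dots> = (Idn C z \<boxdot> LUnit C y) \<cdot> ((Idn C z \<boxdot> (ev \<boxdot> Idn C y)) \<cdot> ((Idn C z \<boxdot> A' y x y) \<cdot>
      ((Assoc C z y (x \<boxtimes> y) \<cdot> (Idn C (z \<boxtimes> y) \<boxdot> coev)) \<cdot> R' (z \<boxtimes> y))))"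
    unfolding 1 by simp
  also have "\<dots> = ((Idn C z \<boxdot> LUnit C y) \<cdot> ((Idn C z \<boxdot> (ev \<boxdot> Idn C y)) \<cdot> ((Idn C z \<boxdot> A' y x y) \<cdot>
      (Idn C z \<boxdot> (Idn C y \<boxdot> coev))))) \<cdot> (Assoc C z y (Unit C) \<cdot> R' (z \<boxtimes> y))"
    unfolding 4 by simp
  also have "(Idn C z \<boxdot> LUnit C y) \<cdot> ((Idn C z \<boxdot> (ev \<boxdot> Idn C y)) \<cdot> ((Idn C z \<boxdot> A' y x y) \<cdot>
      (Idn C z \<boxdot> (Idn C y \<boxdot> coev)))) = Idn C z \<boxdot> RUnit C y"
    by (simp add: whisker_left zigzag2)
  also have "(Idn C z \<boxdot> RUnit C y) \<cdot> (Assoc C z y (Unit C) \<cdot> R' (z \<boxtimes> y))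
      = ((Idn C z \<boxdot> RUnit C y) \<cdot> Assoc C z y (Unit C)) \<cdot> R' (z \<boxtimes> y)"
    by simp
  also have "\<dots> = Idn C (z \<boxtimes> y)"
    unfolding RUnit_tensor[OF z y] by simp
  finally show ?thesis .
qed

lemma dual_adjunction: "dual_adjunction C x y dual_counit dual_unit"
  unfolding dual_adjunction_def
proof (intro conjI ballI allI)
  fix z assume "z \<in> Obj C"
  thus "dual_counit z \<in> Hom C ((z \<boxtimes> y) \<boxtimes> x) z" "dual_unit z \<in> Hom C z ((z \<boxtimes> x) \<boxtimes> y)"
    "dual_counit (z \<boxtimes> x) \<cdot> (dual_unit z \<boxdot> Idn C x) = Idn C (z \<boxtimes> x)"
    "(dual_counit z \<boxdot> Idn C y) \<cdot> dual_unit (z \<boxtimes> y) = Idn C (z \<boxtimes> y)"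
    using triangle1 triangle2 by (auto simp: Hom_iff counit_simps dual_simps)
next
  fix z z' f assume "f \<in> Hom C z z'"
  thus "dual_counit z' \<cdot> ((f \<boxdot> Idn C y) \<boxdot> Idn C x) = f \<cdot> dual_counit z"
    "dual_unit z' \<cdot> f = ((f \<boxdot> Idn C x) \<boxdot> Idn C y) \<cdot> dual_unit z"
    using counit_natural[of f] unit_natural[of f] by (auto simp: Hom_iff)
qed

text \<open>The first zigzag identity read as a splitting. That x is a retract of x \<otimes> y
  \<otimes> x is what allows annihilation by x to be tested after further factors of x have been
  added.\<close>

lemma dual_retract:
  obtains i r where "i \<in> Hom C x ((x \<boxtimes> y) \<boxtimes> x)" "r \<in> Hom C ((x \<boxtimes> y) \<boxtimes> x) x" "r \<cdot> i = Idn C x"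
proof
  note [simp] = dual_simps
  let ?l = "inverse_mor C (LUnit C x)"
  have l: "?l \<in> Mor C" "Dom C ?l = x" "Cod C ?l = Unit C \<boxtimes> x" "LUnit C x \<cdot> ?l = Idn C x"
    using inverse_mor[of "LUnit C x"] lunit_iso[OF x] by (auto simp: Hom_iff)
  show "(coev \<boxdot> Idn C x) \<cdot> ?l \<in> Hom C x ((x \<boxtimes> y) \<boxtimes> x)"
    "RUnit C x \<cdot> ((Idn C x \<boxdot> ev) \<cdot> Assoc C x y x) \<in> Hom C ((x \<boxtimes> y) \<boxtimes> x) x"
    using l by (auto simp: Hom_iff)
  have "(RUnit C x \<cdot> ((Idn C x \<boxdot> ev) \<cdot> Assoc C x y x)) \<cdot> ((coev \<boxdot> Idn C x) \<cdot> ?l)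
      = (RUnit C x \<cdot> ((Idn C x \<boxdot> ev) \<cdot> (Assoc C x y x \<cdot> (coev \<boxdot> Idn C x)))) \<cdot> ?l"
    using l by simp
  also have "\<dots> = Idn C x"
    unfolding zigzag1 by (rule l)
  finally show "(RUnit C x \<cdot> ((Idn C x \<boxdot> ev) \<cdot> Assoc C x y x)) \<cdot> ((coev \<boxdot> Idn C x) \<cdot> ?l) = Idn C x" .
qed

end

lemma rigidE:
  assumes "rigid C x"
  obtains y \<epsilon> \<eta> i r where "y \<in> Obj C" "dual_adjunction C x y \<epsilon> \<eta>"
    "i \<in> Hom C x ((x \<boxtimes> y) \<boxtimes> x)" "r \<in> Hom C ((x \<boxtimes> y) \<boxtimes> x) x" "r \<cdot> i = Idn C x"
proof -
  from assms obtain y ev coev where *: "x \<in> Obj C" "y \<in> Obj C" "ev \<in> Hom C (y \<boxtimes> x) (Unit C)"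
    "coev \<in> Hom C (Unit C) (x \<boxtimes> y)"
    "RUnit C x \<cdot> ((Idn C x \<boxdot> ev) \<cdot> (Assoc C x y x \<cdot> (coev \<boxdot> Idn C x))) = LUnit C x"
    "LUnit C y \<cdot> ((ev \<boxdot> Idn C y) \<cdot> (inverse_mor C (Assoc C y x y) \<cdot> (Idn C y \<boxdot> coev))) = RUnit C y"
    unfolding rigid_def by blast
  obtain i r where "i \<in> Hom C x ((x \<boxtimes> y) \<boxtimes> x)" "r \<in> Hom C ((x \<boxtimes> y) \<boxtimes> x) x" "r \<cdot> i = Idn C x"
    using dual_retract[OF *] .
  thus ?thesis
    using that dual_adjunction[OF *] *(2) by blast
qed

end


context triangulated_category
begin

lemma localizing_coproduct:
  assumes S: "localizing_subcat T S" and I: "small (Univ T) I" and X: "\<And>i. i \<in> I \<Longrightarrow> X i \<in> S"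
    and c: "is_coproduct T I X c \<iota>"
  shows "c \<in> S"
proof -
  obtain e :: "'a \<Rightarrow> 'u" where e: "inj_on e I" "small (Univ T) (e ` I)"
    using small_inj[OF I] .
  have "\<forall>i \<in> e ` I. (X \<circ> inv_into I e) i \<in> S"
    using X e(1) by simp
  from S[unfolded localizing_subcat_def, THEN conjunct2, rule_format,
      OF conjI[OF e(2) conjI[OF this coproduct_reindex[OF c e(1)]]]]
  show ?thesis .
qed

end

section \<open>Tensor products up to isomorphism\<close>

context symmetric_monoidal
begin

lemma isomorphic_tensor:
  assumes "isomorphic C x x'" "isomorphic C y y'"
  shows "isomorphic C (x \<boxtimes> y) (x' \<boxtimes> y')"
proof -
  obtain f f' where f: "f \<in> Hom C x x'" "f' \<in> Hom C x' x" "f' \<cdot> f = Idn C x" "f \<cdot> f' = Idn C x'"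
    using assms(1) by (rule isomorphicE)
  obtain g g' where g: "g \<in> Hom C y y'" "g' \<in> Hom C y' y" "g' \<cdot> g = Idn C y" "g \<cdot> g' = Idn C y'"
    using assms(2) by (rule isomorphicE)
  have obj: "x \<in> Obj C" "x' \<in> Obj C" "y \<in> Obj C" "y' \<in> Obj C"
    using isomorphic_Obj[OF assms(1)] isomorphic_Obj[OF assms(2)] by simp_all
  show ?thesis
  proof (rule isomorphicI)
    show "f \<boxdot> g \<in> Hom C (x \<boxtimes> y) (x' \<boxtimes> y')" "f' \<boxdot> g' \<in> Hom C (x' \<boxtimes> y') (x \<boxtimes> y)"
      using tar_in[OF f(1) g(1)] tar_in[OF f(2) g(2)] by simp_all
    show "(f' \<boxdot> g') \<cdot> (f \<boxdot> g) = Idn C (x \<boxtimes> y)"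
      unfolding tar_cmp[OF f(1,2) g(1,2), symmetric] f(3) g(3) by (rule tar_idn[OF obj(1,3)])
    show "(f \<boxdot> g) \<cdot> (f' \<boxdot> g') = Idn C (x' \<boxtimes> y')"
      unfolding tar_cmp[OF f(2,1) g(2,1), symmetric] f(4) g(4) by (rule tar_idn[OF obj(2,4)])
  qed
qed

lemma isomorphic_assoc:
  "x \<in> Obj C \<Longrightarrow> y \<in> Obj C \<Longrightarrow> z \<in> Obj C \<Longrightarrow> isomorphic C ((x \<boxtimes> y) \<boxtimes> z) (x \<boxtimes> (y \<boxtimes> z))"
  using assoc_iso unfolding isomorphic_def by blast

lemma isomorphic_braid:
  "x \<in> Obj C \<Longrightarrow> y \<in> Obj C \<Longrightarrow> isomorphic C (x \<boxtimes> y) (y \<boxtimes> x)"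
  using braid_in braid_sym by (intro isomorphicI[of "Braid C x y" _ _ "Braid C y x"]) auto

lemma isomorphic_Unit: "x \<in> Obj C \<Longrightarrow> isomorphic C (x \<boxtimes> Unit C) x"
  using runit_iso unfolding isomorphic_def by blast

text \<open>Isomorphism classes form a commutative semigroup, so that isomorphisms between iterated tensor
  products are found by rewriting.\<close>
definition iso_class :: "'o \<Rightarrow> 'o set" where
  "iso_class x = {z. isomorphic C x z}"

definition class_tensor :: "'o set \<Rightarrow> 'o set \<Rightarrow> 'o set" where
  "class_tensor A B = {z. \<exists>a \<in> A. \<exists>b \<in> B. a \<in> Obj C \<and> b \<in> Obj C \<and> isomorphic C (a \<boxtimes> b) z}"

lemma isomorphic_iff_class:
  assumes "y \<in> Obj C"
  shows "isomorphic C x y \<longleftrightarrow> iso_class x = iso_class y"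
proof
  assume "isomorphic C x y"
  thus "iso_class x = iso_class y"
    using isomorphic_trans isomorphic_sym unfolding iso_class_def by blast
next
  assume "iso_class x = iso_class y"
  thus "isomorphic C x y"
    using isomorphic_refl[OF assms] unfolding iso_class_def by blast
qed

lemma iso_class_tensor:
  assumes "x \<in> Obj C" "y \<in> Obj C"
  shows "iso_class (x \<boxtimes> y) = class_tensor (iso_class x) (iso_class y)"
proof (intro equalityI subsetI)
  fix z assume "z \<in> iso_class (x \<boxtimes> y)"
  thus "z \<in> class_tensor (iso_class x) (iso_class y)"
    using assms isomorphic_refl unfolding iso_class_def class_tensor_def by blast
next
  fix z assume "z \<in> class_tensor (iso_class x) (iso_class y)"
  then obtain a b where "isomorphic C x a" "isomorphic C y b" "isomorphic C (a \<boxtimes> b) z"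
    unfolding iso_class_def class_tensor_def by blast
  thus "z \<in> iso_class (x \<boxtimes> y)"
    using isomorphic_trans[OF isomorphic_tensor] unfolding iso_class_def by blast
qed

lemma class_tensor_commute: "class_tensor A B = class_tensor B A"
proof -
  have "class_tensor A B \<subseteq> class_tensor B A" for A B
    using isomorphic_trans[OF isomorphic_braid] unfolding class_tensor_def by blast
  thus ?thesis
    by blast
qed

lemma class_tensor_assoc: "class_tensor (class_tensor A B) D = class_tensor A (class_tensor B D)"
proof (intro equalityI subsetI)
  fix z assume "z \<in> class_tensor (class_tensor A B) D"
  then obtain a b ab d where *: "a \<in> A" "b \<in> B" "d \<in> D" "a \<in> Obj C" "b \<in> Obj C" "d \<in> Obj C"
    "isomorphic C (a \<boxtimes> b) ab" "isomorphic C (ab \<boxtimes> d) z"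
    unfolding class_tensor_def by blast
  have "isomorphic C ((a \<boxtimes> b) \<boxtimes> d) z"
    by (rule isomorphic_trans[OF isomorphic_tensor[OF *(7) isomorphic_refl[OF *(6)]] *(8)])
  hence "isomorphic C (a \<boxtimes> (b \<boxtimes> d)) z"
    using isomorphic_trans isomorphic_sym isomorphic_assoc[OF *(4-6)] by blast
  moreover have "b \<boxtimes> d \<in> class_tensor B D"
    using * isomorphic_refl[of "b \<boxtimes> d"] unfolding class_tensor_def by auto
  ultimately show "z \<in> class_tensor A (class_tensor B D)"
    using * tob_Obj[of b d] unfolding class_tensor_def[of A] by blast
next
  fix z assume "z \<in> class_tensor A (class_tensor B D)"
  then obtain a b bd d where *: "a \<in> A" "b \<in> B" "d \<in> D" "a \<in> Obj C" "b \<in> Obj C" "d \<in> Obj C"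
    "isomorphic C (b \<boxtimes> d) bd" "isomorphic C (a \<boxtimes> bd) z"
    unfolding class_tensor_def by blast
  have "isomorphic C (a \<boxtimes> (b \<boxtimes> d)) z"
    by (rule isomorphic_trans[OF isomorphic_tensor[OF isomorphic_refl[OF *(4)] *(7)] *(8)])
  hence "isomorphic C ((a \<boxtimes> b) \<boxtimes> d) z"
    using isomorphic_trans isomorphic_assoc[OF *(4-6)] by blast
  moreover have "a \<boxtimes> b \<in> class_tensor A B"
    using * isomorphic_refl[of "a \<boxtimes> b"] unfolding class_tensor_def by auto
  ultimately show "z \<in> class_tensor (class_tensor A B) D"
    using * tob_Obj[of a b] unfolding class_tensor_def[of "class_tensor A B"] by blast
qed

lemma class_tensor_left_commute: "class_tensor A (class_tensor B D) = class_tensor B (class_tensor A D)"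
  by (metis class_tensor_assoc class_tensor_commute)

lemmas iso_class_simps = isomorphic_iff_class iso_class_tensor
  class_tensor_assoc class_tensor_commute class_tensor_left_commute

end


section \<open>The tensor product of a tensor triangulated category\<close>

context tensor_triangulated_category
begin

lemma tensor_Zero:
  assumes g: "g \<in> Hom T y y'" and x: "x \<in> Obj T" "x' \<in> Obj T"
  shows "Zero T x x' \<boxdot> g = Zero T (x \<boxtimes> y) (x' \<boxtimes> y')"
proof (rule Add_idem)
  have Z: "Zero T x x' \<in> Hom T x x'"
    by (rule Zero_Hom[OF x])
  thus "Zero T x x' \<boxdot> g \<in> Hom T (x \<boxtimes> y) (x' \<boxtimes> y')"
    using g by (rule tar_in)
  have "Add T (Zero T x x' \<boxdot> g) (Zero T x x' \<boxdot> g) = Add T (Zero T x x') (Zero T x x') \<boxdot> g"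
    using tensor_add[OF Z Z g] by simp
  thus "Add T (Zero T x x' \<boxdot> g) (Zero T x x' \<boxdot> g) = Zero T x x' \<boxdot> g"
    using x by simp
qed

lemma is_zero_tensor:
  assumes x: "is_zero T x" and y: "y \<in> Obj T"
  shows "is_zero T (x \<boxtimes> y)"
proof -
  have xO: "x \<in> Obj T"
    using x by (simp add: is_zero_def)
  have "Idn T (x \<boxtimes> y) = Zero T x x \<boxdot> Idn T y"
    using tar_idn[OF xO y] x by (simp add: is_zero_iff)
  also have "\<dots> = Zero T (x \<boxtimes> y) (x \<boxtimes> y)"
    by (rule tensor_Zero[OF idn_in[OF y] xO xO])
  finally show ?thesis
    using xO y by (simp add: is_zero_iff)
qed

lemma is_zero_retract_tensor:
  assumes i: "i \<in> Hom T x w" "r \<in> Hom T w x" "r \<cdot> i = Idn T x"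
    and M: "M \<in> Obj T" and z: "is_zero T (w \<boxtimes> M)"
  shows "is_zero T (x \<boxtimes> M)"
proof (rule is_zero_retract[OF z])
  show "i \<boxdot> Idn T M \<in> Hom T (x \<boxtimes> M) (w \<boxtimes> M)" "r \<boxdot> Idn T M \<in> Hom T (w \<boxtimes> M) (x \<boxtimes> M)"
    using tar_in[OF i(1) idn_in[OF M]] tar_in[OF i(2) idn_in[OF M]] by simp_all
  have "x \<in> Obj T"
    using i(1) Hom_Obj by blast
  thus "(r \<boxdot> Idn T M) \<cdot> (i \<boxdot> Idn T M) = Idn T (x \<boxtimes> M)"
    using i M by (simp add: Hom_iff whisker_right tar_idn)
qed

text \<open>The connecting map passes through the isomorphism of \<Sigma> x \<otimes> y with
  \<Sigma> (x \<otimes> y); closure under cones only asks that some such map exists.\<close>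

lemma tensor_dist:
  assumes "(f, g, h) \<in> Dist T" "y \<in> Obj T"
  obtains h' where "(f \<boxdot> Idn T y, g \<boxdot> Idn T y, h') \<in> Dist T"
proof -
  from tensor_exact obtain e :: "'o \<Rightarrow> 'o \<Rightarrow> 'm" where
    "\<forall>f g h. \<forall>y \<in> Obj T. (f, g, h) \<in> Dist T \<longrightarrow>
       (f \<boxdot> Idn T y, g \<boxdot> Idn T y, e (Dom T f) y \<cdot> (h \<boxdot> Idn T y)) \<in> Dist T"
    unfolding tensor_exact_def by (elim exE conjE)
  thus ?thesis
    using assms that by blast
qed

lemma susp_tensor:
  assumes "x \<in> Obj T" "y \<in> Obj T"
  shows "isomorphic T (susp_ob T x \<boxtimes> y) (susp_ob T (x \<boxtimes> y))"
proof -
  from tensor_exact obtain e :: "'o \<Rightarrow> 'o \<Rightarrow> 'm" where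
    "\<forall>x \<in> Obj T. \<forall>y \<in> Obj T.
        e x y \<in> Hom T (susp_ob T x \<boxtimes> y) (susp_ob T (x \<boxtimes> y)) \<and> is_iso T (e x y)"
    unfolding tensor_exact_def by (elim exE conjE)
  thus ?thesis
    using assms unfolding isomorphic_def by blast
qed

text \<open>A map k -> z \<otimes> y is recovered from its transpose k \<otimes> x -> z by a
  triangle identity, so it vanishes with the transpose.\<close>

lemma dual_Hom_Zero:
  assumes adj: "dual_adjunction T x y \<epsilon> \<eta>" and O: "x \<in> Obj T" "y \<in> Obj T" "z \<in> Obj T"
    and Z: "\<forall>g \<in> Hom T (k \<boxtimes> x) z. g = Zero T (k \<boxtimes> x) z" and f: "f \<in> Hom T k (z \<boxtimes> y)"
  shows "f = Zero T k (z \<boxtimes> y)"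
proof -
  have k: "k \<in> Obj T"
    using f Hom_Obj by blast
  note [simp] = O k
  have fs [simp]: "f \<in> Mor T" "Dom T f = k" "Cod T f = z \<boxtimes> y"
    using f by (auto simp: Hom_iff)
  have adj': "\<epsilon> z \<in> Hom T ((z \<boxtimes> y) \<boxtimes> x) z" "\<eta> k \<in> Hom T k ((k \<boxtimes> x) \<boxtimes> y)"
    "\<eta> (z \<boxtimes> y) \<in> Hom T (z \<boxtimes> y) (((z \<boxtimes> y) \<boxtimes> x) \<boxtimes> y)"
    "(\<epsilon> z \<boxdot> Idn T y) \<cdot> \<eta> (z \<boxtimes> y) = Idn T (z \<boxtimes> y)"
    "\<eta> (z \<boxtimes> y) \<cdot> f = ((f \<boxdot> Idn T x) \<boxdot> Idn T y) \<cdot> \<eta> k"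
    using adj f unfolding dual_adjunction_def by auto
  note m [simp] = adj'(1-3)[unfolded Hom_iff]
  have "\<epsilon> z \<cdot> (f \<boxdot> Idn T x) \<in> Hom T (k \<boxtimes> x) z"
    by (simp add: Hom_iff)
  hence 0: "\<epsilon> z \<cdot> (f \<boxdot> Idn T x) = Zero T (k \<boxtimes> x) z"
    using Z by blast
  have "f = ((\<epsilon> z \<boxdot> Idn T y) \<cdot> \<eta> (z \<boxtimes> y)) \<cdot> f"
    unfolding adj'(4) by simp
  also have "\<dots> = (\<epsilon> z \<boxdot> Idn T y) \<cdot> (((f \<boxdot> Idn T x) \<boxdot> Idn T y) \<cdot> \<eta> k)"
    by (simp add: adj'(5)[symmetric] del: adj'(4))
  also have "\<dots> = ((\<epsilon> z \<cdot> (f \<boxdot> Idn T x)) \<boxdot> Idn T y) \<cdot> \<eta> k"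
    by (simp flip: whisker_right)
  also have "\<dots> = Zero T k (z \<boxtimes> y)"
    unfolding 0 tensor_Zero[OF idn_in[OF O(2)] tob_Obj[OF k O(1)] O(3)] by simp
  finally show ?thesis .
qed

end

section \<open>Tensoring with a fixed object, and rigidity\<close>

context rigidly_compactly_generated
begin

text \<open>Closedness makes - \<otimes> y a left adjoint: maps out of c \<otimes> y are transposed
  to maps out of c, where the universal property is known.\<close>

lemma coproduct_tensor:
  assumes c: "is_coproduct T I X c \<iota>" and y: "y \<in> Obj T"
  shows "is_coproduct T I (\<lambda>i. X i \<boxtimes> y) (c \<boxtimes> y) (\<lambda>i. \<iota> i \<boxdot> Idn T y)"
proof -
  have curry: "\<exists>h \<in> Obj T. \<exists>e \<in> Hom T (h \<boxtimes> y) z. \<forall>x \<in> Obj T. \<forall>f \<in> Hom T (x \<boxtimes> y) z.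
      \<exists>!g. g \<in> Hom T x h \<and> e \<cdot> (g \<boxdot> Idn T y) = f" if "z \<in> Obj T" for z
    using closed y that unfolding closed_monoidal_def by blast
  note cO = coproduct_in(1)[OF c]
  have split: "(e \<cdot> (g \<boxdot> Idn T y)) \<cdot> (\<iota> i \<boxdot> Idn T y) = e \<cdot> ((g \<cdot> \<iota> i) \<boxdot> Idn T y)"
    if "e \<in> Hom T (h \<boxtimes> y) z" "g \<in> Hom T c h" "i \<in> I" for e g h z i
    using coproduct_in(2)[OF c that(3)] that(1,2) y by (simp add: Hom_iff whisker_right)
  show ?thesis
  proof (rule coproductI)
    show "c \<boxtimes> y \<in> Obj T"
      using cO y by simp
    show "\<iota> i \<boxdot> Idn T y \<in> Hom T (X i \<boxtimes> y) (c \<boxtimes> y)" if "i \<in> I" for i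
      by (rule tar_in[OF coproduct_in(2)[OF c that] idn_in[OF y]])
  next
    fix z f assume z: "z \<in> Obj T" and f: "\<And>i. i \<in> I \<Longrightarrow> f i \<in> Hom T (X i \<boxtimes> y) z"
    obtain h e where h: "h \<in> Obj T" "e \<in> Hom T (h \<boxtimes> y) z"
      and u: "\<forall>x \<in> Obj T. \<forall>f \<in> Hom T (x \<boxtimes> y) z. \<exists>!g. g \<in> Hom T x h \<and> e \<cdot> (g \<boxdot> Idn T y) = f"
      using curry[OF z] by blast
    have "\<forall>i \<in> I. \<exists>g. g \<in> Hom T (X i) h \<and> e \<cdot> (g \<boxdot> Idn T y) = f i"
      using u f coproduct_in(3)[OF c] by blast
    from bchoice[OF this] obtain g
      where g: "\<And>i. i \<in> I \<Longrightarrow> g i \<in> Hom T (X i) h" "\<And>i. i \<in> I \<Longrightarrow> e \<cdot> (g i \<boxdot> Idn T y) = f i"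
      by blast
    obtain k where k: "k \<in> Hom T c h" "\<forall>i \<in> I. k \<cdot> \<iota> i = g i"
      using coproduct_ex[OF c g(1) h(1)] by blast
    have "(e \<cdot> (k \<boxdot> Idn T y)) \<cdot> (\<iota> i \<boxdot> Idn T y) = f i" if "i \<in> I" for i
      using split[OF h(2) k(1) that] k(2) g(2) that by simp
    moreover have "e \<cdot> (k \<boxdot> Idn T y) \<in> Hom T (c \<boxtimes> y) z"
      by (rule cmp_in[OF tar_in[OF k(1) idn_in[OF y]] h(2)])
    ultimately show "\<exists>h \<in> Hom T (c \<boxtimes> y) z. \<forall>i \<in> I. h \<cdot> (\<iota> i \<boxdot> Idn T y) = f i"
      by blast
  next
    fix z f f' assume f: "f \<in> Hom T (c \<boxtimes> y) z" "f' \<in> Hom T (c \<boxtimes> y) z"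
      and eq: "\<And>i. i \<in> I \<Longrightarrow> f \<cdot> (\<iota> i \<boxdot> Idn T y) = f' \<cdot> (\<iota> i \<boxdot> Idn T y)"
    have z: "z \<in> Obj T"
      using f Hom_Obj by blast
    obtain h e where h: "h \<in> Obj T" "e \<in> Hom T (h \<boxtimes> y) z"
      and u: "\<forall>x \<in> Obj T. \<forall>f \<in> Hom T (x \<boxtimes> y) z. \<exists>!g. g \<in> Hom T x h \<and> e \<cdot> (g \<boxdot> Idn T y) = f"
      using curry[OF z] by blast
    obtain g where g: "g \<in> Hom T c h" "e \<cdot> (g \<boxdot> Idn T y) = f"
      using u f(1) cO by blast
    obtain g' where g': "g' \<in> Hom T c h" "e \<cdot> (g' \<boxdot> Idn T y) = f'"
      using u f(2) cO by blast
    have "g = g'"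
    proof (rule coproduct_eqI[OF c g(1) g'(1)])
      fix i assume i: "i \<in> I"
      note ti = coproduct_in(2,3)[OF c i]
      have gi: "g \<cdot> \<iota> i \<in> Hom T (X i) h" "g' \<cdot> \<iota> i \<in> Hom T (X i) h"
        using cmp_in[OF ti(1)] g(1) g'(1) by auto
      have e: "e \<cdot> ((g \<cdot> \<iota> i) \<boxdot> Idn T y) = e \<cdot> ((g' \<cdot> \<iota> i) \<boxdot> Idn T y)"
        using split[OF h(2) g(1) i] split[OF h(2) g'(1) i] g(2) g'(2) eq[OF i] by simp
      have "e \<cdot> ((g \<cdot> \<iota> i) \<boxdot> Idn T y) \<in> Hom T (X i \<boxtimes> y) z"
        by (rule cmp_in[OF tar_in[OF gi(1) idn_in[OF y]] h(2)])
      thus "g \<cdot> \<iota> i = g' \<cdot> \<iota> i"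
        using u ti(2) gi e by metis
    qed
    thus "f = f'"
      using g(2) g'(2) by simp
  qed
qed

text \<open>A preimage under the exact functor - \<otimes> y. It is applied to thick ideals, to the
  zero objects and to the localizing ideal of the final argument.\<close>

lemma triangulated_tensor:
  assumes tri: "triangulated_subcat T S" and y: "y \<in> Obj T"
  shows "triangulated_subcat T {z \<in> Obj T. z \<boxtimes> y \<in> S}" (is "triangulated_subcat T ?S")
proof (rule triangulated_subcatI)
  fix z assume "is_zero T z"
  thus "z \<in> ?S"
    using is_zero_tensor[OF _ y] tri_subD(2)[OF tri] by (auto simp: is_zero_def)
next
  fix x z assume "x \<in> ?S" and iso: "isomorphic T x z"
  thus "z \<in> ?S"
    using tri_subD(3)[OF tri isomorphic_tensor[OF iso isomorphic_refl[OF y]]] isomorphic_Obj[OF iso]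
    by simp
next
  fix x assume "x \<in> ?S"
  thus "susp_ob T x \<in> ?S"
    using tri_subD(3)[OF tri susp_tensor[OF _ y]] tri_subD(4)[OF tri, of "x \<boxtimes> y"] y by simp
next
  fix x assume "x \<in> Obj T" "susp_ob T x \<in> ?S"
  thus "x \<in> ?S"
    using tri_subD(3)[OF tri susp_tensor[OF _ y]] tri_subD(4)[OF tri, of "x \<boxtimes> y"] y by simp
next
  fix f g h assume dist: "(f, g, h) \<in> Dist T" and fS: "Dom T f \<in> ?S" "Cod T f \<in> ?S"
  note D = dist_simps[OF dist]
  obtain h' where h': "(f \<boxdot> Idn T y, g \<boxdot> Idn T y, h') \<in> Dist T"
    using tensor_dist[OF dist y] .
  show "Cod T g \<in> ?S"
    using tri_subD(5)[OF tri h'] fS D y by simp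
qed auto

lemma localizing_tensor:
  assumes S: "localizing_subcat T S" and y: "y \<in> Obj T"
  shows "localizing_subcat T {z \<in> Obj T. z \<boxtimes> y \<in> S}" (is "localizing_subcat T ?S")
proof -
  have "triangulated_subcat T ?S"
    using triangulated_tensor[OF _ y] S by (simp add: localizing_subcat_def)
  moreover have "c \<in> ?S"
    if I: "small (Univ T) I" and X: "\<forall>i \<in> I. X i \<in> ?S" and c: "is_coproduct T I X c \<iota>"
    for I :: "'u set" and X c \<iota>
  proof -
    have "c \<boxtimes> y \<in> S"
      by (rule localizing_coproduct[OF S I _ coproduct_tensor[OF c y]]) (use X in blast)
    thus ?thesis
      using coproduct_in(1)[OF c] by blast
  qed
  ultimately show ?thesis
    unfolding localizing_subcat_def by blast
qed

text \<open>A map w \<otimes> x -> c is transposed to w -> c \<otimes> y, where y is dual to x. As -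
  \<otimes> y preserves coproducts and w is compact, the transpose is finitely supported.\<close>

lemma compact_tensor:
  assumes w: "compact_obj T w" and x: "compact_obj T x"
  shows "compact_obj T (w \<boxtimes> x)"
proof (rule compactI)
  note wO = compact_Obj[OF w] and xO = compact_Obj[OF x]
  thus "w \<boxtimes> x \<in> Obj T"
    by simp
  obtain y \<epsilon> \<eta> i r where yO: "y \<in> Obj T" and adj: "dual_adjunction T x y \<epsilon> \<eta>"
    using x compact_iff_rigid by (metis rigidE)
  fix I :: "'u set" and X c \<iota> f
  assume I: "small (Univ T) I" and c: "is_coproduct T I X c \<iota>" and f: "f \<in> Hom T (w \<boxtimes> x) c"
  note cO = coproduct_in(1)[OF c]
  note [simp] = wO xO yO cO
  have fs [simp]: "f \<in> Mor T" "Dom T f = w \<boxtimes> x" "Cod T f = c"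
    using f by (auto simp: Hom_iff)
  note adj' = adj[unfolded dual_adjunction_def, THEN conjunct1, rule_format]
    and nat = adj[unfolded dual_adjunction_def, THEN conjunct2, rule_format]
  have m: "\<epsilon> c \<in> Hom T ((c \<boxtimes> y) \<boxtimes> x) c" "\<epsilon> (w \<boxtimes> x) \<in> Hom T (((w \<boxtimes> x) \<boxtimes> y) \<boxtimes> x) (w \<boxtimes> x)"
    "\<eta> w \<in> Hom T w ((w \<boxtimes> x) \<boxtimes> y)"
    using adj'[of c] adj'[of w] adj'[of "w \<boxtimes> x"] by auto
  note ms [simp] = m[unfolded Hom_iff]
  define f' where "f' = (f \<boxdot> Idn T y) \<cdot> \<eta> w"
  have f': "f' \<in> Hom T w (c \<boxtimes> y)"
    by (simp add: f'_def Hom_iff)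
  note f's [simp] = f'[unfolded Hom_iff]
  have f_eq: "\<epsilon> c \<cdot> (f' \<boxdot> Idn T x) = f"
  proof -
    have "\<epsilon> c \<cdot> (f' \<boxdot> Idn T x) = (\<epsilon> c \<cdot> ((f \<boxdot> Idn T y) \<boxdot> Idn T x)) \<cdot> (\<eta> w \<boxdot> Idn T x)"
      by (simp add: f'_def whisker_right)
    also have "\<epsilon> c \<cdot> ((f \<boxdot> Idn T y) \<boxdot> Idn T x) = f \<cdot> \<epsilon> (w \<boxtimes> x)"
      using nat[OF f] by simp
    also have "(f \<cdot> \<epsilon> (w \<boxtimes> x)) \<cdot> (\<eta> w \<boxdot> Idn T x) = f \<cdot> (\<epsilon> (w \<boxtimes> x) \<cdot> (\<eta> w \<boxdot> Idn T x))"
      by (rule cmp_assoc') simp_all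
    also have "\<epsilon> (w \<boxtimes> x) \<cdot> (\<eta> w \<boxdot> Idn T x) = Idn T (w \<boxtimes> x)"
      using adj'[of w] by simp
    finally show ?thesis
      by simp
  qed
  note cy = coproduct_tensor[OF c yO]
  obtain F where "supported I (\<lambda>i. X i \<boxtimes> y) (c \<boxtimes> y) (\<lambda>i. \<iota> i \<boxdot> Idn T y) F f'"
    using compact_supported[OF w I cy f'] .
  then obtain q where F: "finite F" "F \<subseteq> I" and qf: "q \<cdot> f' = f'"
    and q: "cut I (\<lambda>i. X i \<boxtimes> y) (c \<boxtimes> y) (\<lambda>i. \<iota> i \<boxdot> Idn T y) F q"
    unfolding supported_def by blast
  obtain p where p: "cut I X c \<iota> F p"
    using ex_cut[OF c] by blast
  have pH: "p \<in> Hom T c c" and qH: "q \<in> Hom T (c \<boxtimes> y) (c \<boxtimes> y)"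
    using p q by (auto simp: cut_def)
  note pqs [simp] = pH[unfolded Hom_iff] qH[unfolded Hom_iff]
  have "(p \<boxdot> Idn T y) \<cdot> (\<iota> i \<boxdot> Idn T y) = (if i \<in> F then \<iota> i \<boxdot> Idn T y else Zero T (X i \<boxtimes> y) (c \<boxtimes> y))"
    if i: "i \<in> I" for i
  proof -
    have "(p \<boxdot> Idn T y) \<cdot> (\<iota> i \<boxdot> Idn T y) = (p \<cdot> \<iota> i) \<boxdot> Idn T y"
      using coproduct_in(2)[OF c i] by (simp add: Hom_iff whisker_right)
    thus ?thesis
      using p i tensor_Zero[OF idn_in[OF yO] coproduct_in(3)[OF c i] cO] by (simp add: cut_def)
  qed
  hence "cut I (\<lambda>i. X i \<boxtimes> y) (c \<boxtimes> y) (\<lambda>i. \<iota> i \<boxdot> Idn T y) F (p \<boxdot> Idn T y)"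
    unfolding cut_def by (simp add: Hom_iff)
  from cut_cmp[OF cy q this] have pq: "(p \<boxdot> Idn T y) \<cdot> q = q"
    by simp
  have "(p \<boxdot> Idn T y) \<cdot> f' = (p \<boxdot> Idn T y) \<cdot> (q \<cdot> f')"
    unfolding qf ..
  also have "\<dots> = ((p \<boxdot> Idn T y) \<cdot> q) \<cdot> f'"
    by (rule cmp_assoc'[symmetric]) simp_all
  finally have pf': "(p \<boxdot> Idn T y) \<cdot> f' = f'"
    unfolding pq qf .
  \<comment> \<open>Naturality of the counit moves the cut of c through the transposition, so f
    inherits the finite support of its transpose.\<close>
  have "p \<cdot> f = (p \<cdot> \<epsilon> c) \<cdot> (f' \<boxdot> Idn T x)"
    unfolding f_eq[symmetric] by (rule cmp_assoc'[symmetric]) simp_all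
  also have "p \<cdot> \<epsilon> c = \<epsilon> c \<cdot> ((p \<boxdot> Idn T y) \<boxdot> Idn T x)"
    using nat[OF pH] by simp
  also have "(\<epsilon> c \<cdot> ((p \<boxdot> Idn T y) \<boxdot> Idn T x)) \<cdot> (f' \<boxdot> Idn T x)
      = \<epsilon> c \<cdot> (((p \<boxdot> Idn T y) \<cdot> f') \<boxdot> Idn T x)"
    by (simp add: whisker_right)
  also have "\<dots> = f"
    unfolding pf' by (rule f_eq)
  finally show "\<exists>F. supported I X c \<iota> F f"
    using F p unfolding supported_def by blast
qed

text \<open>Thick ideals, without the conditions which localizations do not need.\<close>
definition compact_ideal :: "'o set \<Rightarrow> bool" where
  "compact_ideal K \<longleftrightarrow> K \<subseteq> compacts T \<and> stable_under_susp K
     \<and> (\<forall>x \<in> K. \<forall>y \<in> compacts T. x \<boxtimes> y \<in> K)"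

text \<open>For compact k the ideal K contains x \<otimes> k, so the transposes k \<otimes> x -> L
  of maps k -> L \<otimes> y vanish. Generation by compact objects then kills L \<otimes> y, and x
  \<otimes> L is a retract of an object with this tensor factor.\<close>

lemma orthogonal_tensor_zero:
  assumes K: "compact_ideal K" and L: "L \<in> right_orthogonal T K" and x: "x \<in> K"
  shows "is_zero T (x \<boxtimes> L)"
proof -
  have KO: "K \<subseteq> Obj T" and xc: "compact_obj T x"
    using K x compact_Obj by (auto simp: compact_ideal_def)
  have LO: "L \<in> Obj T" and xO: "x \<in> Obj T"
    using L x KO by (auto simp: right_orthogonal_def)
  obtain y \<epsilon> \<eta> i r where yO: "y \<in> Obj T" and adj: "dual_adjunction T x y \<epsilon> \<eta>"
    and i: "i \<in> Hom T x ((x \<boxtimes> y) \<boxtimes> x)" "r \<in> Hom T ((x \<boxtimes> y) \<boxtimes> x) x" "r \<cdot> i = Idn T x"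
    using rigidE[of x] xc compact_iff_rigid by metis
  have "is_zero T (L \<boxtimes> y)"
  proof (rule compacts_generate)
    show "L \<boxtimes> y \<in> Obj T"
      using LO yO by simp
    show "\<forall>k \<in> compacts T. Hom T k (L \<boxtimes> y) = {Zero T k (L \<boxtimes> y)}"
    proof
      fix k assume k: "k \<in> compacts T"
      hence kO: "k \<in> Obj T"
        using compact_Obj by simp
      have "x \<boxtimes> k \<in> K"
        using K x k unfolding compact_ideal_def by blast
      hence "k \<boxtimes> x \<in> K"
        using K isomorphic_braid[OF xO kO] unfolding compact_ideal_def stable_under_susp_def by blast
      hence Z: "\<forall>g \<in> Hom T (k \<boxtimes> x) L. g = Zero T (k \<boxtimes> x) L"
        using L right_orthogonal_iff[OF KO] by blast
      show "Hom T k (L \<boxtimes> y) = {Zero T k (L \<boxtimes> y)}"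
        using dual_Hom_Zero[OF adj xO yO LO Z] Hom_eq_Zero_iff[OF kO tob_Obj[OF LO yO]] by blast
    qed
  qed
  \<comment> \<open>Two factors x are added so that, after reordering, the splitting of x off x
    \<otimes> y \<otimes> x applies.\<close>
  hence "is_zero T ((L \<boxtimes> y) \<boxtimes> (x \<boxtimes> x))"
    using is_zero_tensor xO by simp
  moreover have "isomorphic T ((L \<boxtimes> y) \<boxtimes> (x \<boxtimes> x)) (((x \<boxtimes> y) \<boxtimes> x) \<boxtimes> L)"
    using LO xO yO by (simp add: iso_class_simps)
  ultimately have "is_zero T (((x \<boxtimes> y) \<boxtimes> x) \<boxtimes> L)"
    using is_zero_iso by blast
  thus ?thesis
    by (rule is_zero_retract_tensor[OF i LO])
qed

text \<open>x \<otimes> M is a retract of x \<otimes> y \<otimes> x \<otimes> M, which has x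
  \<otimes> x \<otimes> M as a tensor factor.\<close>

lemma radical_zero:
  assumes x: "compact_obj T x" and M: "M \<in> Obj T" and z: "is_zero T ((x \<boxtimes> x) \<boxtimes> M)"
  shows "is_zero T (x \<boxtimes> M)"
proof -
  note xO = compact_Obj[OF x]
  obtain y \<epsilon> \<eta> i r where yO: "y \<in> Obj T"
    and i: "i \<in> Hom T x ((x \<boxtimes> y) \<boxtimes> x)" "r \<in> Hom T ((x \<boxtimes> y) \<boxtimes> x) x" "r \<cdot> i = Idn T x"
    using rigidE[of x] x compact_iff_rigid by metis
  have "is_zero T (((x \<boxtimes> x) \<boxtimes> M) \<boxtimes> y)"
    by (rule is_zero_tensor[OF z yO])
  moreover have "isomorphic T (((x \<boxtimes> x) \<boxtimes> M) \<boxtimes> y) (((x \<boxtimes> y) \<boxtimes> x) \<boxtimes> M)"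
    using M xO yO by (simp add: iso_class_simps)
  ultimately have "is_zero T (((x \<boxtimes> y) \<boxtimes> x) \<boxtimes> M)"
    using is_zero_iso by blast
  thus ?thesis
    by (rule is_zero_retract_tensor[OF i M])
qed


section \<open>Localization at an ideal of compact objects\<close>

lemma small_nat: "small (Univ T) (UNIV :: nat set)"
  using universe ordIso_ordLess_trans[OF card_of_nat] unfolding small_def inaccessible_def by blast

lemma small_subset: "small (Univ T) A \<Longrightarrow> B \<subseteq> A \<Longrightarrow> small (Univ T) B"
  unfolding small_def using ordLeq_ordLess_trans[OF card_of_mono1] by blast

text \<open>Regularity of the universe. It keeps coproducts over all maps out of a small set of
  compact objects small.\<close>

lemma small_UN:
  assumes "small (Univ T) I" "\<And>i. i \<in> I \<Longrightarrow> small (Univ T) (A i)"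
  shows "small (Univ T) (\<Union>i \<in> I. A i)"
proof -
  have "natLeq \<le>o |Univ T|"
    using universe unfolding inaccessible_def by (simp add: ordLess_imp_ordLeq)
  hence "Cinfinite |Univ T|"
    using infinite_iff_natLeq_ordLeq[of "Univ T"] unfolding cinfinite_def Field_card_of
    by (simp only: card_of_card_order_on simp_thms)
  moreover have "regularCard |Univ T|"
    using universe unfolding inaccessible_def by blast
  ultimately show ?thesis
    using card_of_UNION_ordLess_infinite_Field_regularCard[of "|Univ T|" I A] assms
    unfolding small_def by blast
qed

text \<open>K is closed under isomorphism and may be large, so coproducts indexed by maps out of K
  have to range over representatives.\<close>

lemma ideal_representatives:
  assumes "stable_under_susp K" "K \<subseteq> compacts T"
  obtains S where "S \<subseteq> K" "small (Univ T) S" "\<And>x. x \<in> K \<Longrightarrow> \<exists>y \<in> S. isomorphic T x y"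
proof -
  obtain S where S: "small (Univ T) S" "\<forall>x \<in> compacts T. \<exists>y \<in> S. isomorphic T x y"
    using compacts_essentially_small by blast
  have "\<exists>y \<in> S \<inter> K. isomorphic T x y" if x: "x \<in> K" for x
  proof -
    obtain y where y: "y \<in> S" "isomorphic T x y"
      using S(2) assms(2) x by blast
    moreover have "y \<in> K"
      using assms(1) x y(2) unfolding stable_under_susp_def by blast
    ultimately show ?thesis
      by blast
  qed
  moreover have "small (Univ T) (S \<inter> K)"
    by (rule small_subset[OF S(1)]) blast
  ultimately show ?thesis
    using that[of "S \<inter> K"] by blast
qed

text \<open>The mapping telescope, built as the cone of identity minus shift on the coproduct of the
  G n. The conclusion collects what the localization draws on: it stays in localizing subcategories,
  compatible families extend to it, and maps from compact objects factor through a finite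
  stage.\<close>

lemma telescope:
  fixes G :: "nat \<Rightarrow> 'o"
  assumes j: "\<And>n. j n \<in> Hom T (G n) (G (Suc n))"
  shows "\<exists>g q. g \<in> Obj T \<and> (\<forall>n. q n \<in> Hom T (G n) g) \<and> (\<forall>n. q (Suc n) \<cdot> j n = q n)
    \<and> (\<forall>S. localizing_subcat T S \<longrightarrow> (\<forall>n. G n \<in> S) \<longrightarrow> g \<in> S)
    \<and> (\<forall>x p. (\<forall>n. p n \<in> Hom T (G n) x) \<longrightarrow> (\<forall>n. p (Suc n) \<cdot> j n = p n) \<longrightarrow>
        (\<exists>p' \<in> Hom T g x. \<forall>n. p' \<cdot> q n = p n))
    \<and> (\<forall>s f. compact_obj T s \<longrightarrow> f \<in> Hom T s g \<longrightarrow> (\<exists>n. \<exists>v \<in> Hom T s (G n). f = q n \<cdot> v))"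
proof -
  have GO: "G n \<in> Obj T" for n
    using j Hom_Obj by blast
  obtain c \<iota> where c: "is_coproduct T UNIV G c \<iota>"
    using ex_small_coproduct[OF small_nat, of G] GO by blast
  note cO = coproduct_in(1)[OF c] and \<iota> = coproduct_in(2)[OF c UNIV_I]
  have \<iota>j: "\<iota> (Suc n) \<cdot> j n \<in> Hom T (G n) c" for n
    by (rule cmp_in[OF j \<iota>])
  obtain \<sigma> where \<sigma>: "\<sigma> \<in> Hom T c c" "\<And>n. \<sigma> \<cdot> \<iota> n = \<iota> (Suc n) \<cdot> j n"
    using coproduct_ex[OF c \<iota>j cO] by blast
  define d where "d = Add T (Idn T c) (neg T \<sigma>)"
  note [simp] = cO GO
  note ts [simp] = \<iota>[unfolded Hom_iff] j[unfolded Hom_iff] \<sigma>(1)[unfolded Hom_iff]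
  have d: "d \<in> Hom T c c"
    by (simp add: d_def Hom_iff)
  have d_cmp: "d \<cdot> w = Add T w (neg T (\<sigma> \<cdot> w))" if "w \<in> Hom T s c" for w s
    using that by (simp add: d_def Hom_iff Add_cmp cmp_neg)
  have cmp_d: "w \<cdot> (d \<cdot> \<iota> n) = Add T (w \<cdot> \<iota> n) (neg T (w \<cdot> (\<iota> (Suc n) \<cdot> j n)))" if "w \<in> Hom T c x" for w x n
    using that d_cmp[OF \<iota>, of n] by (simp add: \<sigma>(2) Hom_iff cmp_Add cmp_neg)
  note ds [simp] = d[unfolded Hom_iff]
  obtain q h where dist: "(d, q, h) \<in> Dist T"
    using dist_cone[of d] by auto
  note D = dist_simps[OF dist]
  define g where "g = Cod T q"
  have q: "q \<in> Hom T c g" and h: "h \<in> Hom T g (susp_ob T c)"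
    using D by (auto simp: Hom_iff g_def)
  have gO [simp]: "g \<in> Obj T"
    using q Hom_Obj by blast
  note qs [simp] = q[unfolded Hom_iff] h[unfolded Hom_iff]
  have qd: "q \<cdot> d = Zero T c g"
    using dist_cmp_Zero[OF dist] by simp
  have step: "q \<cdot> (\<iota> (Suc n) \<cdot> j n) = q \<cdot> \<iota> n" for n
  proof -
    have "q \<cdot> (d \<cdot> \<iota> n) = (q \<cdot> d) \<cdot> \<iota> n"
      by (rule cmp_assoc'[symmetric]) simp_all
    hence "Add T (q \<cdot> \<iota> n) (neg T (q \<cdot> (\<iota> (Suc n) \<cdot> j n))) = Zero T (G n) g"
      using cmp_d[OF q, of n] by (simp add: qd del: cmp_assoc')
    thus ?thesis
      using diff_eq_Zero_iff[of "q \<cdot> \<iota> n" "G n" g "q \<cdot> (\<iota> (Suc n) \<cdot> j n)"] by (simp add: Hom_iff)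
  qed
  obtain \<pi> where \<pi>: "projections UNIV G c \<iota> \<pi>"
    using ex_projections[OF c] by blast
  have \<pi>H: "\<pi> n \<in> Hom T c (G n)" and \<pi>\<iota>: "\<pi> n \<cdot> \<iota> m = (if m = n then Idn T (G n) else Zero T (G m) (G n))" for m n
    using \<pi> by (auto simp: projections_def)
  note \<pi>s [simp] = \<pi>H[unfolded Hom_iff]
  have \<pi>\<sigma>: "(\<pi> m \<cdot> \<sigma>) \<cdot> \<iota> n = (\<pi> m \<cdot> \<iota> (Suc n)) \<cdot> j n" for m n
    by (simp add: \<sigma>(2))
  \<comment> \<open>Nothing is shifted into component 0; this starts the induction in
    \<open>d_inj\<close>.\<close>
  have \<pi>0: "\<pi> 0 \<cdot> \<sigma> = Zero T c (G 0)"
  proof (rule coproduct_eqI[OF c])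
    show "\<pi> 0 \<cdot> \<sigma> \<in> Hom T c (G 0)" "Zero T c (G 0) \<in> Hom T c (G 0)"
      by (simp_all add: Hom_iff)
    show "(\<pi> 0 \<cdot> \<sigma>) \<cdot> \<iota> n = Zero T c (G 0) \<cdot> \<iota> n" for n
      unfolding \<pi>\<sigma> by (simp add: \<pi>\<iota> del: cmp_assoc')
  qed
  have \<pi>Suc: "\<pi> (Suc m) \<cdot> \<sigma> = j m \<cdot> \<pi> m" for m
  proof (rule coproduct_eqI[OF c])
    show "\<pi> (Suc m) \<cdot> \<sigma> \<in> Hom T c (G (Suc m))" "j m \<cdot> \<pi> m \<in> Hom T c (G (Suc m))"
      by (simp_all add: Hom_iff)
    fix n
    have "(j m \<cdot> \<pi> m) \<cdot> \<iota> n = j m \<cdot> (\<pi> m \<cdot> \<iota> n)"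
      by (rule cmp_assoc') simp_all
    thus "(\<pi> (Suc m) \<cdot> \<sigma>) \<cdot> \<iota> n = (j m \<cdot> \<pi> m) \<cdot> \<iota> n"
      unfolding \<pi>\<sigma> by (simp add: \<pi>\<iota> del: cmp_assoc')
  qed
  \<comment> \<open>Such a map is fixed by the shift, so its component at 0 is zero and then,
    inductively, every component; being finitely supported it vanishes.\<close>
  have d_inj: "w = Zero T s c" if s: "compact_obj T s" and w: "w \<in> Hom T s c" and dw: "d \<cdot> w = Zero T s c" for s w
  proof -
    note ws [simp] = w[unfolded Hom_iff] compact_Obj[OF s]
    have "Add T w (neg T (\<sigma> \<cdot> w)) = Zero T s c"
      using d_cmp[OF w] dw by simp
    hence w_eq: "w = \<sigma> \<cdot> w"
      using diff_eq_Zero_iff[of w s c "\<sigma> \<cdot> w"] by (simp add: Hom_iff)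
    have "\<pi> n \<cdot> w = Zero T s (G n)" for n
    proof (induction n)
      case 0
      have "\<pi> 0 \<cdot> w = \<pi> 0 \<cdot> (\<sigma> \<cdot> w)"
        using arg_cong[OF w_eq, of "\<lambda>u. \<pi> 0 \<cdot> u"] .
      also have "\<dots> = (\<pi> 0 \<cdot> \<sigma>) \<cdot> w"
        by (rule cmp_assoc'[symmetric]) simp_all
      finally show ?case
        unfolding \<pi>0 by simp
    next
      case (Suc n)
      have "\<pi> (Suc n) \<cdot> w = \<pi> (Suc n) \<cdot> (\<sigma> \<cdot> w)"
        using arg_cong[OF w_eq, of "\<lambda>u. \<pi> (Suc n) \<cdot> u"] .
      also have "\<dots> = (\<pi> (Suc n) \<cdot> \<sigma>) \<cdot> w"
        by (rule cmp_assoc'[symmetric]) simp_all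
      also have "\<dots> = j n \<cdot> (\<pi> n \<cdot> w)"
        unfolding \<pi>Suc by simp
      finally show ?case
        unfolding Suc by simp
    qed
    moreover obtain F where "supported UNIV G c \<iota> F w"
      using compact_supported[OF s small_nat c w] .
    ultimately show ?thesis
      using supported_eq_Zero[OF c _ w \<pi>] by blast
  qed
  \<comment> \<open>The suspension of d composes to zero with h. By \<open>d_inj\<close>, applied to
    a desuspension, h then composes to zero with every map from a compact object, so such maps lift
    to the coproduct.\<close>
  have hf: "h \<cdot> f = Zero T s (susp_ob T c)" if s: "compact_obj T s" and f: "f \<in> Hom T s g" for s f
  proof -
    note sO = compact_Obj[OF s]
    note fs [simp] = f[unfolded Hom_iff] sO
    obtain s' where s': "s' \<in> Obj T" "isomorphic T (susp_ob T s') s"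
      using susp_surj[OF sO] .
    obtain u v where u: "u \<in> Hom T (susp_ob T s') s" and v: "v \<in> Hom T s (susp_ob T s')" and uv: "u \<cdot> v = Idn T s"
      using s'(2) by (rule isomorphicE)
    have cs': "compact_obj T s'"
      using compact_desusp[OF s'(1)] compact_iso[OF isomorphic_sym[OF s'(2)] s] by simp
    note us [simp] = u[unfolded Hom_iff] v[unfolded Hom_iff] s'(1)
    obtain w where w: "w \<in> Hom T s' c" "susp_ar T w = (h \<cdot> f) \<cdot> u"
      using susp_full[OF cmp_in[OF u cmp_in[OF f h]] s'(1) cO] .
    note wss [simp] = w(1)[unfolded Hom_iff]
    have "susp_ar T (d \<cdot> w) = susp_ar T d \<cdot> ((h \<cdot> f) \<cdot> u)"
      by (simp add: susp_cmp flip: w(2))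
    also have "\<dots> = (susp_ar T d \<cdot> h) \<cdot> (f \<cdot> u)"
      by simp
    also have "\<dots> = Zero T (susp_ob T s') (susp_ob T c)"
      unfolding dist_cmp_Zero''[OF dist] by simp
    finally have "d \<cdot> w = Zero T s' c"
      using susp_eq_Zero[of "d \<cdot> w" s' c] by (simp add: Hom_iff)
    hence "w = Zero T s' c"
      by (rule d_inj[OF cs' w(1)])
    hence hfu: "(h \<cdot> f) \<cdot> u = Zero T (susp_ob T s') (susp_ob T c)"
      using w(2) by simp
    have "h \<cdot> f = (h \<cdot> f) \<cdot> (u \<cdot> v)"
      unfolding uv by simp
    also have "\<dots> = ((h \<cdot> f) \<cdot> u) \<cdot> v"
      by simp
    also have "\<dots> = Zero T s (susp_ob T c)"
      unfolding hfu by simp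
    finally show ?thesis .
  qed
  \<comment> \<open>Inside the telescope, a map into stage n may be replaced by its image in any
    later stage.\<close>
  have shift: "\<exists>v' \<in> Hom T s (G (n + k)). q \<cdot> (\<iota> n \<cdot> v) = q \<cdot> (\<iota> (n + k) \<cdot> v')" if v: "v \<in> Hom T s (G n)" for s v n k
  proof (induction k)
    case 0
    show ?case
      using v by auto
  next
    case (Suc k)
    then obtain v' where v': "v' \<in> Hom T s (G (n + k))" "q \<cdot> (\<iota> n \<cdot> v) = q \<cdot> (\<iota> (n + k) \<cdot> v')"
      by blast
    note vs [simp] = v'(1)[unfolded Hom_iff]
    have "q \<cdot> (\<iota> (n + k) \<cdot> v') = (q \<cdot> \<iota> (n + k)) \<cdot> v'"
      by simp
    also have "\<dots> = q \<cdot> (\<iota> (Suc (n + k)) \<cdot> (j (n + k) \<cdot> v'))"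
      unfolding step[symmetric] by simp
    finally have "q \<cdot> (\<iota> n \<cdot> v) = q \<cdot> (\<iota> (n + Suc k) \<cdot> (j (n + k) \<cdot> v'))"
      using v'(2) by simp
    moreover have "j (n + k) \<cdot> v' \<in> Hom T s (G (n + Suc k))"
      by (simp add: Hom_iff)
    ultimately show ?case
      by blast
  qed
  \<comment> \<open>A finite sum over different stages is pushed to a common one. Joining stages i
    and N at i + N is crude but later than both.\<close>
  have sum: "\<exists>N. \<exists>v \<in> Hom T s (G N). q \<cdot> Sum s c (\<lambda>i. \<iota> i \<cdot> \<phi> i) F = q \<cdot> (\<iota> N \<cdot> v)"
    if s: "s \<in> Obj T" and F: "finite F" and \<phi>: "\<And>i. \<phi> i \<in> Hom T s (G i)" for s F \<phi>
    using F
  proof induction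
    case empty
    have "q \<cdot> Sum s c (\<lambda>i. \<iota> i \<cdot> \<phi> i) {} = q \<cdot> (\<iota> 0 \<cdot> Zero T s (G 0))"
      unfolding Sum_empty[OF s cO] using s by simp
    thus ?case
      using Zero_Hom[OF s GO[of 0]] by blast
  next
    case (insert i F)
    then obtain N v where v: "v \<in> Hom T s (G N)" "q \<cdot> Sum s c (\<lambda>i. \<iota> i \<cdot> \<phi> i) F = q \<cdot> (\<iota> N \<cdot> v)"
      by blast
    obtain a where a: "a \<in> Hom T s (G (i + N))" "q \<cdot> (\<iota> i \<cdot> \<phi> i) = q \<cdot> (\<iota> (i + N) \<cdot> a)"
      using shift[OF \<phi>] by blast
    obtain b where b: "b \<in> Hom T s (G (N + i))" "q \<cdot> (\<iota> N \<cdot> v) = q \<cdot> (\<iota> (N + i) \<cdot> b)"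
      using shift[OF v(1)] by blast
    note [simp] = a(1)[unfolded Hom_iff] b(1)[unfolded Hom_iff, unfolded add.commute[of N]] \<phi>[of i, unfolded Hom_iff]
    have m: "\<iota> i \<cdot> \<phi> i \<in> Hom T s c" for i
      by (rule cmp_in[OF \<phi> \<iota>])
    have S: "Sum s c (\<lambda>i. \<iota> i \<cdot> \<phi> i) F \<in> Hom T s c"
      by (rule Sum_Hom[OF s cO m])
    have "q \<cdot> Sum s c (\<lambda>i. \<iota> i \<cdot> \<phi> i) (insert i F)
        = q \<cdot> Add T (\<iota> i \<cdot> \<phi> i) (Sum s c (\<lambda>i. \<iota> i \<cdot> \<phi> i) F)"
      using Sum_insert[OF s cO insert.hyps m] by simp
    also have "\<dots> = Add T (q \<cdot> (\<iota> i \<cdot> \<phi> i)) (q \<cdot> Sum s c (\<lambda>i. \<iota> i \<cdot> \<phi> i) F)"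
      using S by (intro cmp_Add) (simp_all add: Hom_iff)
    also have "\<dots> = Add T (q \<cdot> (\<iota> (i + N) \<cdot> a)) (q \<cdot> (\<iota> (i + N) \<cdot> b))"
      unfolding v(2) a(2) b(2) by (simp add: add.commute)
    also have "\<dots> = q \<cdot> (\<iota> (i + N) \<cdot> Add T a b)"
      by (simp add: cmp_Add)
    finally show ?case
      using Add_Hom[OF a(1) b(1)[unfolded add.commute[of N]]] by blast
  qed
  show ?thesis
  proof (intro exI[of _ g] exI[of _ "\<lambda>n. q \<cdot> \<iota> n"] conjI allI impI)
    show "g \<in> Obj T"
      by (rule gO)
    show "q \<cdot> \<iota> n \<in> Hom T (G n) g" for n
      by (simp add: Hom_iff)
    show "(q \<cdot> \<iota> (Suc n)) \<cdot> j n = q \<cdot> \<iota> n" for n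
      using step[of n] by simp
    show "g \<in> S" if S: "localizing_subcat T S" and GS: "\<forall>n. G n \<in> S" for S
    proof -
      have "c \<in> S"
        by (rule localizing_coproduct[OF S small_nat _ c]) (rule GS[rule_format])
      thus ?thesis
        using tri_subD(5)[OF _ dist] S by (simp add: localizing_subcat_def)
    qed
    show "\<exists>p' \<in> Hom T g x. \<forall>n. p' \<cdot> (q \<cdot> \<iota> n) = p n"
      if p': "\<forall>n. p n \<in> Hom T (G n) x" and pj': "\<forall>n. p (Suc n) \<cdot> j n = p n" for x p
    proof -
      note p = p'[rule_format] and pj = pj'[rule_format]
      have xO: "x \<in> Obj T"
        using p Hom_Obj by blast
      obtain k where k: "k \<in> Hom T c x" "\<And>n. k \<cdot> \<iota> n = p n"
        using coproduct_ex[OF c p xO] by blast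
      note [simp] = k(1)[unfolded Hom_iff] p[unfolded Hom_iff] xO
      have "k \<cdot> d = Zero T c x"
      proof (rule coproduct_eqI[OF c])
        show "k \<cdot> d \<in> Hom T c x" "Zero T c x \<in> Hom T c x"
          by (simp_all add: Hom_iff)
        fix n
        have "k \<cdot> (\<iota> (Suc n) \<cdot> j n) = (k \<cdot> \<iota> (Suc n)) \<cdot> j n"
          by simp
        hence "k \<cdot> (\<iota> (Suc n) \<cdot> j n) = p n"
          unfolding k(2) pj .
        hence "k \<cdot> (d \<cdot> \<iota> n) = Zero T (G n) x"
          using cmp_d[OF k(1), of n] neg_Hom(2)[OF p[of n]] k(2) by simp
        thus "(k \<cdot> d) \<cdot> \<iota> n = Zero T c x \<cdot> \<iota> n"
          by simp
      qed
      then obtain l where l: "l \<in> Hom T g x" "l \<cdot> q = k"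
        using exact_ext[OF dist, of k x] k(1) by auto
      have "l \<cdot> (q \<cdot> \<iota> n) = (l \<cdot> q) \<cdot> \<iota> n" for n
        using l(1) by (simp add: Hom_iff)
      thus ?thesis
        using l k(2) by auto
    qed
    show "\<exists>n. \<exists>v \<in> Hom T s (G n). f = (q \<cdot> \<iota> n) \<cdot> v" if s: "compact_obj T s" and f: "f \<in> Hom T s g" for s f
    proof -
      have "h \<cdot> f = Zero T s (susp_ob T (Dom T d))"
        using hf[OF s f] by simp
      from exact_lift'[OF dist f[unfolded g_def] this]
      obtain u where "u \<in> Hom T s (Cod T d)" "q \<cdot> u = f" .
      hence u: "u \<in> Hom T s c" "q \<cdot> u = f"
        by simp_all
      obtain F where F: "supported UNIV G c \<iota> F u"
        using compact_supported[OF s small_nat c u(1)] .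
      have fin: "finite F"
        using F by (simp add: supported_def)
      have "\<pi> i \<cdot> u \<in> Hom T s (G i)" for i
        by (rule cmp_in[OF u(1) \<pi>H])
      from sum[OF compact_Obj[OF s] fin this] obtain N v where v: "v \<in> Hom T s (G N)"
        "q \<cdot> Sum s c (\<lambda>i. \<iota> i \<cdot> (\<pi> i \<cdot> u)) F = q \<cdot> (\<iota> N \<cdot> v)"
        by (elim exE bexE)
      have "f = q \<cdot> (\<iota> N \<cdot> v)"
        unfolding v(2)[symmetric] supported_eq_Sum[OF c F \<pi> u(1), symmetric] u(2) ..
      hence "f = (q \<cdot> \<iota> N) \<cdot> v"
        using v(1) by (simp add: Hom_iff)
      thus ?thesis
        using v(1) by blast
    qed
  qed
qed

text \<open>Take the cone of the map from the coproduct of all maps from S that p kills. Then p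
  extends over this cone, while each of these maps becomes zero in it.\<close>

lemma kill_kernel:
  assumes S: "small (Univ T) S" "S \<subseteq> L" and L: "localizing_subcat T L"
    and p: "p \<in> Hom T g x" and g: "g \<in> L"
  obtains g' p' j where "g' \<in> L" "p' \<in> Hom T g' x" "j \<in> Hom T g g'" "p' \<cdot> j = p"
    "\<And>s u. s \<in> S \<Longrightarrow> u \<in> Hom T s g \<Longrightarrow> p \<cdot> u = Zero T s x \<Longrightarrow> j \<cdot> u = Zero T s g'"
proof -
  have tri: "triangulated_subcat T L"
    using L by (simp add: localizing_subcat_def)
  have LO: "L \<subseteq> Obj T"
    by (rule tri_subD(1)[OF tri])
  have O: "g \<in> Obj T" "x \<in> Obj T"
    using p Hom_Obj by auto
  \<comment> \<open>The maps index the coproduct by themselves: the summand of u is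
    \<open>Dom T u\<close>, and the map e below restricts to u on it.\<close>
  define I where "I = {u \<in> (\<Union>s \<in> S. Hom T s g). p \<cdot> u = Zero T (Dom T u) x}"
  have uH: "u \<in> Hom T (Dom T u) g" "Dom T u \<in> S" if "u \<in> I" for u
    using that by (auto simp: I_def Hom_iff)
  have "small (Univ T) (\<Union>s \<in> S. Hom T s g)"
    using S LO O by (intro small_UN[OF S(1)] locally_small) auto
  hence I: "small (Univ T) I"
    by (rule small_subset) (auto simp: I_def)
  have X: "Dom T u \<in> Obj T" if "u \<in> I" for u
    using uH(2)[OF that] S(2) LO by blast
  obtain c \<iota> where c: "is_coproduct T I (Dom T) c \<iota>"
    using ex_small_coproduct[OF I X] .
  obtain e where e: "e \<in> Hom T c g" "\<forall>u \<in> I. e \<cdot> \<iota> u = u"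
    using coproduct_ex[OF c uH(1) O(1)] by blast
  have es: "e \<in> Mor T" "Dom T e = c" "Cod T e = g"
    using e(1) by (auto simp: Hom_iff)
  obtain j h where dist: "(e, j, h) \<in> Dist T"
    using dist_cone[OF es(1)] by blast
  note D = dist_simps[OF dist, unfolded es]
  have jH: "j \<in> Hom T g (Cod T j)"
    using D by (auto simp: Hom_iff)
  have "c \<in> L"
    by (rule localizing_coproduct[OF L I _ c]) (use uH(2) S(2) in blast)
  hence gL: "Cod T j \<in> L"
    using tri_subD(5)[OF tri dist] g es by simp
  have "p \<cdot> e = Zero T c x"
  proof (rule coproduct_eqI[OF c cmp_in[OF e(1) p] Zero_Hom[OF coproduct_in(1)[OF c] O(2)]])
    fix u assume u: "u \<in> I"
    note tu = coproduct_in(2,3)[OF c u]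
    have "(p \<cdot> e) \<cdot> \<iota> u = p \<cdot> (e \<cdot> \<iota> u)"
      using p e(1) tu by (intro cmp_assoc') (auto simp: Hom_iff)
    also have "\<dots> = Zero T (Dom T u) x"
      using e(2) u by (simp add: I_def)
    finally show "(p \<cdot> e) \<cdot> \<iota> u = Zero T c x \<cdot> \<iota> u"
      using tu O coproduct_in(1)[OF c] by (simp add: Hom_iff)
  qed
  then obtain p' where p': "p' \<in> Hom T (Cod T j) x" "p' \<cdot> j = p"
    using exact_ext[OF dist, of p x] p es by auto
  have "j \<cdot> u = Zero T s (Cod T j)" if s: "s \<in> S" and u: "u \<in> Hom T s g" and pu: "p \<cdot> u = Zero T s x" for s u
  proof -
    have uI: "u \<in> I" and Du: "Dom T u = s"
      using s u pu by (auto simp: I_def Hom_iff)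
    note tu = coproduct_in(2)[OF c uI]
    have "j \<cdot> u = j \<cdot> (e \<cdot> \<iota> u)"
      using e(2) uI by simp
    also have "\<dots> = (j \<cdot> e) \<cdot> \<iota> u"
      using jH e(1) tu by (intro cmp_assoc'[symmetric]) (auto simp: Hom_iff)
    also have "j \<cdot> e = Zero T c (Cod T j)"
      using dist_cmp_Zero[OF dist] es by simp
    also have "Zero T c (Cod T j) \<cdot> \<iota> u = Zero T s (Cod T j)"
      using tu Du D by (simp add: Hom_iff)
    finally show ?thesis .
  qed
  thus ?thesis
    using that[OF gL p'(1) jH p'(2)] by blast
qed

text \<open>The fiber \<open>g\<close> of the localization of \<open>x\<close> is built as for Brown representability: first map
  onto all maps from objects of \<open>K\<close>, then successively kill the kernel.\<close>
lemma localization_triangle: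
  assumes K: "stable_under_susp K" "K \<subseteq> compacts T" and x: "x \<in> Obj T"
  obtains f g h where "(f, g, h) \<in> Dist T" "Dom T f \<in> Loc T K" "Cod T f = x"
    "Cod T g \<in> right_orthogonal T K"
proof -
  obtain S where S: "S \<subseteq> K" "small (Univ T) S" and rep: "\<And>x. x \<in> K \<Longrightarrow> \<exists>y \<in> S. isomorphic T x y"
    using ideal_representatives[OF K] by blast
  have KO: "K \<subseteq> Obj T"
    using K(1) by (simp add: stable_under_susp_def)
  define L where "L = Loc T K"
  have L: "localizing_subcat T L" and SL: "S \<subseteq> L"
    using Loc_localizing[OF KO] Loc_subset[of K] S(1) by (auto simp: L_def)
  define J where "J = (\<Union>s \<in> S. Hom T s x)"
  have J: "small (Univ T) J"
    unfolding J_def using S KO x by (intro small_UN locally_small) auto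
  have JH: "u \<in> Hom T (Dom T u) x" "Dom T u \<in> S" if "u \<in> J" for u
    using that by (auto simp: J_def Hom_iff)
  have JX: "Dom T u \<in> Obj T" if "u \<in> J" for u
    using JH(2)[OF that] S(1) KO by blast
  obtain c \<iota> where c: "is_coproduct T J (Dom T) c \<iota>"
    using ex_small_coproduct[OF J JX] .
  obtain e where e: "e \<in> Hom T c x" "\<forall>u \<in> J. e \<cdot> \<iota> u = u"
    using coproduct_ex[OF c JH(1) x] by blast
  have cL: "c \<in> L"
    by (rule localizing_coproduct[OF L J _ c]) (use JH(2) SL in blast)
  \<comment> \<open>The state of the recursion is the map to x alone, whose domain is the current
    stage. The clause for n = 0 pins the start at e, through which every map from an object of S to
    x factors.\<close>
  define P where "P = (\<lambda>(n :: nat) p. p \<in> Mor T \<and> Cod T p = x \<and> Dom T p \<in> L \<and> (n = 0 \<longrightarrow> p = e))"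
  define Q where "Q = (\<lambda>(n :: nat) p p'. \<exists>j. j \<in> Hom T (Dom T p) (Dom T p') \<and> p' \<cdot> j = p
    \<and> (\<forall>s \<in> S. \<forall>u \<in> Hom T s (Dom T p). p \<cdot> u = Zero T s x \<longrightarrow> j \<cdot> u = Zero T s (Dom T p')))"
  have "\<exists>p. \<forall>n. P n (p n) \<and> Q n (p n) (p (Suc n))"
  proof (rule dependent_nat_choice)
    show "\<exists>p. P 0 p"
      using e(1) cL by (auto simp: P_def Hom_iff)
    fix p n assume p: "P n p"
    hence pH: "p \<in> Hom T (Dom T p) x" "Dom T p \<in> L"
      by (auto simp: P_def Hom_iff)
    obtain g' p' j where *: "g' \<in> L" "p' \<in> Hom T g' x" "j \<in> Hom T (Dom T p) g'" "p' \<cdot> j = p"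
      "\<And>s u. s \<in> S \<Longrightarrow> u \<in> Hom T s (Dom T p) \<Longrightarrow> p \<cdot> u = Zero T s x \<Longrightarrow> j \<cdot> u = Zero T s g'"
      using kill_kernel[OF S(2) SL L pH] by blast
    have "P (Suc n) p'"
      using * by (auto simp: P_def Hom_iff)
    moreover have "Dom T p' = g'"
      using * by (simp add: Hom_iff)
    hence "Q n p p'"
      unfolding Q_def using *(3-5) by blast
    ultimately show "\<exists>p'. P (Suc n) p' \<and> Q n p p'"
      by blast
  qed
  then obtain p where P: "\<And>n. P n (p n)" and Q: "\<And>n. Q n (p n) (p (Suc n))"
    by blast
  define G where "G = (\<lambda>n. Dom T (p n))"
  have p: "p n \<in> Hom T (G n) x" and GL: "G n \<in> L" for n
    using P[of n] by (auto simp: P_def Hom_iff G_def)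
  have p0: "p 0 = e"
    using P[of 0] by (simp add: P_def)
  from Q obtain j where j: "\<And>n. j n \<in> Hom T (G n) (G (Suc n))" "\<And>n. p (Suc n) \<cdot> j n = p n"
    and kill: "\<And>n s u. s \<in> S \<Longrightarrow> u \<in> Hom T s (G n) \<Longrightarrow> p n \<cdot> u = Zero T s x \<Longrightarrow> j n \<cdot> u = Zero T s (G (Suc n))"
    unfolding Q_def G_def by metis
  obtain g q where g: "g \<in> Obj T" "\<forall>n. q n \<in> Hom T (G n) g" "\<forall>n. q (Suc n) \<cdot> j n = q n"
    "\<forall>S. localizing_subcat T S \<longrightarrow> (\<forall>n. G n \<in> S) \<longrightarrow> g \<in> S"
    "\<forall>x p. (\<forall>n. p n \<in> Hom T (G n) x) \<longrightarrow> (\<forall>n. p (Suc n) \<cdot> j n = p n) \<longrightarrow>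
      (\<exists>p' \<in> Hom T g x. \<forall>n. p' \<cdot> q n = p n)"
    and factor: "\<forall>s f. compact_obj T s \<longrightarrow> f \<in> Hom T s g \<longrightarrow> (\<exists>n. \<exists>v \<in> Hom T s (G n). f = q n \<cdot> v)"
    using telescope[of j G, OF j(1)] by (elim exE conjE) (rule that, assumption+)
  note g = g(1) g(2,3)[rule_format] g(4,5) and factor = factor[rule_format]
  obtain f where f: "f \<in> Hom T g x" "\<And>n. f \<cdot> q n = p n"
    using g(5)[rule_format, of p x, OF p j(2)] by blast
  note fs = f(1)[unfolded Hom_iff]
  obtain l m where dist: "(f, l, m) \<in> Dist T"
    using dist_cone fs by blast
  note D = dist_simps[OF dist]
  have lH: "l \<in> Hom T x (Cod T l)" and mH: "m \<in> Hom T (Cod T l) (susp_ob T g)"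
    using D fs by (auto simp: Hom_iff)
  \<comment> \<open>Up to passing to a representative, a map into g factors through some G n; if its
    image in x vanishes, it dies on the way to G (n + 1).\<close>
  have inj: "u = Zero T s g" if s: "s \<in> K" and u: "u \<in> Hom T s g" and fu: "f \<cdot> u = Zero T s x" for s u
  proof -
    have sO: "s \<in> Obj T"
      using s KO by blast
    obtain s' where s': "s' \<in> S" "isomorphic T s s'"
      using rep[OF s] by blast
    obtain a b where ab: "a \<in> Hom T s s'" "b \<in> Hom T s' s" "b \<cdot> a = Idn T s"
      using s'(2) by (rule isomorphicE)
    have s'O: "s' \<in> Obj T" and s'c: "compact_obj T s'"
      using s'(1) S(1) KO K(2) by auto
    have ub: "u \<cdot> b \<in> Hom T s' g"
      by (rule cmp_in[OF ab(2) u])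
    obtain n v where v: "v \<in> Hom T s' (G n)" "u \<cdot> b = q n \<cdot> v"
      using factor[OF s'c ub] by blast
    have "p n \<cdot> v = f \<cdot> (q n \<cdot> v)"
      unfolding f(2)[symmetric] using f(1) g(2)[of n] v(1) by (simp add: Hom_iff)
    also have "\<dots> = (f \<cdot> u) \<cdot> b"
      unfolding v(2)[symmetric] using f(1) u ab(2) by (simp add: Hom_iff)
    also have "\<dots> = Zero T s' x"
      unfolding fu using ab(2) x by (auto simp: Hom_iff)
    finally have "j n \<cdot> v = Zero T s' (G (Suc n))"
      using kill s'(1) v(1) by blast
    moreover have "q n \<cdot> v = q (Suc n) \<cdot> (j n \<cdot> v)"
      unfolding g(3)[of n, symmetric] using g(2)[of "Suc n"] j(1)[of n] v(1) by (simp add: Hom_iff)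
    ultimately have ub0: "u \<cdot> b = Zero T s' g"
      using v(2) g(2)[of "Suc n"] s'O by (simp add: Hom_iff)
    have "u = u \<cdot> (b \<cdot> a)"
      unfolding ab(3) using u by (simp add: Hom_iff)
    also have "\<dots> = (u \<cdot> b) \<cdot> a"
      using u ab(1,2) by (simp add: Hom_iff)
    also have "\<dots> = Zero T s g"
      unfolding ub0 using ab(1) g(1) by (auto simp: Hom_iff)
    finally show ?thesis .
  qed
  \<comment> \<open>First m \<cdot> k is zero, by \<open>inj\<close> on a desuspension of s, so k
    comes from a map y into x. That map factors through e up to a representative, hence through f,
    and l \<cdot> f = 0.\<close>
  have "k = Zero T s (Cod T l)" if s: "s \<in> K" and k: "k \<in> Hom T s (Cod T l)" for s k
  proof -
    have sO: "s \<in> Obj T"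
      using s KO by blast
    note ks = k[unfolded Hom_iff] mH[unfolded Hom_iff] lH[unfolded Hom_iff]
    obtain s1 where s1: "s1 \<in> K" "isomorphic T (susp_ob T s1) s"
      using stable_under_susp_desusp[OF K(1) s] .
    have s1O: "s1 \<in> Obj T"
      using s1 KO by blast
    obtain a b where ab: "a \<in> Hom T (susp_ob T s1) s" "b \<in> Hom T s (susp_ob T s1)" "a \<cdot> b = Idn T s"
      using s1(2) by (rule isomorphicE)
    have mk: "m \<cdot> k \<in> Hom T s (susp_ob T g)"
      by (rule cmp_in[OF k mH])
    obtain w where w: "w \<in> Hom T s1 g" "susp_ar T w = (m \<cdot> k) \<cdot> a"
      using susp_full[OF cmp_in[OF ab(1) mk] s1O g(1)] .
    have fw: "f \<cdot> w \<in> Hom T s1 x"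
      by (rule cmp_in[OF w(1) f(1)])
    have "susp_ar T (f \<cdot> w) = susp_ar T f \<cdot> ((m \<cdot> k) \<cdot> a)"
      unfolding w(2)[symmetric] using w(1) fs by (intro susp_cmp) (auto simp: Hom_iff)
    also have "\<dots> = (susp_ar T f \<cdot> m) \<cdot> (k \<cdot> a)"
      using fs ks ab(1) by (simp add: Hom_iff)
    also have "\<dots> = Zero T (susp_ob T s1) (susp_ob T x)"
      unfolding dist_cmp_Zero''[OF dist] using fs ks ab(1) x by (simp add: Hom_iff)
    finally have "w = Zero T s1 g"
      by (intro inj[OF s1(1) w(1)] susp_eq_Zero[OF fw])
    hence mka: "(m \<cdot> k) \<cdot> a = Zero T (susp_ob T s1) (susp_ob T g)"
      using w(2) s1O g(1) by simp
    have "m \<cdot> k = (m \<cdot> k) \<cdot> (a \<cdot> b)"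
      unfolding ab(3) using mk by (simp add: Hom_iff)
    also have "\<dots> = ((m \<cdot> k) \<cdot> a) \<cdot> b"
      using mk ab(1,2) by (intro cmp_assoc'[symmetric]) (auto simp: Hom_iff)
    also have "\<dots> = Zero T s (susp_ob T g)"
      unfolding mka using ab(2) g(1) by (auto simp: Hom_iff)
    finally obtain y where y: "y \<in> Hom T s x" "l \<cdot> y = k"
      using exact_lift'[OF dist, of k s] k fs by auto
    obtain s' where s': "s' \<in> S" "isomorphic T s s'"
      using rep[OF s] by blast
    obtain a' b' where ab': "a' \<in> Hom T s s'" "b' \<in> Hom T s' s" "b' \<cdot> a' = Idn T s"
      using s'(2) by (rule isomorphicE)
    have yb: "y \<cdot> b' \<in> Hom T s' x"
      by (rule cmp_in[OF ab'(2) y(1)])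
    hence yJ: "y \<cdot> b' \<in> J" and Dy: "Dom T (y \<cdot> b') = s'"
      using s'(1) by (auto simp: J_def Hom_iff)
    define i where "i = \<iota> (y \<cdot> b')"
    have i: "i \<in> Hom T s' c" "e \<cdot> i = y \<cdot> b'"
      using coproduct_in(2)[OF c yJ] e(2) yJ Dy by (auto simp: i_def)
    have q0: "q 0 \<in> Hom T c g" "f \<cdot> q 0 = e"
      using g(2)[of 0] f(2)[of 0] p0 e(1) by (auto simp: G_def Hom_iff)
    have "k = l \<cdot> (y \<cdot> (b' \<cdot> a'))"
      unfolding ab'(3) using y by (auto simp: Hom_iff)
    also have "\<dots> = l \<cdot> ((y \<cdot> b') \<cdot> a')"
      using y(1) ab'(1,2) by (simp add: Hom_iff)
    also have "\<dots> = (l \<cdot> f) \<cdot> (q 0 \<cdot> (i \<cdot> a'))"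
      unfolding i(2)[symmetric] q0(2)[symmetric] using ks fs q0(1) i(1) ab'(1) by (simp add: Hom_iff)
    also have "\<dots> = Zero T s (Cod T l)"
      unfolding dist_cmp_Zero[OF dist] using ks fs q0(1) i(1) ab'(1) D by (simp add: Hom_iff)
    finally show ?thesis .
  qed
  hence "Cod T l \<in> right_orthogonal T K"
    using right_orthogonal_iff[OF KO] D by simp
  moreover have "Dom T f \<in> Loc T K"
    using g(4)[rule_format, OF L GL] fs by (simp add: L_def)
  ultimately show ?thesis
    using that[OF dist] fs by blast
qed

end


section \<open>Generated topologies\<close>

text \<open>Alexander's subbase theorem for a subset: it is applied to the topology that the traces
  of \<B> generate on U, and open covers are moved there by intersecting with U.\<close>

lemma compactin_topology_generated_by:
  assumes U: "U \<subseteq> \<Union>\<B>"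
    and fin: "\<And>\<C>. \<C> \<subseteq> \<B> \<Longrightarrow> U \<subseteq> \<Union>\<C> \<Longrightarrow> \<exists>\<F>. finite \<F> \<and> \<F> \<subseteq> \<C> \<and> U \<subseteq> \<Union>\<F>"
  shows "compactin (topology_generated_by \<B>) U"
proof -
  define Y where "Y = topology (arbitrary union_of (finite intersection_of (\<lambda>x. x \<in> \<B>) relative_to U))"
  have tY: "topspace Y = U"
    by (simp add: Y_def)
  have open_Y: "openin Y (U \<inter> V)" if "generate_topology_on \<B> V" for V
    using that
  proof induction
    case Empty
    show ?case
      by simp
  next
    case (Int a b)
    have "U \<inter> (a \<inter> b) = (U \<inter> a) \<inter> (U \<inter> b)"
      by blast
    thus ?case
      using openin_Int[OF Int.IH] by simp
  next
    case (UN K)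
    have "U \<inter> \<Union>K = \<Union>((\<inter>) U ` K)"
      by blast
    moreover have "openin Y (\<Union>((\<inter>) U ` K))"
      using UN.IH by (intro openin_Union) blast
    ultimately show ?case
      by simp
  next
    case (Basis B)
    have "(finite intersection_of (\<lambda>x. x \<in> \<B>) relative_to U) (U \<inter> B)"
      by (intro relative_to_inc finite_intersection_of_inc Basis)
    thus ?case
      unfolding Y_def openin_subbase by (rule arbitrary_union_of_inc)
  qed
  have "compact_space Y"
    by (rule Alexander_subbase_alt[OF U fin Y_def[symmetric]])
  hence cY: "\<exists>\<F>. finite \<F> \<and> \<F> \<subseteq> \<U> \<and> U \<subseteq> \<Union>\<F>" if "\<forall>V \<in> \<U>. openin Y V" "U \<subseteq> \<Union>\<U>" for \<U>
    using that unfolding compact_space_def compactin_def tY by blast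
  show ?thesis
    unfolding compactin_def
  proof (intro conjI allI impI)
    show "U \<subseteq> topspace (topology_generated_by \<B>)"
      using U by simp
    fix \<U> assume \<U>: "(\<forall>V \<in> \<U>. openin (topology_generated_by \<B>) V) \<and> U \<subseteq> \<Union>\<U>"
    have o1: "\<forall>V \<in> (\<inter>) U ` \<U>. openin Y V"
      using \<U> open_Y openin_topology_generated_by by blast
    have o2: "U \<subseteq> \<Union>((\<inter>) U ` \<U>)"
      using \<U> by blast
    obtain \<F> where \<F>: "finite \<F>" "\<F> \<subseteq> (\<inter>) U ` \<U>" "U \<subseteq> \<Union>\<F>"
      using cY[OF o1 o2] by (elim exE conjE)
    then obtain \<G> where \<G>: "finite \<G>" "\<G> \<subseteq> \<U>" "\<F> = (\<inter>) U ` \<G>"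
      by (meson finite_subset_image)
    have "U \<subseteq> \<Union>\<G>"
      using \<F>(3) unfolding \<G>(3) by auto
    with \<G>(1,2) show "\<exists>\<F>. finite \<F> \<and> \<F> \<subseteq> \<U> \<and> U \<subseteq> \<Union>\<F>"
      by (intro exI[of _ \<G>] conjI)
  qed
qed

text \<open>Subbasic sets suffice for this separation because missing an intersection means missing
  one of its members.\<close>

lemma generate_topology_on_separates:
  assumes "generate_topology_on \<B> V" "Q \<in> V" "P \<notin> V"
  shows "\<exists>B \<in> \<B>. Q \<in> B \<and> P \<notin> B"
  using assms by induction auto


section \<open>Prime ideals\<close>

context rigidly_compactly_generated
begin

lemma thick_idealD:
  assumes "thick_ideal T S"
  shows "S \<subseteq> compacts T" "triangulated_subcat T S"
    "is_coproduct T (UNIV :: bool set) X c \<iota> \<Longrightarrow> c \<in> S \<Longrightarrow> X i \<in> S"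
    "x \<in> S \<Longrightarrow> y \<in> compacts T \<Longrightarrow> x \<boxtimes> y \<in> S"
proof -
  show "S \<subseteq> compacts T" "triangulated_subcat T S" "x \<in> S \<Longrightarrow> y \<in> compacts T \<Longrightarrow> x \<boxtimes> y \<in> S"
    using assms unfolding thick_ideal_def by blast+
  have *: "\<forall>X c \<iota>. (\<forall>i. X i \<in> Obj T) \<and> is_coproduct T (UNIV :: bool set) X c \<iota> \<and> c \<in> S
      \<longrightarrow> (\<forall>i. X i \<in> S)"
    using assms unfolding thick_ideal_def by (elim conjE)
  show "X i \<in> S" if c: "is_coproduct T (UNIV :: bool set) X c \<iota>" and "c \<in> S"
    using *[rule_format, of X c \<iota> i] coproduct_in(3)[OF c UNIV_I] that by blast
qed

text \<open>Splits off the closure properties of compact objects, so that each ideal below only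
  needs its defining condition examined.\<close>

lemma thick_ideal_Int_compacts:
  assumes "triangulated_subcat T S"
    and "\<And>X c \<iota> i. is_coproduct T (UNIV :: bool set) X c \<iota> \<Longrightarrow> c \<in> S \<Longrightarrow> X i \<in> S"
    and "\<And>x y. x \<in> S \<Longrightarrow> compact_obj T x \<Longrightarrow> compact_obj T y \<Longrightarrow> x \<boxtimes> y \<in> S"
  shows "thick_ideal T (compacts T \<inter> S)"
  unfolding thick_ideal_def
proof (intro conjI allI impI ballI)
  show "triangulated_subcat T (compacts T \<inter> S)"
    using triangulated_subcat_Inter[of "{compacts T, S}"] triangulated_compacts assms(1) by auto
  fix X :: "bool \<Rightarrow> 'o" and c \<iota> i
  assume *: "(\<forall>i. X i \<in> Obj T) \<and> is_coproduct T (UNIV :: bool set) X c \<iota> \<and> c \<in> compacts T \<inter> S"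
  hence "compact_obj T (X i)"
    using compact_summand[of UNIV X c \<iota> i] by simp
  thus "X i \<in> compacts T \<inter> S"
    using assms(2)[of X c \<iota> i] * by simp
next
  fix x y assume "x \<in> compacts T \<inter> S" "y \<in> compacts T"
  thus "x \<boxtimes> y \<in> compacts T \<inter> S"
    using assms(3) compact_tensor by simp
qed simp

lemma thick_ideal_compacts: "thick_ideal T (compacts T)"
  using thick_ideal_Int_compacts[OF triangulated_compacts] compact_summand[OF _ _ UNIV_I] compact_tensor by auto

lemma thick_ideal_Inter:
  assumes "\<And>P. P \<in> \<P> \<Longrightarrow> thick_ideal T P" "\<P> \<noteq> {}"
  shows "thick_ideal T (\<Inter>\<P>)"
proof -
  have "\<Inter>\<P> = compacts T \<inter> \<Inter>\<P>"
    using assms thick_idealD(1) by blast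
  moreover have "thick_ideal T (compacts T \<inter> \<Inter>\<P>)"
  proof (rule thick_ideal_Int_compacts)
    show "triangulated_subcat T (\<Inter>\<P>)"
      by (rule triangulated_subcat_Inter) (use assms thick_idealD(2) in auto)
    show "X i \<in> \<Inter>\<P>" if "is_coproduct T (UNIV :: bool set) X c \<iota>" "c \<in> \<Inter>\<P>" for X c \<iota> i
      using thick_idealD(3)[OF assms(1) that(1)] that(2) by blast
    show "x \<boxtimes> y \<in> \<Inter>\<P>" if "x \<in> \<Inter>\<P>" "compact_obj T x" "compact_obj T y" for x y
      using thick_idealD(4)[OF assms(1)] that by blast
  qed
  ultimately show ?thesis
    by simp
qed

lemma thick_ideal_chain:
  assumes "\<And>P. P \<in> \<P> \<Longrightarrow> thick_ideal T P" "\<P> \<noteq> {}" "\<And>P Q. P \<in> \<P> \<Longrightarrow> Q \<in> \<P> \<Longrightarrow> P \<subseteq> Q \<or> Q \<subseteq> P"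
  shows "thick_ideal T (\<Union>\<P>)"
proof -
  have tri: "triangulated_subcat T P" if "P \<in> \<P>" for P
    using thick_idealD(2)[OF assms(1)[OF that]] .
  have "\<Union>\<P> = compacts T \<inter> \<Union>\<P>"
    using assms(1) thick_idealD(1) by blast
  moreover have "thick_ideal T (compacts T \<inter> \<Union>\<P>)"
  proof (rule thick_ideal_Int_compacts)
    show "triangulated_subcat T (\<Union>\<P>)"
    proof (rule triangulated_subcatI)
      show "\<Union>\<P> \<subseteq> Obj T"
        using tri tri_subD(1) by blast
      show "z \<in> \<Union>\<P>" if "is_zero T z" for z
        using assms(2) tri tri_subD(2)[OF _ that] by blast
      show "y \<in> \<Union>\<P>" if "x \<in> \<Union>\<P>" "isomorphic T x y" for x y
        using tri tri_subD(3)[OF _ that(2)] that(1) by blast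
      show "susp_ob T x \<in> \<Union>\<P>" if "x \<in> \<Union>\<P>" for x
        using tri tri_subD(1,4) that by blast
      show "x \<in> \<Union>\<P>" if "x \<in> Obj T" "susp_ob T x \<in> \<Union>\<P>" for x
        using tri tri_subD(4)[OF _ that(1)] that by blast
      show "Cod T g \<in> \<Union>\<P>" if dist: "(f, g, h) \<in> Dist T" and fP: "Dom T f \<in> \<Union>\<P>" "Cod T f \<in> \<Union>\<P>" for f g h
      proof -
        obtain P Q where PQ: "P \<in> \<P>" "Q \<in> \<P>" "Dom T f \<in> P" "Cod T f \<in> Q"
          using fP by (elim UnionE)
        hence "\<exists>R \<in> \<P>. Dom T f \<in> R \<and> Cod T f \<in> R"
          using assms(3)[OF PQ(1,2)] by blast
        thus ?thesis
          using tri_subD(5)[OF tri dist] by blast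
      qed
    qed
    show "X i \<in> \<Union>\<P>" if "is_coproduct T (UNIV :: bool set) X c \<iota>" "c \<in> \<Union>\<P>" for X c \<iota> i
      using thick_idealD(3)[OF assms(1) that(1)] that(2) by blast
    show "x \<boxtimes> y \<in> \<Union>\<P>" if "x \<in> \<Union>\<P>" "compact_obj T x" "compact_obj T y" for x y
      using thick_idealD(4)[OF assms(1)] that by blast
  qed
  ultimately show ?thesis
    by simp
qed

lemma isomorphic_swap:
  "x \<in> Obj T \<Longrightarrow> y \<in> Obj T \<Longrightarrow> z \<in> Obj T \<Longrightarrow> isomorphic T ((x \<boxtimes> y) \<boxtimes> z) ((x \<boxtimes> z) \<boxtimes> y)"
  by (simp add: iso_class_simps)

text \<open>The colon ideal (P : b). It serves to enlarge P without a description of generated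
  ideals.\<close>

lemma thick_ideal_colon:
  assumes P: "thick_ideal T P" and b: "compact_obj T b"
  shows "thick_ideal T {z \<in> compacts T. z \<boxtimes> b \<in> P}"
proof -
  note bO = compact_Obj[OF b]
  note tri = thick_idealD(2)[OF P]
  have "thick_ideal T (compacts T \<inter> {z \<in> Obj T. z \<boxtimes> b \<in> P})"
  proof (rule thick_ideal_Int_compacts[OF triangulated_tensor[OF tri bO]])
    show "X i \<in> {z \<in> Obj T. z \<boxtimes> b \<in> P}"
      if c: "is_coproduct T (UNIV :: bool set) X c \<iota>" and "c \<in> {z \<in> Obj T. z \<boxtimes> b \<in> P}" for X c \<iota> i
      using thick_idealD(3)[OF P coproduct_tensor[OF c bO]] coproduct_in(3)[OF c UNIV_I] that by blast
    show "x \<boxtimes> y \<in> {z \<in> Obj T. z \<boxtimes> b \<in> P}"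
      if x: "x \<in> {z \<in> Obj T. z \<boxtimes> b \<in> P}" and y: "compact_obj T y" for x y
    proof -
      have "(x \<boxtimes> b) \<boxtimes> y \<in> P"
        using thick_idealD(4)[OF P] x y by blast
      thus ?thesis
        using tri_subD(3)[OF tri isomorphic_swap[of x y b]] x compact_Obj[OF y] bO by simp
    qed
  qed
  moreover have "compacts T \<inter> {z \<in> Obj T. z \<boxtimes> b \<in> P} = {z \<in> compacts T. z \<boxtimes> b \<in> P}"
    using compact_Obj by blast
  ultimately show ?thesis
    by simp
qed

lemma thick_ideal_annihilator:
  assumes M: "M \<in> Obj T"
  shows "thick_ideal T {z \<in> compacts T. is_zero T (z \<boxtimes> M)}"
proof -
  have tri: "triangulated_subcat T {z. is_zero T z}"
    using localizing_zero by (simp add: localizing_subcat_def)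
  have "thick_ideal T (compacts T \<inter> {z \<in> Obj T. z \<boxtimes> M \<in> {z. is_zero T z}})"
  proof (rule thick_ideal_Int_compacts[OF triangulated_tensor[OF tri M]])
    show "X i \<in> {z \<in> Obj T. z \<boxtimes> M \<in> {z. is_zero T z}}"
      if c: "is_coproduct T (UNIV :: bool set) X c \<iota>" and z: "c \<in> {z \<in> Obj T. z \<boxtimes> M \<in> {z. is_zero T z}}"
      for X c \<iota> i
    proof -
      note cM = coproduct_tensor[OF c M]
      obtain \<pi> where \<pi>: "projections UNIV (\<lambda>i. X i \<boxtimes> M) (c \<boxtimes> M) (\<lambda>i. \<iota> i \<boxdot> Idn T M) \<pi>"
        using ex_projections[OF cM] by blast
      have "is_zero T (X i \<boxtimes> M)"
        using is_zero_retract[OF _ coproduct_in(2)[OF cM, of i], of "\<pi> i"] \<pi> z by (simp add: projections_def)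
      thus ?thesis
        using coproduct_in(3)[OF c UNIV_I] by blast
    qed
    show "x \<boxtimes> y \<in> {z \<in> Obj T. z \<boxtimes> M \<in> {z. is_zero T z}}"
      if x: "x \<in> {z \<in> Obj T. z \<boxtimes> M \<in> {z. is_zero T z}}" and y: "compact_obj T y" for x y
    proof -
      have "is_zero T ((x \<boxtimes> M) \<boxtimes> y)"
        using is_zero_tensor x compact_Obj[OF y] by blast
      thus ?thesis
        using is_zero_iso[OF isomorphic_swap[of x y M]] x compact_Obj[OF y] M by simp
    qed
  qed
  moreover have "compacts T \<inter> {z \<in> Obj T. z \<boxtimes> M \<in> {z. is_zero T z}} = {z \<in> compacts T. is_zero T (z \<boxtimes> M)}"
    using compact_Obj by blast
  ultimately show ?thesis
    by simp
qed

text \<open>The analogue of Krull's lemma: an ideal maximal among those disjoint from a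
  multiplicative set is prime.\<close>

lemma ex_prime_avoiding:
  assumes J: "thick_ideal T J" and S: "S \<noteq> {}" "\<And>a b. a \<in> S \<Longrightarrow> b \<in> S \<Longrightarrow> a \<boxtimes> b \<in> S" "S \<subseteq> compacts T"
    and JS: "J \<inter> S = {}"
  obtains P where "P \<in> Spc T" "J \<subseteq> P" "P \<inter> S = {}"
proof -
  define \<A> where "\<A> = {P. thick_ideal T P \<and> J \<subseteq> P \<and> P \<inter> S = {}}"
  have "\<exists>M \<in> \<A>. \<forall>X \<in> \<A>. M \<subseteq> X \<longrightarrow> X = M"
  proof (rule subset_Zorn_nonempty)
    show "\<A> \<noteq> {}"
      using J JS by (auto simp: \<A>_def)
    fix \<C> assume \<C>: "\<C> \<noteq> {}" "subset.chain \<A> \<C>"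
    have "thick_ideal T (\<Union>\<C>)"
      by (rule thick_ideal_chain) (use \<C> in \<open>auto simp: subset_chain_def \<A>_def\<close>)
    thus "\<Union>\<C> \<in> \<A>"
      using \<C> by (auto simp: subset_chain_def \<A>_def)
  qed
  then obtain P where "P \<in> \<A>" and P_max: "\<forall>X \<in> \<A>. P \<subseteq> X \<longrightarrow> X = P"
    by (elim bexE)
  hence P: "thick_ideal T P" "J \<subseteq> P" "P \<inter> S = {}"
    by (simp_all add: \<A>_def)
  have max: "X = P" if "thick_ideal T X" "P \<subseteq> X" "X \<inter> S = {}" for X
    using P_max[rule_format, of X] P(2) that by (auto simp: \<A>_def)
  note tri = thick_idealD(2)[OF P(1)]
  have swap: "y \<boxtimes> x \<in> P" if "x \<boxtimes> y \<in> P" "compact_obj T x" "compact_obj T y" for x y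
    using tri_subD(3)[OF tri isomorphic_braid[of x y]] that compact_Obj by simp
  have "a \<in> P \<or> b \<in> P" if a: "compact_obj T a" and b: "compact_obj T b" and ab: "a \<boxtimes> b \<in> P" for a b
  proof (rule ccontr)
    \<comment> \<open>Now (P : b) contains a, so it is larger than P and contains some s of S. Then
      (P : s) contains b, is larger too and contains some s' of S, so s' \<otimes> s lies both in P
      and in S.\<close>
    assume n: "\<not> (a \<in> P \<or> b \<in> P)"
    have sub: "P \<subseteq> {z \<in> compacts T. z \<boxtimes> c \<in> P}" if "compact_obj T c" for c
      using thick_idealD(1,4)[OF P(1)] that by blast
    have "{z \<in> compacts T. z \<boxtimes> b \<in> P} \<noteq> P"
      using a ab n by blast
    then obtain s where s: "s \<in> S" "compact_obj T s" "s \<boxtimes> b \<in> P"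
      using max[OF thick_ideal_colon[OF P(1) b] sub[OF b]] by blast
    have "{z \<in> compacts T. z \<boxtimes> s \<in> P} \<noteq> P"
      using b n swap[OF s(3,2) b] by blast
    then obtain s' where s': "s' \<in> S" "s' \<boxtimes> s \<in> P"
      using max[OF thick_ideal_colon[OF P(1) s(2)] sub[OF s(2)]] by blast
    thus False
      using S(2)[OF s'(1) s(1)] P(3) by blast
  qed
  moreover have "P \<noteq> compacts T"
    using S P(3) by blast
  ultimately have "P \<in> Spc T"
    using P(1) unfolding Spc_def by blast
  thus ?thesis
    using that P by blast
qed

lemma SpcD:
  assumes "P \<in> Spc T"
  shows "thick_ideal T P" "P \<noteq> compacts T"
    "compact_obj T x \<Longrightarrow> compact_obj T y \<Longrightarrow> x \<boxtimes> y \<in> P \<longleftrightarrow> x \<in> P \<or> y \<in> P"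
proof -
  show P: "thick_ideal T P" "P \<noteq> compacts T"
    using assms by (simp_all add: Spc_def)
  show "x \<boxtimes> y \<in> P \<longleftrightarrow> x \<in> P \<or> y \<in> P" if x: "compact_obj T x" and y: "compact_obj T y"
  proof
    show "x \<boxtimes> y \<in> P" if "x \<in> P \<or> y \<in> P"
      using thick_idealD(4)[OF P(1)] x y that
        tri_subD(3)[OF thick_idealD(2)[OF P(1)] isomorphic_braid[OF compact_Obj[OF x] compact_Obj[OF y]]]
      by blast
    show "x \<in> P \<or> y \<in> P" if "x \<boxtimes> y \<in> P"
      using assms x y that unfolding Spc_def by blast
  qed
qed

lemma mem_balmer_supp: "P \<in> balmer_supp T x \<longleftrightarrow> P \<in> Spc T \<and> x \<notin> P"
  by (simp add: balmer_supp_def)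

lemma balmer_supp_tensor:
  "compact_obj T x \<Longrightarrow> compact_obj T y \<Longrightarrow> balmer_supp T (x \<boxtimes> y) = balmer_supp T x \<inter> balmer_supp T y"
  using SpcD(3) by (auto simp: balmer_supp_def)

lemma balmer_supp_susp: "x \<in> Obj T \<Longrightarrow> balmer_supp T (susp_ob T x) = balmer_supp T x"
  using tri_subD(4)[OF thick_idealD(2)[OF SpcD(1)]] unfolding balmer_supp_def by blast

lemma balmer_supp_iso: "isomorphic T x y \<Longrightarrow> balmer_supp T x = balmer_supp T y"
  using tri_subD(3)[OF thick_idealD(2)[OF SpcD(1)]] unfolding balmer_supp_def by blast

lemma compact_ideal_compacts_on: "compact_ideal (compacts_on T Y)"
  unfolding compact_ideal_def stable_under_susp_def
proof (intro conjI ballI allI impI)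
  show "compacts_on T Y \<subseteq> compacts T" "compacts_on T Y \<subseteq> Obj T"
    using compact_Obj by (auto simp: compacts_on_def)
  show "y \<in> compacts_on T Y" if "x \<in> compacts_on T Y" "isomorphic T x y" for x y
    using balmer_supp_iso[OF that(2)] compact_iso[OF that(2)] that(1) by (simp add: compacts_on_def)
  show "susp_ob T x \<in> compacts_on T Y \<longleftrightarrow> x \<in> compacts_on T Y" if "x \<in> Obj T" for x
    using compact_susp compact_desusp[OF that] balmer_supp_susp[OF that] by (auto simp: compacts_on_def)
  show "x \<boxtimes> y \<in> compacts_on T Y" if "x \<in> compacts_on T Y" "y \<in> compacts T" for x y
    using that compact_tensor balmer_supp_tensor by (auto simp: compacts_on_def)
qed

text \<open>The objects \<open>s\<close> such that annihilation by \<open>s\<close> implies annihilation by \<open>z\<close> form a multiplicative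
  set because thick ideals of compact objects are radical.\<close>
lemma is_zero_tensor_local:
  assumes M: "M \<in> Obj T" and z: "compact_obj T z"
    and cover: "\<And>P. P \<in> balmer_supp T z \<Longrightarrow> \<exists>x \<in> compacts T. is_zero T (x \<boxtimes> M) \<and> P \<in> balmer_supp T x"
  shows "is_zero T (z \<boxtimes> M)"
proof (rule ccontr)
  assume n: "\<not> is_zero T (z \<boxtimes> M)"
  note zO = compact_Obj[OF z]
  define S where "S = {s \<in> compacts T. \<forall>N \<in> Obj T. is_zero T (s \<boxtimes> N) \<longrightarrow> is_zero T (z \<boxtimes> N)}"
  define J where "J = {x \<in> compacts T. is_zero T (x \<boxtimes> M)}"
  have zS: "z \<in> S"
    using z by (simp add: S_def)
  have "a \<boxtimes> b \<in> S" if a: "a \<in> S" and b: "b \<in> S" for a b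
  proof -
    have O: "a \<in> Obj T" "b \<in> Obj T"
      using a b compact_Obj by (auto simp: S_def)
    have "is_zero T (z \<boxtimes> N)" if N: "N \<in> Obj T" and 0: "is_zero T ((a \<boxtimes> b) \<boxtimes> N)" for N
    proof -
      have "isomorphic T ((a \<boxtimes> b) \<boxtimes> N) (a \<boxtimes> (b \<boxtimes> N))"
        by (rule isomorphic_assoc[OF O N])
      \<comment> \<open>The property of a is used for b \<otimes> N and that of b for z \<otimes> N;
        this leaves a second factor z, which \<open>radical_zero\<close> removes.\<close>
      hence "is_zero T (z \<boxtimes> (b \<boxtimes> N))"
        using a 0 is_zero_iso O N by (simp add: S_def)
      moreover have "isomorphic T (z \<boxtimes> (b \<boxtimes> N)) (b \<boxtimes> (z \<boxtimes> N))"
        using zO O N by (simp add: iso_class_simps)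
      ultimately have "is_zero T (z \<boxtimes> (z \<boxtimes> N))"
        using b is_zero_iso zO N by (simp add: S_def)
      hence "is_zero T ((z \<boxtimes> z) \<boxtimes> N)"
        using is_zero_iso isomorphic_assoc[OF zO zO N] by blast
      thus ?thesis
        by (rule radical_zero[OF z N])
    qed
    thus ?thesis
      using a b compact_tensor by (simp add: S_def)
  qed
  moreover have "J \<inter> S = {}"
    using n M by (auto simp: J_def S_def)
  moreover have "thick_ideal T J"
    unfolding J_def by (rule thick_ideal_annihilator[OF M])
  ultimately obtain P where P: "P \<in> Spc T" "J \<subseteq> P" "P \<inter> S = {}"
    using ex_prime_avoiding[of J S] zS unfolding S_def by blast
  hence "P \<in> balmer_supp T z"
    using zS by (auto simp: mem_balmer_supp)
  then obtain x where "x \<in> J" "P \<in> balmer_supp T x"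
    using cover unfolding J_def by blast
  thus False
    using P(2) by (auto simp: mem_balmer_supp)
qed


section \<open>The spectrum\<close>

lemma zero_in_Spc: "P \<in> Spc T \<Longrightarrow> is_zero T z \<Longrightarrow> z \<in> P"
  using tri_subD(2)[OF thick_idealD(2)[OF SpcD(1)]] by blast

lemma balmer_supp_zero: "is_zero T z \<Longrightarrow> balmer_supp T z = {}"
  using zero_in_Spc by (auto simp: balmer_supp_def)

lemma topspace_spectrum: "topspace (spectrum T) = Spc T"
proof -
  obtain z where "is_zero T z"
    using ex_zero by blast
  hence "z \<in> compacts T" "Spc T - balmer_supp T z = Spc T"
    using compact_zero balmer_supp_zero by auto
  hence "Spc T \<in> {Spc T - balmer_supp T x | x. x \<in> compacts T}"
    by blast
  thus ?thesis
    unfolding spectrum_def topology_generated_by_topspace by blast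
qed

lemma openin_basic: "compact_obj T x \<Longrightarrow> openin (spectrum T) (Spc T - balmer_supp T x)"
  unfolding spectrum_def by (rule topology_generated_by_Basis) blast

text \<open>By Alexander's theorem only covers by sets U(y), the primes containing y, need
  consideration. Objects s with U(s) finitely covered form a multiplicative set; without a finite
  subcover of U(x), some prime containing x would avoid this set and hence every y that occurs in
  the cover.\<close>

lemma compactin_basic:
  assumes x: "compact_obj T x"
  shows "compactin (spectrum T) (Spc T - balmer_supp T x)"
  unfolding spectrum_def
proof (rule compactin_topology_generated_by)
  let ?U = "\<lambda>x. Spc T - balmer_supp T x"
  show "?U x \<subseteq> \<Union>{?U x | x. x \<in> compacts T}"
    using x by blast
  fix \<C> assume \<C>: "\<C> \<subseteq> {?U x | x. x \<in> compacts T}" and cover: "?U x \<subseteq> \<Union>\<C>"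
  show "\<exists>\<F>. finite \<F> \<and> \<F> \<subseteq> \<C> \<and> ?U x \<subseteq> \<Union>\<F>"
  proof (rule ccontr)
    assume n: "\<not> ?thesis"
    define S where "S = {s \<in> compacts T. \<exists>\<F>. finite \<F> \<and> \<F> \<subseteq> \<C> \<and> ?U s \<subseteq> \<Union>\<F>}"
    \<comment> \<open>The radical of x as an intersection of primes. Inserting
      \<open>compacts T\<close> keeps the family nonempty when no prime contains x.\<close>
    define J where "J = \<Inter>(insert (compacts T) {P \<in> Spc T. x \<in> P})"
    have "thick_ideal T J"
      unfolding J_def by (rule thick_ideal_Inter) (use thick_ideal_compacts SpcD(1) in auto)
    moreover have "S \<noteq> {}"
    proof -
      have "?U x \<noteq> {}"
        using n by (metis empty_subsetI finite.emptyI)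
      then obtain y where "y \<in> compacts T" "?U y \<in> \<C>"
        using cover \<C> by blast
      hence "y \<in> S"
        unfolding S_def by (intro CollectI conjI exI[of _ "{?U y}"]) auto
      thus ?thesis
        by blast
    qed
    moreover have "a \<boxtimes> b \<in> S" if a: "a \<in> S" and b: "b \<in> S" for a b
    proof -
      obtain \<F> \<G> where *: "finite \<F>" "\<F> \<subseteq> \<C>" "?U a \<subseteq> \<Union>\<F>" "finite \<G>" "\<G> \<subseteq> \<C>" "?U b \<subseteq> \<Union>\<G>"
        using a b unfolding S_def by blast
      have ab: "compact_obj T a" "compact_obj T b"
        using a b by (auto simp: S_def)
      have "?U (a \<boxtimes> b) \<subseteq> \<Union>(\<F> \<union> \<G>)"
        unfolding balmer_supp_tensor[OF ab] using *(3,6) by blast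
      thus ?thesis
        using * ab compact_tensor unfolding S_def
        by (intro CollectI conjI exI[of _ "\<F> \<union> \<G>"]) auto
    qed
    moreover have "S \<subseteq> compacts T"
      by (auto simp: S_def)
    moreover have "J \<inter> S = {}"
    proof (rule ccontr)
      assume "J \<inter> S \<noteq> {}"
      then obtain s \<F> where s: "s \<in> J" "finite \<F>" "\<F> \<subseteq> \<C>" "?U s \<subseteq> \<Union>\<F>"
        unfolding S_def by blast
      have "?U x \<subseteq> ?U s"
        using s(1) by (auto simp: J_def balmer_supp_def)
      thus False
        using n s by blast
    qed
    ultimately obtain P where P: "P \<in> Spc T" "J \<subseteq> P" "P \<inter> S = {}"
      using ex_prime_avoiding[of J S] by blast
    have "x \<in> J"
      using x by (simp add: J_def)
    hence "P \<in> ?U x"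
      using P by (auto simp: balmer_supp_def)
    then obtain y where y: "y \<in> compacts T" "?U y \<in> \<C>" "P \<in> ?U y"
      using cover \<C> by blast
    hence "y \<in> S"
      unfolding S_def by (intro CollectI conjI exI[of _ "{?U y}"]) auto
    thus False
      using P y by (auto simp: balmer_supp_def)
  qed
qed

lemma closedin_balmer_supp:
  assumes "compact_obj T x"
  shows "closedin (spectrum T) (balmer_supp T x)" "topspace (spectrum T) - balmer_supp T x = Spc T - balmer_supp T x"
proof -
  show *: "topspace (spectrum T) - balmer_supp T x = Spc T - balmer_supp T x"
    by (simp add: topspace_spectrum)
  show "closedin (spectrum T) (balmer_supp T x)"
    unfolding closedin_def * using openin_basic[OF assms] by (auto simp: topspace_spectrum balmer_supp_def)
qed

lemma thomason_balmer_supp: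
  assumes "compact_obj T x"
  shows "thomason (spectrum T) (balmer_supp T x)"
  unfolding thomason_def
  using closedin_balmer_supp[OF assms] compactin_basic[OF assms]
  by (intro exI[of _ "{balmer_supp T x}"]) simp

text \<open>The quasi-compact complement of Z is covered by finitely many basic sets of objects
  outside P. The tensor product e of these objects is outside P by primality, and its support avoids
  the whole cover.\<close>

lemma supp_inside_closed:
  assumes Z: "closedin (spectrum T) Z" "compactin (spectrum T) (topspace (spectrum T) - Z)" and P: "P \<in> Z"
  obtains e where "compact_obj T e" "P \<in> balmer_supp T e" "balmer_supp T e \<subseteq> Z"
proof -
  let ?U = "\<lambda>x. Spc T - balmer_supp T x"
  define \<U> where "\<U> = {?U y | y. y \<in> compacts T \<and> y \<notin> P}"
  have PS: "P \<in> Spc T"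
    using Z(1) P closedin_subset topspace_spectrum by blast
  have V: "openin (spectrum T) (Spc T - Z)"
    using Z(1) by (simp add: closedin_def topspace_spectrum)
  have "\<exists>B \<in> \<U>. Q \<in> B" if Q: "Q \<in> Spc T - Z" for Q
  proof -
    have "generate_topology_on {?U x | x. x \<in> compacts T} (Spc T - Z)"
      using V unfolding spectrum_def by (rule openin_topology_generated_by)
    from generate_topology_on_separates[OF this Q, of P]
    obtain y where "y \<in> compacts T" "Q \<in> ?U y" "P \<notin> ?U y"
      using P by blast
    thus ?thesis
      using PS unfolding \<U>_def by (auto simp: balmer_supp_def)
  qed
  hence cover: "topspace (spectrum T) - Z \<subseteq> \<Union>\<U>"
    unfolding topspace_spectrum by blast
  moreover have "\<forall>B \<in> \<U>. openin (spectrum T) B"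
    using openin_basic by (auto simp: \<U>_def)
  ultimately obtain \<F> where \<F>: "finite \<F>" "\<F> \<subseteq> \<U>" "topspace (spectrum T) - Z \<subseteq> \<Union>\<F>"
    using Z(2) unfolding compactin_def by blast
  have "\<exists>e \<in> compacts T. e \<notin> P \<and> balmer_supp T e \<inter> \<Union>\<F> = {}"
    using \<F>(1,2)
  proof induction
    \<comment> \<open>Any compact object outside the proper ideal P starts the product.\<close>
    case empty
    show ?case
      using SpcD(2)[OF PS] thick_idealD(1)[OF SpcD(1)[OF PS]] by blast
  next
    case (insert B \<F>)
    then obtain e where e: "e \<in> compacts T" "e \<notin> P" "balmer_supp T e \<inter> \<Union>\<F> = {}"
      by blast
    obtain y where y: "y \<in> compacts T" "y \<notin> P" "B = ?U y"
      using insert.prems unfolding \<U>_def by blast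
    have "e \<boxtimes> y \<notin> P"
      using SpcD(3)[OF PS] e(1,2) y(1,2) by simp
    moreover have "balmer_supp T (e \<boxtimes> y) \<inter> \<Union>(insert B \<F>) = {}"
      using balmer_supp_tensor[of e y] e(1,3) y(1,3) by auto
    ultimately show ?case
      using compact_tensor e(1) y(1) by blast
  qed
  then obtain e where e: "e \<in> compacts T" "e \<notin> P" "balmer_supp T e \<inter> \<Union>\<F> = {}"
    by blast
  have "balmer_supp T e \<subseteq> Z"
    using \<F>(3) e(3) unfolding topspace_spectrum by (auto simp: balmer_supp_def)
  thus ?thesis
    using that e(1,2) PS by (simp add: mem_balmer_supp)
qed

lemma thomason_supp:
  assumes "thomason (spectrum T) Y" "P \<in> Y"
  obtains e where "e \<in> compacts_on T Y" "P \<in> balmer_supp T e"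
proof -
  obtain Z where Z: "closedin (spectrum T) Z" "compactin (spectrum T) (topspace (spectrum T) - Z)" "P \<in> Z" "Z \<subseteq> Y"
    using assms unfolding thomason_def by blast
  obtain e where "compact_obj T e" "P \<in> balmer_supp T e" "balmer_supp T e \<subseteq> Z"
    using supp_inside_closed[OF Z(1-3)] .
  thus ?thesis
    using that[of e] Z(4) by (auto simp: compacts_on_def)
qed

text \<open>In the constructible topology the basic set U(x) is closed as well, and its complement
  supp x is closed in a compact space, hence quasi-compact. So U(x) is one of the closed sets to
  which \<open>supp_inside_closed\<close> applies; intersections of neighbourhoods become tensor
  products.\<close>

lemma constructible_nhds:
  assumes con: "spectrum T = constructible_topology (spectrum T)"
    and G: "openin (spectrum T) G" "P \<in> G"
  obtains e where "compact_obj T e" "P \<in> balmer_supp T e" "balmer_supp T e \<subseteq> G"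
proof -
  let ?U = "\<lambda>x. Spc T - balmer_supp T x"
  obtain z where z: "is_zero T z"
    using ex_zero by blast
  \<comment> \<open>The basic set of a zero object is the whole spectrum.\<close>
  have compact: "compactin (spectrum T) (Spc T)"
    using compactin_basic[OF compact_zero[OF z]] balmer_supp_zero[OF z] by simp
  have "\<exists>e. compact_obj T e \<and> P \<in> balmer_supp T e \<and> balmer_supp T e \<subseteq> ?U x"
    if x: "compact_obj T x" and P: "P \<in> ?U x" for P x
  proof -
    have "openin (constructible_topology (spectrum T)) (topspace (spectrum T) - ?U x)"
      unfolding constructible_topology_def
      by (rule topology_generated_by_Basis) (use openin_basic[OF x] compactin_basic[OF x] in blast)
    hence "openin (spectrum T) (topspace (spectrum T) - ?U x)"
      using con by simp
    hence "closedin (spectrum T) (?U x)"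
      unfolding closedin_def topspace_spectrum by blast
    moreover have "compactin (spectrum T) (balmer_supp T x)"
      using closed_compactin[OF compact _ closedin_balmer_supp(1)[OF x]] by (auto simp: balmer_supp_def)
    hence "compactin (spectrum T) (topspace (spectrum T) - ?U x)"
      unfolding topspace_spectrum by (simp add: double_diff balmer_supp_def)
    ultimately show ?thesis
      using supp_inside_closed[OF _ _ P] by blast
  qed
  note basic = this
  have "generate_topology_on {?U x | x. x \<in> compacts T} G"
    using G(1) unfolding spectrum_def by (rule openin_topology_generated_by)
  hence "P \<in> G \<Longrightarrow> \<exists>e. compact_obj T e \<and> P \<in> balmer_supp T e \<and> balmer_supp T e \<subseteq> G"
  proof induction
    case (Int a b)
    then obtain d e where "compact_obj T d" "P \<in> balmer_supp T d" "balmer_supp T d \<subseteq> a"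
      "compact_obj T e" "P \<in> balmer_supp T e" "balmer_supp T e \<subseteq> b"
      by blast
    thus ?case
      using compact_tensor[of d e] balmer_supp_tensor[of d e] by (intro exI[of _ "d \<boxtimes> e"]) auto
  next
    case (UN K)
    thus ?case
      by blast
  next
    case (Basis s)
    thus ?case
      using basic by blast
  qed simp
  thus ?thesis
    using G(2) that by blast
qed


section \<open>Rickard idempotents and support\<close>

abbreviation \<Gamma> :: "'o set set \<Rightarrow> 'o" where
  "\<Gamma> Y \<equiv> fst (rickard_pair T Y)"

abbreviation \<Lambda> :: "'o set set \<Rightarrow> 'o" where
  "\<Lambda> Y \<equiv> snd (rickard_pair T Y)"

text \<open>Localizing the unit at the compact objects supported on Y supplies the witness for the
  Hilbert choice.\<close>

lemma rickard_pair: "is_rickard_pair T Y (\<Gamma> Y) (\<Lambda> Y)"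
proof -
  let ?K = "compacts_on T Y"
  have K: "stable_under_susp ?K" "?K \<subseteq> compacts T"
    using compact_ideal_compacts_on by (auto simp: compact_ideal_def)
  obtain f g h where "(f, g, h) \<in> Dist T" "Dom T f \<in> Loc T ?K" "Cod T f = Unit T"
    "Cod T g \<in> right_orthogonal T ?K"
    using localization_triangle[OF K Unit_Obj] .
  hence "is_rickard_pair T Y (Dom T f) (Cod T g)"
    unfolding is_rickard_pair_def right_orthogonal_Loc[OF K(1)] by blast
  hence "\<exists>p. case p of (G, L) \<Rightarrow> is_rickard_pair T Y G L"
    by (intro exI[of _ "(Dom T f, Cod T g)"]) simp
  hence "case rickard_pair T Y of (G, L) \<Rightarrow> is_rickard_pair T Y G L"
    unfolding rickard_pair_def by (rule someI_ex)
  thus ?thesis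
    by (simp add: case_prod_unfold)
qed

lemma rickard_triangle:
  obtains f g h where "(f, g, h) \<in> Dist T" "Dom T f = \<Gamma> Y" "Cod T f = Unit T" "Cod T g = \<Lambda> Y"
  using rickard_pair[of Y] unfolding is_rickard_pair_def by blast

lemma rickard_Obj [simp]: "\<Gamma> Y \<in> Obj T" "\<Lambda> Y \<in> Obj T"
proof -
  obtain f g h where "(f, g, h) \<in> Dist T" "Dom T f = \<Gamma> Y" "Cod T g = \<Lambda> Y"
    using rickard_triangle .
  thus "\<Gamma> Y \<in> Obj T" "\<Lambda> Y \<in> Obj T"
    using dist_simps(1,2) Dom_Obj Cod_Obj by metis+
qed

lemma \<Lambda>_zero:
  assumes "x \<in> compacts_on T Y"
  shows "is_zero T (x \<boxtimes> \<Lambda> Y)"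
proof (rule orthogonal_tensor_zero[OF compact_ideal_compacts_on _ assms])
  have "stable_under_susp (compacts_on T Y)"
    using compact_ideal_compacts_on by (auto simp: compact_ideal_def)
  thus "\<Lambda> Y \<in> right_orthogonal T (compacts_on T Y)"
    using rickard_pair[of Y] right_orthogonal_Loc unfolding is_rickard_pair_def by blast
qed

lemma localizing_annihilator:
  "M \<in> Obj T \<Longrightarrow> localizing_subcat T {z \<in> Obj T. is_zero T (z \<boxtimes> M)}"
  using localizing_tensor[OF localizing_zero] by simp

text \<open>The annihilator of M is localizing, so it is enough that it contains the generators of
  \<open>Loc T (compacts_on T Y)\<close>.\<close>

lemma \<Gamma>_zero:
  assumes M: "M \<in> Obj T" and z: "\<And>z. z \<in> compacts_on T Y \<Longrightarrow> is_zero T (z \<boxtimes> M)"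
  shows "is_zero T (\<Gamma> Y \<boxtimes> M)"
proof -
  have "compacts_on T Y \<subseteq> {z \<in> Obj T. is_zero T (z \<boxtimes> M)}"
    using z compact_Obj by (auto simp: compacts_on_def)
  hence "Loc T (compacts_on T Y) \<subseteq> {z \<in> Obj T. is_zero T (z \<boxtimes> M)}"
    by (rule Loc_least[OF localizing_annihilator[OF M]])
  thus ?thesis
    using rickard_pair[of Y] unfolding is_rickard_pair_def by blast
qed

text \<open>Tensoring with s puts 1 \<otimes> s in the middle, so s is built from its two localized
  parts. It serves for Rickard triangles and for the localization at K alike.\<close>

lemma triangle_over_Unit:
  assumes S: "triangulated_subcat T S" and dist: "(f, g, h) \<in> Dist T" and f: "Cod T f = Unit T"
    and s: "s \<in> Obj T" "Dom T f \<boxtimes> s \<in> S" "Cod T g \<boxtimes> s \<in> S"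
  shows "s \<in> S"
proof -
  note D = dist_simps[OF dist]
  obtain h' where h': "(f \<boxdot> Idn T s, g \<boxdot> Idn T s, h') \<in> Dist T"
    using tensor_dist[OF dist s(1)] .
  have "Unit T \<boxtimes> s \<in> S"
    using tri_sub_two_of_three(2)[OF S h'] D s f by simp
  thus ?thesis
    using tri_subD(3)[OF S isomorphic_trans[OF isomorphic_braid isomorphic_Unit]] s(1) by simp
qed

text \<open>The pair is the one fixed by Hilbert choice in \<open>idem\<close> and may differ from
  the obvious presentation of W; the support computations below therefore have to cope with any
  pair.\<close>

lemma idem_eq:
  assumes "weakly_visible (spectrum T) W"
  obtains Y1 Y2 where "thomason (spectrum T) Y1" "thomason (spectrum T) Y2"
    "W = Y1 \<inter> (Spc T - Y2)" "idem T W = \<Gamma> Y1 \<boxtimes> \<Lambda> Y2"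
proof -
  let ?P = "\<lambda>p. case p of (Y1, Y2) \<Rightarrow> thomason (spectrum T) Y1 \<and> thomason (spectrum T) Y2
    \<and> W = Y1 \<inter> (topspace (spectrum T) - Y2)"
  have ex: "\<exists>p. ?P p"
    using assms unfolding weakly_visible_def by auto
  obtain Y1 Y2 where Y: "(SOME p. ?P p) = (Y1, Y2)"
    by fastforce
  have "?P (Y1, Y2)"
    unfolding Y[symmetric] by (rule someI_ex[OF ex])
  hence "thomason (spectrum T) Y1 \<and> thomason (spectrum T) Y2 \<and> W = Y1 \<inter> (topspace (spectrum T) - Y2)"
    by simp
  moreover have "idem T W = \<Gamma> Y1 \<boxtimes> \<Lambda> Y2"
    unfolding idem_def Y by simp
  ultimately show ?thesis
    using that[of Y1 Y2] unfolding topspace_spectrum by blast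
qed

lemma idem_Obj: "weakly_visible (spectrum T) W \<Longrightarrow> idem T W \<in> Obj T"
  by (erule idem_eq) simp

lemma thomason_subset: "thomason (spectrum T) Y \<Longrightarrow> Y \<subseteq> Spc T"
  unfolding thomason_def using closedin_subset topspace_spectrum by blast

lemma weakly_visible_thomason: "thomason (spectrum T) Y \<Longrightarrow> weakly_visible (spectrum T) Y"
proof -
  assume Y: "thomason (spectrum T) Y"
  have "thomason (spectrum T) {}"
    unfolding thomason_def by blast
  thus ?thesis
    using Y thomason_subset[OF Y] unfolding weakly_visible_def topspace_spectrum
    by (intro exI[of _ Y] exI[of _ "{}"]) auto
qed

lemma weakly_visible_compl_thomason:
  assumes "thomason (spectrum T) Y"
  shows "weakly_visible (spectrum T) (Spc T - Y)"
proof -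
  have "thomason (spectrum T) (Spc T)"
    unfolding thomason_def using closedin_topspace[of "spectrum T"]
    by (intro exI[of _ "{Spc T}"]) (simp add: topspace_spectrum)
  thus ?thesis
    using assms unfolding weakly_visible_def topspace_spectrum by blast
qed

lemma SuppD:
  assumes "P \<in> Supp T t"
  shows "P \<in> Spc T" "weakly_visible (spectrum T) W \<Longrightarrow> P \<in> W \<Longrightarrow> \<not> is_zero T (t \<boxtimes> idem T W)"
  using assms by (auto simp: Supp_def)

lemma Supp_tensor:
  assumes O: "s \<in> Obj T" "r \<in> Obj T"
  shows "Supp T (s \<boxtimes> r) \<subseteq> Supp T s"
proof -
  have "is_zero T ((s \<boxtimes> r) \<boxtimes> idem T W)" if "weakly_visible (spectrum T) W" "is_zero T (s \<boxtimes> idem T W)" for W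
    using is_zero_tensor[OF that(2) O(2)] is_zero_iso[OF isomorphic_swap[OF O(1) idem_Obj[OF that(1)] O(2)]]
    by blast
  thus ?thesis
    unfolding Supp_def by blast
qed

text \<open>Outside Y one tests with the complement of Y, presented as Y1 - Y2, so that Y1 and Y
  meet inside Y2. For compact z on Y1 and e on Y, z \<otimes> e then lives on Y2 and is killed by
  \<Lambda> Y2. The hypothesis on X covers both compact objects supported on Y and \<Gamma>
  Y.\<close>

lemma Supp_generated:
  assumes O: "s \<in> Obj T" "X \<in> Obj T" and Y: "thomason (spectrum T) Y"
    and gen: "\<And>M. M \<in> Obj T \<Longrightarrow> (\<And>e. e \<in> compacts_on T Y \<Longrightarrow> is_zero T (e \<boxtimes> M)) \<Longrightarrow> is_zero T (X \<boxtimes> M)"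
  shows "Supp T (s \<boxtimes> X) \<subseteq> Y"
proof
  fix P assume P: "P \<in> Supp T (s \<boxtimes> X)"
  show "P \<in> Y"
  proof (rule ccontr)
    assume "P \<notin> Y"
    hence PW: "P \<in> Spc T - Y"
      using SuppD(1)[OF P] by blast
    note W = weakly_visible_compl_thomason[OF Y]
    obtain Y1 Y2 where Y12: "thomason (spectrum T) Y1" "Spc T - Y = Y1 \<inter> (Spc T - Y2)"
      and idem: "idem T (Spc T - Y) = \<Gamma> Y1 \<boxtimes> \<Lambda> Y2"
      using idem_eq[OF W] .
    have "is_zero T (z \<boxtimes> (X \<boxtimes> \<Lambda> Y2))" if z: "z \<in> compacts_on T Y1" for z
    proof -
      have zO: "z \<in> Obj T" and zc: "compact_obj T z" and zY: "balmer_supp T z \<subseteq> Y1"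
        using z compact_Obj by (auto simp: compacts_on_def)
      have "is_zero T (e \<boxtimes> (z \<boxtimes> \<Lambda> Y2))" if e: "e \<in> compacts_on T Y" for e
      proof -
        have eO: "e \<in> Obj T" and ec: "compact_obj T e" and eY: "balmer_supp T e \<subseteq> Y"
          using e compact_Obj by (auto simp: compacts_on_def)
        have "balmer_supp T (z \<boxtimes> e) \<subseteq> Y2"
          unfolding balmer_supp_tensor[OF zc ec] using zY eY Y12(2) thomason_subset[OF Y] by blast
        hence "z \<boxtimes> e \<in> compacts_on T Y2"
          using compact_tensor[OF zc ec] by (simp add: compacts_on_def)
        from \<Lambda>_zero[OF this] have "is_zero T ((z \<boxtimes> e) \<boxtimes> \<Lambda> Y2)" .
        moreover have "isomorphic T ((z \<boxtimes> e) \<boxtimes> \<Lambda> Y2) (e \<boxtimes> (z \<boxtimes> \<Lambda> Y2))"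
          using zO eO by (simp add: iso_class_simps)
        ultimately show ?thesis
          using is_zero_iso by blast
      qed
      from gen[OF tob_Obj[OF zO rickard_Obj(2)] this]
      have "is_zero T (X \<boxtimes> (z \<boxtimes> \<Lambda> Y2))" .
      moreover have "isomorphic T (X \<boxtimes> (z \<boxtimes> \<Lambda> Y2)) (z \<boxtimes> (X \<boxtimes> \<Lambda> Y2))"
        using zO O by (simp add: iso_class_simps)
      ultimately show ?thesis
        using is_zero_iso by blast
    qed
    from \<Gamma>_zero[OF tob_Obj[OF O(2) rickard_Obj(2)] this]
    have "is_zero T ((\<Gamma> Y1 \<boxtimes> (X \<boxtimes> \<Lambda> Y2)) \<boxtimes> s)"
      using is_zero_tensor O(1) by blast
    moreover have "isomorphic T ((\<Gamma> Y1 \<boxtimes> (X \<boxtimes> \<Lambda> Y2)) \<boxtimes> s) ((s \<boxtimes> X) \<boxtimes> idem T (Spc T - Y))"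
      unfolding idem using O by (simp add: iso_class_simps)
    ultimately have "is_zero T ((s \<boxtimes> X) \<boxtimes> idem T (Spc T - Y))"
      using is_zero_iso by blast
    thus False
      using SuppD(2)[OF P W PW] by blast
  qed
qed

lemma Supp_tensor_compact:
  assumes "s \<in> Obj T" "compact_obj T e"
  shows "Supp T (s \<boxtimes> e) \<subseteq> balmer_supp T e"
  by (rule Supp_generated[OF assms(1) compact_Obj[OF assms(2)] thomason_balmer_supp[OF assms(2)]])
    (use assms(2) in \<open>simp add: compacts_on_def\<close>)

lemma Supp_tensor_\<Gamma>:
  assumes "s \<in> Obj T" "thomason (spectrum T) Y"
  shows "Supp T (s \<boxtimes> \<Gamma> Y) \<subseteq> Y"
  by (rule Supp_generated[OF assms(1) rickard_Obj(1) assms(2) \<Gamma>_zero])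

text \<open>The test set is Y itself, in an unknown presentation Y1 - Y2. By
  \<open>\<Gamma>_zero\<close> it suffices that compact objects on Y1 annihilate N \<otimes>
  \<Lambda> Y2, which can be decided prime by prime.\<close>

lemma Supp_disjoint:
  assumes N: "N \<in> Obj T" and Y: "thomason (spectrum T) Y"
    and ann: "\<And>Q. Q \<in> Y \<Longrightarrow> \<exists>x \<in> compacts T. is_zero T (x \<boxtimes> N) \<and> Q \<in> balmer_supp T x"
  shows "Supp T N \<inter> Y = {}"
proof (rule ccontr)
  assume "Supp T N \<inter> Y \<noteq> {}"
  then obtain P where P: "P \<in> Supp T N" "P \<in> Y"
    by blast
  note W = weakly_visible_thomason[OF Y]
  obtain Y1 Y2 where Y12: "thomason (spectrum T) Y1" "thomason (spectrum T) Y2" "Y = Y1 \<inter> (Spc T - Y2)"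
    and idem: "idem T Y = \<Gamma> Y1 \<boxtimes> \<Lambda> Y2"
    using idem_eq[OF W] .
  have "is_zero T (z \<boxtimes> (N \<boxtimes> \<Lambda> Y2))" if z: "z \<in> compacts_on T Y1" for z
  proof (rule is_zero_tensor_local)
    show "N \<boxtimes> \<Lambda> Y2 \<in> Obj T" "compact_obj T z"
      using N z by (auto simp: compacts_on_def)
    \<comment> \<open>A prime of Y1 lies in Y, where an annihilator of N is given, or in Y2, where a
      compact object on Y2 annihilates \<Lambda> Y2.\<close>
    fix Q assume Q: "Q \<in> balmer_supp T z"
    hence "Q \<in> Y1" "Q \<in> Spc T"
      using z by (auto simp: compacts_on_def mem_balmer_supp)
    then consider "Q \<in> Y" | "Q \<in> Y2"
      using Y12(3) by blast
    thus "\<exists>x \<in> compacts T. is_zero T (x \<boxtimes> (N \<boxtimes> \<Lambda> Y2)) \<and> Q \<in> balmer_supp T x"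
    proof cases
      case 1
      then obtain x where x: "x \<in> compacts T" "is_zero T (x \<boxtimes> N)" "Q \<in> balmer_supp T x"
        using ann by blast
      have xO: "x \<in> Obj T"
        using x(1) compact_Obj by simp
      have "is_zero T ((x \<boxtimes> N) \<boxtimes> \<Lambda> Y2)"
        by (rule is_zero_tensor[OF x(2) rickard_Obj(2)])
      hence "is_zero T (x \<boxtimes> (N \<boxtimes> \<Lambda> Y2))"
        using is_zero_iso[OF isomorphic_assoc[OF xO N rickard_Obj(2)]] by blast
      thus ?thesis
        using x by blast
    next
      case 2
      obtain x where x: "x \<in> compacts_on T Y2" "Q \<in> balmer_supp T x"
        using thomason_supp[OF Y12(2) 2] .
      have xO: "x \<in> Obj T" "x \<in> compacts T"
        using x(1) compact_Obj by (auto simp: compacts_on_def)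
      have "is_zero T ((x \<boxtimes> \<Lambda> Y2) \<boxtimes> N)"
        by (rule is_zero_tensor[OF \<Lambda>_zero[OF x(1)] N])
      moreover have "isomorphic T ((x \<boxtimes> \<Lambda> Y2) \<boxtimes> N) (x \<boxtimes> (N \<boxtimes> \<Lambda> Y2))"
        using xO(1) N by (simp add: iso_class_simps)
      ultimately show ?thesis
        using is_zero_iso xO(2) x(2) by blast
    qed
  qed
  from \<Gamma>_zero[OF tob_Obj[OF N rickard_Obj(2)] this]
  have "is_zero T (\<Gamma> Y1 \<boxtimes> (N \<boxtimes> \<Lambda> Y2))" .
  moreover have "isomorphic T (\<Gamma> Y1 \<boxtimes> (N \<boxtimes> \<Lambda> Y2)) (N \<boxtimes> idem T Y)"
    unfolding idem using N by (simp add: iso_class_simps)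
  ultimately have "is_zero T (N \<boxtimes> idem T Y)"
    using is_zero_iso by blast
  thus False
    using SuppD(2)[OF P(1) W P(2)] by blast
qed

lemma Supp_tensor_\<Lambda>:
  assumes s: "s \<in> Obj T" and Y: "thomason (spectrum T) Y"
  shows "Supp T (s \<boxtimes> \<Lambda> Y) \<inter> Y = {}"
proof (rule Supp_disjoint[OF _ Y])
  show "s \<boxtimes> \<Lambda> Y \<in> Obj T"
    using s by simp
  fix Q assume "Q \<in> Y"
  then obtain x where x: "x \<in> compacts_on T Y" "Q \<in> balmer_supp T x"
    using thomason_supp[OF Y] by blast
  have xO: "x \<in> Obj T" "x \<in> compacts T"
    using x(1) compact_Obj by (auto simp: compacts_on_def)
  have "is_zero T ((x \<boxtimes> \<Lambda> Y) \<boxtimes> s)"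
    by (rule is_zero_tensor[OF \<Lambda>_zero[OF x(1)] s])
  moreover have "isomorphic T ((x \<boxtimes> \<Lambda> Y) \<boxtimes> s) (x \<boxtimes> (s \<boxtimes> \<Lambda> Y))"
    using xO(1) s by (simp add: iso_class_simps)
  ultimately show "\<exists>x \<in> compacts T. is_zero T (x \<boxtimes> (s \<boxtimes> \<Lambda> Y)) \<and> Q \<in> balmer_supp T x"
    using is_zero_iso xO(2) x(2) by blast
qed


section \<open>The local-to-global principle\<close>

lemma Locid_ideal:
  assumes "X \<subseteq> Obj T"
  shows "localizing_subcat T (Locid T X)" "X \<subseteq> Locid T X"
    "x \<in> Locid T X \<Longrightarrow> y \<in> Obj T \<Longrightarrow> x \<boxtimes> y \<in> Locid T X"
proof -
  have "localizing_ideal T (Obj T)"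
    unfolding localizing_ideal_def using localizing_subcat_Obj by simp
  hence "{S. localizing_ideal T S \<and> X \<subseteq> S} \<noteq> {}"
    using assms by blast
  thus "localizing_subcat T (Locid T X)"
    unfolding Locid_def by (intro localizing_subcat_Inter) (auto simp: localizing_ideal_def)
  show "X \<subseteq> Locid T X"
    unfolding Locid_def by blast
  show "x \<boxtimes> y \<in> Locid T X" if "x \<in> Locid T X" "y \<in> Obj T"
    using that unfolding Locid_def localizing_ideal_def by blast
qed

text \<open>As P lies in Y1 but not in Y2, the objects s \<otimes> \<Gamma> Y2 and s \<otimes>
  \<Lambda> Y1 have empty support and vanish by detection. The two Rickard triangles then recover s
  from s \<otimes> g(W).\<close>

lemma local_object_mem:
  assumes S: "triangulated_subcat T S" and detect: "detection_property T" and s: "s \<in> Obj T"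
    and sP: "Supp T s \<subseteq> {P}" and W: "weakly_visible (spectrum T) W" "P \<in> W" and sW: "s \<boxtimes> idem T W \<in> S"
  shows "s \<in> S"
proof -
  obtain Y1 Y2 where Y: "thomason (spectrum T) Y1" "thomason (spectrum T) Y2" "W = Y1 \<inter> (Spc T - Y2)"
    and idem: "idem T W = \<Gamma> Y1 \<boxtimes> \<Lambda> Y2"
    using idem_eq[OF W(1)] .
  \<comment> \<open>Detection enters here: a support inside {P} that misses P is empty.\<close>
  have zero: "is_zero T (s \<boxtimes> r)" if "r \<in> Obj T" "P \<notin> Supp T (s \<boxtimes> r)" for r
  proof -
    have "Supp T (s \<boxtimes> r) = {}"
      using Supp_tensor[OF s that(1)] sP that(2) by blast
    thus ?thesis
      using detect s that(1) unfolding detection_property_def by simp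
  qed
  have "is_zero T (s \<boxtimes> \<Gamma> Y2)"
    by (rule zero) (use Supp_tensor_\<Gamma>[OF s Y(2)] W(2) Y(3) in auto)
  hence "is_zero T ((s \<boxtimes> \<Gamma> Y2) \<boxtimes> \<Gamma> Y1)"
    using is_zero_tensor by simp
  moreover have "isomorphic T ((s \<boxtimes> \<Gamma> Y2) \<boxtimes> \<Gamma> Y1) (\<Gamma> Y2 \<boxtimes> (\<Gamma> Y1 \<boxtimes> s))"
    using s by (simp add: iso_class_simps)
  ultimately have 1: "\<Gamma> Y2 \<boxtimes> (\<Gamma> Y1 \<boxtimes> s) \<in> S"
    using is_zero_iso tri_subD(2)[OF S] by blast
  have "isomorphic T (s \<boxtimes> idem T W) (\<Lambda> Y2 \<boxtimes> (\<Gamma> Y1 \<boxtimes> s))"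
    unfolding idem using s by (simp add: iso_class_simps)
  hence 2: "\<Lambda> Y2 \<boxtimes> (\<Gamma> Y1 \<boxtimes> s) \<in> S"
    using sW tri_subD(3)[OF S] by blast
  \<comment> \<open>The triangle of Y2 puts \<Gamma> Y1 \<otimes> s between a zero object and s
    \<otimes> g(W).\<close>
  obtain f g h where "(f, g, h) \<in> Dist T" "Dom T f = \<Gamma> Y2" "Cod T f = Unit T" "Cod T g = \<Lambda> Y2"
    using rickard_triangle .
  hence 3: "\<Gamma> Y1 \<boxtimes> s \<in> S"
    using triangle_over_Unit[OF S, of f g h "\<Gamma> Y1 \<boxtimes> s"] s 1 2 by simp
  have "is_zero T (s \<boxtimes> \<Lambda> Y1)"
    by (rule zero) (use Supp_tensor_\<Lambda>[OF s Y(1)] W(2) Y(3) in auto)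
  hence 4: "\<Lambda> Y1 \<boxtimes> s \<in> S"
    using is_zero_iso[OF isomorphic_braid[OF s rickard_Obj(2)]] tri_subD(2)[OF S] by blast
  obtain f g h where "(f, g, h) \<in> Dist T" "Dom T f = \<Gamma> Y1" "Cod T f = Unit T" "Cod T g = \<Lambda> Y1"
    using rickard_triangle .
  thus ?thesis
    using triangle_over_Unit[OF S, of f g h s] s 3 4 by simp
qed

lemma local_to_global_of_scattered:
  assumes detect: "detection_property T"
    and con: "spectrum T = constructible_topology (spectrum T)"
    and t: "t \<in> Obj T" and scat: "scattered (spectrum T) (Supp T t)"
  shows "local_to_global T t"
  unfolding local_to_global_def
proof (intro allI impI)
  fix \<W> assume \<W>: "(\<forall>W \<in> \<W>. weakly_visible (spectrum T) W) \<and> \<Union>\<W> = Spc T"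
  let ?X = "(\<lambda>W. t \<boxtimes> idem T W) ` \<W>"
  have idemO: "idem T W \<in> Obj T" if "W \<in> \<W>" for W
    using idem_Obj \<W> that by blast
  have X: "?X \<subseteq> Obj T"
    using idemO t by auto
  define L where "L = Locid T ?X"
  have loc: "localizing_subcat T L" and XL: "?X \<subseteq> L"
    and LI: "\<And>x y. x \<in> L \<Longrightarrow> y \<in> Obj T \<Longrightarrow> x \<boxtimes> y \<in> L"
    using Locid_ideal[OF X] by (auto simp: L_def)
  have tri: "triangulated_subcat T L"
    using loc by (simp add: localizing_subcat_def)
  \<comment> \<open>Restricting to compact objects makes K essentially small, so that
    \<open>localization_triangle\<close> applies.\<close>
  define K where "K = compacts T \<inter> {z \<in> Obj T. z \<boxtimes> t \<in> L}"
  have triK: "triangulated_subcat T K"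
    unfolding K_def using triangulated_subcat_Inter[of "{compacts T, {z \<in> Obj T. z \<boxtimes> t \<in> L}}"]
      triangulated_compacts triangulated_tensor[OF tri t] by auto
  have "x \<boxtimes> y \<in> K" if x: "x \<in> K" and y: "y \<in> compacts T" for x y
  proof -
    have O: "x \<in> Obj T" "y \<in> Obj T"
      using x y compact_Obj by (auto simp: K_def)
    have "(x \<boxtimes> t) \<boxtimes> y \<in> L"
      using LI x O by (simp add: K_def)
    hence "(x \<boxtimes> y) \<boxtimes> t \<in> L"
      using tri_subD(3)[OF tri isomorphic_swap[OF O(1) t O(2)]] by blast
    thus ?thesis
      using compact_tensor x y O by (simp add: K_def)
  qed
  moreover have stable: "stable_under_susp K"
    unfolding stable_under_susp_def using tri_subD(1,3,4)[OF triK] by blast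
  ultimately have K: "compact_ideal K"
    unfolding compact_ideal_def K_def by blast
  have Kc: "K \<subseteq> compacts T"
    by (simp add: K_def)
  obtain f g h where dist: "(f, g, h) \<in> Dist T" and fK: "Dom T f \<in> Loc T K" and f1: "Cod T f = Unit T"
    and gK: "Cod T g \<in> right_orthogonal T K"
    using localization_triangle[OF stable Kc Unit_Obj] .
  define G N where "G = Dom T f" and "N = Cod T g"
  have O [simp]: "G \<in> Obj T" "N \<in> Obj T"
    using dist_simps(1,2)[OF dist] by (auto simp: G_def N_def)
  \<comment> \<open>This reduces the claim for t to the vanishing of t', and membership of e
    \<otimes> t to its part under N.\<close>
  have mem: "s \<in> L" if "s \<in> Obj T" "G \<boxtimes> s \<in> L" "N \<boxtimes> s \<in> L" for s
    using triangle_over_Unit[OF tri dist f1] that by (simp add: G_def N_def)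
  \<comment> \<open>The condition z \<otimes> t \<in> L is localizing in z, so it spreads from K to
    G.\<close>
  have "Loc T K \<subseteq> {z \<in> Obj T. z \<boxtimes> t \<in> L}"
    by (rule Loc_least[OF localizing_tensor[OF loc t]]) (auto simp: K_def)
  hence Gt: "G \<boxtimes> t \<in> L"
    using fK by (auto simp: G_def)
  define t' where "t' = t \<boxtimes> N"
  have t'O: "t' \<in> Obj T"
    using t by (simp add: t'_def)
  have "is_zero T t'"
  proof (rule ccontr)
    assume "\<not> is_zero T t'"
    hence "Supp T t' \<noteq> {}"
      using detect t'O unfolding detection_property_def by blast
    moreover have sub: "Supp T t' \<subseteq> Supp T t"
      unfolding t'_def by (rule Supp_tensor[OF t O(2)])
    ultimately obtain P where P: "P \<in> Supp T t'" "openin (subtopology (spectrum T) (Supp T t')) {P}"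
      using scat unfolding scattered_def by blast
    then obtain U where U: "openin (spectrum T) U" "{P} = U \<inter> Supp T t'"
      unfolding openin_subtopology by blast
    obtain e where e: "compact_obj T e" "P \<in> balmer_supp T e" "balmer_supp T e \<subseteq> U"
      using constructible_nhds[OF con U(1)] U(2) by blast
    note eO = compact_Obj[OF e(1)]
    define s where "s = t' \<boxtimes> e"
    have sO: "s \<in> Obj T"
      using t'O eO by (simp add: s_def)
    \<comment> \<open>Tensoring with e confines the support to U, which meets the support of t' only
      in P.\<close>
    have sP: "Supp T s \<subseteq> {P}"
      using Supp_tensor[OF t'O eO] Supp_tensor_compact[OF t'O e(1)] e(3) U(2) unfolding s_def by blast
    obtain W where W: "W \<in> \<W>" "P \<in> W"
      using \<W> SuppD(1)[OF P(1)] by blast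
    have "t \<boxtimes> idem T W \<in> L"
      using XL W(1) by blast
    \<comment> \<open>The generator of L belonging to W absorbs the factor N \<otimes> e, which
      gives s \<otimes> g(W) up to reordering.\<close>
    hence "(t \<boxtimes> idem T W) \<boxtimes> (N \<boxtimes> e) \<in> L"
      by (rule LI) (use eO in simp)
    moreover have "isomorphic T ((t \<boxtimes> idem T W) \<boxtimes> (N \<boxtimes> e)) (s \<boxtimes> idem T W)"
      unfolding s_def t'_def using t eO idemO[OF W(1)] by (simp add: iso_class_simps)
    ultimately have "s \<boxtimes> idem T W \<in> L"
      using tri_subD(3)[OF tri] by blast
    hence "s \<in> L"
      using local_object_mem[OF tri detect sO sP _ W(2)] \<W> W(1) by blast
    \<comment> \<open>s is the part of e \<otimes> t under N. Together with the part under G, which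
      lies in L anyway, it puts e into K.\<close>
    moreover have "isomorphic T s (N \<boxtimes> (e \<boxtimes> t))"
      unfolding s_def t'_def using t eO by (simp add: iso_class_simps)
    ultimately have "N \<boxtimes> (e \<boxtimes> t) \<in> L"
      using tri_subD(3)[OF tri] by blast
    moreover have "isomorphic T ((G \<boxtimes> t) \<boxtimes> e) (G \<boxtimes> (e \<boxtimes> t))"
      using t eO by (simp add: iso_class_simps)
    hence "G \<boxtimes> (e \<boxtimes> t) \<in> L"
      using LI[OF Gt eO] tri_subD(3)[OF tri] by blast
    ultimately have "e \<boxtimes> t \<in> L"
      using mem eO t by simp
    hence "e \<in> K"
      using e(1) eO by (simp add: K_def)
    hence "is_zero T ((e \<boxtimes> N) \<boxtimes> t)"
      using is_zero_tensor[OF orthogonal_tensor_zero[OF K gK] t] by (simp add: N_def)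
    moreover have "isomorphic T ((e \<boxtimes> N) \<boxtimes> t) (e \<boxtimes> t')"
      unfolding t'_def using t eO by (simp add: iso_class_simps)
    ultimately have "is_zero T (e \<boxtimes> t')"
      using is_zero_iso by blast
    \<comment> \<open>An object annihilated by e has no support on supp e, but P lies in
      both.\<close>
    hence "Supp T t' \<inter> balmer_supp T e = {}"
      using e(1) by (intro Supp_disjoint[OF t'O thomason_balmer_supp[OF e(1)]]) blast
    thus False
      using P(1) e(2) by blast
  qed
  hence "N \<boxtimes> t \<in> L"
    using is_zero_iso[OF isomorphic_braid[OF t O(2)]] tri_subD(2)[OF tri] by (simp add: t'_def)
  thus "t \<in> Locid T ?X"
    using mem[OF t Gt] by (simp add: L_def)
qed

end

theorem corollary3p9:
  fixes T :: "('u, 'o, 'm) ttc"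
    and \<M> :: "('u, 'a, 'b, 's, 'c, 'd) enhancement"
    and t :: 'o
  assumes "rigidly_compactly_generated T"
    and "detection_property T"
    and "is_model_of \<M> T"
    and "spectrum T = constructible_topology (spectrum T)"
    and "t \<in> Obj T"
    and "scattered (spectrum T) (Supp T t)"
  shows "local_to_global T t"
proof -
  interpret rigidly_compactly_generated T
    by (rule assms(1))
  show ?thesis
    by (rule local_to_global_of_scattered[OF assms(2,4,5,6)])
qed

end
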